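(* Suppose that $X$ is recurrent. Let $X^T$ denote the chain on $\hat S$ obtained by conditioning $\hat X$ on the event $(\tau>T)$. If there exists a $\phi$ such that $I(\phi)=1$ and $I'(\phi-)<\infty$, then for each $s>0$, the restriction of the law of $X^T$ to $\mathcal F_s$ converges weakly as $T\to\infty$ to that of $X^\infty$ restricted to $\mathcal F_s$, where the transition semigroup $P^\infty$ of $X^\infty$ is given by $$P^\infty_{i,j}(t)=\frac{p_j}{p_i}\hat P_{i,j}(t)\ \text{ for } j\in C,\qquad P^\infty_i((0,du);t)=\frac{p_{(0,u)}}{p_i}\hat P_i((0,du);t),$$ with $$p_{(0,0)}=\kappa=\frac{e^{\phi-q_0}}{\phi I'(\phi-)},\qquad p_{(0,u)}=\frac{\int_0^{1-u}e^{(\phi-q_0)s}ds}{\int_0^1e^{(\phi-q_0)s}ds}\kappa\ (u\in[0,1)),\qquad p_i=\kappa\,\mathbb E\,e^{\phi\tau_0^{(i)}}\ (i\in C).$$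
   Context: $X=(X_t)_{t\ge 0}$ is an irreducible, non-explosive continuous-time Markov chain on $S=\mathbb Z^+=\{0,1,2,\dots\}$ or $S=\{0,\dots,K\}$, with distinguished state $0$; $C=S\setminus\{0\}$. Its $Q$-matrix is $(q_{i,j})$ and $q_i=-q_{i,i}$. The current holding time $H_t$ is the time elapsed since the most recent entry of $X$ into $0$ if $X_t=0$, and $H_t=\emptyset$ if $X_t\ne0$. Let $\tau=\inf\{t: H_t\ge1\}$. Let $\hat S=C\cup(\{0\}\times[0,1))$; $\hat X$ denotes the process $(X_t,H_t)$ killed at $\tau$, viewed as a process on $\hat S$: it is in state $i\in C$ when $X_t=i$ and in state $(0,u)$ when $X_t=0$, $H_t=u$. The state $0$ is identified with $(0,0)$. The processes start from a fixed state of $\hat S$; $\mathbb P_i$ is the law started from $i\in\hat S$ (starting from $(0,u)$ means that $X_0=0$ and the chain has already been at $0$ for time $u$) on Skorokhod path space, with corresponding filtration $(\mathcal F_t)_{t\ge0}$. $(\hat P(t))_{t\ge0}$ is the substochastic transition semigroup of $\hat X$, with $\hat P_{i,j}(t)=\mathbb P_i(\hat X_t=j,\ t<\tau)$ for $j\in C$ and $\hat P_i((0,du);t)=\mathbb P_i(\hat X_t\in\{0\}\times du,\ t<\tau)$. $H^1$ denotes a full holding time of $X$ in $0$ (from an entry to $0$ until the next departure), and $R^1$ the subsequent return time (from that departure until the next return to $0$); $W=H^1+R^1$. $g$ is the (defective) density of $W1_{(H^1<1)}$ on $(0,\infty)$, and $I(\lambda)=\int_0^\infty e^{\lambda t}g(t)\,dt=\mathbb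 E[e^{\lambda W}1_{(H^1<1)}]$. $I'(\phi-)$ is the left derivative of $I$ at $\phi$. $\tau_0^{(i)}$ is a random variable distributed as the hitting time of $0$ by $X$ started from $i\in C$.
   Formalization: The transition semigroup P^∞ is given the extra factor e^{φt}, in both displayed formulas; as printed the kernels have total mass e^{-φt} < 1 for t > 0 (φ > 0 always), so they cannot be the semigroup of the weak limit. *)

theory Defs
  imports "HOL-Probability.Probability"
begin

definition cadlag_on :: "real set \<Rightarrow> (real \<Rightarrow> 'a::topological_space) \<Rightarrow> bool" where
  "cadlag_on I f \<longleftrightarrow>
     (\<forall>t\<in>I. (f \<longlongrightarrow> f t) (at t within I \<inter> {t<..})) \<and>
     (\<forall>t\<in>I. \<exists>l. (f \<longlongrightarrow> l) (at t within I \<inter> {..<t}))"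

definition past :: "'w measure \<Rightarrow> 'e measure \<Rightarrow> (real \<Rightarrow> 'w \<Rightarrow> 'e) \<Rightarrow> real \<Rightarrow> 'w measure" where
  "past M E X s = sigma (space M) {X r -` B \<inter> space M | r B. r \<in> {0..s} \<and> B \<in> sets E}"

text \<open>The simple Markov property of \<open>X\<close> under \<open>M\<close>, relative to the filtration generated by \<open>X\<close>
  and with transition probabilities \<open>k t x\<close>.\<close>

definition markov_process ::
  "'e measure \<Rightarrow> (real \<Rightarrow> 'e \<Rightarrow> 'e measure) \<Rightarrow> 'w measure \<Rightarrow> (real \<Rightarrow> 'w \<Rightarrow> 'e) \<Rightarrow> bool" where
  "markov_process E k M X \<longleftrightarrow> prob_space M \<and> (\<forall>t\<ge>0. X t \<in> M \<rightarrow>\<^sub>M E) \<and>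
     (\<forall>s\<ge>0. \<forall>t\<ge>0. \<forall>A\<in>sets (past M E X s). \<forall>B\<in>sets E.
        emeasure M (A \<inter> {\<omega>\<in>space M. X (s + t) \<omega> \<in> B}) =
        (\<integral>\<^sup>+\<omega>\<in>A. emeasure (k t (X s \<omega>)) B \<partial>M))"

definition transition_semigroup :: "'e measure \<Rightarrow> (real \<Rightarrow> 'e \<Rightarrow> 'e measure) \<Rightarrow> bool" where
  "transition_semigroup E k \<longleftrightarrow>
     (\<forall>t\<ge>0. k t \<in> E \<rightarrow>\<^sub>M prob_algebra E) \<and>
     (\<forall>x\<in>space E. k 0 x = return E x) \<and>
     (\<forall>s\<ge>0. \<forall>t\<ge>0. \<forall>x\<in>space E. k (s + t) x = k s x \<bind> k t)"

definition q_matrix :: "nat set \<Rightarrow> (nat \<Rightarrow> nat \<Rightarrow> real) \<Rightarrow> bool" where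
  "q_matrix S q \<longleftrightarrow>
     (\<forall>i\<in>S. \<forall>j\<in>S. i \<noteq> j \<longrightarrow> 0 \<le> q i j) \<and> (\<forall>i\<in>S. (q i has_sum 0) S)"

text \<open>\<open>P i\<close> is the law of the chain started from \<open>i\<close>; the transition probabilities are
  \<open>p\<^sub>i\<^sub>j(t) = P i (X t = j)\<close>, with derivative \<open>q i j\<close> at \<open>0\<close>. As \<open>S\<close> is discrete and all values of
  the paths and all left limits are (finite) natural numbers, a cadlag path has finitely many jumps
  in bounded time intervals; this is non-explosion.\<close>

definition nonexplosive_ctmc ::
  "nat set \<Rightarrow> (nat \<Rightarrow> nat \<Rightarrow> real) \<Rightarrow> (nat \<Rightarrow> 'w measure) \<Rightarrow> (real \<Rightarrow> 'w \<Rightarrow> nat) \<Rightarrow> bool" where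
  "nonexplosive_ctmc S q P X \<longleftrightarrow> q_matrix S q \<and>
     (\<forall>i\<in>S.
        markov_process (count_space S) (\<lambda>t j. distr (P j) (count_space S) (X t)) (P i) X \<and>
        (AE \<omega> in P i. X 0 \<omega> = i) \<and>
        (\<forall>\<omega>\<in>space (P i). cadlag_on {0..} (\<lambda>t. X t \<omega>)) \<and>
        (\<forall>j\<in>S. ((\<lambda>t. measure (P i) {\<omega>\<in>space (P i). X t \<omega> = j})
                   has_real_derivative q i j) (at_right 0)))"

definition irreducible_chain ::
  "nat set \<Rightarrow> (nat \<Rightarrow> 'w measure) \<Rightarrow> (real \<Rightarrow> 'w \<Rightarrow> nat) \<Rightarrow> bool" where
  "irreducible_chain S P X \<longleftrightarrow>
     (\<forall>i\<in>S. \<forall>j\<in>S. \<exists>t\<ge>0. 0 < measure (P i) {\<omega>\<in>space (P i). X t \<omega> = j})"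

definition recurrent_chain ::
  "nat set \<Rightarrow> (nat \<Rightarrow> 'w measure) \<Rightarrow> (real \<Rightarrow> 'w \<Rightarrow> nat) \<Rightarrow> bool" where
  "recurrent_chain S P X \<longleftrightarrow>
     (\<forall>i\<in>S. AE \<omega> in P i. \<not> bdd_above {t. 0 \<le> t \<and> X t \<omega> = i})"

text \<open>Current holding time at time \<open>t\<close> along the path \<open>x\<close>, when the chain has already been at
  \<open>0\<close> for time \<open>u\<close> if \<open>x\<close> starts there. For a right-continuous step path, the last entry into \<open>0\<close>
  is the supremum of the earlier times spent outside \<open>0\<close>.\<close>

definition holding_time :: "real \<Rightarrow> (real \<Rightarrow> nat) \<Rightarrow> real \<Rightarrow> real option" where
  "holding_time u x t =
     (if x t \<noteq> 0 then None
      else if \<forall>r\<in>{0..t}. x r = 0 then Some (u + t)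
      else Some (t - Sup {r\<in>{0..t}. x r \<noteq> 0}))"

definition killing_time :: "real \<Rightarrow> (real \<Rightarrow> nat) \<Rightarrow> ereal" where
  "killing_time u x = Inf {ereal t | t. 0 \<le> t \<and> (\<exists>h. holding_time u x t = Some h \<and> 1 \<le> h)}"

definition hitting_time_0 :: "(real \<Rightarrow> nat) \<Rightarrow> ereal" where
  "hitting_time_0 x = Inf {ereal t | t. 0 \<le> t \<and> x t = 0}"

text \<open>For a path that enters \<open>0\<close> at time \<open>0\<close>: the full holding time \<open>H\<^sup>1\<close>, and \<open>W = H\<^sup>1 + R\<^sup>1\<close>,
  which is the time of the first visit to \<open>0\<close> after an excursion outside \<open>0\<close>.\<close>

definition full_holding_time :: "(real \<Rightarrow> nat) \<Rightarrow> ereal" where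
  "full_holding_time x = Inf {ereal t | t. 0 \<le> t \<and> x t \<noteq> 0}"

definition cycle_time :: "(real \<Rightarrow> nat) \<Rightarrow> ereal" where
  "cycle_time x = Inf {ereal t | t. x t = 0 \<and> (\<exists>r\<in>{0..t}. x r \<noteq> 0)}"

definition exp_ereal :: "real \<Rightarrow> ereal \<Rightarrow> ennreal" where
  "exp_ereal l t = (if t = \<infinity> then (if l > 0 then \<infinity> else if l = 0 then 1 else 0)
                    else ennreal (exp (l * real_of_ereal t)))"

text \<open>\<open>I(\<lambda>) = E[exp (\<lambda> W); H\<^sup>1 < 1]\<close>, possibly infinite; for a recurrent chain \<open>W\<close> is
  almost surely finite.\<close>

definition cycle_mgf :: "(nat \<Rightarrow> 'w measure) \<Rightarrow> (real \<Rightarrow> 'w \<Rightarrow> nat) \<Rightarrow> real \<Rightarrow> ennreal" where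
  "cycle_mgf P X l =
     (\<integral>\<^sup>+\<omega>\<in>{\<omega>. full_holding_time (\<lambda>t. X t \<omega>) < 1}.
        exp_ereal l (cycle_time (\<lambda>t. X t \<omega>)) \<partial>P 0)"

text \<open>The state \<open>i \<in> C\<close> is encoded as \<open>(i, 0)\<close>. The topology induced by \<open>nat \<times> real\<close> is
  the discrete one on \<open>C\<close> and the usual one on \<open>{0} \<times> [0,1)\<close>.\<close>

type_synonym hat_state = "nat \<times> real"

definition hat_states :: "nat set \<Rightarrow> hat_state set" where
  "hat_states S = (S - {0}) \<times> {0} \<union> {0} \<times> {0..<1}"

definition hat_space :: "nat set \<Rightarrow> hat_state measure" where
  "hat_space S = restrict_space borel (hat_states S)"

definition hat_X :: "real \<Rightarrow> (real \<Rightarrow> nat) \<Rightarrow> real \<Rightarrow> hat_state" where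
  "hat_X u x t = (case holding_time u x t of None \<Rightarrow> (x t, 0) | Some h \<Rightarrow> (0, h))"

text \<open>The event \<open>\<tau> > t\<close> for the process started from \<open>(i, u)\<close>, to be used under \<open>P i\<close>.\<close>

definition survival ::
  "(nat \<Rightarrow> 'w measure) \<Rightarrow> (real \<Rightarrow> 'w \<Rightarrow> nat) \<Rightarrow> real \<Rightarrow> hat_state \<Rightarrow> 'w set" where
  "survival P X t = (\<lambda>(i, u). {\<omega>\<in>space (P i). ereal t < killing_time u (\<lambda>r. X r \<omega>)})"

text \<open>The substochastic kernel \<open>B \<mapsto> P (hat_X t \<in> B, t < \<tau>)\<close>.\<close>

definition hat_P ::
  "nat set \<Rightarrow> (nat \<Rightarrow> 'w measure) \<Rightarrow> (real \<Rightarrow> 'w \<Rightarrow> nat) \<Rightarrow> real \<Rightarrow> hat_state \<Rightarrow> hat_state measure"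
  where
  "hat_P S P X t = (\<lambda>(i, u).
     distr (restrict_space (P i) (survival P X t (i, u))) (hat_space S)
       (\<lambda>\<omega>. hat_X u (\<lambda>r. X r \<omega>) t))"

text \<open>Paths on the time set \<open>I\<close> with values in \<open>hat_states S\<close>, with the \<open>\<sigma>\<close>-algebra generated by
  the coordinates. Left limits are taken in \<open>nat \<times> real\<close>, so the left limit \<open>(0, 1)\<close> is allowed: it
  arises, with probability \<open>0\<close>, when the chain leaves \<open>0\<close> exactly at age \<open>1\<close>.\<close>

definition skorokhod_space :: "nat set \<Rightarrow> real set \<Rightarrow> (real \<Rightarrow> hat_state) measure" where
  "skorokhod_space S I = restrict_space (\<Pi>\<^sub>M t\<in>I. hat_space S) {f. cadlag_on I f}"

definition hat_dist :: "hat_state \<Rightarrow> hat_state \<Rightarrow> real" where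
  "hat_dist x y = (if fst x = fst y then min 1 \<bar>snd x - snd y\<bar> else 1)"

definition time_changes :: "real \<Rightarrow> (real \<Rightarrow> real) set" where
  "time_changes s = {l. strict_mono_on {0..s} l \<and> l ` {0..s} = {0..s}}"

definition skorokhod_dist :: "real \<Rightarrow> (real \<Rightarrow> hat_state) \<Rightarrow> (real \<Rightarrow> hat_state) \<Rightarrow> real" where
  "skorokhod_dist s f g =
     Inf {e. 0 \<le> e \<and> (\<exists>l\<in>time_changes s. \<forall>t\<in>{0..s}. \<bar>l t - t\<bar> \<le> e \<and> hat_dist (f (l t)) (g t) \<le> e)}"

lemma hat_dist_le_1: "hat_dist x y \<le> 1"
  and hat_dist_nonneg: "0 \<le> hat_dist x y"
  and hat_dist_commute: "hat_dist x y = hat_dist y x"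
  and hat_dist_zero: "hat_dist x y = 0 \<longleftrightarrow> x = y"
  and hat_dist_triangle: "hat_dist x z \<le> hat_dist x y + hat_dist y z"
  by (auto simp: hat_dist_def prod_eq_iff min_def)

lemma tendsto_hat_dist:
  assumes "(f \<longlongrightarrow> x) F"
  shows "((\<lambda>t. hat_dist (f t) x) \<longlongrightarrow> 0) F"
proof -
  have "((\<lambda>t. fst (f t)) \<longlongrightarrow> fst x) F" and 1: "((\<lambda>t. snd (f t)) \<longlongrightarrow> snd x) F"
    using assms by (auto intro: tendsto_intros)
  then have 2: "\<forall>\<^sub>F t in F. fst (f t) = fst x"
    by (simp add: tendsto_discrete)
  have "((\<lambda>t. min 1 \<bar>snd (f t) - snd x\<bar>) \<longlongrightarrow> min 1 \<bar>snd x - snd x\<bar>) F"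
    by (intro tendsto_intros 1)
  then have "((\<lambda>t. min 1 \<bar>snd (f t) - snd x\<bar>) \<longlongrightarrow> 0) F"
    by simp
  then show ?thesis
    by (rule Lim_transform_eventually) (use 2 in eventually_elim, simp add: hat_dist_def)
qed

lemma time_changes_id: "(\<lambda>t. t) \<in> time_changes s"
  by (auto simp: time_changes_def strict_mono_on_def)

lemma time_changes_comp:
  assumes "l \<in> time_changes s" "m \<in> time_changes s"
  shows "(\<lambda>t. l (m t)) \<in> time_changes s"
proof -
  have "(\<lambda>t. l (m t)) ` {0..s} = l ` m ` {0..s}"
    by auto
  moreover have "m t \<in> {0..s}" if "t \<in> {0..s}" for t
    using assms that by (auto simp: time_changes_def)
  ultimately show ?thesis
    using assms by (auto simp: time_changes_def strict_mono_on_def)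
qed

lemma time_changes_inv:
  assumes l: "l \<in> time_changes s"
  shows "the_inv_into {0..s} l \<in> time_changes s"
proof -
  have inj: "inj_on l {0..s}" and im: "l ` {0..s} = {0..s}" and sm: "strict_mono_on {0..s} l"
    using l by (auto simp: time_changes_def strict_mono_on_imp_inj_on)
  let ?m = "the_inv_into {0..s} l"
  have m: "?m t \<in> {0..s}" "l (?m t) = t" if "t \<in> {0..s}" for t
    using that im the_inv_into_into[OF inj, of t "{0..s}"] f_the_inv_into_f[OF inj, of t] by auto
  have "strict_mono_on {0..s} ?m"
  proof (rule strict_mono_onI)
    fix r t assume rt: "r \<in> {0..s}" "t \<in> {0..s}" "r < t"
    show "?m r < ?m t"
    proof (rule ccontr)
      assume "\<not> ?m r < ?m t"
      then have "l (?m t) \<le> l (?m r)"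
        using strict_mono_on_leD[OF sm m(1)[OF rt(2)] m(1)[OF rt(1)]] by simp
      then show False using m rt by simp
    qed
  qed
  moreover have "?m ` {0..s} = {0..s}"
    using the_inv_into_onto[OF inj] im by simp
  ultimately show ?thesis by (simp add: time_changes_def)
qed

lemma skorokhod_dist_aux:
  "1 \<in> {e. 0 \<le> e \<and> (\<exists>l\<in>time_changes s. \<forall>t\<in>{0..s}. \<bar>l t - t\<bar> \<le> e \<and> hat_dist (f (l t)) (g t) \<le> e)}"
  using time_changes_id[of s] hat_dist_le_1 by (auto intro!: bexI[of _ "\<lambda>t. t"])

lemma skorokhod_dist_lessD:
  assumes "skorokhod_dist s f g < e"
  obtains l where "l \<in> time_changes s"
    "\<And>t. t \<in> {0..s} \<Longrightarrow> \<bar>l t - t\<bar> < e \<and> hat_dist (f (l t)) (g t) < e"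
proof -
  let ?A = "{e. 0 \<le> e \<and> (\<exists>l\<in>time_changes s. \<forall>t\<in>{0..s}. \<bar>l t - t\<bar> \<le> e \<and> hat_dist (f (l t)) (g t) \<le> e)}"
  have "?A \<noteq> {}" using skorokhod_dist_aux by blast
  then obtain d where "d \<in> ?A" "d < e"
    using assms cInf_lessD[of ?A e] unfolding skorokhod_dist_def by blast
  then obtain l where "l \<in> time_changes s"
    "\<forall>t\<in>{0..s}. \<bar>l t - t\<bar> \<le> d \<and> hat_dist (f (l t)) (g t) \<le> d"
    by blast
  with \<open>d < e\<close> show thesis
    by (intro that[of l]) (auto intro: le_less_trans)
qed

lemma skorokhod_dist_leI:
  assumes "l \<in> time_changes s" "0 \<le> e"
    and "\<And>t. t \<in> {0..s} \<Longrightarrow> \<bar>l t - t\<bar> \<le> e \<and> hat_dist (f (l t)) (g t) \<le> e"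
  shows "skorokhod_dist s f g \<le> e"
  unfolding skorokhod_dist_def
proof (rule cInf_lower)
  show "e \<in> {e. 0 \<le> e \<and> (\<exists>l\<in>time_changes s. \<forall>t\<in>{0..s}. \<bar>l t - t\<bar> \<le> e \<and> hat_dist (f (l t)) (g t) \<le> e)}"
    using assms by blast
qed (auto intro!: bdd_belowI[of _ 0])

lemma skorokhod_dist_nonneg: "0 \<le> skorokhod_dist s f g"
  unfolding skorokhod_dist_def using skorokhod_dist_aux by (intro cInf_greatest) blast+

lemma skorokhod_dist_commute_le: "skorokhod_dist s g f \<le> skorokhod_dist s f g"
proof (rule field_le_epsilon)
  fix e :: real assume "0 < e"
  then obtain l where l: "l \<in> time_changes s"
    "\<And>t. t \<in> {0..s} \<Longrightarrow> \<bar>l t - t\<bar> < skorokhod_dist s f g + e \<and>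
       hat_dist (f (l t)) (g t) < skorokhod_dist s f g + e"
    using skorokhod_dist_lessD[of s f g "skorokhod_dist s f g + e"] by auto
  let ?m = "the_inv_into {0..s} l"
  have inj: "inj_on l {0..s}" and im: "l ` {0..s} = {0..s}"
    using l(1) by (auto simp: time_changes_def strict_mono_on_imp_inj_on)
  have m: "?m t \<in> {0..s}" "l (?m t) = t" if "t \<in> {0..s}" for t
    using that im the_inv_into_into[OF inj, of t "{0..s}"] f_the_inv_into_f[OF inj, of t] by auto
  show "skorokhod_dist s g f \<le> skorokhod_dist s f g + e"
  proof (rule skorokhod_dist_leI[OF time_changes_inv[OF l(1)]])
    show "0 \<le> skorokhod_dist s f g + e"
      using skorokhod_dist_nonneg[of s f g] \<open>0 < e\<close> by simp
    fix t assume t: "t \<in> {0..s}"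
    show "\<bar>?m t - t\<bar> \<le> skorokhod_dist s f g + e \<and>
      hat_dist (g (?m t)) (f t) \<le> skorokhod_dist s f g + e"
      using l(2)[OF m(1)[OF t]] m(2)[OF t] hat_dist_commute[of "f t" "g (?m t)"]
      by (simp add: abs_minus_commute)
  qed
qed

lemma skorokhod_dist_triangle: "skorokhod_dist s f h \<le> skorokhod_dist s f g + skorokhod_dist s g h"
proof (rule field_le_epsilon)
  fix e :: real assume e: "0 < e"
  define a b where "a = skorokhod_dist s f g + e / 2" and "b = skorokhod_dist s g h + e / 2"
  obtain l where l: "l \<in> time_changes s"
    "\<And>t. t \<in> {0..s} \<Longrightarrow> \<bar>l t - t\<bar> < a \<and> hat_dist (f (l t)) (g t) < a"
    using skorokhod_dist_lessD[of s f g a] e unfolding a_def by auto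
  obtain m where m: "m \<in> time_changes s"
    "\<And>t. t \<in> {0..s} \<Longrightarrow> \<bar>m t - t\<bar> < b \<and> hat_dist (g (m t)) (h t) < b"
    using skorokhod_dist_lessD[of s g h b] e unfolding b_def by auto
  have "skorokhod_dist s f h \<le> a + b"
  proof (rule skorokhod_dist_leI[OF time_changes_comp[OF l(1) m(1)]])
    show "0 \<le> a + b"
      using skorokhod_dist_nonneg[of s f g] skorokhod_dist_nonneg[of s g h] e
      by (simp add: a_def b_def)
    fix t assume t: "t \<in> {0..s}"
    then have "m t \<in> {0..s}" using m(1) by (auto simp: time_changes_def)
    with l(2)[of "m t"] m(2)[OF t] hat_dist_triangle[of "f (l (m t))" "h t" "g (m t)"]
    show "\<bar>l (m t) - t\<bar> \<le> a + b \<and> hat_dist (f (l (m t))) (h t) \<le> a + b"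
      by auto
  qed
  then show "skorokhod_dist s f h \<le> skorokhod_dist s f g + skorokhod_dist s g h + e"
    by (simp add: a_def b_def)
qed

lemma skorokhod_dist_eq_0D:
  assumes f: "cadlag_on {0..s} f" and g: "cadlag_on {0..s} g"
    and zero: "skorokhod_dist s f g = 0" and t: "t \<in> {0..s}"
  shows "f t = g t"
proof (rule ccontr)
  assume "f t \<noteq> g t"
  define e where "e = hat_dist (f t) (g t) / 3"
  have e: "0 < e"
    using \<open>f t \<noteq> g t\<close> hat_dist_zero[of "f t" "g t"] hat_dist_nonneg[of "f t" "g t"]
    by (simp add: e_def)
  show False
  proof (cases "t = s")
    case True
    obtain l where l: "l \<in> time_changes s"
      "\<And>r. r \<in> {0..s} \<Longrightarrow> \<bar>l r - r\<bar> < e \<and> hat_dist (f (l r)) (g r) < e"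
      using skorokhod_dist_lessD[of s f g e] zero e by auto
    have "s \<in> l ` {0..s}" using l(1) t by (auto simp: time_changes_def)
    then obtain r where r: "r \<in> {0..s}" "l r = s" by auto
    have "l r \<le> l s"
      using l(1) r(1) t strict_mono_on_leD[of "{0..s}" l r s] by (auto simp: time_changes_def)
    moreover have "l s \<in> {0..s}" using l(1) t True by (auto simp: time_changes_def)
    ultimately have "l s = s" using r by auto
    then show False using l(2)[of s] t True e unfolding e_def by auto
  next
    case False
    then have ts: "0 \<le> t" "t < s" using t by auto
    have near: "\<exists>d>0. \<forall>r. t < r \<and> r < t + d \<and> r \<le> s \<longrightarrow> hat_dist (k r) (k t) < e"
      if k: "cadlag_on {0..s} k" for k
    proof -
      have "(k \<longlongrightarrow> k t) (at t within {0..s} \<inter> {t<..})"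
        using k t by (auto simp: cadlag_on_def)
      from order_tendstoD(2)[OF tendsto_hat_dist[OF this] e]
      obtain d where "d > 0"
        "\<And>r. r \<in> {0..s} \<inter> {t<..} \<Longrightarrow> r \<noteq> t \<Longrightarrow> dist r t < d \<Longrightarrow> hat_dist (k r) (k t) < e"
        unfolding eventually_at by blast
      then show ?thesis
        using ts by (intro exI[of _ d]) (auto simp: dist_real_def)
    qed
    obtain d1 where d1: "d1 > 0" "\<And>r. t < r \<Longrightarrow> r < t + d1 \<Longrightarrow> r \<le> s \<Longrightarrow> hat_dist (f r) (f t) < e"
      using near[OF f] by blast
    obtain d2 where d2: "d2 > 0" "\<And>r. t < r \<Longrightarrow> r < t + d2 \<Longrightarrow> r \<le> s \<Longrightarrow> hat_dist (g r) (g t) < e"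
      using near[OF g] by blast
    define d where "d = min (min d1 d2) (s - t)"
    have d: "0 < d" "d \<le> d1" "d \<le> d2" "t + d \<le> s"
      using d1 d2 ts by (auto simp: d_def)
    obtain l where l: "l \<in> time_changes s"
      "\<And>r. r \<in> {0..s} \<Longrightarrow> \<bar>l r - r\<bar> < min e (d / 2) \<and> hat_dist (f (l r)) (g r) < min e (d / 2)"
      using skorokhod_dist_lessD[of s f g "min e (d / 2)"] zero e d by auto
    define r where "r = t + d / 2"
    have r: "r \<in> {0..s}" "t < r" "r < t + d" using d ts by (auto simp: r_def)
    have lr: "\<bar>l r - r\<bar> < d / 2" "hat_dist (f (l r)) (g r) < e"
      using l(2)[OF r(1)] by auto
    have 1: "hat_dist (f (l r)) (f t) < e"
      using lr(1) d by (intro d1(2)) (auto simp: r_def abs_if split: if_splits)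
    have 2: "hat_dist (g r) (g t) < e"
      using r d by (intro d2(2)) auto
    have "hat_dist (f t) (g t) \<le> hat_dist (f (l r)) (f t) + hat_dist (f (l r)) (g r) + hat_dist (g r) (g t)"
      using hat_dist_triangle[of "f t" "g t" "f (l r)"] hat_dist_triangle[of "f (l r)" "g t" "g r"]
        hat_dist_commute[of "f t" "f (l r)"] by linarith
    then show False using 1 2 lr(2) by (simp add: e_def)
  qed
qed

lemma Metric_space_skorokhod:
  "Metric_space (space (skorokhod_space S {0..s})) (skorokhod_dist s)"
proof
  show "0 \<le> skorokhod_dist s f g" for f g
    by (rule skorokhod_dist_nonneg)
  show "skorokhod_dist s f g = skorokhod_dist s g f" for f g
    by (intro antisym skorokhod_dist_commute_le)
  show "skorokhod_dist s f h \<le> skorokhod_dist s f g + skorokhod_dist s g h" for f g h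
    by (rule skorokhod_dist_triangle)
  fix f g
  assume fg: "f \<in> space (skorokhod_space S {0..s})" "g \<in> space (skorokhod_space S {0..s})"
  show "skorokhod_dist s f g = 0 \<longleftrightarrow> f = g"
  proof
    assume zero: "skorokhod_dist s f g = 0"
    have "f \<in> extensional {0..s}" "g \<in> extensional {0..s}"
      using fg by (auto simp: skorokhod_space_def space_restrict_space space_PiM PiE_def)
    moreover have "f t = g t" if "t \<in> {0..s}" for t
      using fg zero that
      by (intro skorokhod_dist_eq_0D[of s f g]) (auto simp: skorokhod_space_def space_restrict_space)
    ultimately show "f = g"
      by (intro extensionalityI) auto
  next
    assume "f = g"
    then have "skorokhod_dist s f g \<le> 0"
      by (intro skorokhod_dist_leI[OF time_changes_id]) (auto simp: hat_dist_def)
    then show "skorokhod_dist s f g = 0"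
      using skorokhod_dist_nonneg[of s f g] by simp
  qed
qed

definition skorokhod_topology :: "nat set \<Rightarrow> real \<Rightarrow> (real \<Rightarrow> hat_state) topology" where
  "skorokhod_topology S s =
     Metric_space.mtopology (space (skorokhod_space S {0..s})) (skorokhod_dist s)"

text \<open>Weak convergence of laws \<open>\<mu> T\<close> to \<open>\<nu>\<close> as \<open>T \<longlonglongrightarrow> \<infinity>\<close>. On \<open>skorokhod_space S {0..s}\<close>
  the coordinate \<open>\<sigma>\<close>-algebra is the Borel \<open>\<sigma>\<close>-algebra of \<open>skorokhod_topology S s\<close>, so the test
  functions are measurable.\<close>

definition weakly_converges :: "'p topology \<Rightarrow> (real \<Rightarrow> 'p measure) \<Rightarrow> 'p measure \<Rightarrow> bool" where
  "weakly_converges \<T> \<mu> \<nu> \<longleftrightarrow>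
     (\<forall>F. continuous_map \<T> euclideanreal F \<and> bounded (F ` topspace \<T>) \<longrightarrow>
        ((\<lambda>T. \<integral>f. F f \<partial>\<mu> T) \<longlongrightarrow> (\<integral>f. F f \<partial>\<nu>)) at_top)"

text \<open>The law of \<open>X\<^sup>T\<close>, started from \<open>(i, u)\<close>, restricted to \<open>\<F>\<^sub>s\<close>, i.e. the conditional law of
  \<open>(hat_X t)\<close>, \<open>0 \<le> t \<le> s\<close>, given \<open>\<tau> > T\<close>. It is meaningful for \<open>T \<ge> s\<close> only, as otherwise the
  process may be killed before \<open>s\<close>.\<close>

definition conditioned_law ::
  "nat set \<Rightarrow> (nat \<Rightarrow> 'w measure) \<Rightarrow> (real \<Rightarrow> 'w \<Rightarrow> nat) \<Rightarrow> hat_state \<Rightarrow> real \<Rightarrow> real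
     \<Rightarrow> (real \<Rightarrow> hat_state) measure" where
  "conditioned_law S P X = (\<lambda>(i, u) s T.
     let A = survival P X T (i, u) in
     distr (restrict_space (uniform_measure (P i) A) A) (skorokhod_space S {0..s})
       (\<lambda>\<omega>. \<lambda>t\<in>{0..s}. hat_X u (\<lambda>r. X r \<omega>) t))"

definition restricted_law ::
  "nat set \<Rightarrow> (real \<Rightarrow> hat_state) measure \<Rightarrow> real \<Rightarrow> (real \<Rightarrow> hat_state) measure" where
  "restricted_law S N s = distr N (skorokhod_space S {0..s}) (\<lambda>f. restrict f {0..s})"

definition exit_rate :: "(nat \<Rightarrow> nat \<Rightarrow> real) \<Rightarrow> nat \<Rightarrow> real" where
  "exit_rate q i = - q i i"

text \<open>\<open>D\<close> stands for the left derivative of \<open>cycle_mgf\<close> at \<open>\<phi>\<close>.\<close>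

definition kappa :: "(nat \<Rightarrow> nat \<Rightarrow> real) \<Rightarrow> real \<Rightarrow> real \<Rightarrow> real" where
  "kappa q \<phi> D = exp (\<phi> - exit_rate q 0) / (\<phi> * D)"

definition p_fun ::
  "(nat \<Rightarrow> nat \<Rightarrow> real) \<Rightarrow> (nat \<Rightarrow> 'w measure) \<Rightarrow> (real \<Rightarrow> 'w \<Rightarrow> nat) \<Rightarrow> real \<Rightarrow> real
     \<Rightarrow> hat_state \<Rightarrow> ennreal" where
  "p_fun q P X \<phi> D = (\<lambda>(i, u).
     if i = 0 then
       ennreal (integral {0..1 - u} (\<lambda>s. exp ((\<phi> - exit_rate q 0) * s)) /
                integral {0..1} (\<lambda>s. exp ((\<phi> - exit_rate q 0) * s)) * kappa q \<phi> D)
     else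
       ennreal (kappa q \<phi> D) * (\<integral>\<^sup>+\<omega>. exp_ereal \<phi> (hitting_time_0 (\<lambda>t. X t \<omega>)) \<partial>P i))"

text \<open>\<open>P\<^sup>\<infinity>\<^sub>x(dy; t) = exp (\<phi> t) (p\<^sub>y / p\<^sub>x) hat_P\<^sub>x(dy; t)\<close>, for \<open>y\<close> in \<open>C\<close> as well as in
  \<open>{0} \<times> [0,1)\<close>. The factor \<open>exp (\<phi> t)\<close> is the one for which the total mass is \<open>1\<close>: since
  \<open>P\<^sub>x(\<tau> > T) ~ p\<^sub>x exp (- \<phi> T)\<close>, the function \<open>p\<close> satisfies
  \<open>\<integral> p\<^sub>y hat_P\<^sub>x(dy; t) = exp (- \<phi> t) p\<^sub>x\<close>, with \<open>\<phi> > 0\<close>.\<close>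

definition P_infinity ::
  "nat set \<Rightarrow> (nat \<Rightarrow> nat \<Rightarrow> real) \<Rightarrow> (nat \<Rightarrow> 'w measure) \<Rightarrow> (real \<Rightarrow> 'w \<Rightarrow> nat) \<Rightarrow> real \<Rightarrow> real
     \<Rightarrow> real \<Rightarrow> hat_state \<Rightarrow> hat_state measure" where
  "P_infinity S q P X \<phi> D t x =
     density (hat_P S P X t x)
       (\<lambda>y. ennreal (exp (\<phi> * t)) * (p_fun q P X \<phi> D y / p_fun q P X \<phi> D x))"

end

theory Submission
  imports Defs
begin

text \<open>Let \<open>Z t = exp (\<phi> t) P\<^sub>0(\<tau> > t)\<close>. Splitting at the first return to \<open>0\<close> gives a renewal equation
  \<open>Z t = z t + \<integral> Z (t - r) \<nu>(dr)\<close>, in which \<open>\<nu>(dr) = exp (\<phi> r) P\<^sub>0(W \<in> dr, H\<^sup>1 < 1)\<close> is a probability law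
  because \<open>I(\<phi>) = 1\<close>, with finite mean \<open>I'(\<phi>-)\<close>. Hence \<open>Z\<close> has a positive limit, and splitting at the
  first return once more, \<open>exp (\<phi> t) P\<^sub>y(\<tau> > t)\<close> tends to a constant times
  \<open>gam y = E\<^sub>y[exp (\<phi> W); the first stay in 0 ends in time]\<close>, which is \<open>p\<^sub>y / \<kappa>\<close> and which is finite and positive
  by irreducibility.

  By the Markov property at \<open>s\<close>, conditioning on \<open>\<tau> > T\<close> gives \<open>hat_X\<close> on \<open>[0,s]\<close> the density
  \<open>1(\<tau> > s) P\<^sub>h(\<tau> > T - s) / P\<^sub>y(\<tau> > T)\<close> with \<open>h = hat_X s\<close>, which converges to
  \<open>tilt = exp (\<phi> s) 1(\<tau> > s) gam h / gam y\<close> as \<open>T \<longrightarrow> \<infinity>\<close>. As \<open>gam\<close> is harmonic, \<open>tilt\<close> has mean \<open>1\<close> and the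
  expectations of all bounded measurable functionals converge, whatever the topology on the path space.
  The limit process is the Doob transform of the killed process by \<open>gam\<close>; its law on \<open>[0,\<infinity>)\<close> is glued
  from pieces of unit length by the Ionescu-Tulcea theorem.\<close>

section \<open>The killed process as a functional of the path\<close>

text \<open>The hypotheses provide the Markov property at fixed times only, while the killed process
  carries an age that depends on the past. Ages are therefore computed along the path by a
  deterministic flow, and regeneration at the first return is obtained by approximating the return
  time from the right by grid times; the passage to the limit needs survival to be continuous in a
  small age, which the exponential holding time in 0 supplies. The same exponential time smears
  \<nu>: prolonging a stay in 0 delays the return, so the support of \<nu> contains an interval.
  Together with the monotonicity of \<open>exp (- \<phi> t) Z t\<close>, which stands in for
  continuity of \<open>Z\<close>, this is what drives the renewal theorem. Finiteness of
  \<open>gam\<close> on \<open>C\<close> has to be derived: Fatou's lemma makes \<open>gam\<close>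
  superharmonic while infinite values are still possible at later states, and accessibility from 0
  then bounds \<open>gam (i, 0)\<close> by a multiple of \<open>gam (0, 0) = 1\<close>. The closed
  form of \<open>gam (0, u)\<close> solves a cocycle equation in the remaining time
  \<open>1 - u\<close>, whose exponent is \<phi> from the delayed return plus \<open>q 0 0\<close>
  from the prolonged stay.\<close>

definition path_alive :: "real \<Rightarrow> (real \<Rightarrow> nat) \<Rightarrow> real \<Rightarrow> bool" where
  "path_alive u x t \<longleftrightarrow> (\<forall>r\<in>{0..t}. snd (hat_X u x r) < 1)"

text \<open>Only nonnegative times matter; \<open>max 0\<close> keeps the shifted path in the state space at negative ones.\<close>

definition path_shift :: "real \<Rightarrow> (real \<Rightarrow> nat) \<Rightarrow> real \<Rightarrow> nat" where
  "path_shift s x = (\<lambda>t. x (s + max 0 t))"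

text \<open>The past up to \<open>s\<close> is expressed by invariance:
  \<open>F (path_stop s x) = F x\<close> says that \<open>F\<close> reads the path up to
  \<open>s\<close> only. This replaces a filtration on path space.\<close>

definition path_stop :: "real \<Rightarrow> (real \<Rightarrow> nat) \<Rightarrow> real \<Rightarrow> nat" where
  "path_stop s x = (\<lambda>t. x (min s t))"

text \<open>The event \<open>W \<le> t\<close> in terms of times of the path. From a start outside 0
  it is the event that 0 has been hit, so the states of \<open>C\<close> and the states
  \<open>(0, u)\<close> share one decomposition at the first return.\<close>

definition returned :: "(real \<Rightarrow> nat) \<Rightarrow> real \<Rightarrow> bool" where
  "returned x t \<longleftrightarrow> (\<exists>r r'. 0 \<le> r \<and> r \<le> r' \<and> r' \<le> t \<and> x r \<noteq> 0 \<and> x r' = 0)"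

text \<open>The first stay in 0 of a path of initial age \<open>u\<close> does not kill it. The
  interval is closed, since a path that leaves exactly at age 1 has only had ages below 1. A start
  outside 0 passes the test at time 0.\<close>

definition exits :: "real \<Rightarrow> (real \<Rightarrow> nat) \<Rightarrow> bool" where
  "exits u x \<longleftrightarrow> (\<exists>r\<in>{0..1-u}. x r \<noteq> 0)"

text \<open>In the discrete space \<open>nat\<close> a limit is attained eventually, so one-sided
  limits give intervals on which the path is constant.\<close>

lemma cadlag_right_const:
  fixes x :: "real \<Rightarrow> nat"
  assumes "cadlag_on {0..} x" "0 \<le> t"
  obtains e where "e > 0" "\<And>r. t \<le> r \<Longrightarrow> r < t + e \<Longrightarrow> x r = x t"
proof -
  have "(x \<longlongrightarrow> x t) (at t within {0..} \<inter> {t<..})"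
    using assms unfolding cadlag_on_def by auto
  then have "\<forall>\<^sub>F r in at t within {0..} \<inter> {t<..}. x r = x t"
    by (simp add: tendsto_discrete)
  then obtain d where d: "d > 0"
    "\<And>r. r \<in> {0..} \<inter> {t<..} \<Longrightarrow> r \<noteq> t \<Longrightarrow> dist r t < d \<Longrightarrow> x r = x t"
    unfolding eventually_at by blast
  show thesis
  proof (rule that[OF d(1)])
    fix r assume "t \<le> r" "r < t + d"
    then show "x r = x t"
      using d(2)[of r] assms(2) by (cases "r = t") (auto simp: dist_real_def)
  qed
qed

lemma cadlag_left_const:
  fixes x :: "real \<Rightarrow> nat"
  assumes "cadlag_on {0..} x" "0 < t"
  obtains e l where "e > 0" "e \<le> t" "\<And>r. t - e \<le> r \<Longrightarrow> r < t \<Longrightarrow> x r = l"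
proof -
  obtain l where "(x \<longlongrightarrow> l) (at t within {0..} \<inter> {..<t})"
    using assms unfolding cadlag_on_def by force
  then have "\<forall>\<^sub>F r in at t within {0..} \<inter> {..<t}. x r = l"
    by (simp add: tendsto_discrete)
  then obtain d where d: "d > 0"
    "\<And>r. r \<in> {0..} \<inter> {..<t} \<Longrightarrow> r \<noteq> t \<Longrightarrow> dist r t < d \<Longrightarrow> x r = l"
    unfolding eventually_at by blast
  show thesis
  proof (rule that[of "min t (d / 2)" l])
    fix r assume "t - min t (d / 2) \<le> r" "r < t"
    then show "x r = l"
      using d(1) d(2)[of r] assms(2) by (auto simp: dist_real_def min_def split: if_splits)
  qed (use d(1) assms(2) in auto)
qed

section \<open>Ages along a path\<close>

lemma snd_hat_X:
  "snd (hat_X u x t) = (if x t \<noteq> 0 then 0 else if \<forall>r\<in>{0..t}. x r = 0 then u + t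
     else t - Sup {r\<in>{0..t}. x r \<noteq> 0})"
  by (simp add: hat_X_def holding_time_def)

lemma snd_hat_X_Sup:
  "x t = 0 \<Longrightarrow> \<not> (\<forall>r\<in>{0..t}. x r = 0) \<Longrightarrow> snd (hat_X u x t) = t - Sup {r\<in>{0..t}. x r \<noteq> 0}"
  unfolding snd_hat_X by (simp only: if_True if_False simp_thms)

lemma fst_hat_X [simp]: "fst (hat_X u x t) = x t"
  by (simp add: hat_X_def holding_time_def)

lemma hat_X_cong:
  assumes "\<And>r. 0 \<le> r \<Longrightarrow> r \<le> t \<Longrightarrow> x r = y r" "0 \<le> t"
  shows "hat_X u x t = hat_X u y t"
proof -
  have "x t = y t" "(\<forall>r\<in>{0..t}. x r = 0) \<longleftrightarrow> (\<forall>r\<in>{0..t}. y r = 0)"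
    "{r\<in>{0..t}. x r \<noteq> 0} = {r\<in>{0..t}. y r \<noteq> 0}"
    using assms by auto
  then show ?thesis
    by (intro prod_eqI) (simp_all add: snd_hat_X)
qed

lemma path_alive_cong:
  assumes "\<And>r. 0 \<le> r \<Longrightarrow> r \<le> t \<Longrightarrow> x r = y r"
  shows "path_alive u x t = path_alive u y t"
  unfolding path_alive_def using assms by (intro ball_cong refl, subst hat_X_cong[of _ x y]) auto

lemma hat_X_stop: "0 \<le> t \<Longrightarrow> t \<le> s \<Longrightarrow> hat_X u (path_stop s x) t = hat_X u x t"
  by (rule hat_X_cong) (auto simp: path_stop_def)

lemma path_alive_stop: "t \<le> s \<Longrightarrow> path_alive u (path_stop s x) t = path_alive u x t"
  by (rule path_alive_cong) (auto simp: path_stop_def)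

lemma path_shift_apply: "0 \<le> t \<Longrightarrow> path_shift s x t = x (s + t)"
  by (simp add: path_shift_def)

lemma hat_X_0: "hat_X u x 0 = (x 0, if x 0 = 0 then u else 0)"
  by (intro prod_eqI) (auto simp: snd_hat_X)

text \<open>The age is all the memory that the hat process needs. If the path stays in 0 on
  \<open>[s, s + t]\<close>, the age grows linearly from its value at \<open>s\<close>; otherwise
  the last entry into 0 is not before \<open>s\<close> and its time is merely translated.\<close>

lemma hat_X_flow:
  assumes "0 \<le> s" "0 \<le> t"
  shows "hat_X u x (s + t) = hat_X (snd (hat_X u x s)) (path_shift s x) t"
proof (rule prod_eqI)
  show "fst (hat_X u x (s + t)) = fst (hat_X (snd (hat_X u x s)) (path_shift s x) t)"
    using assms by (simp add: path_shift_apply)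
  let ?z = "path_shift s x" and ?v = "snd (hat_X u x s)"
  show "snd (hat_X u x (s + t)) = snd (hat_X ?v ?z t)"
  proof (cases "x (s + t) = 0")
    case False
    then show ?thesis using assms by (simp add: snd_hat_X path_shift_apply)
  next
    case True
    show ?thesis
    proof (cases "\<forall>r\<in>{0..t}. ?z r = 0")
      case zero: True
      have z: "x r = 0" if "s \<le> r" "r \<le> s + t" for r
        using zero[rule_format, of "r - s"] that by (simp add: path_shift_apply)
      have xs: "x s = 0" using z[of s] assms by simp
      have rhs: "snd (hat_X ?v ?z t) = ?v + t"
        using zero assms by (auto simp: snd_hat_X)
      show ?thesis
      proof (cases "\<forall>r\<in>{0..s}. x r = 0")
        case all: True
        have "\<forall>r\<in>{0..s+t}. x r = 0"
          using all z by (metis atLeastAtMost_iff linear)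
        then show ?thesis unfolding rhs using all True xs by (simp add: snd_hat_X)
      next
        case False
        \<comment> \<open>No time outside 0 is added after \<open>s\<close>, so the ages at
          \<open>s\<close> and at \<open>s + t\<close> refer to the same last entry.\<close>
        have "r \<le> s" if "r \<le> s + t" "x r \<noteq> 0" for r
          using z[of r] that by (cases "r \<le> s") auto
        then have "{r\<in>{0..s+t}. x r \<noteq> 0} = {r\<in>{0..s}. x r \<noteq> 0}"
          using assms by force
        moreover have "\<not> (\<forall>r\<in>{0..s+t}. x r = 0)"
          using False assms by auto
        ultimately have "snd (hat_X u x (s + t)) = s + t - Sup {r\<in>{0..s}. x r \<noteq> 0}"
          using True snd_hat_X_Sup[of x "s + t" u] by simp
        moreover have "?v = s - Sup {r\<in>{0..s}. x r \<noteq> 0}"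
          using False xs by (rule snd_hat_X_Sup[rotated])
        ultimately show ?thesis unfolding rhs by simp
      qed
    next
      case False
      let ?A = "{r\<in>{0..t}. ?z r \<noteq> 0}"
      have ne: "?A \<noteq> {}" using False by auto
      have bdd: "bdd_above ?A" by (rule bdd_aboveI[of _ t]) auto
      have "Sup {r\<in>{0..s+t}. x r \<noteq> 0} = s + Sup ?A"
      proof (rule cSup_eq_non_empty)
        obtain a where a: "a \<in> ?A" using ne by blast
        then show "{r\<in>{0..s+t}. x r \<noteq> 0} \<noteq> {}"
          using assms by (auto simp: path_shift_apply intro!: exI[of _ "s + a"])
        fix b assume b: "b \<in> {r\<in>{0..s+t}. x r \<noteq> 0}"
        show "b \<le> s + Sup ?A"
        proof (cases "b \<le> s")
          case True
          have "0 \<le> Sup ?A" using a bdd by (intro cSup_upper2[of a]) auto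
          then show ?thesis using True by simp
        next
          case False
          then have "b - s \<in> ?A" using b by (auto simp: path_shift_apply)
          then show ?thesis using cSup_upper[OF _ bdd, of "b - s"] by simp
        qed
      next
        fix y assume y: "\<And>b. b \<in> {r\<in>{0..s+t}. x r \<noteq> 0} \<Longrightarrow> b \<le> y"
        have "Sup ?A \<le> y - s"
        proof (rule cSup_least[OF ne])
          fix a assume "a \<in> ?A"
          then have "s + a \<in> {r\<in>{0..s+t}. x r \<noteq> 0}"
            using assms by (auto simp: path_shift_apply)
          from y[OF this] show "a \<le> y - s" by simp
        qed
        then show "s + Sup ?A \<le> y" by simp
      qed
      moreover have "\<not> (\<forall>r\<in>{0..s+t}. x r = 0)"
        using ne assms by (auto simp: path_shift_apply)
      ultimately have "snd (hat_X u x (s + t)) = s + t - (s + Sup ?A)"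
        using True snd_hat_X_Sup[of x "s + t" u] by simp
      moreover have "snd (hat_X ?v ?z t) = t - Sup ?A"
        using True False assms(2) by (intro snd_hat_X_Sup) (simp_all add: path_shift_apply)
      ultimately show ?thesis by simp
    qed
  qed
qed

lemma path_alive_flow:
  assumes "0 \<le> s" "0 \<le> t"
  shows "path_alive u x (s + t) \<longleftrightarrow>
    path_alive u x s \<and> path_alive (snd (hat_X u x s)) (path_shift s x) t"
proof safe
  assume a: "path_alive u x (s + t)"
  then show "path_alive u x s" using assms by (auto simp: path_alive_def)
  show "path_alive (snd (hat_X u x s)) (path_shift s x) t"
    unfolding path_alive_def
  proof
    fix r assume "r \<in> {0..t}"
    then show "snd (hat_X (snd (hat_X u x s)) (path_shift s x) r) < 1"
      using a[unfolded path_alive_def, rule_format, of "s + r"] assms hat_X_flow[of s r u x] by simp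
  qed
next
  assume a: "path_alive u x s" "path_alive (snd (hat_X u x s)) (path_shift s x) t"
  show "path_alive u x (s + t)"
    unfolding path_alive_def
  proof
    fix r assume r: "r \<in> {0..s+t}"
    show "snd (hat_X u x r) < 1"
    proof (cases "r \<le> s")
      case True
      then show ?thesis using a(1) r by (auto simp: path_alive_def)
    next
      case False
      then have "r - s \<in> {0..t}" using r by auto
      then show ?thesis
        using a(2) hat_X_flow[of s "r - s" u x] assms(1) by (auto simp: path_alive_def)
    qed
  qed
qed

lemma path_alive_mono: "path_alive u x t \<Longrightarrow> s \<le> t \<Longrightarrow> path_alive u x s"
  by (auto simp: path_alive_def)

lemma age_zero_run:
  assumes "0 \<le> a" "a \<le> b" "\<And>r. a \<le> r \<Longrightarrow> r \<le> b \<Longrightarrow> x r = 0"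
  shows "hat_X u x b = (0, snd (hat_X u x a) + (b - a))"
proof -
  have "\<forall>r\<in>{0..b-a}. path_shift a x r = 0"
    using assms by (auto simp: path_shift_apply)
  moreover from this have "path_shift a x (b - a) = 0"
    using assms(2) by auto
  ultimately have "snd (hat_X (snd (hat_X u x a)) (path_shift a x) (b - a)) = snd (hat_X u x a) + (b - a)"
    by (subst snd_hat_X) (rule if_not_P[THEN trans], simp, rule if_P)
  then show ?thesis
    using hat_X_flow[of a "b - a" u x] assms(1,2) assms(3)[of b]
    by (intro prod_eqI) (auto simp: path_shift_apply)
qed

lemma age_nonneg:
  assumes "0 \<le> u" "0 \<le> t"
  shows "0 \<le> snd (hat_X u x t)"
proof -
  have "Sup {r\<in>{0..t}. x r \<noteq> 0} \<le> t" if "\<not> (\<forall>r\<in>{0..t}. x r = 0)"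
    using that by (intro cSup_least) auto
  then show ?thesis using assms by (auto simp: snd_hat_X)
qed

text \<open>The path is locally constant to the right, so the age is locally affine in 0 and
  vanishes outside. Besides right-continuity this shows that an age below 1, or at least 1, persists
  for a while.\<close>

lemma hat_X_right:
  assumes "cadlag_on {0..} x" "0 \<le> t"
  obtains e where "e > 0" "\<And>r. t \<le> r \<Longrightarrow> r < t + e \<Longrightarrow>
    hat_X u x r = (x t, if x t = 0 then snd (hat_X u x t) + (r - t) else 0)"
proof -
  obtain e where e: "e > 0" "\<And>r. t \<le> r \<Longrightarrow> r < t + e \<Longrightarrow> x r = x t"
    using cadlag_right_const[OF assms] by blast
  show thesis
  proof (rule that[OF e(1)])
    fix r assume r: "t \<le> r" "r < t + e"
    show "hat_X u x r = (x t, if x t = 0 then snd (hat_X u x t) + (r - t) else 0)"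
    proof (cases "x t = 0")
      case True
      have "x q = 0" if "t \<le> q" "q \<le> r" for q
        using e(2)[of q] True that r by linarith
      from age_zero_run[OF assms(2) r(1) this] True show ?thesis by simp
    next
      case False
      then show ?thesis using e(2)[OF r] by (intro prod_eqI) (auto simp: snd_hat_X)
    qed
  qed
qed

lemma cadlag_hat_X:
  assumes x: "cadlag_on {0..} x"
  shows "cadlag_on {0..} (hat_X u x)"
  unfolding cadlag_on_def
proof (intro conjI ballI)
  fix t :: real assume "t \<in> {0..}"
  then have t: "0 \<le> t" by simp
  obtain e where e: "e > 0" "\<And>r. t \<le> r \<Longrightarrow> r < t + e \<Longrightarrow>
    hat_X u x r = (x t, if x t = 0 then snd (hat_X u x t) + (r - t) else 0)"
    using hat_X_right[OF x t] by blast
  let ?g = "\<lambda>r. (x t, if x t = 0 then snd (hat_X u x t) + (r - t) else 0)"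
  have "(?g \<longlongrightarrow> ?g t) (at t within {0..} \<inter> {t<..})"
    by (cases "x t = 0") (auto intro!: tendsto_eq_intros)
  then have "(hat_X u x \<longlongrightarrow> ?g t) (at t within {0..} \<inter> {t<..})"
    by (rule Lim_transform_within[OF _ e(1)]) (subst e(2), auto simp: dist_real_def)
  then show "(hat_X u x \<longlongrightarrow> hat_X u x t) (at t within {0..} \<inter> {t<..})"
    using e(2)[of t] e(1) by simp
  show "\<exists>l. (hat_X u x \<longlongrightarrow> l) (at t within {0..} \<inter> {..<t})"
  proof (cases "t = 0")
    case True
    then have "{0..} \<inter> {..<t} = ({} :: real set)" by auto
    then show ?thesis by simp
  next
    case False
    then have "0 < t" using t by simp
    then obtain d l where d: "d > 0" "d \<le> t" "\<And>r. t - d \<le> r \<Longrightarrow> r < t \<Longrightarrow> x r = l"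
      using cadlag_left_const[OF x] by blast
    \<comment> \<open>Left of \<open>t\<close> the path is constant, so the age is affine there. The
      left limit is taken in \<open>nat \<times> real\<close> and need not belong to
      \<open>hat_states S\<close>.\<close>
    let ?h = "\<lambda>r. (l, if l = 0 then snd (hat_X u x (t - d)) + (r - (t - d)) else 0)"
    have h: "hat_X u x r = ?h r" if "t - d \<le> r" "r < t" for r
    proof (cases "l = 0")
      case True
      then show ?thesis using age_zero_run[of "t - d" r x u] d that by simp
    next
      case False
      then show ?thesis using d(3)[OF that] by (intro prod_eqI) (auto simp: snd_hat_X)
    qed
    have "(?h \<longlongrightarrow> ?h t) (at t within {0..} \<inter> {..<t})"
      by (cases "l = 0") (auto intro!: tendsto_eq_intros)
    then have "(hat_X u x \<longlongrightarrow> ?h t) (at t within {0..} \<inter> {..<t})"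
      by (rule Lim_transform_within[OF _ d(1)]) (use h in \<open>auto simp: dist_real_def\<close>)
    then show ?thesis by blast
  qed
qed

section \<open>Killing, returns, and survival before the first return\<close>

lemma less_killing_time_iff:
  assumes x: "cadlag_on {0..} x" and t: "0 \<le> t"
  shows "ereal t < killing_time u x \<longleftrightarrow> path_alive u x t"
proof
  assume a: "ereal t < killing_time u x"
  show "path_alive u x t"
    unfolding path_alive_def
  proof (rule ballI, rule ccontr)
    fix r assume r: "r \<in> {0..t}" "\<not> snd (hat_X u x r) < 1"
    then have "\<exists>h. holding_time u x r = Some h \<and> 1 \<le> h"
      by (auto simp: hat_X_def split: option.splits)
    then have "killing_time u x \<le> ereal r"
      using r unfolding killing_time_def by (intro Inf_lower) auto
    then have "ereal t < ereal r" using a by (rule order_less_le_trans[rotated])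
    then show False using r by simp
  qed
next
  assume a: "path_alive u x t"
  obtain e where e: "e > 0" "\<And>r. t \<le> r \<Longrightarrow> r < t + e \<Longrightarrow>
    hat_X u x r = (x t, if x t = 0 then snd (hat_X u x t) + (r - t) else 0)"
    using hat_X_right[OF x t] by blast
  \<comment> \<open>Within \<open>d\<close> the age in 0 grows by less than what is left to 1, so
    all ages before \<open>t + d\<close> stay below 1 and the infimum exceeds \<open>t\<close>
    strictly.\<close>
  define d where "d = min e (1 - snd (hat_X u x t))"
  have al: "snd (hat_X u x t) < 1" using a t by (auto simp: path_alive_def)
  then have d: "d > 0" using e(1) by (simp add: d_def)
  have "ereal (t + d) \<le> killing_time u x"
    unfolding killing_time_def
  proof (rule Inf_greatest, safe)
    fix r h assume r: "0 \<le> r" "holding_time u x r = Some h" "1 \<le> h"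
    then have age: "1 \<le> snd (hat_X u x r)" by (simp add: hat_X_def)
    show "ereal (t + d) \<le> ereal r"
    proof (rule ccontr)
      assume "\<not> ereal (t + d) \<le> ereal r"
      then have rd: "r < t + d" by simp
      have "t < r"
      proof (rule ccontr)
        assume "\<not> t < r"
        then show False using a[unfolded path_alive_def, rule_format, of r] age r(1) by simp
      qed
      then have "snd (hat_X u x r) \<le> max 0 (snd (hat_X u x t) + (r - t))"
        using e(2)[of r] rd by (auto simp: d_def)
      then show False using age rd by (auto simp: d_def)
    qed
  qed
  then show "ereal t < killing_time u x"
    by (rule order_less_le_trans[rotated]) (simp add: d)
qed

text \<open>A finite cycle time is a minimum: times of the set that are close to the infimum
  \<open>c\<close> fall into the interval on which the path keeps its value at \<open>c\<close>, so
  \<open>x c = 0\<close>. The witness \<open>r\<close> outside 0 then lies strictly before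
  \<open>c\<close>.\<close>

lemma cycle_timeE:
  assumes x: "cadlag_on {0..} x" and "cycle_time x \<noteq> \<infinity>"
  obtains c r where "cycle_time x = ereal c" "0 \<le> r" "r < c" "x r \<noteq> 0" "x c = 0"
    "\<And>t. t < c \<Longrightarrow> \<not> returned x t"
proof -
  let ?A = "{t. x t = 0 \<and> (\<exists>r\<in>{0..t}. x r \<noteq> 0)}"
  have eq: "cycle_time x = Inf (ereal ` ?A)"
    unfolding cycle_time_def by (rule arg_cong[of _ _ Inf]) auto
  have ne: "?A \<noteq> {}"
  proof
    assume "?A = {}"
    then have "cycle_time x = \<infinity>" unfolding eq by (simp only: image_empty Inf_empty top_ereal_def)
    then show False using assms(2) by simp
  qed
  have bdd: "bdd_below ?A" by (rule bdd_belowI[of _ 0]) auto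
  define c where "c = Inf ?A"
  have ct: "cycle_time x = ereal c"
    unfolding eq c_def using ereal_Inf'[OF bdd ne] by (simp add: image_image)
  have c0: "0 \<le> c" unfolding c_def using ne by (intro cInf_greatest) auto
  obtain e where e: "e > 0" "\<And>r. c \<le> r \<Longrightarrow> r < c + e \<Longrightarrow> x r = x c"
    using cadlag_right_const[OF x c0] by blast
  obtain t where t: "t \<in> ?A" "t < c + e"
    using cInf_lessD[OF ne, of "c + e"] e(1) unfolding c_def by auto
  have ct': "c \<le> t" unfolding c_def using t(1) bdd by (intro cInf_lower) auto
  have xc: "x c = 0" using e(2)[OF ct' t(2)] t(1) by auto
  obtain r where r: "0 \<le> r" "r \<le> t" "x r \<noteq> 0" using t(1) by auto
  have "r < c"
    using e(2)[of r] r t(2) xc by (cases "r < c") auto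
  moreover have "\<not> returned x s" if "s < c" for s
  proof
    assume "returned x s"
    then obtain a b where "0 \<le> a" "a \<le> b" "b \<le> s" "x a \<noteq> 0" "x b = 0"
      by (auto simp: returned_def)
    then have "b \<in> ?A" by auto
    then have "c \<le> b" unfolding c_def using bdd by (intro cInf_lower) auto
    then show False using \<open>b \<le> s\<close> that by simp
  qed
  ultimately show thesis using that ct r xc by blast
qed

lemma cycle_time_le_iff:
  assumes x: "cadlag_on {0..} x"
  shows "cycle_time x \<le> ereal t \<longleftrightarrow> returned x t"
proof
  assume le: "cycle_time x \<le> ereal t"
  then have "cycle_time x \<noteq> \<infinity>" by auto
  then obtain c r where "cycle_time x = ereal c" "0 \<le> r" "r < c" "x r \<noteq> 0" "x c = 0"
    using cycle_timeE[OF x] by blast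
  then show "returned x t" using le unfolding returned_def by (intro exI[of _ r] exI[of _ c]) auto
next
  assume "returned x t"
  then obtain a b where "0 \<le> a" "a \<le> b" "b \<le> t" "x a \<noteq> 0" "x b = 0"
    by (auto simp: returned_def)
  then have "cycle_time x \<le> ereal b"
    unfolding cycle_time_def by (intro Inf_lower) auto
  then show "cycle_time x \<le> ereal t" by (rule order_trans) (simp add: \<open>b \<le> t\<close>)
qed

lemma cycle_time_nonneg: "0 \<le> cycle_time x"
  unfolding cycle_time_def by (rule Inf_greatest) auto

text \<open>Without a return there is at most one stay in 0, the initial one, so the age of a path
  that is in 0 at time \<open>r\<close> is \<open>u + r\<close>. The path can be killed only because
  that stay reaches age 1, at time \<open>1 - u\<close>.\<close>

lemma alive_before_cycle:
  assumes "0 \<le> u" "u < 1" "0 \<le> t" and nr: "\<not> returned x t"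
  shows "path_alive u x t \<longleftrightarrow> t < 1 - u \<or> exits u x"
proof
  have age: "snd (hat_X u x r) = u + r \<and> (\<forall>q\<in>{0..r}. x q = 0)" if "x r = 0" "r \<in> {0..t}" for r
  proof -
    have "\<forall>q\<in>{0..r}. x q = 0"
    proof (rule ballI, rule ccontr)
      fix q assume "q \<in> {0..r}" "x q \<noteq> 0"
      then have "returned x t"
        using that unfolding returned_def by (intro exI[of _ q] exI[of _ r]) auto
      then show False using nr by simp
    qed
    then show ?thesis using that by (auto simp: snd_hat_X)
  qed
  {
    assume a: "path_alive u x t"
    show "t < 1 - u \<or> exits u x"
    proof (rule ccontr)
      assume n: "\<not> ?thesis"
      then have "x (1 - u) = 0" using assms by (auto simp: exits_def)
      then have "snd (hat_X u x (1 - u)) = 1" using age[of "1 - u"] n assms by auto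
      then show False using a[unfolded path_alive_def, rule_format, of "1 - u"] n assms by simp
    qed
  next
    assume b: "t < 1 - u \<or> exits u x"
    show "path_alive u x t"
      unfolding path_alive_def
    proof
      fix r assume r: "r \<in> {0..t}"
      show "snd (hat_X u x r) < 1"
      proof (cases "x r = 0")
        case True
        have "r < 1 - u"
        proof (rule ccontr)
          assume "\<not> r < 1 - u"
          then show False using b age[OF True r] r unfolding exits_def by force
        qed
        then show ?thesis using age[OF True r] by simp
      next
        case False
        then show ?thesis by (simp add: snd_hat_X)
      qed
    qed
  }
qed

text \<open>The excursion outside 0 lasts right up to \<open>c\<close>, so the last entry into 0 is
  \<open>c\<close> itself and the age restarts at 0. This is why the first return is a regeneration
  time.\<close>

lemma hat_X_at_cycle:
  assumes x: "cadlag_on {0..} x" and c: "cycle_time x = ereal c"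
  shows "0 < c" "hat_X u x c = (0, 0)" "0 \<le> u \<Longrightarrow> u < 1 \<Longrightarrow> path_alive u x c \<longleftrightarrow> exits u x"
proof -
  obtain r where r: "0 \<le> r" "r < c" "x r \<noteq> 0" "x c = 0" "\<And>t. t < c \<Longrightarrow> \<not> returned x t"
    using cycle_timeE[OF x, of thesis] c by auto
  show "0 < c" using r by simp
  have nz: "x q \<noteq> 0" if "r \<le> q" "q < c" for q
    using r(5)[OF that(2)] r(1,3) that(1) unfolding returned_def by auto
  have "Sup {q\<in>{0..c}. x q \<noteq> 0} = c"
  proof (rule cSup_eq_non_empty)
    fix y assume y: "\<And>q. q \<in> {q\<in>{0..c}. x q \<noteq> 0} \<Longrightarrow> q \<le> y"
    show "c \<le> y"
    proof (rule dense_le_bounded[OF r(2)])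
      fix w assume "r < w" "w < c"
      then show "w \<le> y" using nz[of w] r(1) by (intro y) auto
    qed
  qed (use r in \<open>auto intro!: exI[of _ r]\<close>)
  moreover have "\<not> (\<forall>q\<in>{0..c}. x q = 0)" using r by (auto intro!: bexI[of _ r])
  ultimately show *: "hat_X u x c = (0, 0)" using r(4) by (intro prod_eqI) (auto simp: snd_hat_X)
  assume u: "0 \<le> u" "u < 1"
  show "path_alive u x c \<longleftrightarrow> exits u x"
  proof
    assume "path_alive u x c"
    then have "path_alive u x r" using r(2) path_alive_mono by force
    then have "r < 1 - u \<or> exits u x" using alive_before_cycle[OF u r(1) r(5)[OF r(2)]] by simp
    then show "exits u x"
    proof
      assume "r < 1 - u"
      then show ?thesis using r(1,3) unfolding exits_def by (intro bexI[of _ r]) auto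
    qed
  next
    assume ex: "exits u x"
    show "path_alive u x c" unfolding path_alive_def
    proof
      fix q assume q: "q \<in> {0..c}"
      show "snd (hat_X u x q) < 1"
      proof (cases "q = c")
        case False
        then have "path_alive u x q" using alive_before_cycle[OF u, of q x] r(5)[of q] q ex by auto
        then show ?thesis using q by (auto simp: path_alive_def)
      qed (simp add: *)
    qed
  qed
qed

lemma hitting_time_eq_cycle_time:
  assumes "x 0 \<noteq> 0"
  shows "hitting_time_0 x = cycle_time x"
proof -
  have "{ereal t |t. 0 \<le> t \<and> x t = 0} = {ereal t |t. x t = 0 \<and> (\<exists>r\<in>{0..t}. x r \<noteq> 0)}"
    using assms by (auto intro!: bexI[of _ 0])
  then show ?thesis by (simp add: hitting_time_0_def cycle_time_def)
qed

lemma full_holding_time_less_iff: "full_holding_time x < 1 \<longleftrightarrow> (\<exists>r\<in>{0..<1}. x r \<noteq> 0)"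
  unfolding full_holding_time_def Inf_less_iff by (auto simp: one_ereal_def) force

lemma cadlag_path_shift:
  assumes "cadlag_on {0..} x" "0 \<le> s"
  shows "cadlag_on {0..} (path_shift s x)"
  unfolding cadlag_on_def
proof (intro conjI ballI)
  fix t :: real assume "t \<in> {0..}"
  then have t: "0 \<le> t" by simp
  obtain e where e: "e > 0" "\<And>r. s + t \<le> r \<Longrightarrow> r < s + t + e \<Longrightarrow> x r = x (s + t)"
    using cadlag_right_const[OF assms(1), of "s + t"] assms(2) t by auto
  have "\<forall>\<^sub>F r in at t within {0..} \<inter> {t<..}. path_shift s x r = path_shift s x t"
    unfolding eventually_at
  proof (intro exI[of _ e] conjI ballI impI e(1))
    fix r assume "r \<in> {0..} \<inter> {t<..}" "r \<noteq> t \<and> dist r t < e"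
    then show "path_shift s x r = path_shift s x t"
      using e(2)[of "s + r"] t by (simp add: dist_real_def path_shift_apply)
  qed
  then show "(path_shift s x \<longlongrightarrow> path_shift s x t) (at t within {0..} \<inter> {t<..})"
    by (simp add: tendsto_discrete)
  show "\<exists>l. (path_shift s x \<longlongrightarrow> l) (at t within {0..} \<inter> {..<t})"
  proof (cases "t = 0")
    case True
    then have "{0..} \<inter> {..<t} = ({} :: real set)" by auto
    then show ?thesis by simp
  next
    case False
    then obtain e l where e: "e > 0" "\<And>r. s + t - e \<le> r \<Longrightarrow> r < s + t \<Longrightarrow> x r = l"
      using cadlag_left_const[OF assms(1), of "s + t"] assms(2) t by (metis add_nonneg_pos less_eq_real_def)
    have "\<forall>\<^sub>F r in at t within {0..} \<inter> {..<t}. path_shift s x r = l"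
      unfolding eventually_at using e t
      by (intro exI[of _ e]) (auto simp: dist_real_def path_shift_apply)
    then show ?thesis by (auto simp: tendsto_discrete)
  qed
qed

lemma cadlag_path_stop:
  assumes x: "cadlag_on {0..} x" "0 \<le> s"
  shows "cadlag_on {0..} (path_stop s x)"
  unfolding cadlag_on_def
proof (intro conjI ballI)
  fix t :: real assume "t \<in> {0..}"
  then have t: "0 \<le> t" by simp
  obtain e where e: "e > 0" "\<And>r. t \<le> r \<Longrightarrow> r < t + e \<Longrightarrow> x r = x t"
    using cadlag_right_const[OF x(1) t] by auto
  have "\<forall>\<^sub>F r in at t within {0..} \<inter> {t<..}. path_stop s x r = path_stop s x t"
    unfolding eventually_at
  proof (intro exI[of _ e] conjI ballI impI e(1))
    fix r assume "r \<in> {0..} \<inter> {t<..}" "r \<noteq> t \<and> dist r t < e"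
    then show "path_stop s x r = path_stop s x t"
      using e(2)[of r] e(2)[of s] by (auto simp: dist_real_def path_stop_def min_def)
  qed
  then show "(path_stop s x \<longlongrightarrow> path_stop s x t) (at t within {0..} \<inter> {t<..})"
    by (simp add: tendsto_discrete)
  show "\<exists>l. (path_stop s x \<longlongrightarrow> l) (at t within {0..} \<inter> {..<t})"
  proof (cases "t = 0")
    case True
    then have "{0..} \<inter> {..<t} = ({} :: real set)" by auto
    then show ?thesis by simp
  next
    case False
    obtain e l where e: "e > 0" "\<And>r. t - e \<le> r \<Longrightarrow> r < t \<Longrightarrow> x r = l"
      using cadlag_left_const[OF x(1), of t] False t by (metis less_eq_real_def)
    have "\<exists>l. \<forall>\<^sub>F r in at t within {0..} \<inter> {..<t}. path_stop s x r = l"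
    proof (cases "s < t")
      case True
      then show ?thesis unfolding eventually_at
        by (intro exI[of _ "x s"] exI[of _ "t - s"]) (auto simp: dist_real_def path_stop_def min_def)
    next
      case False
      then show ?thesis unfolding eventually_at using e
        by (intro exI[of _ l] exI[of _ e]) (auto simp: dist_real_def path_stop_def min_def)
    qed
    then show ?thesis by (auto simp: tendsto_discrete)
  qed
qed

section \<open>Markov chains on path space\<close>

text \<open>Paths are total functions on \<open>\<real>\<close>, constrained at negative times only to take values in \<open>S\<close>.\<close>

definition path_space :: "nat set \<Rightarrow> (real \<Rightarrow> nat) measure" where
  "path_space S = restrict_space (\<Pi>\<^sub>M t\<in>UNIV. count_space S) {x. cadlag_on {0..} x}"

section \<open>Measurability of path functionals\<close>

lemma space_path_space: "x \<in> space (path_space S) \<longleftrightarrow> cadlag_on {0..} x \<and> (\<forall>t. x t \<in> S)"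
  by (auto simp: path_space_def space_restrict_space space_PiM PiE_def Pi_def)

lemma path_space_cadlag: "x \<in> space (path_space S) \<Longrightarrow> cadlag_on {0..} x"
  and path_space_mem: "x \<in> space (path_space S) \<Longrightarrow> x t \<in> S"
  by (auto simp: space_path_space)

lemma measurable_path_coord_S: "(\<lambda>x. x t) \<in> path_space S \<rightarrow>\<^sub>M count_space S"
  unfolding path_space_def by (intro measurable_restrict_space1 measurable_component_singleton) simp

lemma measurable_path_coord [measurable]: "(\<lambda>x. x t) \<in> path_space S \<rightarrow>\<^sub>M count_space UNIV"
  by (rule measurable_compose[OF measurable_path_coord_S[of t S]]) simp

lemma measurable_into_path_space:
  assumes "\<And>t. (\<lambda>\<omega>. f \<omega> t) \<in> M \<rightarrow>\<^sub>M count_space S" "\<And>\<omega>. \<omega> \<in> space M \<Longrightarrow> cadlag_on {0..} (f \<omega>)"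
  shows "f \<in> M \<rightarrow>\<^sub>M path_space S"
  unfolding path_space_def
proof (rule measurable_restrict_space2)
  show "f \<in> space M \<rightarrow> {x. cadlag_on {0..} x}" using assms(2) by auto
  show "f \<in> M \<rightarrow>\<^sub>M (\<Pi>\<^sub>M t\<in>UNIV. count_space S)"
  proof (rule measurable_PiM_single')
    show "f \<in> space M \<rightarrow> (\<Pi>\<^sub>E i\<in>UNIV. space (count_space S))"
      using measurable_space[OF assms(1)] by (auto simp: PiE_def)
  qed (rule assms(1))
qed

lemma measurable_path_shift [measurable]:
  "0 \<le> s \<Longrightarrow> path_shift s \<in> path_space S \<rightarrow>\<^sub>M path_space S"
  by (rule measurable_into_path_space)
     (auto simp: path_shift_def[abs_def] path_space_def[symmetric] measurable_path_coord_S
       intro!: cadlag_path_shift[unfolded path_shift_def] dest: path_space_cadlag)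

lemma measurable_path_stop [measurable]:
  "0 \<le> s \<Longrightarrow> path_stop s \<in> path_space S \<rightarrow>\<^sub>M path_space S"
  by (rule measurable_into_path_space)
     (auto simp: path_stop_def[abs_def] measurable_path_coord_S
       intro!: cadlag_path_stop[unfolded path_stop_def] dest: path_space_cadlag)

text \<open>A property that persists to the right is seen at a rational time, unless it occurs at
  the right endpoint alone. This makes existential quantifiers over an interval countable and is the
  source of the measurability of visits, returns and survival.\<close>

lemma ex_right_stable_iff:
  fixes a b :: real
  assumes "\<And>t. a \<le> t \<Longrightarrow> t < b \<Longrightarrow> P t \<Longrightarrow> \<exists>e>0. \<forall>r\<in>{t..<t+e}. P r"
  shows "(\<exists>t\<in>{a..b}. P t) \<longleftrightarrow> (a \<le> b \<and> P b) \<or> (\<exists>r\<in>\<rat> \<inter> {a..b}. P r)"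
proof
  assume "\<exists>t\<in>{a..b}. P t"
  then obtain t where t: "a \<le> t" "t \<le> b" "P t" by auto
  show "(a \<le> b \<and> P b) \<or> (\<exists>r\<in>\<rat> \<inter> {a..b}. P r)"
  proof (cases "t = b")
    case False
    then obtain e where e: "e > 0" "\<forall>r\<in>{t..<t+e}. P r" using assms[of t] t by auto
    obtain r where "r \<in> \<rat>" "t < r" "r < min (t + e) b"
      using Rats_dense_in_real[of t "min (t + e) b"] e(1) t False by auto
    then show ?thesis using e(2) t by (intro disjI2 bexI[of _ r]) auto
  qed (use t in auto)
qed auto

lemma pred_ex_right_stable:
  fixes a b :: real
  assumes P: "\<And>t. t \<in> {a..b} \<Longrightarrow> Measurable.pred M (\<lambda>\<omega>. P \<omega> t)"
    and R: "\<And>\<omega> t. \<omega> \<in> space M \<Longrightarrow> a \<le> t \<Longrightarrow> t < b \<Longrightarrow> P \<omega> t \<Longrightarrow> \<exists>e>0. \<forall>r\<in>{t..<t+e}. P \<omega> r"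
  shows "Measurable.pred M (\<lambda>\<omega>. \<exists>t\<in>{a..b}. P \<omega> t)"
proof -
  have "Measurable.pred M (\<lambda>\<omega>. (a \<le> b \<and> P \<omega> b) \<or> (\<exists>r\<in>\<rat> \<inter> {a..b}. P \<omega> r))"
  proof (cases "a \<le> b")
    case True
    have "Measurable.pred M (\<lambda>\<omega>. \<exists>r\<in>\<rat> \<inter> {a..b}. P \<omega> r)"
    proof -
      have "Measurable.pred M (\<lambda>\<omega>. \<exists>q::rat. of_rat q \<in> {a..b} \<and> P \<omega> (of_rat q))"
      proof (rule pred_intros_countable(2))
        fix q :: rat
        show "Measurable.pred M (\<lambda>\<omega>. of_rat q \<in> {a..b} \<and> P \<omega> (of_rat q))"
          using P[of "of_rat q"] by (cases "of_rat q \<in> {a..b}") auto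
      qed
      also have "(\<lambda>\<omega>. \<exists>q::rat. of_rat q \<in> {a..b} \<and> P \<omega> (of_rat q)) =
          (\<lambda>\<omega>. \<exists>r\<in>\<rat> \<inter> {a..b}. P \<omega> r)"
        by (intro ext) (auto simp: Rats_def)
      finally show ?thesis .
    qed
    moreover have "Measurable.pred M (\<lambda>\<omega>. P \<omega> b)" using P True by auto
    ultimately show ?thesis by simp
  next
    case False
    then show ?thesis by simp
  qed
  then show ?thesis
    by (rule measurable_cong[THEN iffD1, rotated]) (rule ex_right_stable_iff[symmetric, OF R], auto)
qed

lemma right_stable_coord:
  fixes x :: "real \<Rightarrow> nat"
  assumes "cadlag_on {0..} x" "0 \<le> t" "P (x t)"
  shows "\<exists>e>0. \<forall>r\<in>{t..<t+e}. P (x r)"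
proof -
  obtain e where "e > 0" "\<And>r. t \<le> r \<Longrightarrow> r < t + e \<Longrightarrow> x r = x t"
    using cadlag_right_const[OF assms(1,2)] by blast
  then show ?thesis using assms(3) by (intro exI[of _ e]) (metis atLeastLessThan_iff)
qed

lemma pred_visit [measurable]:
  "0 \<le> a \<Longrightarrow> Measurable.pred (path_space S) (\<lambda>x. \<exists>r\<in>{a..b}. x r \<noteq> 0)"
  by (rule pred_ex_right_stable)
     (auto intro!: right_stable_coord[where P="\<lambda>k. 0 < k", simplified] dest: path_space_cadlag)

lemma pred_zero_on [measurable]:
  "0 \<le> a \<Longrightarrow> Measurable.pred (path_space S) (\<lambda>x. \<forall>r\<in>{a..b}. x r = 0)"
  using pred_intros_logic(2)[OF pred_visit[of a b S]] by simp

lemma pred_returned [measurable]: "Measurable.pred (path_space S) (\<lambda>x. returned x t)"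
proof -
  \<comment> \<open>The inner quantifier ends at the outer time, so that the whole condition
    persists to the right of a zero of the path.\<close>
  have "Measurable.pred (path_space S) (\<lambda>x. \<exists>r'\<in>{0..t}. x r' = 0 \<and> (\<exists>r\<in>{0..r'}. x r \<noteq> 0))"
  proof (rule pred_ex_right_stable)
    fix x and r' :: real
    assume x: "x \<in> space (path_space S)" "0 \<le> r'" and P: "x r' = 0 \<and> (\<exists>r\<in>{0..r'}. x r \<noteq> 0)"
    obtain e where "e > 0" "\<forall>r\<in>{r'..<r'+e}. x r = 0"
      using right_stable_coord[OF path_space_cadlag[OF x(1)] x(2), of "\<lambda>k. k = 0"] P by auto
    then show "\<exists>e>0. \<forall>q\<in>{r'..<r'+e}. x q = 0 \<and> (\<exists>r\<in>{0..q}. x r \<noteq> 0)"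
      using P by (intro exI[of _ e]) force
  next
    fix r' :: real
    show "Measurable.pred (path_space S) (\<lambda>x. x r' = 0 \<and> (\<exists>r\<in>{0..r'}. x r \<noteq> 0))"
      using pred_visit[of 0 r' S] by (intro pred_intros_logic) auto
  qed
  also have "(\<lambda>x. \<exists>r'\<in>{0..t}. x r' = 0 \<and> (\<exists>r\<in>{0..r'}. x r \<noteq> 0)) = (\<lambda>x. returned x t)"
  proof (intro ext iffI)
    fix x :: "real \<Rightarrow> nat"
    assume "returned x t"
    then obtain r r' where "0 \<le> r" "r \<le> r'" "r' \<le> t" "x r \<noteq> 0" "x r' = 0"
      by (auto simp: returned_def)
    then show "\<exists>r'\<in>{0..t}. x r' = 0 \<and> (\<exists>r\<in>{0..r'}. x r \<noteq> 0)"
      by (intro bexI[of _ r'] conjI bexI[of _ r]) auto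
  next
    fix x :: "real \<Rightarrow> nat"
    assume "\<exists>r'\<in>{0..t}. x r' = 0 \<and> (\<exists>r\<in>{0..r'}. x r \<noteq> 0)"
    then obtain r r' where "0 \<le> r" "r \<le> r'" "r' \<le> t" "x r \<noteq> 0" "x r' = 0"
      by auto
    then show "returned x t" unfolding returned_def by (intro exI[of _ r] exI[of _ r']) auto
  qed
  finally show ?thesis .
qed

lemma borel_measurable_cycle_time [measurable]: "cycle_time \<in> borel_measurable (path_space S)"
proof (subst borel_measurable_iff_Iic_ereal, safe)
  fix a :: ereal
  show "cycle_time -` {..a} \<inter> space (path_space S) \<in> sets (path_space S)"
  proof (cases a)
    case (real t)
    have "cycle_time -` {..a} \<inter> space (path_space S) = {x\<in>space (path_space S). returned x t}"
      unfolding real by (auto simp: cycle_time_le_iff path_space_cadlag)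
    then show ?thesis by simp
  next
    case MInf
    have "\<not> cycle_time x \<le> -\<infinity>" for x using cycle_time_nonneg[of x] by auto
    then have "cycle_time -` {..a} = {}" using MInf by auto
    then show ?thesis by simp
  next
    case PInf
    then have "cycle_time -` {..a} = UNIV" by auto
    then show ?thesis by simp
  qed
qed

lemma full_holding_time_le_iff:
  assumes x: "cadlag_on {0..} x"
  shows "full_holding_time x \<le> ereal t \<longleftrightarrow> (\<exists>r\<in>{0..t}. x r \<noteq> 0)"
proof
  assume le: "full_holding_time x \<le> ereal t"
  show "\<exists>r\<in>{0..t}. x r \<noteq> 0"
  proof (rule ccontr)
    assume n: "\<not> ?thesis"
    have nn: "0 \<le> full_holding_time x" unfolding full_holding_time_def by (rule Inf_greatest) auto
    have "0 \<le> ereal t" using nn le by (rule order_trans)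
    then have t: "0 \<le> t" by simp
    then have xt: "x t = 0" using n by auto
    \<comment> \<open>An infimum of at most \<open>t\<close> without a visit up to \<open>t\<close>
      would need visits outside 0 immediately after \<open>t\<close>; right-continuity excludes
      them.\<close>
    obtain e where e: "e > 0" "\<forall>r\<in>{t..<t+e}. x r = 0"
      using right_stable_coord[OF x t, of "\<lambda>k. k = 0"] xt by auto
    have "ereal (t + e) \<le> full_holding_time x"
      unfolding full_holding_time_def
    proof (rule Inf_greatest, safe)
      fix r assume r: "0 \<le> r" "0 < x r"
      then have "t < r" using n by (cases "r \<le> t") auto
      moreover have "\<not> r < t + e" using e(2)[rule_format, of r] r \<open>t < r\<close> by auto
      ultimately show "ereal (t + e) \<le> ereal r" by simp
    qed
    then have "ereal (t + e) \<le> ereal t" using le by (rule order_trans)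
    then show False using e(1) by simp
  qed
next
  assume "\<exists>r\<in>{0..t}. x r \<noteq> 0"
  then obtain r where r: "0 \<le> r" "r \<le> t" "x r \<noteq> 0" by auto
  then have "full_holding_time x \<le> ereal r"
    unfolding full_holding_time_def by (intro Inf_lower) auto
  also have "ereal r \<le> ereal t" using r by simp
  finally show "full_holding_time x \<le> ereal t" .
qed

lemma exits_iff: "cadlag_on {0..} x \<Longrightarrow> exits u x \<longleftrightarrow> full_holding_time x \<le> ereal (1 - u)"
  by (simp add: full_holding_time_le_iff exits_def)

lemma borel_measurable_full_holding_time [measurable]:
  "full_holding_time \<in> borel_measurable (path_space S)"
proof (subst borel_measurable_iff_Iic_ereal, safe)
  fix a :: ereal
  show "full_holding_time -` {..a} \<inter> space (path_space S) \<in> sets (path_space S)"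
  proof (cases a)
    case (real t)
    have "full_holding_time -` {..a} \<inter> space (path_space S) =
      {x\<in>space (path_space S). \<exists>r\<in>{0..t}. x r \<noteq> 0}"
      unfolding real using full_holding_time_le_iff[OF path_space_cadlag, of _ S t] by blast
    then show ?thesis using pred_visit[of 0 t S] by (simp add: pred_def)
  next
    case MInf
    have nn: "0 \<le> full_holding_time x" for x
      unfolding full_holding_time_def by (rule Inf_greatest) auto
    have "\<not> full_holding_time x \<le> -\<infinity>" for x using nn[of x] by auto
    then have "full_holding_time -` {..a} = {}" using MInf by auto
    then show ?thesis by simp
  next
    case PInf
    then have "full_holding_time -` {..a} = UNIV" by auto
    then show ?thesis by simp
  qed
qed

lemma pred_exits [measurable]: "Measurable.pred (path_space S) (exits u)"
  by (rule measurable_cong[THEN iffD2, OF exits_iff[OF path_space_cadlag]]) auto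

text \<open>Measurability holds jointly in the initial age and the path. The supremum exceeds
  \<open>a\<close> exactly when the path is outside 0 at some time after \<open>a\<close>, a
  condition that persists to the right.\<close>

lemma measurable_age [measurable (raw)]:
  assumes [measurable]: "f \<in> borel_measurable M" "g \<in> M \<rightarrow>\<^sub>M path_space S" and t: "0 \<le> t"
  shows "(\<lambda>\<omega>. snd (hat_X (f \<omega>) (g \<omega>) t)) \<in> borel_measurable M"
proof -
  let ?D = "path_space S"
  \<comment> \<open>The supremum is replaced by 0 in the branches where the age is given otherwise,
    since \<open>Sup {}\<close> is unspecified.\<close>
  let ?L = "\<lambda>x. if x t = 0 \<and> \<not> (\<forall>r\<in>{0..t}. x r = 0) then Sup {r\<in>{0..t}. x r \<noteq> 0} else 0"
  have [measurable]: "?L \<in> borel_measurable ?D"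
  proof (subst borel_measurable_iff_le, safe)
    fix a :: real
    have [measurable]: "Measurable.pred ?D (\<lambda>x. \<exists>r\<in>{0..t}. x r \<noteq> 0 \<and> a < r)"
    proof (rule pred_ex_right_stable)
      fix x and q :: real assume x: "x \<in> space ?D" "0 \<le> q" "x q \<noteq> 0 \<and> a < q"
      obtain e where "e > 0" "\<forall>r\<in>{q..<q+e}. x r \<noteq> 0"
        using right_stable_coord[OF path_space_cadlag[OF x(1)] x(2), of "\<lambda>k. k \<noteq> 0"] x(3) by auto
      then show "\<exists>e>0. \<forall>r\<in>{q..<q+e}. x r \<noteq> 0 \<and> a < r" using x by (intro exI[of _ e]) auto
    qed auto
    have eq: "?L x \<le> a \<longleftrightarrow> (if x t = 0 \<and> \<not> (\<forall>r\<in>{0..t}. x r = 0)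
        then \<not> (\<exists>r\<in>{0..t}. x r \<noteq> 0 \<and> a < r) else 0 \<le> a)" for x :: "real \<Rightarrow> nat"
    proof (cases "\<forall>r\<in>{0..t}. x r = 0")
      case False
      then have ne: "{r\<in>{0..t}. x r \<noteq> 0} \<noteq> {}" by auto
      have bdd: "bdd_above {r\<in>{0..t}. x r \<noteq> 0}" by (rule bdd_aboveI[of _ t]) auto
      have "Sup {r\<in>{0..t}. x r \<noteq> 0} \<le> a \<longleftrightarrow> \<not> (\<exists>r\<in>{0..t}. x r \<noteq> 0 \<and> a < r)"
        unfolding cSup_le_iff[OF ne bdd] by force
      then show ?thesis using False by simp
    qed simp
    show "{x \<in> space ?D. ?L x \<le> a} \<in> sets ?D"
      unfolding eq by measurable
  qed
  have [measurable]: "Measurable.pred M (\<lambda>\<omega>. \<forall>r\<in>{0..t}. g \<omega> r = 0)"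
    by (rule measurable_compose[OF assms(2) pred_zero_on]) simp
  have "(\<lambda>\<omega>. snd (hat_X (f \<omega>) (g \<omega>) t)) = (\<lambda>\<omega>. if g \<omega> t \<noteq> 0 then 0
     else if \<forall>r\<in>{0..t}. g \<omega> r = 0 then f \<omega> + t else t - ?L (g \<omega>))"
    by (intro ext) (auto simp: snd_hat_X)
  also have "\<dots> \<in> borel_measurable M"
    by measurable
  finally show ?thesis .
qed

lemma right_stable_old:
  assumes "cadlag_on {0..} x" "0 \<le> t" "1 \<le> snd (hat_X u x t)"
  shows "\<exists>e>0. \<forall>r\<in>{t..<t+e}. 1 \<le> snd (hat_X u x r)"
proof -
  obtain e where e: "e > 0" "\<And>r. t \<le> r \<Longrightarrow> r < t + e \<Longrightarrow>
    hat_X u x r = (x t, if x t = 0 then snd (hat_X u x t) + (r - t) else 0)"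
    using hat_X_right[OF assms(1,2)] by blast
  have xt: "x t = 0" using assms(3) by (simp add: snd_hat_X split: if_splits)
  have "1 \<le> snd (hat_X u x r)" if "r \<in> {t..<t+e}" for r
    using e(2)[of r] that assms(3) xt by auto
  then show ?thesis using e(1) by blast
qed

lemma pred_path_alive [measurable (raw)]:
  assumes [measurable]: "f \<in> borel_measurable M" and g [measurable]: "g \<in> M \<rightarrow>\<^sub>M path_space S"
  shows "Measurable.pred M (\<lambda>\<omega>. path_alive (f \<omega>) (g \<omega>) t)"
proof -
  have "Measurable.pred M (\<lambda>\<omega>. \<exists>r\<in>{0..t}. 1 \<le> snd (hat_X (f \<omega>) (g \<omega>) r))"
  proof (rule pred_ex_right_stable)
    fix \<omega> and q :: real
    assume "\<omega> \<in> space M" "0 \<le> q" "1 \<le> snd (hat_X (f \<omega>) (g \<omega>) q)"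
    then show "\<exists>e>0. \<forall>r\<in>{q..<q+e}. 1 \<le> snd (hat_X (f \<omega>) (g \<omega>) r)"
      using measurable_space[OF g] path_space_cadlag by (intro right_stable_old) auto
  qed auto
  then have "Measurable.pred M (\<lambda>\<omega>. \<not> (\<exists>r\<in>{0..t}. 1 \<le> snd (hat_X (f \<omega>) (g \<omega>) r)))"
    by measurable
  then show ?thesis by (simp add: path_alive_def not_le)
qed

text \<open>After the killing time the value is the junk state \<open>(0, 0)\<close>, so that \<open>hat_at\<close> stays in \<open>hat_states\<close>;
  it is always used together with \<open>alive_ind\<close>.\<close>

definition hat_at :: "hat_state \<Rightarrow> real \<Rightarrow> (real \<Rightarrow> nat) \<Rightarrow> hat_state" where
  "hat_at y t x = (if path_alive (snd y) x t then hat_X (snd y) x t else (0, 0))"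

lemma space_hat_space [simp]: "space (hat_space S) = hat_states S"
  by (simp add: hat_space_def space_restrict_space)

lemma hat_states_iff: "y \<in> hat_states S \<longleftrightarrow>
    (fst y \<in> S \<and> fst y \<noteq> 0 \<and> snd y = 0) \<or> (fst y = 0 \<and> 0 \<le> snd y \<and> snd y < 1)"
  by (cases y) (auto simp: hat_states_def)

lemma hat_states_snd: "y \<in> hat_states S \<Longrightarrow> 0 \<le> snd y \<and> snd y < 1"
  by (auto simp: hat_states_iff)

lemma measurable_snd_hat [measurable]: "snd \<in> hat_space S \<rightarrow>\<^sub>M borel"
  unfolding hat_space_def by (intro measurable_restrict_space1 borel_measurable_continuous_onI continuous_intros)

lemma measurable_fst_hat [measurable]: "fst \<in> hat_space S \<rightarrow>\<^sub>M count_space UNIV"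
proof -
  have "fst \<in> borel_measurable (borel :: (nat \<times> real) measure)"
    by (intro borel_measurable_continuous_onI continuous_intros)
  moreover have "(\<lambda>n::nat. n) \<in> borel \<rightarrow>\<^sub>M count_space UNIV"
    by (rule measurableI) (simp_all add: sets_borel_eq_count_space)
  ultimately show ?thesis
    unfolding hat_space_def by (intro measurable_restrict_space1) (rule measurable_compose)
qed

lemma hat_X_in_hat_states:
  assumes "path_alive u x t" "0 \<le> u" "0 \<le> t" "x t \<in> S"
  shows "hat_X u x t \<in> hat_states S"
proof (cases "x t = 0")
  case True
  then show ?thesis
    using assms age_nonneg[of u t x] unfolding hat_states_iff path_alive_def by auto
next
  case False
  then show ?thesis using assms by (auto simp: hat_states_iff snd_hat_X)
qed

lemma hat_at_in_hat_states:
  "y \<in> hat_states S \<Longrightarrow> 0 \<le> t \<Longrightarrow> x t \<in> S \<Longrightarrow> hat_at y t x \<in> hat_states S"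
  using hat_states_snd[of y S]
  by (auto simp: hat_at_def intro!: hat_X_in_hat_states) (simp add: hat_states_iff)

lemma measurable_hat_X_borel [measurable (raw)]:
  assumes [measurable]: "f \<in> borel_measurable M" "g \<in> M \<rightarrow>\<^sub>M path_space S" and t: "0 \<le> t"
  shows "(\<lambda>\<omega>. hat_X (f \<omega>) (g \<omega>) t) \<in> borel_measurable M"
proof -
  have m: "(\<lambda>n::nat. n) \<in> count_space UNIV \<rightarrow>\<^sub>M borel" by simp
  have [measurable]: "(\<lambda>\<omega>. g \<omega> t) \<in> borel_measurable M"
    by (rule measurable_compose[OF _ m]) measurable
  have "(\<lambda>\<omega>. (g \<omega> t, snd (hat_X (f \<omega>) (g \<omega>) t))) \<in> borel_measurable M"
    using t by (intro borel_measurable_Pair) measurable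
  also have "(\<lambda>\<omega>. (g \<omega> t, snd (hat_X (f \<omega>) (g \<omega>) t))) = (\<lambda>\<omega>. hat_X (f \<omega>) (g \<omega>) t)"
    by (intro ext prod_eqI) auto
  finally show ?thesis .
qed

lemma measurable_hat_at [measurable (raw)]:
  assumes f [measurable]: "f \<in> M \<rightarrow>\<^sub>M hat_space S" and g [measurable]: "g \<in> M \<rightarrow>\<^sub>M path_space S"
    and t: "0 \<le> t"
  shows "(\<lambda>\<omega>. hat_at (f \<omega>) t (g \<omega>)) \<in> M \<rightarrow>\<^sub>M hat_space S"
proof -
  have [measurable]: "(\<lambda>\<omega>. snd (f \<omega>)) \<in> borel_measurable M"
    by (rule measurable_compose[OF f]) measurable
  have "(\<lambda>\<omega>. hat_at (f \<omega>) t (g \<omega>)) \<in> borel_measurable M"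
    unfolding hat_at_def using t by measurable
  moreover have "(\<lambda>\<omega>. hat_at (f \<omega>) t (g \<omega>)) \<in> space M \<rightarrow> hat_states S"
    using measurable_space[OF f] measurable_space[OF g] t
    by (auto intro!: hat_at_in_hat_states simp: path_space_mem)
  ultimately show ?thesis
    unfolding hat_space_def by (intro measurable_restrict_space2)
qed

section \<open>From the simple Markov property to laws on path space\<close>

lemma nn_integral_discrete_mult:
  fixes f :: "nat \<Rightarrow> ennreal"
  assumes [measurable]: "Y \<in> M \<rightarrow>\<^sub>M count_space UNIV" "g \<in> borel_measurable M"
  shows "(\<integral>\<^sup>+\<omega>. f (Y \<omega>) * g \<omega> \<partial>M) = (\<Sum>k. f k * (\<integral>\<^sup>+\<omega>. indicator {k} (Y \<omega>) * g \<omega> \<partial>M))"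
proof -
  have [measurable]: "(\<lambda>\<omega>. indicator {k} (Y \<omega>) :: ennreal) \<in> borel_measurable M" for k
    by (rule measurable_compose[OF assms(1)]) auto
  have f: "f (Y \<omega>) = (\<Sum>k. f k * indicator {k} (Y \<omega>))" for \<omega>
    by (rule suminf_cmult_indicator[symmetric]) (auto simp: disjoint_family_on_def)
  have "f (Y \<omega>) * g \<omega> = (\<Sum>k. f k * (indicator {k} (Y \<omega>) * g \<omega>))" for \<omega>
    by (subst f) (simp only: ennreal_suminf_multc[symmetric] mult.assoc)
  then have "(\<integral>\<^sup>+\<omega>. f (Y \<omega>) * g \<omega> \<partial>M) = (\<integral>\<^sup>+\<omega>. (\<Sum>k. f k * (indicator {k} (Y \<omega>) * g \<omega>)) \<partial>M)"
    by simp
  also have "\<dots> = (\<Sum>k. \<integral>\<^sup>+\<omega>. f k * (indicator {k} (Y \<omega>) * g \<omega>) \<partial>M)"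
    by (rule nn_integral_suminf) measurable
  also have "\<dots> = (\<Sum>k. f k * (\<integral>\<^sup>+\<omega>. indicator {k} (Y \<omega>) * g \<omega> \<partial>M))"
    by (intro suminf_cong nn_integral_cmult) measurable
  finally show ?thesis .
qed

locale ctmc =
  fixes S :: "nat set" and q :: "nat \<Rightarrow> nat \<Rightarrow> real" and P :: "nat \<Rightarrow> 'w measure"
    and X :: "real \<Rightarrow> 'w \<Rightarrow> nat"
  assumes zero_mem: "0 \<in> S"
    and nonexplosive: "nonexplosive_ctmc S q P X"
begin

lemma prob_P: "i \<in> S \<Longrightarrow> prob_space (P i)"
  using nonexplosive by (auto simp: nonexplosive_ctmc_def markov_process_def)

lemma measurable_X: "i \<in> S \<Longrightarrow> 0 \<le> t \<Longrightarrow> X t \<in> P i \<rightarrow>\<^sub>M count_space S"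
  using nonexplosive by (auto simp: nonexplosive_ctmc_def markov_process_def)

lemma X_mem: "i \<in> S \<Longrightarrow> 0 \<le> t \<Longrightarrow> \<omega> \<in> space (P i) \<Longrightarrow> X t \<omega> \<in> S"
  using measurable_space[OF measurable_X] by force

lemma measurable_X_UNIV: "i \<in> S \<Longrightarrow> 0 \<le> t \<Longrightarrow> X t \<in> P i \<rightarrow>\<^sub>M count_space UNIV"
  by (rule measurable_compose[OF measurable_X]) auto

lemma measurable_fun_X [measurable]:
  fixes f :: "nat \<Rightarrow> ennreal"
  shows "i \<in> S \<Longrightarrow> 0 \<le> t \<Longrightarrow> (\<lambda>\<omega>. f (X t \<omega>)) \<in> borel_measurable (P i)"
  by (rule measurable_compose[OF measurable_X_UNIV]) auto

abbreviation past_sets :: "nat \<Rightarrow> real \<Rightarrow> 'w set set" where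
  "past_sets i s \<equiv> sets (past (P i) (count_space S) X s)"

lemma past_generator: "i \<in> S \<Longrightarrow>
  {X r -` B \<inter> space (P i) | r B. r \<in> {0..s} \<and> B \<in> sets (count_space S)} \<subseteq> sets (P i)"
  using measurable_sets[OF measurable_X] by auto

lemma space_past: "space (past (P i) (count_space S) X s) = space (P i)"
  by (simp add: past_def space_measure_of_conv)

lemma past_sets_eq: "past_sets i s =
   sigma_sets (space (P i)) {X r -` B \<inter> space (P i) | r B. r \<in> {0..s} \<and> B \<in> sets (count_space S)}"
  unfolding past_def by (rule sets_measure_of) auto

lemma past_sets_mono: "s \<le> t \<Longrightarrow> past_sets i s \<subseteq> past_sets i t"
  unfolding past_sets_eq by (rule sigma_sets_mono') fastforce

lemma past_sets_P: "i \<in> S \<Longrightarrow> A \<in> past_sets i s \<Longrightarrow> A \<in> sets (P i)"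
  using sets.sigma_sets_subset[OF past_generator[of i s]] by (auto simp: past_sets_eq)

lemma measurable_X_past: "i \<in> S \<Longrightarrow> 0 \<le> r \<Longrightarrow> r \<le> s \<Longrightarrow>
  X r \<in> past (P i) (count_space S) X s \<rightarrow>\<^sub>M count_space S"
  by (rule measurableI)
    (auto simp: space_past past_sets_eq X_mem intro!: sigma_sets.Basic)

lemma past_event: "i \<in> S \<Longrightarrow> 0 \<le> r \<Longrightarrow> r \<le> s \<Longrightarrow> {\<omega>\<in>space (P i). X r \<omega> \<in> B} \<in> past_sets i s"
proof -
  assume a: "i \<in> S" "0 \<le> r" "r \<le> s"
  have "{\<omega>\<in>space (P i). X r \<omega> \<in> B} = X r -` (B \<inter> S) \<inter> space (P i)"
    using X_mem[OF a(1,2)] by auto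
  also have "\<dots> \<in> past_sets i s" unfolding past_sets_eq
    using a by (intro sigma_sets.Basic CollectI exI[of _ r] exI[of _ "B \<inter> S"]) auto
  finally show ?thesis .
qed

lemma markov_step:
  assumes i: "i \<in> S" and st: "0 \<le> s" "0 \<le> t" and A: "A \<in> past_sets i s"
  shows "emeasure (P i) (A \<inter> {\<omega>\<in>space (P i). X (s + t) \<omega> \<in> B}) =
    (\<integral>\<^sup>+\<omega>. emeasure (P (X s \<omega>)) {\<omega>'\<in>space (P (X s \<omega>)). X t \<omega>' \<in> B} * indicator A \<omega> \<partial>P i)"
proof -
  have "{\<omega>\<in>space (P i). X (s + t) \<omega> \<in> B} = {\<omega>\<in>space (P i). X (s + t) \<omega> \<in> B \<inter> S}"
    using X_mem[OF i] st by auto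
  moreover have "emeasure (P i) (A \<inter> {\<omega>\<in>space (P i). X (s + t) \<omega> \<in> B \<inter> S}) =
     (\<integral>\<^sup>+\<omega>\<in>A. emeasure (distr (P (X s \<omega>)) (count_space S) (X t)) (B \<inter> S) \<partial>P i)"
  proof -
    have "markov_process (count_space S) (\<lambda>t j. distr (P j) (count_space S) (X t)) (P i) X"
      using nonexplosive i unfolding nonexplosive_ctmc_def by blast
    moreover have "B \<inter> S \<in> sets (count_space S)" by simp
    ultimately show ?thesis using st A unfolding markov_process_def by blast
  qed
  moreover have "emeasure (distr (P (X s \<omega>)) (count_space S) (X t)) (B \<inter> S) =
    emeasure (P (X s \<omega>)) {\<omega>'\<in>space (P (X s \<omega>)). X t \<omega>' \<in> B}" if "\<omega> \<in> space (P i)" for \<omega>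
  proof -
    have "X s \<omega> \<in> S" using X_mem[OF i st(1) that] .
    then have "emeasure (distr (P (X s \<omega>)) (count_space S) (X t)) (B \<inter> S) =
      emeasure (P (X s \<omega>)) (X t -` (B \<inter> S) \<inter> space (P (X s \<omega>)))"
      using st by (intro emeasure_distr measurable_X) auto
    also have "X t -` (B \<inter> S) \<inter> space (P (X s \<omega>)) = {\<omega>'\<in>space (P (X s \<omega>)). X t \<omega>' \<in> B}"
      using X_mem[OF \<open>X s \<omega> \<in> S\<close> st(2)] by auto
    finally show ?thesis .
  qed
  ultimately show ?thesis by (simp cong: nn_integral_cong)
qed

text \<open>The state space is countable, so the case of functions follows from that of single
  states by summation.\<close>

lemma markov_step_fun:
  fixes f :: "nat \<Rightarrow> ennreal"
  assumes i: "i \<in> S" and st: "0 \<le> s" "0 \<le> t" and A: "A \<in> past_sets i s"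
  shows "(\<integral>\<^sup>+\<omega>. f (X (s + t) \<omega>) * indicator A \<omega> \<partial>P i) =
    (\<integral>\<^sup>+\<omega>. (\<integral>\<^sup>+\<omega>'. f (X t \<omega>') \<partial>P (X s \<omega>)) * indicator A \<omega> \<partial>P i)"
proof -
  have [measurable]: "A \<in> sets (P i)" using past_sets_P i A by blast
  have ev: "(\<integral>\<^sup>+\<omega>. indicator {k} (X (s + t) \<omega>) * indicator A \<omega> \<partial>P i) =
      (\<integral>\<^sup>+\<omega>. emeasure (P (X s \<omega>)) {\<omega>'\<in>space (P (X s \<omega>)). X t \<omega>' \<in> {k}} * indicator A \<omega> \<partial>P i)"
    for k
  proof -
    have "(\<integral>\<^sup>+\<omega>. indicator {k} (X (s + t) \<omega>) * indicator A \<omega> \<partial>P i) =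
      (\<integral>\<^sup>+\<omega>. indicator (A \<inter> {\<omega>\<in>space (P i). X (s + t) \<omega> \<in> {k}}) \<omega> \<partial>P i)"
      by (intro nn_integral_cong) (auto simp: indicator_def)
    also have "\<dots> = emeasure (P i) (A \<inter> {\<omega>\<in>space (P i). X (s + t) \<omega> \<in> {k}})"
      using past_sets_P[OF i past_event[OF i, of "s+t" "s+t" "{k}"]] st
      by (intro nn_integral_indicator sets.Int) auto
    finally show ?thesis using markov_step[OF i st A, of "{k}"] by simp
  qed
  have inner: "(\<integral>\<^sup>+\<omega>'. f (X t \<omega>') \<partial>P j) = (\<Sum>k. f k * emeasure (P j) {\<omega>'\<in>space (P j). X t \<omega>' \<in> {k}})"
    if j: "j \<in> S" for j
  proof -
    have "(\<integral>\<^sup>+\<omega>'. indicator {k} (X t \<omega>') * 1 \<partial>P j) = emeasure (P j) {\<omega>'\<in>space (P j). X t \<omega>' \<in> {k}}" for k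
    proof -
      have "(\<integral>\<^sup>+\<omega>'. indicator {k} (X t \<omega>') * 1 \<partial>P j) =
          (\<integral>\<^sup>+\<omega>'. indicator {\<omega>'\<in>space (P j). X t \<omega>' \<in> {k}} \<omega>' \<partial>P j)"
        by (intro nn_integral_cong) (auto simp: indicator_def)
      also have "\<dots> = emeasure (P j) {\<omega>'\<in>space (P j). X t \<omega>' \<in> {k}}"
        using past_sets_P[OF j past_event[OF j, of t t "{k}"]] st by (intro nn_integral_indicator) auto
      finally show ?thesis .
    qed
    moreover have "(\<integral>\<^sup>+\<omega>'. f (X t \<omega>') * 1 \<partial>P j) = (\<Sum>k. f k * (\<integral>\<^sup>+\<omega>'. indicator {k} (X t \<omega>') * 1 \<partial>P j))"
      by (intro nn_integral_discrete_mult measurable_X_UNIV j st) auto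
    ultimately show ?thesis by simp
  qed
  have "(\<integral>\<^sup>+\<omega>. f (X (s + t) \<omega>) * indicator A \<omega> \<partial>P i) =
    (\<Sum>k. f k * (\<integral>\<^sup>+\<omega>. emeasure (P (X s \<omega>)) {\<omega>'\<in>space (P (X s \<omega>)). X t \<omega>' \<in> {k}} * indicator A \<omega> \<partial>P i))"
    unfolding ev[symmetric] using st by (intro nn_integral_discrete_mult measurable_X_UNIV i) auto
  also have "\<dots> = (\<Sum>k. \<integral>\<^sup>+\<omega>. f k * (emeasure (P (X s \<omega>)) {\<omega>'\<in>space (P (X s \<omega>)). X t \<omega>' \<in> {k}} * indicator A \<omega>) \<partial>P i)"
    using i st by (intro suminf_cong nn_integral_cmult[symmetric]) measurable
  also have "\<dots> = (\<integral>\<^sup>+\<omega>. (\<Sum>k. f k * (emeasure (P (X s \<omega>)) {\<omega>'\<in>space (P (X s \<omega>)). X t \<omega>' \<in> {k}} * indicator A \<omega>)) \<partial>P i)"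
    using i st by (intro nn_integral_suminf[symmetric]) measurable
  also have "\<dots> = (\<integral>\<^sup>+\<omega>. (\<integral>\<^sup>+\<omega>'. f (X t \<omega>') \<partial>P (X s \<omega>)) * indicator A \<omega> \<partial>P i)"
    using X_mem[OF i st(1)] by (intro nn_integral_cong) (simp only: inner ennreal_suminf_multc[symmetric] mult.assoc)
  finally show ?thesis .
qed

text \<open>Induction on the number of times, simultaneously for all starts, all \<open>s\<close>
  and all past events. The earliest time \<open>m\<close> is removed: the condition at
  \<open>m\<close> joins the past event, and the remaining times are counted from
  \<open>m\<close>.\<close>

lemma markov_fdd:
  assumes "finite J" "J \<subseteq> {0..}" "i \<in> S" "0 \<le> s" "A \<in> past_sets i s"
  shows "emeasure (P i) (A \<inter> {\<omega>\<in>space (P i). \<forall>t\<in>J. X (s + t) \<omega> \<in> B t}) =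
    (\<integral>\<^sup>+\<omega>. emeasure (P (X s \<omega>)) {\<omega>'\<in>space (P (X s \<omega>)). \<forall>t\<in>J. X t \<omega>' \<in> B t} * indicator A \<omega> \<partial>P i)"
  using assms
proof (induction "card J" arbitrary: J i s A B)
  case 0
  then have "J = {}" by simp
  have [measurable]: "A \<in> sets (P i)" using past_sets_P 0 by blast
  have "(\<integral>\<^sup>+\<omega>. emeasure (P (X s \<omega>)) {\<omega>'\<in>space (P (X s \<omega>)). \<forall>t\<in>J. X t \<omega>' \<in> B t} * indicator A \<omega> \<partial>P i) =
     (\<integral>\<^sup>+\<omega>. indicator A \<omega> \<partial>P i)"
    using X_mem[OF 0(4,5)] prob_space.emeasure_space_1[OF prob_P] \<open>J = {}\<close>
    by (intro nn_integral_cong) simp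
  moreover have "A \<inter> space (P i) = A" using sets.sets_into_space[OF \<open>A \<in> sets (P i)\<close>] by blast
  ultimately show ?case using \<open>J = {}\<close> by simp
next
  case (Suc n)
  note i = \<open>i \<in> S\<close> and s = \<open>0 \<le> s\<close> and A = \<open>A \<in> past_sets i s\<close>
  have ne: "J \<noteq> {}" using Suc.hyps(2) by auto
  define m where "m = Min J"
  have m: "m \<in> J" "0 \<le> m" "\<And>t. t \<in> J \<Longrightarrow> m \<le> t"
    using Suc.prems(1,2) ne Min_in[of J] Min_le[of J] unfolding m_def by auto
  define J' where "J' = (\<lambda>t. t - m) ` (J - {m})"
  define B' where "B' t = B (m + t)" for t
  have c: "n = card J'" unfolding J'_def
    using Suc.hyps(2) Suc.prems(1) m(1) by (subst card_image) (auto simp: inj_on_def)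
  have fin: "finite J'" "J' \<subseteq> {0..}" using Suc.prems(1) m(3) by (auto simp: J'_def)
  have ev: "(\<forall>t\<in>J. Y (u + t) \<in> B t) \<longleftrightarrow> Y (u + m) \<in> B m \<and> (\<forall>t\<in>J'. Y (u + m + t) \<in> B' t)"
    for Y :: "real \<Rightarrow> nat" and u
    using m(1) by (auto simp: J'_def B'_def)
  define r where "r j = emeasure (P j) {\<omega>'\<in>space (P j). \<forall>t\<in>J'. X t \<omega>' \<in> B' t}" for j
  \<comment> \<open>Used twice: at time \<open>s\<close> under \<open>P i\<close>, and at time 0
    with the full event under the restarted chain. One application of \<open>markov_step_fun\<close>
    connects the two.\<close>
  have main: "emeasure (P j) (A' \<inter> {\<omega>\<in>space (P j). \<forall>t\<in>J. X (u + t) \<omega> \<in> B t}) =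
      (\<integral>\<^sup>+\<omega>. (r (X (u + m) \<omega>) * indicator (B m) (X (u + m) \<omega>)) * indicator A' \<omega> \<partial>P j)"
    if j: "j \<in> S" "0 \<le> u" "A' \<in> past_sets j u" for j u A'
  proof -
    have ii: "A' \<inter> {\<omega>\<in>space (P j). X (u + m) \<omega> \<in> B m} \<in> past_sets j (u + m)"
      using j m past_sets_mono[of u "u + m" j] by (intro sets.Int past_event) auto
    have "A' \<inter> {\<omega>\<in>space (P j). \<forall>t\<in>J. X (u + t) \<omega> \<in> B t} =
      (A' \<inter> {\<omega>\<in>space (P j). X (u + m) \<omega> \<in> B m}) \<inter> {\<omega>\<in>space (P j). \<forall>t\<in>J'. X (u + m + t) \<omega> \<in> B' t}"
      using ev[of "\<lambda>t. X t \<omega>" u for \<omega>] by auto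
    then have "emeasure (P j) (A' \<inter> {\<omega>\<in>space (P j). \<forall>t\<in>J. X (u + t) \<omega> \<in> B t}) =
      (\<integral>\<^sup>+\<omega>. r (X (u + m) \<omega>) * indicator (A' \<inter> {\<omega>\<in>space (P j). X (u + m) \<omega> \<in> B m}) \<omega> \<partial>P j)"
      using Suc.hyps(1)[OF c fin j(1) _ ii, of B'] j m by (simp add: r_def)
    also have "\<dots> = (\<integral>\<^sup>+\<omega>. (r (X (u + m) \<omega>) * indicator (B m) (X (u + m) \<omega>)) * indicator A' \<omega> \<partial>P j)"
      by (intro nn_integral_cong) (auto simp: indicator_def)
    finally show ?thesis .
  qed
  have top: "space (P j) \<in> past_sets j 0" for j
    using sets.top[of "past (P j) (count_space S) X 0"] by (simp add: space_past)
  have "emeasure (P i) (A \<inter> {\<omega>\<in>space (P i). \<forall>t\<in>J. X (s + t) \<omega> \<in> B t}) =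
     (\<integral>\<^sup>+\<omega>. (\<integral>\<^sup>+\<omega>'. r (X m \<omega>') * indicator (B m) (X m \<omega>') \<partial>P (X s \<omega>)) * indicator A \<omega> \<partial>P i)"
    unfolding main[OF i s A] by (rule markov_step_fun[OF i s m(2) A])
  also have "\<dots> = (\<integral>\<^sup>+\<omega>. emeasure (P (X s \<omega>)) {\<omega>'\<in>space (P (X s \<omega>)). \<forall>t\<in>J. X t \<omega>' \<in> B t} * indicator A \<omega> \<partial>P i)"
  proof (intro nn_integral_cong arg_cong2[where f="(*)"] refl)
    fix \<omega> assume "\<omega> \<in> space (P i)"
    then have j: "X s \<omega> \<in> S" using X_mem i s by blast
    have "emeasure (P (X s \<omega>)) (space (P (X s \<omega>)) \<inter> {\<omega>'\<in>space (P (X s \<omega>)). \<forall>t\<in>J. X (0 + t) \<omega>' \<in> B t}) =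
      (\<integral>\<^sup>+\<omega>'. r (X (0 + m) \<omega>') * indicator (B m) (X (0 + m) \<omega>') * indicator (space (P (X s \<omega>))) \<omega>' \<partial>P (X s \<omega>))"
      by (rule main[OF j order_refl top])
    moreover have "\<dots> = (\<integral>\<^sup>+\<omega>'. r (X m \<omega>') * indicator (B m) (X m \<omega>') \<partial>P (X s \<omega>))"
      by (intro nn_integral_cong) simp
    moreover have "space (P (X s \<omega>)) \<inter> {\<omega>'\<in>space (P (X s \<omega>)). \<forall>t\<in>J. X (0 + t) \<omega>' \<in> B t} =
       {\<omega>'\<in>space (P (X s \<omega>)). \<forall>t\<in>J. X t \<omega>' \<in> B t}" by auto
    ultimately show "(\<integral>\<^sup>+\<omega>'. r (X m \<omega>') * indicator (B m) (X m \<omega>') \<partial>P (X s \<omega>)) =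
       emeasure (P (X s \<omega>)) {\<omega>'\<in>space (P (X s \<omega>)). \<forall>t\<in>J. X t \<omega>' \<in> B t}" by simp
  qed
  finally show ?case .
qed

definition path_of :: "'w \<Rightarrow> real \<Rightarrow> nat" where
  "path_of \<omega> = (\<lambda>t. X (max 0 t) \<omega>)"

definition law :: "nat \<Rightarrow> (real \<Rightarrow> nat) measure" where
  "law i = distr (P i) (path_space S) path_of"

lemma path_of_eq_shift: "path_of \<omega> = path_shift 0 (\<lambda>t. X t \<omega>)"
  by (simp add: path_of_def path_shift_def)

lemma cadlag_path_of: "i \<in> S \<Longrightarrow> \<omega> \<in> space (P i) \<Longrightarrow> cadlag_on {0..} (path_of \<omega>)"
  using nonexplosive unfolding path_of_eq_shift
  by (intro cadlag_path_shift) (auto simp: nonexplosive_ctmc_def)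

lemma measurable_path_of [measurable]: "i \<in> S \<Longrightarrow> path_of \<in> P i \<rightarrow>\<^sub>M path_space S"
  by (rule measurable_into_path_space[OF _ cadlag_path_of])
     (auto simp: path_of_def intro!: measurable_X)

lemma law_prob: "i \<in> S \<Longrightarrow> law i \<in> space (prob_algebra (path_space S))"
  unfolding law_def space_prob_algebra
  by (auto intro!: prob_space.prob_space_distr prob_P)

text \<open>On the event \<open>A\<close>, the law of the future and the mixture of the laws
  \<open>law (X s \<omega>)\<close> are compared as measures on the full product space, where
  agreement on finite-dimensional cylinders suffices. The restriction to cadlag paths is reinstated
  at the end.\<close>

lemma markov_path:
  assumes i: "i \<in> S" and s: "0 \<le> s" and A: "A \<in> past_sets i s" and E: "E \<in> sets (path_space S)"
  shows "emeasure (P i) (A \<inter> {\<omega>\<in>space (P i). path_shift s (path_of \<omega>) \<in> E}) =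
    (\<integral>\<^sup>+\<omega>. emeasure (law (X s \<omega>)) E * indicator A \<omega> \<partial>P i)"
proof -
  let ?M = "\<Pi>\<^sub>M t\<in>UNIV::real set. count_space S"
  have [measurable]: "A \<in> sets (P i)" using past_sets_P i A by blast
  have A_sub: "A \<subseteq> space (P i)" using sets.sets_into_space[OF \<open>A \<in> sets (P i)\<close>] .
  have DM: "f \<in> N \<rightarrow>\<^sub>M path_space S \<Longrightarrow> f \<in> N \<rightarrow>\<^sub>M ?M" for f and N :: "'w measure"
    unfolding path_space_def by (simp add: measurable_restrict_space2_iff)
  have ps: "(\<lambda>\<omega>. path_shift s (path_of \<omega>)) \<in> P i \<rightarrow>\<^sub>M path_space S"
    using measurable_compose[OF measurable_path_of[OF i] measurable_path_shift[OF s]] .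
  define K where "K j = distr (P j) ?M path_of" for j
  have K: "(\<lambda>\<omega>. K (X s \<omega>)) \<in> P i \<rightarrow>\<^sub>M subprob_algebra ?M"
  proof (rule measurable_compose[OF measurable_X[OF i s]])
    show "K \<in> count_space S \<rightarrow>\<^sub>M subprob_algebra ?M"
    proof (subst measurable_count_space_eq1, safe)
      fix j assume j: "j \<in> S"
      interpret prob_space "P j" using prob_P[OF j] .
      interpret pj: prob_space "distr (P j) ?M path_of"
        by (rule prob_space_distr[OF DM[OF measurable_path_of[OF j]]])
      show "K j \<in> space (subprob_algebra ?M)"
        unfolding K_def space_subprob_algebra using pj.subprob_space_axioms
        by (auto intro: pj.prob_space_axioms prob_space_imp_subprob_space)
    qed
  qed
  define N where "N = density (P i) (indicator A)"
  have spN: "space N = space (P i)" "sets N = sets (P i)" by (auto simp: N_def)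
  have nespace: "space N \<noteq> {}" unfolding spN using prob_space.not_empty[OF prob_P[OF i]] .
  have KN: "(\<lambda>\<omega>. K (X s \<omega>)) \<in> N \<rightarrow>\<^sub>M subprob_algebra ?M"
    using K by (simp cong: measurable_cong_sets add: spN)
  have psN: "(\<lambda>\<omega>. path_shift s (path_of \<omega>)) \<in> N \<rightarrow>\<^sub>M ?M"
    using DM[OF ps] by (simp cong: measurable_cong_sets add: spN)
  have "distr N ?M (\<lambda>\<omega>. path_shift s (path_of \<omega>)) = N \<bind> (\<lambda>\<omega>. K (X s \<omega>))"
  proof (rule measure_eqI_PiM_infinite)
    show "sets (N \<bind> (\<lambda>\<omega>. K (X s \<omega>))) = sets ?M"
      using nespace by (intro sets_bind) (auto simp: K_def)
    have "emeasure N (space N) = emeasure (P i) A"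
      unfolding N_def using A_sub by (simp add: emeasure_density)
    then have "emeasure N (space N) \<noteq> \<infinity>"
      using prob_P[OF i] by (metis finite_measure.emeasure_finite infinity_ennreal_def prob_space.finite_measure)
    then show "finite_measure (distr N ?M (\<lambda>\<omega>. path_shift s (path_of \<omega>)))"
      by (intro finite_measure.finite_measure_distr[OF _ psN] finite_measureI)
    fix F :: "real \<Rightarrow> nat set" and J :: "real set"
    assume J: "finite J" and "J \<subseteq> UNIV" and F: "\<And>t. t \<in> J \<Longrightarrow> F t \<in> sets (count_space S)"
    let ?E = "prod_emb UNIV (\<lambda>_. count_space S) J (Pi\<^sub>E J F)"
    have E: "?E \<in> sets ?M" using J F by (intro sets_PiM_I) auto
    \<comment> \<open>Cylinders may constrain negative times, at which the shifted path repeats its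
      value at time 0. Folding the times with \<open>max 0\<close> and intersecting the constraints
      gives an equivalent condition at nonnegative times.\<close>
    define J' where "J' = max 0 ` J"
    define F' where "F' r = (\<Inter>t\<in>{t\<in>J. max 0 t = r}. F t)" for r
    have memE: "x \<in> ?E \<longleftrightarrow> (\<forall>t\<in>J'. x t \<in> F' t)"
      if "\<And>t. x t \<in> S" "\<And>t. x t = x (max 0 t)" for x
    proof -
      have "x \<in> ?E \<longleftrightarrow> (\<forall>t\<in>J. x t \<in> F t)"
        using that(1) by (auto simp: prod_emb_def PiE_def Pi_iff extensional_def restrict_def)
      also have "\<dots> \<longleftrightarrow> (\<forall>t\<in>J. x (max 0 t) \<in> F t)" using that(2) by metis
      also have "\<dots> \<longleftrightarrow> (\<forall>t\<in>J'. x t \<in> F' t)" unfolding J'_def F'_def by auto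
      finally show ?thesis .
    qed
    have J': "finite J'" "J' \<subseteq> {0..}" using J by (auto simp: J'_def)
    have "emeasure (distr N ?M (\<lambda>\<omega>. path_shift s (path_of \<omega>))) ?E =
      emeasure N ((\<lambda>\<omega>. path_shift s (path_of \<omega>)) -` ?E \<inter> space N)"
      by (rule emeasure_distr[OF psN E])
    also have "(\<lambda>\<omega>. path_shift s (path_of \<omega>)) -` ?E \<inter> space N =
       {\<omega>\<in>space (P i). \<forall>t\<in>J'. X (s + t) \<omega> \<in> F' t}"
    proof -
      have "path_shift s (path_of \<omega>) \<in> ?E \<longleftrightarrow> (\<forall>t\<in>J'. X (s + t) \<omega> \<in> F' t)"
        if "\<omega> \<in> space (P i)" for \<omega>
      proof -
        have "path_shift s (path_of \<omega>) \<in> ?E \<longleftrightarrow> (\<forall>t\<in>J'. path_shift s (path_of \<omega>) t \<in> F' t)"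
          by (rule memE) (use X_mem[OF i _ that] s in \<open>auto simp: path_shift_def path_of_def\<close>)
        also have "\<dots> \<longleftrightarrow> (\<forall>t\<in>J'. X (s + t) \<omega> \<in> F' t)"
          using J'(2) s by (intro ball_cong refl) (auto simp: path_shift_def path_of_def)
        finally show ?thesis .
      qed
      then show ?thesis unfolding spN by auto
    qed
    also have "emeasure N \<dots> = emeasure (P i) (A \<inter> {\<omega>\<in>space (P i). \<forall>t\<in>J'. X (s + t) \<omega> \<in> F' t})"
    proof -
      have "{\<omega>\<in>space (P i). \<forall>t\<in>J'. X (s + t) \<omega> \<in> F' t} \<in> sets (P i)"
      proof (intro sets.sets_Collect_finite_All J')
        fix t assume "t \<in> J'"
        then show "{\<omega>\<in>space (P i). X (s + t) \<omega> \<in> F' t} \<in> sets (P i)"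
          using past_sets_P[OF i past_event[OF i, of "s+t" "s+t"]] J'(2) s by auto
      qed
      then show ?thesis unfolding N_def
        by (subst emeasure_density) (auto simp: nn_integral_indicator[symmetric] indicator_inter_arith
             simp del: nn_integral_indicator)
    qed
    also have "\<dots> = (\<integral>\<^sup>+\<omega>. emeasure (P (X s \<omega>)) {\<omega>'\<in>space (P (X s \<omega>)). \<forall>t\<in>J'. X t \<omega>' \<in> F' t} * indicator A \<omega> \<partial>P i)"
      by (rule markov_fdd[OF J' i s A])
    also have "\<dots> = (\<integral>\<^sup>+\<omega>. indicator A \<omega> * emeasure (K (X s \<omega>)) ?E \<partial>P i)"
    proof (rule nn_integral_cong)
      fix \<omega> assume "\<omega> \<in> space (P i)"
      then have j: "X s \<omega> \<in> S" using X_mem i s by blast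
      have "emeasure (K (X s \<omega>)) ?E = emeasure (P (X s \<omega>)) (path_of -` ?E \<inter> space (P (X s \<omega>)))"
        unfolding K_def by (rule emeasure_distr[OF DM[OF measurable_path_of[OF j]] E])
      also have "path_of -` ?E \<inter> space (P (X s \<omega>)) = {\<omega>'\<in>space (P (X s \<omega>)). \<forall>t\<in>J'. X t \<omega>' \<in> F' t}"
      proof -
        have "path_of \<omega>' \<in> ?E \<longleftrightarrow> (\<forall>t\<in>J'. X t \<omega>' \<in> F' t)" if "\<omega>' \<in> space (P (X s \<omega>))" for \<omega>'
        proof -
          have "path_of \<omega>' \<in> ?E \<longleftrightarrow> (\<forall>t\<in>J'. path_of \<omega>' t \<in> F' t)"
            by (rule memE) (use X_mem[OF j _ that] in \<open>auto simp: path_of_def\<close>)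
          also have "\<dots> \<longleftrightarrow> (\<forall>t\<in>J'. X t \<omega>' \<in> F' t)"
            using J'(2) by (intro ball_cong refl) (auto simp: path_of_def max_def)
          finally show ?thesis .
        qed
        then show ?thesis by auto
      qed
      finally show "emeasure (P (X s \<omega>)) {\<omega>'\<in>space (P (X s \<omega>)). \<forall>t\<in>J'. X t \<omega>' \<in> F' t} * indicator A \<omega> =
        indicator A \<omega> * emeasure (K (X s \<omega>)) ?E" by (simp add: mult.commute)
    qed
    also have "\<dots> = (\<integral>\<^sup>+\<omega>. emeasure (K (X s \<omega>)) ?E \<partial>N)"
      unfolding N_def
      by (rule nn_integral_density[symmetric])
         (auto intro!: measurable_compose[OF K measurable_emeasure_subprob_algebra] E)
    also have "\<dots> = emeasure (N \<bind> (\<lambda>\<omega>. K (X s \<omega>))) ?E"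
      by (rule emeasure_bind[OF nespace KN E, symmetric])
    finally show "emeasure (distr N ?M (\<lambda>\<omega>. path_shift s (path_of \<omega>))) ?E =
       emeasure (N \<bind> (\<lambda>\<omega>. K (X s \<omega>))) ?E" .
  qed auto
  note eq = this
  \<comment> \<open>A measurable set of paths is the trace of a product set \<open>E'\<close>. Every
    path that occurs is cadlag, so membership in \<open>E\<close> and in \<open>E'\<close>
    agree.\<close>
  obtain E' where E': "E' \<in> sets ?M" "E = {x. cadlag_on {0..} x} \<inter> E'"
    using E unfolding path_space_def sets_restrict_space by auto
  have "A \<inter> {\<omega>\<in>space (P i). path_shift s (path_of \<omega>) \<in> E} =
     A \<inter> ((\<lambda>\<omega>. path_shift s (path_of \<omega>)) -` E' \<inter> space (P i))"
    using measurable_space[OF ps] unfolding E'(2) by (auto dest: path_space_cadlag)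
  then have "emeasure (P i) (A \<inter> {\<omega>\<in>space (P i). path_shift s (path_of \<omega>) \<in> E}) =
     emeasure N ((\<lambda>\<omega>. path_shift s (path_of \<omega>)) -` E' \<inter> space (P i))"
    unfolding N_def using measurable_sets[OF DM[OF ps] E'(1)]
    by (subst emeasure_density) (auto simp: nn_integral_indicator[symmetric] indicator_inter_arith
             simp del: nn_integral_indicator)
  also have "\<dots> = emeasure (distr N ?M (\<lambda>\<omega>. path_shift s (path_of \<omega>))) E'"
    by (subst emeasure_distr[OF psN E'(1)]) (simp add: spN)
  also have "\<dots> = (\<integral>\<^sup>+\<omega>. emeasure (K (X s \<omega>)) E' \<partial>N)"
    unfolding eq by (rule emeasure_bind[OF nespace KN E'(1)])
  also have "\<dots> = (\<integral>\<^sup>+\<omega>. indicator A \<omega> * emeasure (K (X s \<omega>)) E' \<partial>P i)"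
    unfolding N_def
    by (rule nn_integral_density)
       (auto intro!: measurable_compose[OF K measurable_emeasure_subprob_algebra] E')
  also have "\<dots> = (\<integral>\<^sup>+\<omega>. emeasure (law (X s \<omega>)) E * indicator A \<omega> \<partial>P i)"
  proof (rule nn_integral_cong)
    fix \<omega> assume "\<omega> \<in> space (P i)"
    then have j: "X s \<omega> \<in> S" using X_mem i s by blast
    have "path_of -` E' \<inter> space (P (X s \<omega>)) = path_of -` E \<inter> space (P (X s \<omega>))"
      using cadlag_path_of[OF j] unfolding E'(2) by auto
    then have "emeasure (K (X s \<omega>)) E' = emeasure (law (X s \<omega>)) E"
      unfolding K_def law_def emeasure_distr[OF DM[OF measurable_path_of[OF j]] E'(1)]
        emeasure_distr[OF measurable_path_of[OF j] E] by simp
    then show "indicator A \<omega> * emeasure (K (X s \<omega>)) E' = emeasure (law (X s \<omega>)) E * indicator A \<omega>"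
      by (simp add: mult.commute)
  qed
  finally show ?thesis .
qed

text \<open>The stopped path is measurable with respect to the past, so
  \<open>path_stop s x \<in> A\<close> is a past event to which \<open>markov_path\<close>
  applies.\<close>

lemma law_markov:
  assumes i: "i \<in> S" and s: "0 \<le> s" and A: "A \<in> sets (path_space S)" and E: "E \<in> sets (path_space S)"
  shows "emeasure (law i) {x\<in>space (path_space S). path_stop s x \<in> A \<and> path_shift s x \<in> E} =
    (\<integral>\<^sup>+x. indicator A (path_stop s x) * emeasure (law (x s)) E \<partial>law i)"
proof -
  let ?D = "path_space S"
  have m: "{x\<in>space ?D. path_stop s x \<in> A \<and> path_shift s x \<in> E} \<in> sets ?D"
    using A E s by measurable
  have past_stop: "(\<lambda>\<omega>. path_stop s (path_of \<omega>)) \<in> past (P i) (count_space S) X s \<rightarrow>\<^sub>M ?D"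
  proof (rule measurable_into_path_space)
    fix t show "(\<lambda>\<omega>. path_stop s (path_of \<omega>) t) \<in> past (P i) (count_space S) X s \<rightarrow>\<^sub>M count_space S"
      unfolding path_stop_def path_of_def using s by (intro measurable_X_past i) auto
  qed (use s in \<open>auto simp: space_past intro!: cadlag_path_stop cadlag_path_of i\<close>)
  define A' where "A' = (\<lambda>\<omega>. path_stop s (path_of \<omega>)) -` A \<inter> space (P i)"
  have A': "A' \<in> past_sets i s"
    using measurable_sets[OF past_stop A] by (simp add: A'_def space_past)
  have "emeasure (law i) {x\<in>space ?D. path_stop s x \<in> A \<and> path_shift s x \<in> E} =
     emeasure (P i) (A' \<inter> {\<omega>\<in>space (P i). path_shift s (path_of \<omega>) \<in> E})"
    unfolding law_def emeasure_distr[OF measurable_path_of[OF i] m]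
    using measurable_space[OF measurable_path_of[OF i]]
    by (intro arg_cong[where f="emeasure (P i)"]) (auto simp: A'_def)
  also have "\<dots> = (\<integral>\<^sup>+\<omega>. emeasure (law (X s \<omega>)) E * indicator A' \<omega> \<partial>P i)"
    by (rule markov_path[OF i s A' E])
  also have "\<dots> = (\<integral>\<^sup>+\<omega>. indicator A (path_stop s (path_of \<omega>)) * emeasure (law (path_of \<omega> s)) E \<partial>P i)"
    using s by (intro nn_integral_cong) (auto simp: A'_def path_of_def indicator_def)
  also have "\<dots> = (\<integral>\<^sup>+x. indicator A (path_stop s x) * emeasure (law (x s)) E \<partial>law i)"
    unfolding law_def[of i]
  proof -
    have "(\<lambda>x. emeasure (law (x s)) E) \<in> borel_measurable ?D"
      by (rule measurable_compose[OF measurable_path_coord]) auto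
    then have "(\<lambda>x. indicator A (path_stop s x) * emeasure (law (x s)) E) \<in> borel_measurable ?D"
      using A s by measurable
    then have "(\<lambda>x. indicator A (path_stop s x) * emeasure (law (x s)) E) \<in> borel_measurable (distr (P i) ?D path_of)"
      by simp
    from nn_integral_distr[OF measurable_path_of[OF i] this, symmetric]
    show "(\<integral>\<^sup>+\<omega>. indicator A (path_stop s (path_of \<omega>)) * emeasure (law (path_of \<omega> s)) E \<partial>P i) =
      (\<integral>\<^sup>+x. indicator A (path_stop s x) * emeasure (law (x s)) E \<partial>distr (P i) ?D path_of)" .
  qed
  finally show ?thesis .
qed

lemma law_start: "i \<in> S \<Longrightarrow> AE x in law i. x 0 = i"
proof -
  assume i: "i \<in> S"
  have "AE \<omega> in P i. X 0 \<omega> = i" using nonexplosive i by (auto simp: nonexplosive_ctmc_def)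
  then have "AE \<omega> in P i. path_of \<omega> 0 = i" by (simp add: path_of_def)
  then show ?thesis unfolding law_def
    by (subst AE_distr_iff[OF measurable_path_of[OF i]]) auto
qed

lemma measure_law_coord:
  assumes "i \<in> S" "0 \<le> t"
  shows "measure (law i) {x\<in>space (path_space S). x t = j} = measure (P i) {\<omega>\<in>space (P i). X t \<omega> = j}"
proof -
  have "{x\<in>space (path_space S). x t = j} \<in> sets (path_space S)" by measurable
  then show ?thesis unfolding law_def
    using assms measurable_space[OF measurable_path_of[OF assms(1)]]
    by (subst measure_distr[OF measurable_path_of]) (auto intro!: arg_cong[where f="measure (P i)"] simp: path_of_def)
qed

lemma law_rate: "((\<lambda>t. measure (law 0) {x\<in>space (path_space S). x t = 0}) has_real_derivative q 0 0) (at_right 0)"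
proof -
  have "((\<lambda>t. measure (P 0) {\<omega>\<in>space (P 0). X t \<omega> = 0}) has_real_derivative q 0 0) (at_right 0)"
    using nonexplosive zero_mem by (auto simp: nonexplosive_ctmc_def)
  then show ?thesis
    unfolding has_field_derivative_iff
    by (rule Lim_transform_within[where d=1]) (auto simp: measure_law_coord zero_mem)
qed

end

section \<open>The canonical chain and its Markov property with ages\<close>

definition alive_ind :: "hat_state \<Rightarrow> real \<Rightarrow> (real \<Rightarrow> nat) \<Rightarrow> ennreal" where
  "alive_ind y t x = (if path_alive (snd y) x t then 1 else 0)"

lemma measurable_alive_ind [measurable (raw)]:
  assumes f: "f \<in> M \<rightarrow>\<^sub>M hat_space S" and [measurable]: "g \<in> M \<rightarrow>\<^sub>M path_space S"
  shows "(\<lambda>\<omega>. alive_ind (f \<omega>) t (g \<omega>)) \<in> borel_measurable M"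
proof -
  have [measurable]: "(\<lambda>\<omega>. snd (f \<omega>)) \<in> borel_measurable M"
    by (rule measurable_compose[OF f]) measurable
  show ?thesis unfolding alive_ind_def by measurable
qed

lemma measurable_alive_ind' [measurable]: "alive_ind y t \<in> borel_measurable (path_space S)"
  unfolding alive_ind_def by measurable

lemma measurable_hat_at' [measurable]:
  assumes "y \<in> hat_states S" "0 \<le> t"
  shows "hat_at y t \<in> path_space S \<rightarrow>\<^sub>M hat_space S"
  by (rule measurable_hat_at[of "\<lambda>_. y" _ S "\<lambda>x. x"]) (use assms in auto)

lemma alive_ind_le_1: "alive_ind y t x \<le> 1"
  by (simp add: alive_ind_def)

lemma alive_ind_stop: "t \<le> s \<Longrightarrow> alive_ind y t (path_stop s x) = alive_ind y t x"
  by (simp add: alive_ind_def path_alive_stop)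

lemma hat_at_stop: "0 \<le> t \<Longrightarrow> t \<le> s \<Longrightarrow> hat_at y t (path_stop s x) = hat_at y t x"
  by (simp add: hat_at_def path_alive_stop hat_X_stop)

lemma alive_ind_flow:
  "0 \<le> s \<Longrightarrow> 0 \<le> t \<Longrightarrow> alive_ind y (s + t) x = alive_ind y s x * alive_ind (hat_at y s x) t (path_shift s x)"
  by (simp add: alive_ind_def path_alive_flow hat_at_def)

lemma hat_at_flow:
  "0 \<le> s \<Longrightarrow> 0 \<le> t \<Longrightarrow> path_alive (snd y) x s \<Longrightarrow>
    hat_at y (s + t) x = hat_at (hat_at y s x) t (path_shift s x)"
  by (simp add: hat_at_def path_alive_flow hat_X_flow)

lemma hat_at_alive: "path_alive (snd y) x t \<Longrightarrow> hat_at y t x = hat_X (snd y) x t"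
  by (simp add: hat_at_def)

lemma fst_hat_at: "path_alive (snd y) x t \<Longrightarrow> fst (hat_at y t x) = x t"
  by (simp add: hat_at_def)

text \<open>The chain in canonical form: \<open>Q i\<close> is the law of the path started in
  \<open>i\<close>, and \<open>path_stop s\<close> and \<open>path_shift s\<close> represent past
  and future. The rate \<open>q00\<close> fixes the holding time in 0, and accessibility is stated
  from 0.\<close>

locale path_chain =
  fixes S :: "nat set" and Q :: "nat \<Rightarrow> (real \<Rightarrow> nat) measure" and q00 :: real
  assumes zero_mem: "0 \<in> S"
    and Q_prob: "i \<in> S \<Longrightarrow> Q i \<in> space (prob_algebra (path_space S))"
    and Q_start: "i \<in> S \<Longrightarrow> AE x in Q i. x 0 = i"
    and Q_markov: "\<lbrakk>i \<in> S; 0 \<le> s; A \<in> sets (path_space S); E \<in> sets (path_space S)\<rbrakk> \<Longrightarrow>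
      emeasure (Q i) {x\<in>space (path_space S). path_stop s x \<in> A \<and> path_shift s x \<in> E} =
      (\<integral>\<^sup>+x. indicator A (path_stop s x) * emeasure (Q (x s)) E \<partial>Q i)"
    and Q_rate: "((\<lambda>t. measure (Q 0) {x\<in>space (path_space S). x t = 0}) has_real_derivative q00) (at_right 0)"
    and Q_irreducible: "i \<in> S \<Longrightarrow> \<exists>t\<ge>0. 0 < measure (Q 0) {x\<in>space (path_space S). x t = i}"
begin

abbreviation "\<D> \<equiv> path_space S"
abbreviation "\<H> \<equiv> hat_space S"

lemma sets_Q [measurable_cong, simp]: "i \<in> S \<Longrightarrow> sets (Q i) = sets \<D>"
  and prob_Q: "i \<in> S \<Longrightarrow> prob_space (Q i)"
  using Q_prob by (auto simp: space_prob_algebra)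

lemma space_Q [simp]: "i \<in> S \<Longrightarrow> space (Q i) = space \<D>"
  by (rule sets_eq_imp_space_eq) simp

lemma measurable_Q_iff [simp]: "i \<in> S \<Longrightarrow> measurable (Q i) N = measurable \<D> N"
  by (rule measurable_cong_sets) auto

lemma Q_one: "i \<in> S \<Longrightarrow> (\<integral>\<^sup>+x. c \<partial>Q i) = c"
  using prob_space.emeasure_space_1[OF prob_Q] by (simp del: space_Q)

lemma measurable_Q [measurable (raw)]:
  "f \<in> M \<rightarrow>\<^sub>M count_space S \<Longrightarrow> (\<lambda>\<omega>. Q (f \<omega>)) \<in> M \<rightarrow>\<^sub>M prob_algebra \<D>"
  by (rule measurable_compose[where N="count_space S"]) (auto simp: Q_prob)

lemma hat_fst_mem: "y \<in> hat_states S \<Longrightarrow> fst y \<in> S"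
  using zero_mem by (auto simp: hat_states_iff)

lemma measurable_fst_hat_S [measurable]: "fst \<in> \<H> \<rightarrow>\<^sub>M count_space S"
proof -
  have "countable S" by simp
  then show ?thesis
    using measurable_sets[OF measurable_fst_hat]
    by (subst measurable_count_space_eq_countable) (auto simp: hat_fst_mem)
qed

lemma measurable_integral_Q:
  assumes "(\<lambda>(y, z). G y z) \<in> borel_measurable (\<H> \<Otimes>\<^sub>M \<D>)"
  shows "(\<lambda>y. \<integral>\<^sup>+z. G y z \<partial>Q (fst y)) \<in> borel_measurable \<H>"
  using assms
  by (rule nn_integral_measurable_subprob_algebra2)
     (rule measurable_prob_algebraD, rule measurable_Q, rule measurable_fst_hat_S)

text \<open>The joint law of the stopped and the shifted path is compared on rectangles with the
  composition of \<open>Q i\<close> and the kernel that freezes the past and draws the future from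
  \<open>Q (x s)\<close>. Rectangles determine the law, so every jointly measurable functional is
  covered.\<close>

lemma markov_integral:
  fixes \<Psi> :: "(real \<Rightarrow> nat) \<Rightarrow> (real \<Rightarrow> nat) \<Rightarrow> ennreal"
  assumes i: "i \<in> S" and s: "0 \<le> s"
    and \<Psi>: "(\<lambda>(x, z). \<Psi> x z) \<in> borel_measurable (\<D> \<Otimes>\<^sub>M \<D>)"
  shows "(\<integral>\<^sup>+x. \<Psi> (path_stop s x) (path_shift s x) \<partial>Q i) =
    (\<integral>\<^sup>+x. \<integral>\<^sup>+z. \<Psi> (path_stop s x) z \<partial>Q (x s) \<partial>Q i)"
proof -
  let ?DD = "\<D> \<Otimes>\<^sub>M \<D>"
  note [measurable] = measurable_path_stop[OF s] measurable_path_shift[OF s]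
  define K where "K = (\<lambda>x. distr (Q (x s)) ?DD (Pair (path_stop s x)))"
  have Qs: "(\<lambda>x. Q (x s)) \<in> \<D> \<rightarrow>\<^sub>M prob_algebra \<D>"
    by (intro measurable_Q measurable_path_coord_S)
  have K: "K \<in> Q i \<rightarrow>\<^sub>M subprob_algebra ?DD"
    unfolding K_def using i
    by (simp, intro measurable_distr2[OF _ measurable_prob_algebraD[OF Qs]]) measurable
  have ne: "space (Q i) \<noteq> {}" using prob_space.not_empty[OF prob_Q[OF i]] .
  have pair: "(\<lambda>x. (path_stop s x, path_shift s x)) \<in> Q i \<rightarrow>\<^sub>M ?DD"
    using i by simp
  have sK: "sets (Q i \<bind> K) = sets ?DD"
    by (intro sets_bind ne) (simp add: K_def)
  have "distr (Q i) ?DD (\<lambda>x. (path_stop s x, path_shift s x)) = Q i \<bind> K"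
  proof (rule measure_eqI_generator_eq[OF Int_stable_pair_measure_generator[of \<D> \<D>]])
    show "{a \<times> b |a b. a \<in> sets \<D> \<and> b \<in> sets \<D>} \<subseteq> Pow (space ?DD)"
      using sets.space_closed[of \<D>] by (auto simp: space_pair_measure)
    show "sets (distr (Q i) ?DD (\<lambda>x. (path_stop s x, path_shift s x))) =
      sigma_sets (space ?DD) {a \<times> b |a b. a \<in> sets \<D> \<and> b \<in> sets \<D>}"
      by (simp add: sets_pair_measure space_pair_measure)
    show "sets (Q i \<bind> K) = sigma_sets (space ?DD) {a \<times> b |a b. a \<in> sets \<D> \<and> b \<in> sets \<D>}"
      unfolding sK by (simp add: sets_pair_measure space_pair_measure)
    show "range (\<lambda>_::nat. space \<D> \<times> space \<D>) \<subseteq> {a \<times> b |a b. a \<in> sets \<D> \<and> b \<in> sets \<D>}"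
      by auto
    show "(\<Union>j::nat. space \<D> \<times> space \<D>) = space ?DD" by (simp add: space_pair_measure)
    show "emeasure (distr (Q i) ?DD (\<lambda>x. (path_stop s x, path_shift s x))) (space \<D> \<times> space \<D>) \<noteq> \<infinity>" for j :: nat
      using finite_measure.emeasure_finite[OF prob_space.finite_measure[OF
          prob_space.prob_space_distr[OF prob_Q[OF i] pair]]]
      by simp
    fix Z assume "Z \<in> {a \<times> b |a b. a \<in> sets \<D> \<and> b \<in> sets \<D>}"
    then obtain A E where Z: "Z = A \<times> E" and AE: "A \<in> sets \<D>" "E \<in> sets \<D>" by auto
    have Zs: "Z \<in> sets ?DD" unfolding Z using AE by auto
    have "emeasure (distr (Q i) ?DD (\<lambda>x. (path_stop s x, path_shift s x))) Z =
      emeasure (Q i) {x\<in>space \<D>. path_stop s x \<in> A \<and> path_shift s x \<in> E}"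
      unfolding emeasure_distr[OF pair Zs] using i
      by (intro arg_cong[where f="emeasure (Q i)"]) (auto simp: Z)
    also have "\<dots> = (\<integral>\<^sup>+x. indicator A (path_stop s x) * emeasure (Q (x s)) E \<partial>Q i)"
      by (rule Q_markov[OF i s AE])
    also have "\<dots> = (\<integral>\<^sup>+x. emeasure (K x) Z \<partial>Q i)"
    proof (rule nn_integral_cong)
      fix x assume "x \<in> space (Q i)"
      then have x: "x \<in> space \<D>" "path_stop s x \<in> space \<D>" "x s \<in> S"
        using i s measurable_space[OF measurable_path_stop[OF s]] path_space_mem by auto
      have "emeasure (K x) Z = emeasure (Q (x s)) (Pair (path_stop s x) -` Z \<inter> space (Q (x s)))"
        unfolding K_def using x by (intro emeasure_distr Zs) auto
      also have "Pair (path_stop s x) -` Z \<inter> space (Q (x s)) = (if path_stop s x \<in> A then E else {})"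
        using x AE sets.sets_into_space unfolding Z by auto
      finally show "indicator A (path_stop s x) * emeasure (Q (x s)) E = emeasure (K x) Z"
        by simp
    qed
    also have "\<dots> = emeasure (Q i \<bind> K) Z"
      by (rule emeasure_bind[OF ne K Zs, symmetric])
    finally show "emeasure (distr (Q i) ?DD (\<lambda>x. (path_stop s x, path_shift s x))) Z = emeasure (Q i \<bind> K) Z" .
  qed
  note eq = this
  have "(\<integral>\<^sup>+x. \<Psi> (path_stop s x) (path_shift s x) \<partial>Q i) =
     (\<integral>\<^sup>+w. (\<lambda>(x, z). \<Psi> x z) w \<partial>distr (Q i) ?DD (\<lambda>x. (path_stop s x, path_shift s x)))"
    by (subst nn_integral_distr[OF pair]) (use \<Psi> in auto)
  also have "\<dots> = (\<integral>\<^sup>+x. \<integral>\<^sup>+w. (\<lambda>(x, z). \<Psi> x z) w \<partial>K x \<partial>Q i)"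
    unfolding eq by (rule nn_integral_bind[OF \<Psi> K])
  also have "\<dots> = (\<integral>\<^sup>+x. \<integral>\<^sup>+z. \<Psi> (path_stop s x) z \<partial>Q (x s) \<partial>Q i)"
  proof (rule nn_integral_cong)
    fix x assume "x \<in> space (Q i)"
    then have x: "path_stop s x \<in> space \<D>" "x s \<in> S"
      using i s measurable_space[OF measurable_path_stop[OF s]] path_space_mem by auto
    show "(\<integral>\<^sup>+w. (\<lambda>(x, z). \<Psi> x z) w \<partial>K x) = (\<integral>\<^sup>+z. \<Psi> (path_stop s x) z \<partial>Q (x s))"
      unfolding K_def using x \<Psi> by (subst nn_integral_distr) auto
  qed
  finally show ?thesis .
qed

lemma markov_simple:
  fixes F G :: "(real \<Rightarrow> nat) \<Rightarrow> ennreal"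
  assumes i: "i \<in> S" and s: "0 \<le> s"
    and F [measurable]: "F \<in> borel_measurable \<D>" and G [measurable]: "G \<in> borel_measurable \<D>"
    and stop: "\<And>x. F (path_stop s x) = F x"
  shows "(\<integral>\<^sup>+x. F x * G (path_shift s x) \<partial>Q i) = (\<integral>\<^sup>+x. F x * (\<integral>\<^sup>+z. G z \<partial>Q (x s)) \<partial>Q i)"
proof -
  have "(\<integral>\<^sup>+x. F (path_stop s x) * G (path_shift s x) \<partial>Q i) =
     (\<integral>\<^sup>+x. \<integral>\<^sup>+z. F (path_stop s x) * G z \<partial>Q (x s) \<partial>Q i)"
    by (rule markov_integral[OF i s]) measurable
  also have "\<dots> = (\<integral>\<^sup>+x. F x * (\<integral>\<^sup>+z. G z \<partial>Q (x s)) \<partial>Q i)"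
    unfolding stop
  proof (rule nn_integral_cong)
    fix x assume "x \<in> space (Q i)"
    then have "x s \<in> S" using i path_space_mem by auto
    then show "(\<integral>\<^sup>+z. F x * G z \<partial>Q (x s)) = F x * (\<integral>\<^sup>+z. G z \<partial>Q (x s))"
      by (intro nn_integral_cmult) auto
  qed
  finally show ?thesis by (simp add: stop)
qed

text \<open>The Markov property for the process with ages. The factor \<open>alive_ind\<close>
  ensures that \<open>fst (hat_at y s x)\<close> is the true state \<open>x s\<close>, so the value
  assigned after killing never enters.\<close>

lemma markov_hat:
  assumes y: "y \<in> hat_states S" and s: "0 \<le> s"
    and F [measurable]: "F \<in> borel_measurable \<D>"
    and G: "(\<lambda>(y, z). G y z) \<in> borel_measurable (\<H> \<Otimes>\<^sub>M \<D>)"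
    and stop: "\<And>x. F (path_stop s x) = F x"
  shows "(\<integral>\<^sup>+x. F x * alive_ind y s x * G (hat_at y s x) (path_shift s x) \<partial>Q (fst y)) =
    (\<integral>\<^sup>+x. F x * alive_ind y s x * (\<integral>\<^sup>+z. G (hat_at y s x) z \<partial>Q (fst (hat_at y s x))) \<partial>Q (fst y))"
proof -
  have i: "fst y \<in> S" using y by (rule hat_fst_mem)
  have G': "(\<lambda>w. G (f w) (g w)) \<in> borel_measurable N"
    if "f \<in> N \<rightarrow>\<^sub>M \<H>" "g \<in> N \<rightarrow>\<^sub>M \<D>" for f g and N :: "'x measure"
    using measurable_compose[OF measurable_Pair[OF that] G] by simp
  note [measurable] = measurable_hat_at'[OF y s]
  have "(\<integral>\<^sup>+x. F (path_stop s x) * alive_ind y s (path_stop s x) *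
        G (hat_at y s (path_stop s x)) (path_shift s x) \<partial>Q (fst y)) =
     (\<integral>\<^sup>+x. \<integral>\<^sup>+z. F (path_stop s x) * alive_ind y s (path_stop s x) *
        G (hat_at y s (path_stop s x)) z \<partial>Q (x s) \<partial>Q (fst y))"
  proof (rule markov_integral[OF i s])
    have [measurable]: "(\<lambda>w. G (hat_at y s (fst w)) (snd w)) \<in> borel_measurable (\<D> \<Otimes>\<^sub>M \<D>)"
      by (rule G') measurable
    show "(\<lambda>(x, z). F x * alive_ind y s x * G (hat_at y s x) z) \<in> borel_measurable (\<D> \<Otimes>\<^sub>M \<D>)"
      by (simp add: split_beta') 
  qed
  also have "\<dots> = (\<integral>\<^sup>+x. F x * alive_ind y s x *
      (\<integral>\<^sup>+z. G (hat_at y s x) z \<partial>Q (fst (hat_at y s x))) \<partial>Q (fst y))"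
  proof (rule nn_integral_cong)
    fix x assume "x \<in> space (Q (fst y))"
    then have x: "x \<in> space \<D>" "x s \<in> S" using i path_space_mem by auto
    have h: "hat_at y s x \<in> hat_states S" using y s x by (intro hat_at_in_hat_states)
    have "(\<lambda>z. G (hat_at y s x) z) \<in> borel_measurable \<D>"
      by (rule G') (use h in auto)
    then have "(\<integral>\<^sup>+z. F x * alive_ind y s x * G (hat_at y s x) z \<partial>Q (x s)) =
        F x * alive_ind y s x * (\<integral>\<^sup>+z. G (hat_at y s x) z \<partial>Q (x s))"
      using x by (intro nn_integral_cmult) auto
    also have "\<dots> = F x * alive_ind y s x * (\<integral>\<^sup>+z. G (hat_at y s x) z \<partial>Q (fst (hat_at y s x)))"
      by (cases "path_alive (snd y) x s") (auto simp: fst_hat_at alive_ind_def)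
    finally show "(\<integral>\<^sup>+z. F (path_stop s x) * alive_ind y s (path_stop s x) *
        G (hat_at y s (path_stop s x)) z \<partial>Q (x s)) =
      F x * alive_ind y s x * (\<integral>\<^sup>+z. G (hat_at y s x) z \<partial>Q (fst (hat_at y s x)))"
      using s by (simp add: stop alive_ind_stop hat_at_stop)
  qed
  finally show ?thesis using s by (simp add: stop alive_ind_stop hat_at_stop)
qed

definition surv :: "hat_state \<Rightarrow> real \<Rightarrow> ennreal" where
  "surv y t = (\<integral>\<^sup>+x. alive_ind y t x \<partial>Q (fst y))"

lemma measurable_surv [measurable]: "(\<lambda>y. surv y t) \<in> borel_measurable \<H>"
  unfolding surv_def by (rule measurable_integral_Q) measurable

lemma surv_le_1: "y \<in> hat_states S \<Longrightarrow> surv y t \<le> 1"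
proof -
  assume y: "y \<in> hat_states S"
  have "surv y t \<le> (\<integral>\<^sup>+x. 1 \<partial>Q (fst y))"
    unfolding surv_def by (intro nn_integral_mono alive_ind_le_1)
  then show ?thesis unfolding Q_one[OF hat_fst_mem[OF y]] .
qed

lemma surv_antimono: "s \<le> t \<Longrightarrow> surv y t \<le> surv y s"
  unfolding surv_def
  by (intro nn_integral_mono) (auto simp: alive_ind_def dest: path_alive_mono)

text \<open>The weight \<open>F\<close> of the path up to \<open>s\<close> is what makes this
  flexible: it is taken as an indicator of staying in 0, as an indicator of the grid cell of the
  first return, and as a test functional of the conditioned path.\<close>

lemma surv_markov_weight:
  assumes y: "y \<in> hat_states S" and s: "0 \<le> s" and t: "0 \<le> t"
    and F [measurable]: "F \<in> borel_measurable \<D>" and stop: "\<And>x. F (path_stop s x) = F x"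
  shows "(\<integral>\<^sup>+x. F x * alive_ind y (s + t) x \<partial>Q (fst y)) =
    (\<integral>\<^sup>+x. F x * alive_ind y s x * surv (hat_at y s x) t \<partial>Q (fst y))"
proof -
  have "(\<integral>\<^sup>+x. F x * alive_ind y (s + t) x \<partial>Q (fst y)) =
    (\<integral>\<^sup>+x. F x * alive_ind y s x * alive_ind (hat_at y s x) t (path_shift s x) \<partial>Q (fst y))"
    using s t by (simp add: alive_ind_flow mult.assoc)
  also have "\<dots> = (\<integral>\<^sup>+x. F x * alive_ind y s x * surv (hat_at y s x) t \<partial>Q (fst y))"
    unfolding surv_def by (rule markov_hat[OF y s F _ stop]) measurable
  finally show ?thesis .
qed

lemma surv_markov:
  assumes "y \<in> hat_states S" "0 \<le> s" "0 \<le> t"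
  shows "surv y (s + t) = (\<integral>\<^sup>+x. alive_ind y s x * surv (hat_at y s x) t \<partial>Q (fst y))"
  using surv_markov_weight[OF assms, of "\<lambda>_. 1"] by (simp add: surv_def[of y])

lemma AE_start_hat:
  assumes "y \<in> hat_states S"
  shows "AE x in Q (fst y). x \<in> space \<D> \<and> x 0 = fst y"
  using Q_start[OF hat_fst_mem[OF assms]] AE_space[of "Q (fst y)"] hat_fst_mem[OF assms] by auto

end

section \<open>The exponential holding time in 0\<close>

lemma tendsto_power_exp_of_deriv:
  fixes f :: "real \<Rightarrow> real"
  assumes f0: "f 0 = 1" and D: "(f has_real_derivative D) (at_right 0)" and t: "0 < t"
  shows "(\<lambda>n. f (t / real n) ^ n) \<longlonglongrightarrow> exp (D * t)"
proof -
  \<comment> \<open>Since \<open>f 0 = 1\<close>, the logarithm of the power is \<open>t\<close>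
    times a difference quotient of \<open>ln f\<close> at 0.\<close>
  have "((\<lambda>y. ln (f y)) has_real_derivative (inverse (f 0) * D)) (at_right 0)"
    by (rule DERIV_chain'[OF D]) (use f0 in \<open>auto intro!: derivative_eq_intros simp: divide_inverse\<close>)
  then have "((\<lambda>y. ln (f y) / y) \<longlongrightarrow> D) (at_right 0)"
    unfolding has_field_derivative_iff by (simp add: f0)
  moreover have lim: "filterlim (\<lambda>n. t / real n) (at_right 0) sequentially"
    using t by real_asymp
  ultimately have "(\<lambda>n. ln (f (t / real n)) / (t / real n)) \<longlonglongrightarrow> D"
    by (rule filterlim_compose)
  then have "(\<lambda>n. exp (ln (f (t / real n)) / (t / real n) * t)) \<longlonglongrightarrow> exp (D * t)"
    by (intro tendsto_intros)
  moreover have "(f \<longlongrightarrow> 1) (at_right 0)"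
    using DERIV_continuous[OF D] f0 by (simp add: continuous_within)
  then have "(\<lambda>n. f (t / real n)) \<longlonglongrightarrow> 1" by (rule filterlim_compose[OF _ lim])
  then have "eventually (\<lambda>n. 0 < f (t / real n)) sequentially"
    by (rule order_tendstoD) simp
  then have "eventually (\<lambda>n. exp (ln (f (t / real n)) / (t / real n) * t) = f (t / real n) ^ n) sequentially"
    using eventually_gt_at_top[of 0]
  proof eventually_elim
    case (elim n)
    then have "exp (ln (f (t / real n)) / (t / real n) * t) = exp (real n * ln (f (t / real n)))"
      using t by (simp add: field_simps)
    also have "\<dots> = f (t / real n) ^ n" using elim by (simp add: exp_of_nat_mult)
    finally show ?case .
  qed
  ultimately show ?thesis by (rule Lim_transform_eventually)
qed

text \<open>A monotone \<open>R\<close> that is false at 0 switches on at most once, and the only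
  term that can survive is the one at the switch.\<close>

lemma sum_first_index:
  fixes R :: "nat \<Rightarrow> bool" and a :: "nat \<Rightarrow> 'a::comm_monoid_add"
  assumes "\<not> R 0" "mono R"
  shows "(\<Sum>k=1..n. if R k \<and> \<not> R (k - 1) then a k else 0) = (if R n then a (LEAST k. R k) else 0)"
proof (induction n)
  case (Suc n)
  show ?case
  proof (cases "R n")
    case True
    then have "R (Suc n)" using monoD[OF assms(2), of n "Suc n"] by simp
    then show ?thesis using Suc True by simp
  next
    case False
    have "(LEAST k. R k) = Suc n" if "R (Suc n)"
    proof (rule Least_equality[of R, OF that])
      fix k assume "R k"
      then show "Suc n \<le> k" using False monoD[OF assms(2), of k n] by (cases "k \<le> n") auto
    qed
    then show ?thesis using Suc False by simp
  qed
qed (use assms in auto)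

lemma exp_grid_dense:
  fixes r t e :: real
  assumes "0 \<le> r" "r < t" "0 < e"
  obtains m k where "k \<le> 2 ^ m" "r \<le> real k * (t / 2 ^ m)" "real k * (t / 2 ^ m) < r + e"
proof -
  have t: "0 < t" using assms by simp
  define c where "c = min e (t - r)"
  have c: "0 < c" "c \<le> e" "c \<le> t - r" using assms by (auto simp: c_def)
  obtain m where m: "t / c < 2 ^ m" using real_arch_pow[of 2 "t / c"] by auto
  then have d: "t / 2 ^ m < c" using c(1) by (simp add: field_simps)
  define k where "k = nat \<lceil>r / (t / 2 ^ m)\<rceil>"
  have dp: "0 < t / 2 ^ m" using t by simp
  have k: "real k = of_int \<lceil>r / (t / 2 ^ m)\<rceil>"
  proof -
    have "0 \<le> r / (t / 2 ^ m)" using assms(1) dp by (rule divide_nonneg_pos)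
    then have "0 \<le> \<lceil>r / (t / 2 ^ m)\<rceil>" by linarith
    then show ?thesis unfolding k_def by (rule of_nat_nat)
  qed
  have "r / (t / 2 ^ m) \<le> real k" "real k < r / (t / 2 ^ m) + 1"
    unfolding k by (linarith)+
  then have 1: "r \<le> real k * (t / 2 ^ m)" and 2: "real k * (t / 2 ^ m) < r + t / 2 ^ m"
    using dp by (simp_all add: field_simps)
  from 2 d c have "real k * (t / 2 ^ m) < t" by linarith
  then have "real k < 2 ^ m" using t by (simp add: field_simps)
  then have "k \<le> 2 ^ m" by (metis less_imp_le of_nat_less_iff of_nat_numeral of_nat_power)
  with 1 2 d c show thesis by (intro that) auto
qed

context path_chain
begin

definition p00 :: "real \<Rightarrow> real" where
  "p00 d = measure (Q 0) {x\<in>space \<D>. x d = 0}"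

text \<open>Each grid point at which the path is in 0 is a restart from 0, so the probabilities
  multiply.\<close>

lemma emeasure_zero_grid:
  assumes d: "0 \<le> d"
  shows "emeasure (Q 0) {x\<in>space \<D>. \<forall>k\<le>n. x (real k * d) = 0} = ennreal (p00 d ^ n)"
proof (induction n)
  case 0
  interpret prob_space "Q 0" using prob_Q zero_mem by blast
  have "emeasure (Q 0) {x\<in>space \<D>. x 0 = 0} = 1"
  proof (rule emeasure_eq_1_AE)
    show "{x\<in>space \<D>. x 0 = 0} \<in> events" using zero_mem by simp
    show "AE x in Q 0. x \<in> {x\<in>space \<D>. x 0 = 0}"
      using Q_start[OF zero_mem] AE_space[of "Q 0"] by eventually_elim (use zero_mem in auto)
  qed
  then show ?case by simp
next
  case (Suc n)
  interpret prob_space "Q 0" using prob_Q zero_mem by blast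
  define F :: "(real \<Rightarrow> nat) \<Rightarrow> ennreal" where "F x = (if \<forall>k\<le>n. x (real k * d) = 0 then 1 else 0)" for x
  define G :: "(real \<Rightarrow> nat) \<Rightarrow> ennreal" where "G z = (if z d = 0 then 1 else 0)" for z
  have [measurable]: "F \<in> borel_measurable \<D>" "G \<in> borel_measurable \<D>"
    unfolding F_def G_def by measurable
  have stop: "F (path_stop (real n * d) x) = F x" for x
  proof -
    have "path_stop (real n * d) x (real k * d) = x (real k * d)" if "k \<le> n" for k
      using that d by (simp add: path_stop_def mult_right_mono min_absorb2)
    then show ?thesis unfolding F_def by (metis (no_types, lifting))
  qed
  have ind: "(\<integral>\<^sup>+x. (if P x then 1 else 0) \<partial>Q 0) = emeasure (Q 0) {x\<in>space \<D>. P x}"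
    if [measurable]: "Measurable.pred \<D> P" for P
  proof -
    have "(\<integral>\<^sup>+x. (if P x then 1 else 0) \<partial>Q 0) = (\<integral>\<^sup>+x. indicator {x\<in>space \<D>. P x} x \<partial>Q 0)"
      using zero_mem by (intro nn_integral_cong) (auto simp: indicator_def)
    then show ?thesis using zero_mem by (simp add: nn_integral_indicator)
  qed
  have "(\<integral>\<^sup>+z. G z \<partial>Q 0) = emeasure (Q 0) {x\<in>space \<D>. x d = 0}"
    unfolding G_def by (rule ind) measurable
  then have G0: "(\<integral>\<^sup>+z. G z \<partial>Q 0) = ennreal (p00 d)" by (simp add: p00_def emeasure_eq_measure)
  have "emeasure (Q 0) {x\<in>space \<D>. \<forall>k\<le>Suc n. x (real k * d) = 0} =
     (\<integral>\<^sup>+x. (if \<forall>k\<le>Suc n. x (real k * d) = 0 then 1 else 0) \<partial>Q 0)"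
    by (rule ind[symmetric]) measurable
  also have "\<dots> = (\<integral>\<^sup>+x. F x * G (path_shift (real n * d) x) \<partial>Q 0)"
    using d by (intro nn_integral_cong) (auto simp: F_def G_def path_shift_apply le_Suc_eq algebra_simps)
  also have "\<dots> = (\<integral>\<^sup>+x. F x * (\<integral>\<^sup>+z. G z \<partial>Q (x (real n * d))) \<partial>Q 0)"
    using d by (intro markov_simple zero_mem stop) auto
  also have "\<dots> = (\<integral>\<^sup>+x. F x * ennreal (p00 d) \<partial>Q 0)"
    by (intro nn_integral_cong) (auto simp: F_def G0)
  also have "\<dots> = (\<integral>\<^sup>+x. F x \<partial>Q 0) * ennreal (p00 d)"
    by (rule nn_integral_multc) (simp add: zero_mem)
  also have "(\<integral>\<^sup>+x. F x \<partial>Q 0) = ennreal (p00 d ^ n)"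
    unfolding F_def Suc[symmetric] by (rule ind) measurable
  finally show ?case by (simp add: ennreal_mult[symmetric] p00_def mult.commute)
qed

text \<open>Dyadic grids are nested, so the events of being in 0 at all grid points decrease.
  Right-continuity identifies their intersection, and the probabilities
  \<open>p00 (t / 2 ^ m) ^ 2 ^ m\<close> tend to \<open>exp (q00 * t)\<close> by the rate at
  0.\<close>

lemma emeasure_zero_on:
  assumes t: "0 \<le> t"
  shows "emeasure (Q 0) {x\<in>space \<D>. \<forall>r\<in>{0..t}. x r = 0} = ennreal (exp (q00 * t))"
proof (cases "t = 0")
  case True
  then show ?thesis using emeasure_zero_grid[of 0 0] by simp
next
  case False
  then have tp: "0 < t" using t by simp
  interpret prob_space "Q 0" using prob_Q zero_mem by blast
  define A where "A m = {x\<in>space \<D>. \<forall>k\<le>2^m. x (real k * (t / real (2^m))) = 0}" for m :: nat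
  have A: "range A \<subseteq> sets (Q 0)" unfolding A_def using zero_mem by auto
  have dec: "decseq A"
  proof (rule decseq_SucI, rule subsetI)
    fix m x assume x: "x \<in> A (Suc m)"
    have "x (real k * (t / real (2^m))) = 0" if "k \<le> 2^m" for k
    proof -
      have "2 * k \<le> 2 ^ Suc m" using that by simp
      then have "x (real (2 * k) * (t / real (2^Suc m))) = 0" using x unfolding A_def by blast
      then show ?thesis by simp
    qed
    then show "x \<in> A m" using x by (auto simp: A_def)
  qed
  have "(\<Inter>m. A m) = {x\<in>space \<D>. \<forall>r\<in>{0..t}. x r = 0}"
  proof (intro equalityI subsetI)
    fix x assume x: "x \<in> (\<Inter>m. A m)"
    then have xD: "x \<in> space \<D>" by (auto simp: A_def)
    have grid: "x (real k * (t / 2 ^ m)) = 0" if "k \<le> 2 ^ m" for k m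
      using x that unfolding A_def by force
    have "x r = 0" if r: "0 \<le> r" "r \<le> t" for r
    proof (cases "r = t")
      case True
      then show ?thesis using grid[of 1 0] by simp
    next
      case False
      obtain e where e: "e > 0" "\<And>q. r \<le> q \<Longrightarrow> q < r + e \<Longrightarrow> x q = x r"
        using cadlag_right_const[OF path_space_cadlag[OF xD] r(1)] by blast
      have rt: "r < t" using r False by simp
      obtain m k where "k \<le> 2 ^ m" "r \<le> real k * (t / 2 ^ m)" "real k * (t / 2 ^ m) < r + e"
        using exp_grid_dense[OF r(1) rt e(1)] by blast
      then show ?thesis using grid e(2) by metis
    qed
    then show "x \<in> {x\<in>space \<D>. \<forall>r\<in>{0..t}. x r = 0}" using xD by auto
  next
    fix x assume x: "x \<in> {x\<in>space \<D>. \<forall>r\<in>{0..t}. x r = 0}"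
    have "real k * (t / real (2^m)) \<in> {0..t}" if "k \<le> 2 ^ m" for k m
    proof -
      have "real k \<le> 2 ^ m" using that by (metis of_nat_le_iff of_nat_numeral of_nat_power)
      then show ?thesis using tp by (simp add: field_simps)
    qed
    then show "x \<in> (\<Inter>m. A m)" using x unfolding A_def by blast
  qed
  then have "(\<lambda>m. emeasure (Q 0) (A m)) \<longlonglongrightarrow> emeasure (Q 0) {x\<in>space \<D>. \<forall>r\<in>{0..t}. x r = 0}"
    using Lim_emeasure_decseq[OF A dec] by simp
  moreover have "emeasure (Q 0) (A m) = ennreal (p00 (t / real (2^m)) ^ (2^m))" for m
    unfolding A_def using t by (intro emeasure_zero_grid) simp
  moreover have "(\<lambda>m. ennreal (p00 (t / real (2^m)) ^ (2^m))) \<longlonglongrightarrow> ennreal (exp (q00 * t))"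
  proof (intro tendsto_ennrealI)
    have "p00 0 = 1"
      using emeasure_zero_grid[of 0 0] by (simp add: p00_def measure_def)
    then have "(\<lambda>n. p00 (t / real n) ^ n) \<longlonglongrightarrow> exp (q00 * t)"
      using Q_rate tp by (intro tendsto_power_exp_of_deriv) (simp_all add: p00_def[abs_def])
    moreover have "filterlim (\<lambda>m. 2 ^ m :: nat) sequentially sequentially"
      by (intro filterlim_subseq) (simp add: strict_mono_def)
    ultimately show "(\<lambda>m. p00 (t / real (2^m)) ^ (2^m)) \<longlonglongrightarrow> exp (q00 * t)"
      by (rule filterlim_compose[of "\<lambda>n. p00 (t / real n) ^ n" _ sequentially "\<lambda>m. 2^m"])
  qed
  ultimately show ?thesis using LIMSEQ_unique by simp
qed

lemma nn_integral_zero_on: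
  assumes t: "0 \<le> t"
  shows "(\<integral>\<^sup>+x. (if \<forall>r\<in>{0..t}. x r = 0 then c else 0) \<partial>Q 0) = c * ennreal (exp (q00 * t))"
proof -
  have "(\<integral>\<^sup>+x. (if \<forall>r\<in>{0..t}. x r = 0 then c else 0) \<partial>Q 0) =
     (\<integral>\<^sup>+x. c * indicator {x\<in>space \<D>. \<forall>r\<in>{0..t}. x r = 0} x \<partial>Q 0)"
    using zero_mem by (intro nn_integral_cong) (auto simp: indicator_def)
  also have "\<dots> = c * emeasure (Q 0) {x\<in>space \<D>. \<forall>r\<in>{0..t}. x r = 0}"
    using zero_mem by (intro nn_integral_cmult_indicator) simp
  finally show ?thesis by (simp add: emeasure_zero_on[OF t])
qed

lemma q00_nonpos: "q00 \<le> 0"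
proof -
  interpret prob_space "Q 0" using prob_Q zero_mem by blast
  have "ennreal (exp (q00 * 1)) \<le> 1" by (subst emeasure_zero_on[symmetric]) (auto simp: emeasure_le_1)
  then show ?thesis by simp
qed

lemma hat_at_zero_run:
  assumes "\<forall>r\<in>{0..v}. x r = 0" "0 \<le> v" "u + v < 1" 
  shows "path_alive u x v" "hat_at (0, u) v x = (0, u + v)"
proof -
  have a: "hat_X u x r = (0, u + r)" if "r \<in> {0..v}" for r
    using assms that by (intro prod_eqI) (auto simp: snd_hat_X)
  show "path_alive u x v"
    unfolding path_alive_def using a assms(3) by simp
  then show "hat_at (0, u) v x = (0, u + v)"
    using a[of v] assms(2) by (simp add: hat_at_def)
qed

text \<open>A start at age \<open>v\<close> is compared with a fresh start that happens to stay in 0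
  during \<open>[0, v]\<close>, an event of probability \<open>exp (q00 * v)\<close> after which the
  age is \<open>v\<close>. The error term of the second bound is the probability of leaving earlier.
  For small \<open>v\<close> the two bounds give continuity of survival in the age.\<close>

lemma surv_zero_bounds:
  assumes v: "0 \<le> v" "v < 1" and t: "0 \<le> t"
  shows "surv (0, v) t * ennreal (exp (q00 * v)) \<le> surv (0, 0) (v + t)"
    and "surv (0, 0) (v + t) \<le> surv (0, v) t * ennreal (exp (q00 * v)) + ennreal (1 - exp (q00 * v))"
proof -
  interpret prob_space "Q 0" using prob_Q zero_mem by blast
  define Z where "Z x \<longleftrightarrow> (\<forall>r\<in>{0..v}. x r = 0)" for x :: "real \<Rightarrow> nat"
  have [measurable]: "Measurable.pred \<D> Z" unfolding Z_def by measurable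
  have y: "(0, 0) \<in> hat_states S" by (simp add: hat_states_iff)
  have stop: "(if Z (path_stop v x) then 1 else 0) = (if Z x then 1 else 0 :: ennreal)" for x
    by (simp add: Z_def path_stop_def)
  have 1: "(\<integral>\<^sup>+x. (if Z x then 1 else 0) * alive_ind (0, 0) (v + t) x \<partial>Q 0) = surv (0, v) t * ennreal (exp (q00 * v))"
  proof -
    have "(\<integral>\<^sup>+x. (if Z x then 1 else 0) * alive_ind (0, 0) (v + t) x \<partial>Q 0) =
       (\<integral>\<^sup>+x. (if Z x then 1 else 0) * alive_ind (0, 0) v x * surv (hat_at (0, 0) v x) t \<partial>Q 0)"
      using surv_markov_weight[OF y v(1) t, of "\<lambda>x. if Z x then 1 else 0"] stop by simp
    also have "\<dots> = (\<integral>\<^sup>+x. (if Z x then surv (0, v) t else 0) \<partial>Q 0)"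
      using hat_at_zero_run[where u=0] v
      by (intro nn_integral_cong) (auto simp: Z_def alive_ind_def)
    finally show ?thesis unfolding Z_def by (simp add: nn_integral_zero_on[OF v(1)])
  qed
  show "surv (0, v) t * ennreal (exp (q00 * v)) \<le> surv (0, 0) (v + t)"
    unfolding 1[symmetric] surv_def[of "(0, 0)"] by (auto intro!: nn_integral_mono)
  have "surv (0, 0) (v + t) \<le> (\<integral>\<^sup>+x. (if Z x then 1 else 0) * alive_ind (0, 0) (v + t) x + (if Z x then 0 else 1) \<partial>Q 0)"
    unfolding surv_def[of "(0, 0)"] by (auto intro!: nn_integral_mono simp: alive_ind_def)
  also have "\<dots> = surv (0, v) t * ennreal (exp (q00 * v)) + (\<integral>\<^sup>+x. (if Z x then 0 else 1) \<partial>Q 0)"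
    unfolding 1[symmetric] by (rule nn_integral_add) (auto simp: zero_mem)
  also have "(\<integral>\<^sup>+x. (if Z x then 0 else 1) \<partial>Q 0) = emeasure (Q 0) (space (Q 0) - {x\<in>space \<D>. Z x})"
  proof -
    have "(\<integral>\<^sup>+x. (if Z x then 0 else 1) \<partial>Q 0) = (\<integral>\<^sup>+x. indicator (space (Q 0) - {x\<in>space \<D>. Z x}) x \<partial>Q 0)"
      using zero_mem by (intro nn_integral_cong) (auto simp: indicator_def)
    also have "\<dots> = emeasure (Q 0) (space (Q 0) - {x\<in>space \<D>. Z x})"
      using zero_mem by (intro nn_integral_indicator) simp
    finally show ?thesis .
  qed
  also have "emeasure (Q 0) (space (Q 0) - {x\<in>space \<D>. Z x}) = ennreal (1 - exp (q00 * v))"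
  proof -
    have s: "{x\<in>space \<D>. Z x} \<in> events" using zero_mem by simp
    have "emeasure (Q 0) {x\<in>space \<D>. Z x} = ennreal (exp (q00 * v))"
      unfolding Z_def by (rule emeasure_zero_on[OF v(1)])
    then have "prob {x\<in>space \<D>. Z x} = exp (q00 * v)" by (simp add: emeasure_eq_measure)
    then show ?thesis using prob_compl[OF s] by (simp add: emeasure_eq_measure)
  qed
  finally show "surv (0, 0) (v + t) \<le> surv (0, v) t * ennreal (exp (q00 * v)) + ennreal (1 - exp (q00 * v))" .
qed

end

section \<open>Decomposition of the survival probability at the first return\<close>

definition exit_ind :: "hat_state \<Rightarrow> (real \<Rightarrow> nat) \<Rightarrow> ennreal" where
  "exit_ind y x = (if exits (snd y) x then 1 else 0)"

lemma measurable_exit_ind [measurable]: "exit_ind y \<in> borel_measurable (path_space S)"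
  unfolding exit_ind_def by measurable

lemma returned_mono: "returned x s \<Longrightarrow> s \<le> t \<Longrightarrow> returned x t"
  unfolding returned_def by (meson order_trans)

lemma not_returned_0: "\<not> returned x 0"
  unfolding returned_def by (metis order_antisym order_trans neq0_conv)

lemma returned_stop: "t \<le> s \<Longrightarrow> returned (path_stop s x) t = returned x t"
  unfolding returned_def path_stop_def by (smt (verit) min_def)

context path_chain
begin

lemma origin_mem: "(0, 0) \<in> hat_states S"
  by (simp add: hat_states_iff)

lemma surv_real: "y \<in> hat_states S \<Longrightarrow> surv y t = ennreal (enn2real (surv y t))"
  using surv_le_1[of y t] by (metis ennreal_enn2real ennreal_one_less_top order_le_less_trans)

lemma measurable_surv_time [measurable]:
  assumes y: "y \<in> hat_states S"
  shows "surv y \<in> borel_measurable borel"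
proof -
  have "mono (\<lambda>t. - enn2real (surv y t))"
    using surv_antimono[of _ _ y] surv_le_1[OF y]
    by (intro monoI) (auto intro!: enn2real_mono order_le_less_trans[OF surv_le_1[OF y]])
  then have "(\<lambda>t. - enn2real (surv y t)) \<in> borel_measurable borel" by (rule borel_measurable_mono)
  then have "(\<lambda>t. ennreal (- (- enn2real (surv y t)))) \<in> borel_measurable borel" by measurable
  then show ?thesis using surv_real[OF y] by (simp cong: measurable_cong)
qed

lemma surv_zero_tendsto:
  assumes v: "v \<longlonglongrightarrow> 0" and v01: "eventually (\<lambda>n. 0 \<le> v n \<and> v n \<le> T) sequentially"
  shows "(\<lambda>n. surv (0, v n) (T - v n)) \<longlonglongrightarrow> surv (0, 0) T"
proof -
  define a where "a n = enn2real (surv (0, v n) (T - v n))" for n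
  define b where "b = enn2real (surv (0, 0) T)"
  have vl: "eventually (\<lambda>n. v n < 1) sequentially" using v by (rule order_tendstoD) simp
  have "(\<lambda>n. a n - b) \<longlonglongrightarrow> 0"
  proof (rule Lim_null_comparison)
    show "(\<lambda>n. 1 - exp (q00 * v n)) \<longlonglongrightarrow> 0"
      using v by (auto intro!: tendsto_eq_intros)
    show "eventually (\<lambda>n. norm (a n - b) \<le> 1 - exp (q00 * v n)) sequentially"
      using vl v01
    proof eventually_elim
      case (elim n)
      let ?e = "exp (q00 * v n)"
      have m: "(0, v n) \<in> hat_states S" using elim by (simp add: hat_states_iff)
      have e1: "?e \<le> 1" using q00_nonpos elim by (simp add: mult_nonpos_nonneg)
      have a01: "0 \<le> a n" "a n \<le> 1"
        using surv_le_1[OF m, of "T - v n"] by (auto simp: a_def intro!: enn2real_leI)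
      have ra: "surv (0, v n) (T - v n) = ennreal (a n)" unfolding a_def by (rule surv_real[OF m])
      have rb: "surv (0, 0) T = ennreal b" unfolding b_def by (rule surv_real[OF origin_mem])
      have b0: "0 \<le> b" by (simp add: b_def)
      have sum: "v n + (T - v n) = T" by simp
      have T: "0 \<le> v n" "v n < 1" "0 \<le> T - v n" using elim by auto
      have "ennreal (a n * ?e) \<le> ennreal b"
        using surv_zero_bounds(1)[OF T] a01 unfolding sum ra rb by (simp add: ennreal_mult)
      then have 1: "a n * ?e \<le> b" using b0 by simp
      have "ennreal b \<le> ennreal (a n * ?e + (1 - ?e))"
        using surv_zero_bounds(2)[OF T] a01 e1 unfolding sum ra rb
        by (simp add: ennreal_mult ennreal_plus)
      then have 2: "b \<le> a n * ?e + (1 - ?e)" using a01 e1 by (subst (asm) ennreal_le_iff) auto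
      \<comment> \<open>The lower and the upper bound on \<open>b\<close> differ from
        \<open>a n\<close> by \<open>a n * (1 - ?e)\<close> and \<open>(1 - a n) * (1 - ?e)\<close>,
        each of which is at most \<open>1 - ?e\<close>.\<close>
      have "0 \<le> (1 - a n) * (1 - ?e)" "0 \<le> a n * (1 - ?e)" using a01 e1 by auto
      then show ?case using 1 2 a01 by (simp add: abs_le_iff algebra_simps)
    qed
  qed
  then have "a \<longlonglongrightarrow> b" by (rule LIM_zero_cancel)
  then have "(\<lambda>n. ennreal (a n)) \<longlonglongrightarrow> ennreal b" by (rule tendsto_ennrealI)
  moreover have "eventually (\<lambda>n. ennreal (a n) = surv (0, v n) (T - v n)) sequentially"
    using vl v01
  proof eventually_elim
    case (elim n)
    then show ?case unfolding a_def by (intro surv_real[symmetric]) (simp add: hat_states_iff)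
  qed
  ultimately show ?thesis
    unfolding b_def surv_real[OF origin_mem, symmetric] by (rule Lim_transform_eventually)
qed

definition cycle :: "(real \<Rightarrow> nat) \<Rightarrow> real" where
  "cycle x = real_of_ereal (cycle_time x)"

lemma measurable_cycle [measurable]: "cycle \<in> borel_measurable \<D>"
  unfolding cycle_def by measurable

lemma cycleE:
  assumes "x \<in> space \<D>" "returned x t"
  shows "cycle_time x = ereal (cycle x)" "cycle x \<le> t" "0 < cycle x"
    "\<And>r. returned x r \<longleftrightarrow> cycle x \<le> r"
proof -
  have x: "cadlag_on {0..} x" using assms(1) by (rule path_space_cadlag)
  have "cycle_time x \<le> ereal t" using assms(2) cycle_time_le_iff[OF x] by simp
  then have "cycle_time x \<noteq> \<infinity>" by auto
  then obtain c where c: "cycle_time x = ereal c" using cycle_timeE[OF x] by metis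
  then show e: "cycle_time x = ereal (cycle x)" by (simp add: cycle_def)
  show "returned x r \<longleftrightarrow> cycle x \<le> r" for r using cycle_time_le_iff[OF x, of r] e by simp
  then show "cycle x \<le> t" using assms(2) by simp
  show "0 < cycle x" using hat_X_at_cycle(1)[OF x e] .
qed

text \<open>The strong Markov property at the first return, derived from the simple one. The return
  time is replaced by the next point of a grid of mesh \<open>t / (n + 1)\<close>. For a fine grid
  an alive path is there in a state \<open>(0, v)\<close> with \<open>v\<close> at most the mesh,
  and \<open>surv_zero_tendsto\<close> removes \<open>v\<close> in the limit.\<close>

lemma surv_returned:
  assumes y: "y \<in> hat_states S" and t: "0 < t"
  shows "(\<integral>\<^sup>+x. (if returned x t then alive_ind y t x else 0) \<partial>Q (fst y)) =
    (\<integral>\<^sup>+x. (if returned x t then exit_ind y x * surv (0, 0) (t - cycle x) else 0) \<partial>Q (fst y))"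
proof -
  have i: "fst y \<in> S" using y by (rule hat_fst_mem)
  have u: "0 \<le> snd y" "snd y < 1" using hat_states_snd[OF y] by auto
  define s where "s n k = real k * (t / real (Suc n))" for n k
  \<comment> \<open>The condition selects the grid cell that contains the first return. Survival up
    to \<open>t\<close> is split at the right end of this cell.\<close>
  define g where "g n x = (\<Sum>k=1..Suc n. if returned x (s n k) \<and> \<not> returned x (s n (k - 1))
      then alive_ind y (s n k) x * surv (hat_at y (s n k) x) (t - s n k) else 0)" for n x
  have s_nn: "0 \<le> s n k" for n k using t by (simp add: s_def)
  have s_le: "s n k \<le> t" if "k \<le> Suc n" for n k
  proof -
    have "s n k \<le> real (Suc n) * (t / real (Suc n))"
      unfolding s_def using that t by (intro mult_right_mono) auto
    then show ?thesis by simp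
  qed
  have s_mono: "s n k \<le> s n l" if "k \<le> l" for n k l
    unfolding s_def using that t by (intro mult_right_mono) auto
  have s_last: "s n (Suc n) = t" for n by (simp add: s_def)
  have R0: "\<not> returned x (s n 0)" for n x by (simp add: s_def not_returned_0)
  have Rm: "mono (\<lambda>k. returned x (s n k))" for n x
    by (intro monoI) (auto intro: returned_mono s_mono)
  have fi: "(\<Sum>k=1..Suc n. if returned x (s n k) \<and> \<not> returned x (s n (k - 1)) then a k else 0) =
      (if returned x t then a (LEAST k. returned x (s n k)) else 0)" for n x and a :: "nat \<Rightarrow> ennreal"
    using sum_first_index[of "\<lambda>k. returned x (s n k)" a "Suc n", OF R0 Rm] unfolding s_last .
  note [measurable] = measurable_hat_at'[OF y]
  have meas_g [measurable]: "g n \<in> borel_measurable \<D>" for n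
  proof -
    have [measurable]: "(\<lambda>x. surv (hat_at y (s n k) x) (t - s n k)) \<in> borel_measurable \<D>" for k
      by (rule measurable_compose[OF measurable_hat_at'[OF y s_nn] measurable_surv])
    show ?thesis unfolding g_def by measurable
  qed
  have int_g: "(\<integral>\<^sup>+x. g n x \<partial>Q (fst y)) = (\<integral>\<^sup>+x. (if returned x t then alive_ind y t x else 0) \<partial>Q (fst y))" for n
  proof -
    have [measurable]: "(\<lambda>x. surv (hat_at y (s n k) x) (t - s n k)) \<in> borel_measurable \<D>" for k
      by (rule measurable_compose[OF measurable_hat_at'[OF y s_nn] measurable_surv])
    have "(\<integral>\<^sup>+x. g n x \<partial>Q (fst y)) = (\<Sum>k=1..Suc n. \<integral>\<^sup>+x. (if returned x (s n k) \<and> \<not> returned x (s n (k - 1))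
      then alive_ind y (s n k) x * surv (hat_at y (s n k) x) (t - s n k) else 0) \<partial>Q (fst y))"
      unfolding g_def using i by (intro nn_integral_sum) simp
    also have "\<dots> = (\<Sum>k=1..Suc n. \<integral>\<^sup>+x. (if returned x (s n k) \<and> \<not> returned x (s n (k - 1))
      then alive_ind y t x else 0) \<partial>Q (fst y))"
    proof (rule sum.cong[OF refl])
      fix k assume k: "k \<in> {1..Suc n}"
      let ?F = "\<lambda>x. if returned x (s n k) \<and> \<not> returned x (s n (k - 1)) then 1 else 0 :: ennreal"
      have stp: "?F (path_stop (s n k) x) = ?F x" for x
        using s_mono[of "k - 1" k n] by (simp add: returned_stop)
      have Fm: "?F \<in> borel_measurable \<D>" by measurable
      have tt: "0 \<le> t - s n k" using s_le[of k n] k by simp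
      from surv_markov_weight[where F="?F" and s="s n k" and t="t - s n k", OF y s_nn tt Fm stp]
      have "(\<integral>\<^sup>+x. ?F x * alive_ind y t x \<partial>Q (fst y)) =
        (\<integral>\<^sup>+x. ?F x * alive_ind y (s n k) x * surv (hat_at y (s n k) x) (t - s n k) \<partial>Q (fst y))"
        by simp
      then show "(\<integral>\<^sup>+x. (if returned x (s n k) \<and> \<not> returned x (s n (k - 1))
          then alive_ind y (s n k) x * surv (hat_at y (s n k) x) (t - s n k) else 0) \<partial>Q (fst y)) =
        (\<integral>\<^sup>+x. (if returned x (s n k) \<and> \<not> returned x (s n (k - 1)) then alive_ind y t x else 0) \<partial>Q (fst y))"
        by (simp add: if_distrib[of "\<lambda>z. z * _"] mult.assoc cong: if_cong)
    qed
    also have "\<dots> = (\<integral>\<^sup>+x. (\<Sum>k=1..Suc n. if returned x (s n k) \<and> \<not> returned x (s n (k - 1))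
      then alive_ind y t x else 0) \<partial>Q (fst y))"
      using i by (intro nn_integral_sum[symmetric]) simp
    also have "\<dots> = (\<integral>\<^sup>+x. (if returned x t then alive_ind y t x else 0) \<partial>Q (fst y))"
      by (simp only: fi)
    finally show ?thesis .
  qed
  have lim: "(\<lambda>n. g n x) \<longlonglongrightarrow> (if returned x t then exit_ind y x * surv (0, 0) (t - cycle x) else 0)"
    if x: "x \<in> space \<D>" for x
  proof (cases "returned x t")
    case False
    then have "g n x = 0" for n
      unfolding g_def fi by simp
    then show ?thesis using False by simp
  next
    case True
    note xc = path_space_cadlag[OF x] and c = cycleE[OF x True]
    define k where "k n = (LEAST k. returned x (s n k))" for n
    define \<sigma> where "\<sigma> n = s n (k n)" for n
    have Rl: "returned x (s n (Suc n))" for n using True by (simp add: s_last)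
    have gn: "g n x = alive_ind y (\<sigma> n) x * surv (hat_at y (\<sigma> n) x) (t - \<sigma> n)" for n
      unfolding g_def fi using True by (simp add: \<sigma>_def k_def)
    have kn: "returned x (\<sigma> n)" for n unfolding \<sigma>_def k_def by (rule LeastI[of "\<lambda>k. returned x (s n k)", OF Rl])
    have c1: "cycle x \<le> \<sigma> n" for n using kn[of n] c(4)[of "\<sigma> n"] by blast
    have kle: "k n \<le> Suc n" for n unfolding k_def by (rule Least_le[of "\<lambda>k. returned x (s n k)", OF Rl])
    then have st: "\<sigma> n \<le> t" for n unfolding \<sigma>_def by (rule s_le)
    have k0: "k n \<noteq> 0" for n using kn[of n] R0 unfolding \<sigma>_def by metis
    have c2: "\<sigma> n \<le> cycle x + t / real (Suc n)" for n
    proof -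
      have "\<not> returned x (s n (k n - 1))"
        using k0[of n] unfolding k_def by (intro not_less_Least) auto
      then have "s n (k n - 1) < cycle x" using c(4) by simp
      moreover have "s n (k n) = s n (k n - 1) + t / real (Suc n)"
        using k0[of n] by (cases "k n") (auto simp: s_def algebra_simps add_divide_distrib)
      ultimately show ?thesis unfolding \<sigma>_def by simp
    qed
    have slim: "(\<lambda>n. \<sigma> n - cycle x) \<longlonglongrightarrow> 0"
    proof (rule tendsto_sandwich[of "\<lambda>_. 0" _ _ "\<lambda>n. t / real (Suc n)"])
      show "(\<lambda>n. t / real (Suc n)) \<longlonglongrightarrow> 0" by real_asymp
    qed (use c1 c2 in \<open>auto simp: algebra_simps\<close>)
    obtain e where e: "e > 0" "\<And>r. cycle x \<le> r \<Longrightarrow> r < cycle x + e \<Longrightarrow> x r = x (cycle x)"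
      using cadlag_right_const[OF xc, of "cycle x"] c(3) by (metis less_imp_le)
    have at_c: "hat_X (snd y) x (cycle x) = (0, 0)" "path_alive (snd y) x (cycle x) \<longleftrightarrow> exits (snd y) x"
      using hat_X_at_cycle[OF xc c(1)] u by auto
    have xz: "x (cycle x) = 0" using arg_cong[OF at_c(1), of fst] by simp
    have "eventually (\<lambda>n. \<sigma> n - cycle x < min e 1) sequentially"
      using slim by (rule order_tendstoD) (use e in auto)
    then have ev: "eventually (\<lambda>n. exit_ind y x * surv (0, \<sigma> n - cycle x) (t - cycle x - (\<sigma> n - cycle x)) = g n x) sequentially"
    proof eventually_elim
      case (elim n)
      let ?v = "\<sigma> n - cycle x"
      \<comment> \<open>For large \<open>n\<close> the path has not left 0 again between the return
        and the next grid point, so the age there is \<open>?v\<close> and no killing has occurred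
        in between.\<close>
      have zr: "\<forall>r\<in>{0..?v}. path_shift (cycle x) x r = 0"
      proof
        fix r assume "r \<in> {0..?v}"
        then show "path_shift (cycle x) x r = 0"
          using e(2)[of "cycle x + r"] xz elim by (simp add: path_shift_apply)
      qed
      have v: "0 \<le> ?v" "0 + ?v < 1" using c1[of n] elim by auto
      have fl: "cycle x + ?v = \<sigma> n" by simp
      note zrun = hat_at_zero_run[OF zr v]
      have al: "path_alive (snd y) x (\<sigma> n) \<longleftrightarrow> exits (snd y) x"
        using path_alive_flow[of "cycle x" ?v "snd y" x] c(3) v(1) zrun(1) at_c unfolding fl by simp
      have "hat_at y (\<sigma> n) x = (0, ?v)" if "exits (snd y) x"
      proof -
        have "hat_X 0 (path_shift (cycle x) x) ?v = (0, ?v)"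
          using zrun by (simp add: hat_at_def)
        then show ?thesis
          using that al hat_X_flow[of "cycle x" ?v "snd y" x] c(3) v(1) at_c unfolding fl
          by (simp add: hat_at_def)
      qed
      then show ?case unfolding gn exit_ind_def alive_ind_def using al by simp
    qed
    have "(\<lambda>n. surv (0, \<sigma> n - cycle x) (t - cycle x - (\<sigma> n - cycle x))) \<longlonglongrightarrow> surv (0, 0) (t - cycle x)"
      by (rule surv_zero_tendsto[OF slim]) (use c1 st in auto)
    then have "(\<lambda>n. exit_ind y x * surv (0, \<sigma> n - cycle x) (t - cycle x - (\<sigma> n - cycle x))) \<longlonglongrightarrow>
        exit_ind y x * surv (0, 0) (t - cycle x)"
      by (cases "exits (snd y) x") (auto simp: exit_ind_def)
    then have "(\<lambda>n. g n x) \<longlonglongrightarrow> exit_ind y x * surv (0, 0) (t - cycle x)"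
      using ev by (rule Lim_transform_eventually)
    then show ?thesis using True by simp
  qed
  have g_le: "g n x \<le> 1" if x: "x \<in> space \<D>" for n x
  proof -
    have "alive_ind y (s n k) x * surv (hat_at y (s n k) x) (t - s n k) \<le> 1 * 1" for k
      using x y path_space_mem[OF x] s_nn
      by (intro mult_mono alive_ind_le_1 surv_le_1 hat_at_in_hat_states) auto
    then show ?thesis
      unfolding g_def fi by simp
  qed
  have [measurable]: "surv (0, 0) \<in> borel_measurable borel" by (rule measurable_surv_time[OF origin_mem])
  have lm: "(\<lambda>n. \<integral>\<^sup>+x. g n x \<partial>Q (fst y)) \<longlonglongrightarrow>
     (\<integral>\<^sup>+x. (if returned x t then exit_ind y x * surv (0, 0) (t - cycle x) else 0) \<partial>Q (fst y))"
  proof (rule nn_integral_dominated_convergence[where w="\<lambda>_. 1"])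
    show "(\<integral>\<^sup>+x. 1 \<partial>Q (fst y)) < \<infinity>" using Q_one[OF i, of 1] by (simp del: nn_integral_const)
    show "AE x in Q (fst y). (\<lambda>n. g n x) \<longlonglongrightarrow>
        (if returned x t then exit_ind y x * surv (0, 0) (t - cycle x) else 0)"
      by (intro AE_I2 lim) (simp add: i)
    show "AE x in Q (fst y). g n x \<le> 1" for n
      by (intro AE_I2 g_le) (simp add: i)
    show "g n \<in> borel_measurable (Q (fst y))" for n
      unfolding measurable_Q_iff[OF i] by (rule meas_g)
    have "(\<lambda>x. if returned x t then exit_ind y x * surv (0, 0) (t - cycle x) else 0) \<in> borel_measurable \<D>"
      by measurable
    then show "(\<lambda>x. if returned x t then exit_ind y x * surv (0, 0) (t - cycle x) else 0) \<in> borel_measurable (Q (fst y))"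
      unfolding measurable_Q_iff[OF i] .
  qed simp
  show ?thesis using LIMSEQ_unique[OF tendsto_const lm[unfolded int_g]] .
qed

lemma surv_renewal:
  assumes y: "y \<in> hat_states S" and t: "0 \<le> t"
  shows "surv y t = (\<integral>\<^sup>+x. (if returned x t then 0 else alive_ind y t x) \<partial>Q (fst y)) +
    (\<integral>\<^sup>+x. (if returned x t then exit_ind y x * surv (0, 0) (t - cycle x) else 0) \<partial>Q (fst y))"
proof (cases "t = 0")
  case True
  then show ?thesis by (simp add: not_returned_0 surv_def)
next
  case False
  have i: "fst y \<in> S" using y by (rule hat_fst_mem)
  have "surv y t = (\<integral>\<^sup>+x. (if returned x t then 0 else alive_ind y t x) + (if returned x t then alive_ind y t x else 0) \<partial>Q (fst y))"
    unfolding surv_def by (intro nn_integral_cong) auto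
  also have "\<dots> = (\<integral>\<^sup>+x. (if returned x t then 0 else alive_ind y t x) \<partial>Q (fst y)) +
     (\<integral>\<^sup>+x. (if returned x t then alive_ind y t x else 0) \<partial>Q (fst y))"
    using i by (intro nn_integral_add) auto
  finally show ?thesis using surv_returned[OF y] t False by simp
qed

end

section \<open>A renewal theorem\<close>

text \<open>The suprema over \<open>[n, \<infinity>)\<close> decrease to the upper limit
  \<open>M\<close>; for each \<open>n\<close> a point of \<open>[n, \<infinity>)\<close> is chosen
  whose value is within \<open>1 / (n + 1)\<close> of the supremum.\<close>

lemma limsup_sequence:
  fixes Y :: "real \<Rightarrow> real"
  assumes "\<And>t. \<bar>Y t\<bar> \<le> B"
  obtains M t where "filterlim t at_top sequentially" "(\<lambda>n. Y (t n)) \<longlonglongrightarrow> M"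
    "\<And>e. e > 0 \<Longrightarrow> eventually (\<lambda>t. Y t \<le> M + e) at_top"
proof -
  define s where "s n = Sup (Y ` {real n..})" for n :: nat
  have bdd: "bdd_above (Y ` {real n..})" for n
    using assms by (intro bdd_aboveI[of _ B]) (auto simp: abs_le_iff)
  have up: "Y t \<le> s n" if "real n \<le> t" for t n
    unfolding s_def using that by (intro cSUP_upper bdd) auto
  have dec: "decseq s"
    unfolding s_def by (intro antimonoI cSUP_subset_mono bdd) auto
  have low: "- B \<le> s n" for n
    using up[of n "real n"] assms[of "real n"] by (auto simp: abs_le_iff)
  obtain M where M: "s \<longlonglongrightarrow> M" "\<And>n. M \<le> s n"
    using decseq_convergent[OF dec, of "- B"] low by blast
  have "\<exists>t\<ge>real n. s n - 1 / real (Suc n) < Y t" for n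
  proof -
    have lt: "s n - 1 / real (Suc n) < Sup (Y ` {real n..})" by (simp add: s_def)
    have "Y ` {real n..} \<noteq> {}" by auto
    then obtain y where "y \<in> Y ` {real n..}" "s n - 1 / real (Suc n) < y"
      by (rule less_cSupE[OF lt])
    then show ?thesis by auto
  qed
  then obtain t where t: "\<And>n. real n \<le> t n" "\<And>n. s n - 1 / real (Suc n) < Y (t n)" by metis
  show thesis
  proof (rule that[of t M])
    show "filterlim t at_top sequentially"
      by (rule filterlim_at_top_mono[OF filterlim_real_sequentially]) (simp add: t)
    show "(\<lambda>n. Y (t n)) \<longlonglongrightarrow> M"
    proof (rule tendsto_sandwich[OF _ _ _ M(1)])
      have "(\<lambda>n. s n - 1 / real (Suc n)) \<longlonglongrightarrow> M - 0"
        by (intro tendsto_diff M(1)) real_asymp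
      then show "(\<lambda>n. s n - 1 / real (Suc n)) \<longlonglongrightarrow> M" by simp
      show "\<forall>\<^sub>F n in sequentially. s n - 1 / real (Suc n) \<le> Y (t n)"
        by (intro always_eventually allI less_imp_le t)
      show "\<forall>\<^sub>F n in sequentially. Y (t n) \<le> s n"
        by (intro always_eventually allI up t)
    qed
    fix e :: real assume "e > 0"
    then have "eventually (\<lambda>n. s n < M + e) sequentially"
      using M(1) by (intro order_tendstoD) auto
    then obtain n where n: "s n < M + e" by (auto simp: eventually_sequentially)
    show "eventually (\<lambda>t. Y t \<le> M + e) at_top"
      using eventually_ge_at_top[of "real n"] by eventually_elim (use up n in force)
  qed
qed

locale renewal_law = prob_space \<nu> for \<nu> :: "real measure" +
  assumes sets_nu [measurable_cong, simp]: "sets \<nu> = sets borel"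
    and pos: "AE r in \<nu>. 0 < r"
    and mean: "integrable \<nu> (\<lambda>r. r)"
begin

definition tail :: "real \<Rightarrow> real" where "tail a = prob {a<..}"

lemma space_nu [simp]: "space \<nu> = UNIV"
  using sets_eq_imp_space_eq[OF sets_nu] by simp

lemma tail_antimono: "a \<le> b \<Longrightarrow> tail b \<le> tail a"
  unfolding tail_def by (intro finite_measure_mono) auto

lemma tail_nn: "0 \<le> tail a" by (simp add: tail_def)

lemma tail_meas [measurable]: "tail \<in> borel_measurable borel"
proof -
  have "(\<lambda>a. - tail a) \<in> borel_measurable borel"
    by (rule borel_measurable_mono) (auto intro!: monoI tail_antimono)
  then have "(\<lambda>a. - (- tail a)) \<in> borel_measurable borel" by measurable
  then show ?thesis by simp
qed

lemma sigma_finite_nu: "sigma_finite_measure \<nu>" ..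

text \<open>The mean is the area below the tail, by Fubini's theorem and positivity.\<close>

lemma tail_integral: "(\<integral>\<^sup>+r\<in>{0..}. ennreal (tail r) \<partial>lborel) = ennreal (expectation (\<lambda>r. r))"
proof -
  interpret pair_sigma_finite lborel \<nu> by (intro pair_sigma_finite.intro sigma_finite_nu lborel.sigma_finite_measure_axioms)
  have "(\<integral>\<^sup>+r\<in>{0..}. ennreal (tail r) \<partial>lborel) = (\<integral>\<^sup>+r. \<integral>\<^sup>+x. indicator {0..} r * indicator {r<..} x \<partial>\<nu> \<partial>lborel)"
    by (intro nn_integral_cong) (simp add: nn_integral_cmult emeasure_eq_measure tail_def mult.commute)
  also have "\<dots> = (\<integral>\<^sup>+r. \<integral>\<^sup>+x. indicator {0..} r * (if r < x then 1 else 0) \<partial>\<nu> \<partial>lborel)"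
    by (intro nn_integral_cong) (auto simp: indicator_def)
  also have "\<dots> = (\<integral>\<^sup>+x. \<integral>\<^sup>+r. indicator {0..} r * (if r < x then 1 else 0) \<partial>lborel \<partial>\<nu>)"
    by (rule Fubini'[symmetric]) measurable
  also have "\<dots> = (\<integral>\<^sup>+x. ennreal x \<partial>\<nu>)"
  proof (rule nn_integral_cong)
    fix x :: real
    have "(\<integral>\<^sup>+r. indicator {0..} r * (if r < x then 1 else 0) \<partial>lborel) = (\<integral>\<^sup>+r. indicator {0..<x} r \<partial>lborel)"
      by (intro nn_integral_cong) (auto simp: indicator_def)
    also have "\<dots> = ennreal x" by (cases "0 \<le> x") (auto simp: ennreal_neg)
    finally show "(\<integral>\<^sup>+r. indicator {0..} r * (if r < x then 1 else 0) \<partial>lborel) = ennreal x" .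
  qed
  also have "\<dots> = ennreal (expectation (\<lambda>r. r))"
    by (rule nn_integral_eq_integral[OF mean]) (use pos in eventually_elim, simp)
  finally show ?thesis .
qed

lemma mean_pos: "0 < expectation (\<lambda>r. r)"
proof -
  have nn: "AE r in \<nu>. 0 \<le> r" using pos by eventually_elim simp
  have "0 \<le> expectation (\<lambda>r. r)" by (rule integral_nonneg_AE[OF nn])
  moreover have "expectation (\<lambda>r. r) \<noteq> 0"
  proof
    assume "expectation (\<lambda>r. r) = 0"
    then have "AE r in \<nu>. r = 0"
      using integral_nonneg_eq_0_iff_AE[OF mean nn] by simp
    then have "AE r in \<nu>. False" using pos by eventually_elim simp
    then show False by simp
  qed
  ultimately show ?thesis by simp
qed

text \<open>A tail that vanished at all positive points would have integral 0, although this
  integral is the positive mean.\<close>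

lemma tail_pos: obtains e where "0 < e" "0 < tail e"
proof (rule ccontr)
  assume n: "\<not> thesis"
  then have "tail e = 0" if "0 < e" for e using that tail_nn[of e] \<open>\<And>e. \<lbrakk>0 < e; 0 < tail e\<rbrakk> \<Longrightarrow> thesis\<close> by force
  then have "(\<integral>\<^sup>+r\<in>{0..}. ennreal (tail r) \<partial>lborel) = (\<integral>\<^sup>+r. 0 \<partial>(lborel :: real measure))"
    by (intro nn_integral_cong_AE, use AE_lborel_singleton[of 0] in eventually_elim)
       (auto simp: indicator_def)
  then show False using tail_integral mean_pos by simp
qed

end

text \<open>\<open>quasi\<close> says that \<open>exp (- \<phi> t) Z t\<close> decreases, a
  one-sided regularity in place of continuity. \<open>supp\<close> puts the interval
  \<open>(c, c + d)\<close> into the support of \<open>\<nu>\<close>, which excludes lattice laws.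
  As \<open>Z\<close> vanishes at negative times, the integral in \<open>eq\<close> effectively runs
  over \<open>r \<le> t\<close>.\<close>

locale renewal = renewal_law \<nu> for \<nu> :: "real measure" +
  fixes Z z :: "real \<Rightarrow> real" and \<phi> c d J :: real
  assumes phi: "0 \<le> \<phi>" and cd: "0 < c" "0 < d"
    and Z_meas [measurable]: "Z \<in> borel_measurable borel" and z_meas [measurable]: "z \<in> borel_measurable borel"
    and Z_nn: "\<And>t. 0 \<le> Z t" and Z_neg: "\<And>t. t < 0 \<Longrightarrow> Z t = 0" and z_nn: "\<And>t. 0 \<le> z t"
    and quasi: "\<And>t s. 0 \<le> t \<Longrightarrow> 0 \<le> s \<Longrightarrow> Z (t + s) \<le> exp (\<phi> * s) * Z t"
    and eq: "\<And>t. 0 \<le> t \<Longrightarrow> ennreal (Z t) = ennreal (z t) + (\<integral>\<^sup>+r. ennreal (Z (t - r)) \<partial>\<nu>)"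
    and z_lim: "(z \<longlongrightarrow> 0) at_top"
    and z_int: "(\<integral>\<^sup>+t\<in>{0..}. ennreal (z t) \<partial>lborel) = ennreal J" and J: "0 \<le> J"
    and supp: "\<And>r e. c < r \<Longrightarrow> r < c + d \<Longrightarrow> 0 < e \<Longrightarrow> 0 < prob {r - e<..<r + e}"
begin

lemma Z_local: "s \<le> t \<Longrightarrow> 0 \<le> t \<Longrightarrow> Z s \<le> exp (\<phi> * t) * Z 0"
proof (cases "0 \<le> s")
  case True
  assume "s \<le> t"
  have "Z s \<le> exp (\<phi> * s) * Z 0" using quasi[of 0 s] True by simp
  also have "\<dots> \<le> exp (\<phi> * t) * Z 0" using \<open>s \<le> t\<close> phi by (intro mult_right_mono Z_nn) (simp add: mult_left_mono)
  finally show ?thesis .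
qed (simp add: Z_neg Z_nn)

text \<open>The renewal equation is integrated over \<open>[0, t]\<close>. After an exchange of
  integrals the convolution term becomes the integral of \<open>Z s * prob {..t - s}\<close>, and
  removing it from both sides leaves the tails. The identity serves to bound \<open>Z\<close> and to
  determine its limit.\<close>

lemma renewal_identity:
  assumes t: "0 \<le> t"
  shows "(\<integral>\<^sup>+r\<in>{0..}. ennreal (Z (t - r) * tail r) \<partial>lborel) = (\<integral>\<^sup>+s\<in>{0..t}. ennreal (z s) \<partial>lborel)"
proof -
  interpret pair_sigma_finite lborel \<nu> by (intro pair_sigma_finite.intro sigma_finite_nu lborel.sigma_finite_measure_axioms)
  define I where "I = (\<integral>\<^sup>+s\<in>{0..t}. ennreal (Z s * prob {..t - s}) \<partial>lborel)"
  have [measurable]: "(\<lambda>s. prob {..t - s}) \<in> borel_measurable borel"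
  proof -
    have "mono (\<lambda>a. prob {..a})" by (intro monoI finite_measure_mono) auto
    then have [measurable]: "(\<lambda>a. prob {..a}) \<in> borel_measurable borel" by (rule borel_measurable_mono)
    show ?thesis by measurable
  qed
  have "(\<integral>\<^sup>+s\<in>{0..t}. ennreal (Z s) \<partial>lborel) =
     (\<integral>\<^sup>+s. ennreal (z s) * indicator {0..t} s + (\<integral>\<^sup>+r. ennreal (Z (s - r)) * indicator {0..t} s \<partial>\<nu>) \<partial>lborel)"
    by (intro nn_integral_cong) (auto simp: eq indicator_def)
  also have "\<dots> = (\<integral>\<^sup>+s\<in>{0..t}. ennreal (z s) \<partial>lborel) + (\<integral>\<^sup>+s. \<integral>\<^sup>+r. ennreal (Z (s - r)) * indicator {0..t} s \<partial>\<nu> \<partial>lborel)"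
    by (rule nn_integral_add) measurable
  also have "(\<integral>\<^sup>+s. \<integral>\<^sup>+r. ennreal (Z (s - r)) * indicator {0..t} s \<partial>\<nu> \<partial>lborel) =
      (\<integral>\<^sup>+r. \<integral>\<^sup>+s. ennreal (Z (s - r)) * indicator {0..t} s \<partial>lborel \<partial>\<nu>)"
    by (rule Fubini'[symmetric]) measurable
  also have "\<dots> = (\<integral>\<^sup>+r. \<integral>\<^sup>+s. ennreal (Z s) * indicator {0..t} (s + r) \<partial>lborel \<partial>\<nu>)"
  proof (rule nn_integral_cong)
    fix r
    have "(\<integral>\<^sup>+s. ennreal (Z (s - r)) * indicator {0..t} s \<partial>lborel) =
       (\<integral>\<^sup>+s. ennreal (Z (r + 1 * s - r)) * indicator {0..t} (r + 1 * s) \<partial>lborel)"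
      by (subst nn_integral_real_affine[where c=1 and t=r]) auto
    then show "(\<integral>\<^sup>+s. ennreal (Z (s - r)) * indicator {0..t} s \<partial>lborel) =
       (\<integral>\<^sup>+s. ennreal (Z s) * indicator {0..t} (s + r) \<partial>lborel)" by (simp add: add.commute)
  qed
  also have "\<dots> = (\<integral>\<^sup>+s. \<integral>\<^sup>+r. ennreal (Z s) * indicator {0..t} (s + r) \<partial>\<nu> \<partial>lborel)"
    by (rule Fubini') measurable
  also have "\<dots> = I"
    unfolding I_def
  proof (rule nn_integral_cong)
    fix s
    show "(\<integral>\<^sup>+r. ennreal (Z s) * indicator {0..t} (s + r) \<partial>\<nu>) = ennreal (Z s * prob {..t - s}) * indicator {0..t} s"
    proof (cases "0 \<le> s")
      case True
      have "(\<integral>\<^sup>+r. ennreal (Z s) * indicator {0..t} (s + r) \<partial>\<nu>) = (\<integral>\<^sup>+r. ennreal (Z s) * indicator {..t - s} r * indicator {0..t} s \<partial>\<nu>)"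
        by (rule nn_integral_cong_AE, use pos in eventually_elim) (use True in \<open>auto simp: indicator_def\<close>)
      also have "\<dots> = ennreal (Z s) * emeasure \<nu> {..t - s} * indicator {0..t} s"
        by (subst nn_integral_multc) (auto simp: nn_integral_cmult_indicator)
      finally show ?thesis by (simp add: emeasure_eq_measure ennreal_mult Z_nn)
    qed (simp add: Z_neg)
  qed
  finally have 1: "(\<integral>\<^sup>+s\<in>{0..t}. ennreal (Z s) \<partial>lborel) = (\<integral>\<^sup>+s\<in>{0..t}. ennreal (z s) \<partial>lborel) + I" .
  have "(\<integral>\<^sup>+s\<in>{0..t}. ennreal (Z s) \<partial>lborel) =
     (\<integral>\<^sup>+s. ennreal (Z s * tail (t - s)) * indicator {0..t} s + ennreal (Z s * prob {..t - s}) * indicator {0..t} s \<partial>lborel)"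
  proof (rule nn_integral_cong)
    fix s
    have "tail (t - s) + prob {..t - s} = prob ({t - s<..} \<union> {..t - s})"
      unfolding tail_def by (intro finite_measure_Union[symmetric]) auto
    also have "{t - s<..} \<union> {..t - s} = space \<nu>" by auto
    finally have "tail (t - s) + prob {..t - s} = 1" by (simp only: prob_space)
    then have "Z s = Z s * tail (t - s) + Z s * prob {..t - s}" by (metis mult.right_neutral distrib_left)
    then have "ennreal (Z s) = ennreal (Z s * tail (t - s)) + ennreal (Z s * prob {..t - s})"
      using Z_nn[of s] tail_nn[of "t - s"] by (subst ennreal_plus[symmetric]) auto
    then show "ennreal (Z s) * indicator {0..t} s =
      ennreal (Z s * tail (t - s)) * indicator {0..t} s + ennreal (Z s * prob {..t - s}) * indicator {0..t} s"
      by (auto simp: indicator_def)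
  qed
  also have "\<dots> = (\<integral>\<^sup>+s\<in>{0..t}. ennreal (Z s * tail (t - s)) \<partial>lborel) + I"
    unfolding I_def by (rule nn_integral_add) measurable
  finally have 2: "(\<integral>\<^sup>+s\<in>{0..t}. ennreal (Z s) \<partial>lborel) = (\<integral>\<^sup>+s\<in>{0..t}. ennreal (Z s * tail (t - s)) \<partial>lborel) + I" .
  have "(\<integral>\<^sup>+s\<in>{0..t}. ennreal (Z s) \<partial>lborel) \<le> (\<integral>\<^sup>+s. ennreal (exp (\<phi> * t) * Z 0) * indicator {0..t} s \<partial>lborel)"
    using t by (intro nn_integral_mono) (auto simp: indicator_def intro!: ennreal_leI Z_local)
  also have "\<dots> < \<infinity>" using t by (subst nn_integral_cmult_indicator) (auto simp: ennreal_mult_less_top)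
  finally have "(\<integral>\<^sup>+s\<in>{0..t}. ennreal (Z s) \<partial>lborel) < \<infinity>" .
  \<comment> \<open>\<open>Z\<close> is bounded on \<open>[0, t]\<close> by \<open>Z_local\<close>,
    so the common term \<open>I\<close> is finite and may be cancelled.\<close>
  then have fin: "I \<noteq> \<infinity>" unfolding 2 by auto
  have "(\<integral>\<^sup>+s\<in>{0..t}. ennreal (Z s * tail (t - s)) \<partial>lborel) + I = (\<integral>\<^sup>+s\<in>{0..t}. ennreal (z s) \<partial>lborel) + I"
    using 1 2 by simp
  then have "(\<integral>\<^sup>+s\<in>{0..t}. ennreal (Z s * tail (t - s)) \<partial>lborel) = (\<integral>\<^sup>+s\<in>{0..t}. ennreal (z s) \<partial>lborel)"
    using fin by (simp add: add.commute[of _ I] ennreal_add_left_cancel)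
  moreover have "(\<integral>\<^sup>+s\<in>{0..t}. ennreal (Z s * tail (t - s)) \<partial>lborel) = (\<integral>\<^sup>+r\<in>{0..}. ennreal (Z (t - r) * tail r) \<partial>lborel)"
  proof -
    have "(\<integral>\<^sup>+s\<in>{0..t}. ennreal (Z s * tail (t - s)) \<partial>lborel) =
       (\<integral>\<^sup>+r. ennreal (Z (t + -1 * r) * tail (t - (t + -1 * r))) * indicator {0..t} (t + -1 * r) \<partial>lborel)"
      by (subst nn_integral_real_affine[where c="-1" and t=t]) auto
    also have "\<dots> = (\<integral>\<^sup>+r\<in>{0..}. ennreal (Z (t - r) * tail r) \<partial>lborel)"
      by (intro nn_integral_cong) (auto simp: indicator_def Z_neg not_le)
    finally show ?thesis .
  qed
  ultimately show ?thesis by simp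
qed

text \<open>If \<open>Z t\<close> is large, \<open>quasi\<close> keeps \<open>Z\<close> large on all
  of \<open>[t - e, t]\<close>, and the left side of \<open>renewal_identity\<close> would exceed
  \<open>J\<close>. The constant \<open>K\<close> is the bound on \<open>Z t\<close> that results;
  times before \<open>e\<close> are covered by \<open>Z_local\<close>.\<close>

lemma Z_bounded: obtains B where "\<And>t. Z t \<le> B"
proof -
  obtain e where e: "0 < e" "0 < tail e" using tail_pos by blast
  define K where "K = J / (exp (- \<phi> * e) * tail e * e)"
  have bound: "Z t \<le> K" if t: "e \<le> t" for t
  proof -
    have "ennreal (exp (- \<phi> * e) * Z t * tail e * e) = (\<integral>\<^sup>+r. ennreal (exp (- \<phi> * e) * Z t * tail e) * indicator {0..e} r \<partial>lborel)"
      using e Z_nn[of t] by (subst nn_integral_cmult_indicator) (auto simp: ennreal_mult[symmetric])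
    also have "\<dots> \<le> (\<integral>\<^sup>+r\<in>{0..}. ennreal (Z (t - r) * tail r) \<partial>lborel)"
    proof (intro nn_integral_mono)
      fix r
      show "ennreal (exp (- \<phi> * e) * Z t * tail e) * indicator {0..e} r \<le> ennreal (Z (t - r) * tail r) * indicator {0..} r"
      proof (cases "r \<in> {0..e}")
        case True
        have "Z t \<le> exp (\<phi> * r) * Z (t - r)" using quasi[of "t - r" r] True t by simp
        also have "\<dots> \<le> exp (\<phi> * e) * Z (t - r)" using True phi by (intro mult_right_mono Z_nn) (auto intro: mult_left_mono)
        finally have "exp (- \<phi> * e) * Z t \<le> Z (t - r)" by (simp add: exp_minus field_simps)
        then have "exp (- \<phi> * e) * Z t * tail e \<le> Z (t - r) * tail r"
          using True by (intro mult_mono tail_antimono Z_nn tail_nn) auto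
        then show ?thesis using True by (auto intro: ennreal_leI)
      qed simp
    qed
    also have "\<dots> = (\<integral>\<^sup>+s\<in>{0..t}. ennreal (z s) \<partial>lborel)" using t e by (intro renewal_identity) simp
    also have "\<dots> \<le> (\<integral>\<^sup>+t\<in>{0..}. ennreal (z t) \<partial>lborel)" by (intro nn_integral_mono) (auto simp: indicator_def)
    finally have "exp (- \<phi> * e) * Z t * tail e * e \<le> J" unfolding z_int using J by simp
    then show ?thesis unfolding K_def using e by (simp add: field_simps)
  qed
  have "Z t \<le> max K (exp (\<phi> * e) * Z 0)" for t
  proof (cases "e \<le> t")
    case True
    then show ?thesis using bound[of t] by simp
  next
    case False
    then show ?thesis using Z_local[of t e] e(1) by (simp add: le_max_iff_disj)
  qed
  then show thesis by (rule that)
qed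

section \<open>Extremal limit points of the renewal function\<close>

lemma renewal_eq_real:
  assumes "0 \<le> t"
  shows "Z t = z t + expectation (\<lambda>r. Z (t - r))"
proof -
  obtain B where B: "\<And>t. Z t \<le> B" using Z_bounded by blast
  have int: "integrable \<nu> (\<lambda>r. Z (t - r))"
    using B Z_nn by (intro integrable_const_bound[of _ B]) auto
  have "ennreal (Z t) = ennreal (z t) + ennreal (expectation (\<lambda>r. Z (t - r)))"
    unfolding eq[OF assms] using int Z_nn by (subst nn_integral_eq_integral) auto
  also have "\<dots> = ennreal (z t + expectation (\<lambda>r. Z (t - r)))"
    using z_nn Z_nn by (intro ennreal_plus[symmetric] integral_nonneg) auto
  finally show ?thesis using z_nn Z_nn by (subst (asm) ennreal_inj) (auto intro!: add_nonneg_nonneg integral_nonneg)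
qed

lemma integrable_shift:
  shows "integrable \<nu> (\<lambda>r. Z (t - r))"
proof -
  obtain B where B: "\<And>t. Z t \<le> B" using Z_bounded by blast
  show ?thesis using B Z_nn by (intro integrable_const_bound[of _ B]) auto
qed

lemma filterlim_shift_top:
  fixes T :: "nat \<Rightarrow> real"
  assumes T: "filterlim T at_top sequentially"
  shows "filterlim (\<lambda>n. T n - a) at_top sequentially"
  unfolding filterlim_at_top
proof
  fix K
  have "eventually (\<lambda>n. K + a \<le> T n) sequentially" using T by (simp add: filterlim_at_top)
  then show "eventually (\<lambda>n. K \<le> T n - a) sequentially" by eventually_elim simp
qed

text \<open>At an extremal limit point \<open>L\<close> of \<open>Z\<close> the renewal equation forces
  \<open>Z (T n - r)\<close> to be close to \<open>L\<close> for \<open>\<nu>\<close>-most \<open>r\<close>; \<open>\<sigma> = 1\<close> treats the upper limit and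
  \<open>\<sigma> = -1\<close> the lower one.\<close>

lemma extremal_L1:
  assumes \<sigma>: "\<sigma> = 1 \<or> \<sigma> = -1" and T: "filterlim T at_top sequentially"
    and L: "(\<lambda>n. Z (T n)) \<longlonglongrightarrow> L"
    and ext: "\<And>e. e > 0 \<Longrightarrow> eventually (\<lambda>t. \<sigma> * (Z t - L) \<le> e) at_top"
  shows "(\<lambda>n. expectation (\<lambda>r. \<bar>Z (T n - r) - L\<bar>)) \<longlonglongrightarrow> 0"
proof -
  obtain B where B: "\<And>t. Z t \<le> B" using Z_bounded by blast
  have bnd: "\<bar>Z t - L\<bar> \<le> B + \<bar>L\<bar>" for t using B[of t] Z_nn[of t] by linarith
  let ?f = "\<lambda>n r. max 0 (\<sigma> * (Z (T n - r) - L))"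
  have fb: "norm (?f n r) \<le> B + \<bar>L\<bar>" for n r
    using \<sigma> bnd[of "T n - r"] by (elim disjE) (simp_all add: max_def abs_le_iff)
  have i1: "integrable \<nu> (?f n)" for n
    by (intro integrable_const_bound[of _ "B + \<bar>L\<bar>"] AE_I2 fb) measurable
  have i2: "integrable \<nu> (\<lambda>r. Z (T n - r) - L)" for n
    by (intro Bochner_Integration.integrable_diff integrable_shift) simp
  have "(\<lambda>n. expectation (?f n)) \<longlonglongrightarrow> expectation (\<lambda>_. 0)"
  proof (rule integral_dominated_convergence[where w="\<lambda>_. B + \<bar>L\<bar>"])
    show "AE r in \<nu>. (\<lambda>n. ?f n r) \<longlonglongrightarrow> 0"
    proof (rule AE_I2)
      fix r
      have lim: "filterlim (\<lambda>n. T n - r) at_top sequentially"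
        by (rule filterlim_shift_top[OF T])
      show "(\<lambda>n. ?f n r) \<longlonglongrightarrow> 0"
      proof (rule LIMSEQ_I)
        fix e :: real assume "e > 0"
        then have "eventually (\<lambda>t. \<sigma> * (Z t - L) \<le> e / 2) at_top" by (rule ext[OF half_gt_zero])
        then have "eventually (\<lambda>n. \<sigma> * (Z (T n - r) - L) \<le> e / 2) sequentially"
          using lim by (rule eventually_compose_filterlim)
        then have "eventually (\<lambda>n. norm (?f n r - 0) < e) sequentially"
          by eventually_elim (use \<open>e > 0\<close> in auto)
        then show "\<exists>no. \<forall>n\<ge>no. norm (?f n r - 0) < e" by (simp add: eventually_sequentially)
      qed
    qed
    show "AE r in \<nu>. norm (?f n r) \<le> B + \<bar>L\<bar>" for n
      by (intro AE_I2 fb)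
  qed auto
  then have 1: "(\<lambda>n. expectation (?f n)) \<longlonglongrightarrow> 0" by simp
  \<comment> \<open>The signed deviations have mean tending to 0 by the renewal equation, since
    \<open>Z (T n)\<close> tends to \<open>L\<close> and \<open>z\<close> vanishes at
    infinity.\<close>
  have "eventually (\<lambda>n. 0 \<le> T n) sequentially"
    using T by (simp add: filterlim_at_top)
  then have "eventually (\<lambda>n. (Z (T n) - L) - z (T n) = expectation (\<lambda>r. Z (T n - r) - L)) sequentially"
  proof eventually_elim
    case (elim n)
    show ?case using renewal_eq_real[OF elim] integrable_shift[of "T n"] prob_space by simp
  qed
  moreover have "(\<lambda>n. (Z (T n) - L) - z (T n)) \<longlonglongrightarrow> 0"
    using L filterlim_compose[OF z_lim T] by (auto intro!: tendsto_eq_intros)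
  ultimately have 2: "(\<lambda>n. expectation (\<lambda>r. Z (T n - r) - L)) \<longlonglongrightarrow> 0"
    by (rule Lim_transform_eventually[rotated])
  \<comment> \<open>With \<open>a = Z (T n - r) - L\<close>, the absolute value of \<open>a\<close>
    is \<open>2 * max 0 (\<sigma> * a) - \<sigma> * a\<close>: the excess beyond the extremal value
    and the signed deviation control everything.\<close>
  have "expectation (\<lambda>r. \<bar>Z (T n - r) - L\<bar>) = 2 * expectation (?f n) - \<sigma> * expectation (\<lambda>r. Z (T n - r) - L)" for n
  proof -
    have "expectation (\<lambda>r. \<bar>Z (T n - r) - L\<bar>) = expectation (\<lambda>r. 2 * ?f n r - \<sigma> * (Z (T n - r) - L))"
      using \<sigma> by (intro Bochner_Integration.integral_cong) (auto simp: max_def abs_if)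
    also have "\<dots> = expectation (\<lambda>r. 2 * ?f n r) - expectation (\<lambda>r. \<sigma> * (Z (T n - r) - L))"
      by (intro Bochner_Integration.integral_diff integrable_mult_right i1 i2)
    finally show ?thesis by simp
  qed
  moreover have "(\<lambda>n. 2 * expectation (?f n) - \<sigma> * expectation (\<lambda>r. Z (T n - r) - L)) \<longlonglongrightarrow> 2 * 0 - \<sigma> * 0"
    by (intro tendsto_intros 1 2)
  ultimately show ?thesis by simp
qed

text \<open>Closeness holds at points slightly before and slightly after \<open>T n - x\<close>, as \<open>\<nu>\<close> charges every
  neighbourhood of \<open>x\<close>; the growth bound \<open>quasi\<close> carries it over to \<open>T n - x\<close> itself.\<close>

lemma extremal_shift:
  assumes L1: "(\<lambda>n. expectation (\<lambda>r. \<bar>Z (T n - r) - L\<bar>)) \<longlonglongrightarrow> 0"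
    and T: "filterlim T at_top sequentially" and L0: "0 \<le> L" and x: "c < x" "x < c + d"
  shows "(\<lambda>n. Z (T n - x)) \<longlonglongrightarrow> L"
proof -
  have Tx: "eventually (\<lambda>n. K \<le> T n) sequentially" for K
    using T by (simp add: filterlim_at_top)
  have i2: "integrable \<nu> (\<lambda>r. \<bar>Z (T n - r) - L\<bar>)" for n
    by (intro integrable_abs Bochner_Integration.integrable_diff integrable_shift) simp
  \<comment> \<open>If every point of the interval deviated by at least \<open>\<delta>\<close>, the
    mean deviation would be at least \<open>\<delta>\<close> times the positive mass of the
    interval.\<close>
  have close: "eventually (\<lambda>n. \<exists>r\<in>{w - e<..<w + e}. \<bar>Z (T n - r) - L\<bar> < \<delta>) sequentially"
    if w: "c < w" "w < c + d" and e: "0 < e" and \<delta>: "0 < \<delta>" for w e \<delta>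
  proof -
    let ?I = "{w - e<..<w + e}"
    have p: "0 < prob ?I" by (rule supp[OF w e])
    have "eventually (\<lambda>n. expectation (\<lambda>r. \<bar>Z (T n - r) - L\<bar>) < \<delta> * prob ?I) sequentially"
      using L1 p \<delta> by (intro order_tendstoD(2)) auto
    then show ?thesis
    proof eventually_elim
      case (elim n)
      show ?case
      proof (rule ccontr)
        have ii: "integrable \<nu> (\<lambda>r. \<delta> * indicator ?I r)"
          by (intro integrable_mult_right integrable_const_bound[of _ 1]) auto
        assume "\<not> ?thesis"
        then have "\<delta> * indicator ?I r \<le> \<bar>Z (T n - r) - L\<bar>" for r
          by (auto simp: indicator_def not_less)
        then have "expectation (\<lambda>r. \<delta> * indicator ?I r) \<le> expectation (\<lambda>r. \<bar>Z (T n - r) - L\<bar>)"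
          using ii by (intro integral_mono i2) auto
        then show False using elim by simp
      qed
    qed
  qed
  show ?thesis
  proof (rule LIMSEQ_I)
    fix \<eta> :: real assume \<eta>: "0 < \<eta>"
    \<comment> \<open>\<open>e\<close> is taken so small that the error \<open>e\<close>, magnified
      by the growth over a time \<open>2 * e\<close>, costs less than \<open>\<eta>\<close> on
      either side.\<close>
    have "((\<lambda>e. exp (\<phi> * (2 * e)) * (L + e)) \<longlongrightarrow> exp (\<phi> * (2 * 0)) * (L + 0)) (at_right 0)"
      by (intro tendsto_intros)
    moreover have "((\<lambda>e. exp (- \<phi> * (2 * e)) * (L - e)) \<longlongrightarrow> exp (- \<phi> * (2 * 0)) * (L - 0)) (at_right 0)"
      by (intro tendsto_intros)
    ultimately have "eventually (\<lambda>e. exp (\<phi> * (2 * e)) * (L + e) < L + \<eta>) (at_right 0)"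
      "eventually (\<lambda>e. L - \<eta> < exp (- \<phi> * (2 * e)) * (L - e)) (at_right 0)"
      using \<eta> by (auto intro: order_tendstoD)
    moreover have "eventually (\<lambda>e. e < min (x - c) (c + d - x)) (at_right (0::real))"
      using x by (intro order_tendstoD(2)[OF tendsto_ident_at]) auto
    moreover have "eventually (\<lambda>e::real. 0 < e) (at_right 0)" by (simp add: eventually_at_right_less)
    ultimately have "eventually (\<lambda>e. exp (\<phi> * (2 * e)) * (L + e) < L + \<eta> \<and>
      L - \<eta> < exp (- \<phi> * (2 * e)) * (L - e) \<and> e < min (x - c) (c + d - x) \<and> 0 < e) (at_right 0)"
      by eventually_elim auto
    then obtain e where e: "exp (\<phi> * (2 * e)) * (L + e) < L + \<eta>"
      "L - \<eta> < exp (- \<phi> * (2 * e)) * (L - e)" "e < x - c" "e < c + d - x" "0 < e"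
      using eventually_happens'[OF trivial_limit_at_right_real] by force
    \<comment> \<open>A point \<open>r\<close> below \<open>x\<close> belongs to the later time
      \<open>T n - r\<close> and bounds \<open>Z (T n - x)\<close> from below; a point
      \<open>r'\<close> above \<open>x\<close> belongs to an earlier time and bounds it from
      above.\<close>
    have "eventually (\<lambda>n. \<exists>r\<in>{x - e - e<..<x - e + e}. \<bar>Z (T n - r) - L\<bar> < e) sequentially"
      using e x by (intro close) auto
    moreover have "eventually (\<lambda>n. \<exists>r\<in>{x + e - e<..<x + e + e}. \<bar>Z (T n - r) - L\<bar> < e) sequentially"
      using e x by (intro close) auto
    ultimately have "eventually (\<lambda>n. norm (Z (T n - x) - L) < \<eta>) sequentially"
      using Tx[of "x + 2 * e"]
    proof eventually_elim
      case (elim n)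
      obtain r where r: "x - 2 * e < r" "r < x" "\<bar>Z (T n - r) - L\<bar> < e" using elim(1) by auto
      obtain r' where r': "x < r'" "r' < x + 2 * e" "\<bar>Z (T n - r') - L\<bar> < e" using elim(2) by auto
      have "Z (T n - r) \<le> exp (\<phi> * (x - r)) * Z (T n - x)"
        using quasi[of "T n - x" "x - r"] r elim(3) e by simp
      also have "\<dots> \<le> exp (\<phi> * (2 * e)) * Z (T n - x)"
        using r phi by (intro mult_right_mono Z_nn) (auto intro: mult_left_mono)
      finally have "exp (- \<phi> * (2 * e)) * Z (T n - r) \<le> Z (T n - x)"
        by (simp add: exp_minus field_simps)
      moreover have "exp (- \<phi> * (2 * e)) * (L - e) \<le> exp (- \<phi> * (2 * e)) * Z (T n - r)"
        using r by (intro mult_left_mono) auto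
      moreover have "Z (T n - x) \<le> exp (\<phi> * (2 * e)) * (L + e)"
      proof -
        have "Z (T n - x) \<le> exp (\<phi> * (r' - x)) * Z (T n - r')"
          using quasi[of "T n - r'" "r' - x"] r' elim(3) by simp
        also have "\<dots> \<le> exp (\<phi> * (2 * e)) * (L + e)"
          using r' phi L0 e by (intro mult_mono Z_nn) (auto intro: mult_left_mono)
        finally show ?thesis .
      qed
      ultimately have "L - \<eta> < Z (T n - x)" "Z (T n - x) < L + \<eta>" using e by linarith+
      then show ?case by (simp add: abs_less_iff)
    qed
    then show "\<exists>no. \<forall>n\<ge>no. norm (Z (T n - x) - L) < \<eta>" by (simp add: eventually_sequentially)
  qed
qed

text \<open>Iterating \<open>extremal_shift\<close> carries the limit \<open>L\<close> to
  \<open>T n - a\<close> for all multiples \<open>a\<close> of points of \<open>(c, c + d)\<close>,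
  hence for all large \<open>a\<close>. Along a shifted sequence \<open>Z (S n - r)\<close> tends to
  \<open>L\<close> for every \<open>r \<ge> 0\<close>, and in the limit
  \<open>renewal_identity\<close> says that \<open>L\<close> times the mean is
  \<open>J\<close>.\<close>

lemma extremal_value:
  assumes \<sigma>: "\<sigma> = 1 \<or> \<sigma> = -1" and T: "filterlim T at_top sequentially"
    and L: "(\<lambda>n. Z (T n)) \<longlonglongrightarrow> L"
    and ext: "\<And>e. e > 0 \<Longrightarrow> eventually (\<lambda>t. \<sigma> * (Z t - L) \<le> e) at_top"
  shows "L = J / expectation (\<lambda>r. r)"
proof -
  have L0: "0 \<le> L" using L by (rule LIMSEQ_le_const) (use Z_nn in auto)
  note shift_top = filterlim_shift_top[OF T]
  have step: "(\<lambda>n. Z (T n - (a + x))) \<longlonglongrightarrow> L"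
    if "(\<lambda>n. Z (T n - a)) \<longlonglongrightarrow> L" "c < x" "x < c + d" for a x
    using extremal_shift[OF extremal_L1[OF \<sigma> shift_top that(1) ext] shift_top L0 that(2,3)]
    by (simp add: algebra_simps)
  have mult: "(\<lambda>n. Z (T n - real k * x)) \<longlonglongrightarrow> L" if x: "c < x" "x < c + d" for k x
  proof (induction k)
    case (Suc k)
    then show ?case using step[OF Suc x] by (simp add: algebra_simps)
  qed (simp add: L)
  \<comment> \<open>A suitable multiple exists once the interval \<open>(a / (c + d), a / c)\<close>
    contains an integer, which holds when its length \<open>a * d / (c * (c + d))\<close> exceeds
    1.\<close>
  define b where "b = c * (c + d) / d"
  have far: "(\<lambda>n. Z (T n - a)) \<longlonglongrightarrow> L" if a: "b < a" for a
  proof -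
    have "0 < b" unfolding b_def using cd by (intro divide_pos_pos mult_pos_pos) auto
    then have a0: "0 < a" using a by simp
    define k where "k = nat \<lfloor>a / (c + d)\<rfloor> + 1"
    have q: "0 \<le> a / (c + d)" using a0 cd by simp
    have k: "real k = of_int \<lfloor>a / (c + d)\<rfloor> + 1"
      unfolding k_def using q by (simp add: of_nat_nat)
    have k1: "a / (c + d) < real k" unfolding k by linarith
    have k2: "real k \<le> a / (c + d) + 1" unfolding k by linarith
    have "c * (c + d) < a * d" using a cd by (simp add: b_def field_simps)
    then have "a / (c + d) + 1 < a / c" using cd by (simp add: field_simps)
    then have k3: "real k < a / c" using k2 by simp
    have kp: "0 < real k" using k1 q by simp
    have "c < a / real k" using k3 kp cd by (simp add: field_simps)
    moreover have "a / real k < c + d" using k1 kp cd by (simp add: field_simps)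
    ultimately have "(\<lambda>n. Z (T n - real k * (a / real k))) \<longlonglongrightarrow> L" by (rule mult)
    then show ?thesis using kp by simp
  qed
  \<comment> \<open>The extra 1 puts \<open>b + 1 + r\<close> strictly beyond \<open>b\<close> for
    every \<open>r \<ge> 0\<close>.\<close>
  define S where "S n = T n - (b + 1)" for n
  have S: "filterlim S at_top sequentially" unfolding S_def by (rule shift_top)
  obtain B where B: "\<And>t. Z t \<le> B" using Z_bounded by blast
  have B0: "0 \<le> B" using B[of 0] Z_nn[of 0] by simp
  have "(\<lambda>n. \<integral>\<^sup>+r\<in>{0..}. ennreal (Z (S n - r) * tail r) \<partial>lborel) \<longlonglongrightarrow> (\<integral>\<^sup>+r\<in>{0..}. ennreal (L * tail r) \<partial>lborel)"
  proof (rule nn_integral_dominated_convergence[where w="\<lambda>r. ennreal B * (ennreal (tail r) * indicator {0..} r)"])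
    show "AE r in lborel. (\<lambda>n. ennreal (Z (S n - r) * tail r) * indicator {0..} r) \<longlonglongrightarrow> ennreal (L * tail r) * indicator {0..} r"
    proof (rule AE_I2)
      fix r :: real
      show "(\<lambda>n. ennreal (Z (S n - r) * tail r) * indicator {0..} r) \<longlonglongrightarrow> ennreal (L * tail r) * indicator {0..} r"
      proof (cases "0 \<le> r")
        case True
        then have "(\<lambda>n. Z (S n - r)) \<longlonglongrightarrow> L"
          using far[of "b + 1 + r"] by (simp add: S_def algebra_simps)
        then have "(\<lambda>n. ennreal (Z (S n - r) * tail r)) \<longlonglongrightarrow> ennreal (L * tail r)"
          by (intro tendsto_ennrealI tendsto_intros)
        then show ?thesis using True by simp
      qed simp
    qed
    show "AE r in lborel. ennreal (Z (S n - r) * tail r) * indicator {0..} r \<le> ennreal B * (ennreal (tail r) * indicator {0..} r)" for n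
      using B B0 tail_nn Z_nn by (intro AE_I2) (auto simp: indicator_def ennreal_mult[symmetric] intro!: ennreal_leI mult_right_mono)
    show "(\<integral>\<^sup>+r. ennreal B * (ennreal (tail r) * indicator {0..} r) \<partial>lborel) < \<infinity>"
      using tail_integral by (subst nn_integral_cmult) (auto simp: ennreal_mult_less_top)
  qed measurable
  also have "(\<integral>\<^sup>+r\<in>{0..}. ennreal (L * tail r) \<partial>lborel) = ennreal (L * expectation (\<lambda>r. r))"
  proof -
    have "(\<integral>\<^sup>+r\<in>{0..}. ennreal (L * tail r) \<partial>lborel) = (\<integral>\<^sup>+r. ennreal L * (ennreal (tail r) * indicator {0..} r) \<partial>lborel)"
      using L0 tail_nn by (intro nn_integral_cong) (simp add: ennreal_mult mult.assoc)
    also have "\<dots> = ennreal L * ennreal (expectation (\<lambda>r. r))"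
      by (subst nn_integral_cmult) (auto simp: tail_integral)
    finally show ?thesis using L0 mean_pos by (simp add: ennreal_mult)
  qed
  finally have lim1: "(\<lambda>n. \<integral>\<^sup>+r\<in>{0..}. ennreal (Z (S n - r) * tail r) \<partial>lborel) \<longlonglongrightarrow> ennreal (L * expectation (\<lambda>r. r))" .
  have "(\<lambda>n. \<integral>\<^sup>+s\<in>{0..S n}. ennreal (z s) \<partial>lborel) \<longlonglongrightarrow> (\<integral>\<^sup>+s\<in>{0..}. ennreal (z s) \<partial>lborel)"
  proof (rule nn_integral_dominated_convergence[where w="\<lambda>s. ennreal (z s) * indicator {0..} s"])
    show "AE s in lborel. (\<lambda>n. ennreal (z s) * indicator {0..S n} s) \<longlonglongrightarrow> ennreal (z s) * indicator {0..} s"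
    proof (rule AE_I2, rule tendsto_eventually)
      fix s :: real
      have "eventually (\<lambda>n. s \<le> S n) sequentially" using S by (simp add: filterlim_at_top)
      then show "eventually (\<lambda>n. ennreal (z s) * indicator {0..S n} s = ennreal (z s) * indicator {0..} s) sequentially"
        by eventually_elim (auto simp: indicator_def)
    qed
    show "AE s in lborel. ennreal (z s) * indicator {0..S n} s \<le> ennreal (z s) * indicator {0..} s" for n
      by (intro AE_I2) (auto simp: indicator_def)
    show "(\<integral>\<^sup>+s. ennreal (z s) * indicator {0..} s \<partial>lborel) < \<infinity>" by (simp add: z_int)
  qed measurable
  moreover have "eventually (\<lambda>n. 0 \<le> S n) sequentially" using S by (simp add: filterlim_at_top)
  then have "eventually (\<lambda>n. (\<integral>\<^sup>+s\<in>{0..S n}. ennreal (z s) \<partial>lborel) = (\<integral>\<^sup>+r\<in>{0..}. ennreal (Z (S n - r) * tail r) \<partial>lborel)) sequentially"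
    by eventually_elim (rule renewal_identity[symmetric])
  ultimately have "(\<lambda>n. \<integral>\<^sup>+r\<in>{0..}. ennreal (Z (S n - r) * tail r) \<partial>lborel) \<longlonglongrightarrow> ennreal J"
    unfolding z_int by (rule Lim_transform_eventually)
  from LIMSEQ_unique[OF lim1 this] have "L * expectation (\<lambda>r. r) = J"
    using L0 J mean_pos by (subst (asm) ennreal_inj) auto
  then show ?thesis using mean_pos by (simp add: field_simps)
qed

text \<open>The upper and the lower limit of \<open>Z\<close> are extremal limit points, and
  \<open>extremal_value\<close> gives them the same value.\<close>

theorem renewal_limit: "(Z \<longlongrightarrow> J / expectation (\<lambda>r. r)) at_top"
proof -
  obtain B where B: "\<And>t. Z t \<le> B" using Z_bounded by blast
  have abs: "\<bar>Z t\<bar> \<le> B" "\<bar>- Z t\<bar> \<le> B" for t using B Z_nn by auto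
  obtain T M where M: "filterlim T at_top sequentially" "(\<lambda>n. Z (T n)) \<longlonglongrightarrow> M"
    "\<And>e. e > 0 \<Longrightarrow> eventually (\<lambda>t. Z t \<le> M + e) at_top"
    by (rule limsup_sequence[of Z, OF abs(1)]) (rule that, assumption+)
  have "M = J / expectation (\<lambda>r. r)"
    by (rule extremal_value[of 1, OF _ M(1,2)]) (use M(3) in \<open>auto simp: algebra_simps\<close>)
  moreover obtain T' N where N: "filterlim T' at_top sequentially" "(\<lambda>n. - Z (T' n)) \<longlonglongrightarrow> N"
    "\<And>e. e > 0 \<Longrightarrow> eventually (\<lambda>t. - Z t \<le> N + e) at_top"
    by (rule limsup_sequence[of "\<lambda>t. - Z t", OF abs(2)]) (rule that, assumption+)
  have "- N = J / expectation (\<lambda>r. r)"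
  proof (rule extremal_value[of "-1", OF _ N(1)])
    show "(\<lambda>n. Z (T' n)) \<longlonglongrightarrow> - N" using tendsto_minus[OF N(2)] by simp
    show "eventually (\<lambda>t. -1 * (Z t - - N) \<le> e) at_top" if "e > 0" for e
      by (rule eventually_mono[OF N(3)[OF that]]) auto
  qed simp
  ultimately have MN: "M = J / expectation (\<lambda>r. r)" "- N = J / expectation (\<lambda>r. r)" by auto
  show ?thesis
  proof (rule tendstoI)
    fix e :: real assume "e > 0"
    then have "eventually (\<lambda>t. Z t \<le> M + e / 2) at_top" "eventually (\<lambda>t. - Z t \<le> N + e / 2) at_top"
      by (auto intro!: M(3) N(3))
    then show "eventually (\<lambda>t. dist (Z t) (J / expectation (\<lambda>r. r)) < e) at_top"
    proof eventually_elim
      case (elim t)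
      then show ?case unfolding MN(1)[symmetric] using MN \<open>e > 0\<close> by (auto simp: dist_real_def abs_less_iff)
    qed
  qed
qed

end

section \<open>Asymptotics of the survival probability\<close>

lemma measurable_exp_ereal [measurable]: "exp_ereal l \<in> borel_measurable borel"
  unfolding exp_ereal_def by measurable

lemma exp_ereal_real [simp]: "exp_ereal l (ereal c) = ennreal (exp (l * c))"
  by (simp add: exp_ereal_def)

lemma exp_ereal_ge_1: "0 \<le> l \<Longrightarrow> 0 \<le> t \<Longrightarrow> 1 \<le> exp_ereal l t"
  by (cases t) (auto simp: exp_ereal_def)

lemma exp_ereal_mono_time: "0 < l \<Longrightarrow> ereal a \<le> t \<Longrightarrow> ennreal (exp (l * a)) \<le> exp_ereal l t"
  by (cases t) (auto simp: exp_ereal_def intro!: ennreal_leI)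

lemma exp_ereal_le_1: "l \<le> 0 \<Longrightarrow> 0 \<le> t \<Longrightarrow> exp_ereal l t \<le> 1"
  by (cases t) (auto simp: exp_ereal_def mult_nonpos_nonneg)

lemma exp_ereal_mono: "l \<le> k \<Longrightarrow> 0 \<le> t \<Longrightarrow> exp_ereal l t \<le> exp_ereal k t"
  by (cases t) (auto simp: exp_ereal_def intro!: ennreal_leI mult_right_mono)

locale yaglom = path_chain +
  fixes \<phi> D :: real
  assumes mgf: "(\<integral>\<^sup>+x. (if full_holding_time x < 1 then exp_ereal \<phi> (cycle_time x) else 0) \<partial>Q 0) = 1"
    and deriv: "((\<lambda>l. enn2real (\<integral>\<^sup>+x. (if full_holding_time x < 1 then exp_ereal l (cycle_time x) else 0) \<partial>Q 0))
      has_real_derivative D) (at_left \<phi>)"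
begin

sublocale Q0: prob_space "Q 0" using prob_Q zero_mem by blast

abbreviation wt :: "(real \<Rightarrow> nat) \<Rightarrow> ennreal" where "wt x \<equiv> exp_ereal \<phi> (cycle_time x)"

section \<open>The cycle law at the exponent \<phi>\<close>

definition gam :: "hat_state \<Rightarrow> ennreal" where
  "gam y = (\<integral>\<^sup>+x. exit_ind y x * wt x \<partial>Q (fst y))"

lemma nn_integral_indicator_Q:
  assumes "i \<in> S" and [measurable]: "Measurable.pred \<D> P"
  shows "(\<integral>\<^sup>+x. (if P x then c else 0) \<partial>Q i) = c * emeasure (Q i) {x\<in>space \<D>. P x}"
proof -
  have "(\<integral>\<^sup>+x. (if P x then c else 0) \<partial>Q i) = (\<integral>\<^sup>+x. c * indicator {x\<in>space \<D>. P x} x \<partial>Q i)"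
    using assms(1) by (intro nn_integral_cong) (auto simp: indicator_def)
  also have "\<dots> = c * emeasure (Q i) {x\<in>space \<D>. P x}"
    using assms(1) by (intro nn_integral_cmult_indicator) simp
  finally show ?thesis .
qed

lemma prob_zero_on: "0 \<le> t \<Longrightarrow> Q0.prob {x\<in>space \<D>. \<forall>r\<in>{0..t}. x r = 0} = exp (q00 * t)"
  using emeasure_zero_on[of t] by (simp add: Q0.emeasure_eq_measure)

text \<open>The holding time has no atom at 1: leaving exactly at time 1 requires staying in 0
  throughout \<open>[0, t]\<close> but not throughout \<open>[0, 1]\<close>, for every
  \<open>t < 1\<close>, and the probability \<open>exp (q00 * t) - exp q00\<close> of that tends to
  0. This reconciles the closed interval in \<open>exits\<close> with the condition
  \<open>H\<^sup>1 < 1\<close> in \<open>I\<close>.\<close>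

lemma AE_exit_strict: "AE x in Q 0. exits 0 x \<longleftrightarrow> full_holding_time x < 1"
proof -
  let ?E = "\<lambda>t. {x\<in>space \<D>. \<forall>r\<in>{0..t}. x r = 0}"
  define N where "N = {x\<in>space \<D>. exits 0 x \<and> \<not> full_holding_time x < 1}"
  have Em: "?E t \<in> sets (Q 0)" for t using zero_mem by simp
  have Nm: "N \<in> sets (Q 0)" using zero_mem by (simp add: N_def)
  have "Q0.prob N \<le> exp (q00 * t) - exp q00" if t: "0 \<le> t" "t < 1" for t
  proof -
    have "Q0.prob N \<le> Q0.prob (?E t - ?E 1)"
      using t Em by (intro Q0.finite_measure_mono) (auto simp: N_def exits_def full_holding_time_less_iff)
    also have "\<dots> = Q0.prob (?E t) - Q0.prob (?E 1)"
      using t Em by (intro Q0.finite_measure_Diff) auto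
    finally show ?thesis using t by (simp add: prob_zero_on)
  qed
  then have "eventually (\<lambda>t. Q0.prob N \<le> exp (q00 * t) - exp q00) (at_left 1)"
    using eventually_at_left_real[of 0 1] by (auto elim!: eventually_mono)
  moreover have "((\<lambda>t. exp (q00 * t) - exp q00) \<longlongrightarrow> exp (q00 * 1) - exp q00) (at_left 1)"
    by (intro tendsto_intros)
  ultimately have "Q0.prob N \<le> 0"
    using tendsto_lowerbound[of _ "exp (q00 * 1) - exp q00" "at_left (1::real)"] by (simp add: trivial_limit_at_left_real)
  then have "Q0.prob N = 0" by (intro antisym) auto
  then have "emeasure (Q 0) N = 0" by (simp add: Q0.emeasure_eq_measure)
  then have "N \<in> null_sets (Q 0)" using Nm by auto
  moreover have "{x\<in>space (Q 0). \<not> (exits 0 x \<longleftrightarrow> full_holding_time x < 1)} \<subseteq> N"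
    using zero_mem by (auto simp: N_def exits_def full_holding_time_less_iff intro: less_imp_le)
  ultimately show ?thesis by (rule AE_I')
qed

text \<open>Up to the null set of \<open>AE_exit_strict\<close> this is the hypothesis
  \<open>I(\<phi>) = 1\<close>.\<close>

lemma gam_origin: "gam (0, 0) = 1"
proof -
  have "gam (0, 0) = (\<integral>\<^sup>+x. (if full_holding_time x < 1 then wt x else 0) \<partial>Q 0)"
    unfolding gam_def fst_conv
    by (intro nn_integral_cong_AE) (use AE_exit_strict in eventually_elim, simp add: exit_ind_def)
  then show ?thesis by (simp add: mgf)
qed

text \<open>If 0 were absorbing, almost no path would leave it and \<open>I(\<phi>)\<close> would be
  0.\<close>

lemma q00_neg: "q00 < 0"
proof (rule ccontr)
  assume "\<not> q00 < 0"
  then have q: "q00 = 0" using q00_nonpos by simp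
  have "AE x in Q 0. x \<in> {x\<in>space \<D>. \<forall>r\<in>{0..1}. x r = 0}"
    using emeasure_zero_on[of 1] q zero_mem
    by (intro Q0.AE_prob_1) (simp add: Q0.emeasure_eq_measure)
  then have "gam (0, 0) = (\<integral>\<^sup>+x. 0 \<partial>Q 0)"
    unfolding gam_def fst_conv
    by (intro nn_integral_cong_AE, elim eventually_mono) (simp add: exit_ind_def exits_def)
  then show False by (simp add: gam_origin)
qed

text \<open>For \<open>\<phi> \<le> 0\<close> the weights are at most 1, so
  \<open>gam (0, 0)\<close> would be at most the probability of leaving 0 by time 1, which is below
  1.\<close>

lemma phi_pos: "0 < \<phi>"
proof (rule ccontr)
  assume "\<not> 0 < \<phi>"
  then have "gam (0, 0) \<le> (\<integral>\<^sup>+x. (if \<exists>r\<in>{0..1}. x r \<noteq> 0 then 1 else 0) \<partial>Q 0)"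
    unfolding gam_def
    by (auto intro!: nn_integral_mono exp_ereal_le_1 simp: exit_ind_def exits_def cycle_time_nonneg)
  also have "\<dots> = emeasure (Q 0) {x\<in>space \<D>. \<exists>r\<in>{0..1}. x r \<noteq> 0}"
    using pred_visit[of 0 1 S] by (subst nn_integral_indicator_Q[OF zero_mem]) auto
  also have "{x\<in>space \<D>. \<exists>r\<in>{0..1}. x r \<noteq> 0} = space (Q 0) - {x\<in>space \<D>. \<forall>r\<in>{0..1}. x r = 0}"
    using zero_mem by auto
  also have "emeasure (Q 0) \<dots> = ennreal (1 - exp (q00 * 1))"
  proof -
    have "{x\<in>space \<D>. \<forall>r\<in>{0..1}. x r = 0} \<in> Q0.events" using zero_mem by simp
    from Q0.prob_compl[OF this] show ?thesis unfolding Q0.emeasure_eq_measure by (simp add: prob_zero_on[of 1, simplified])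
  qed
  finally have "ennreal 1 \<le> ennreal (1 - exp (q00 * 1))" by (simp add: gam_origin)
  then have "1 \<le> 1 - exp (q00 * 1)" using q00_nonpos by (subst (asm) ennreal_le_iff) auto
  then show False by simp
qed

text \<open>As \<open>\<phi> > 0\<close>, an infinite cycle has infinite weight, and
  \<open>gam (0, 0) = 1\<close> allows this on a null set only.\<close>

lemma AE_cycle_finite: "AE x in Q 0. exits 0 x \<longrightarrow> cycle_time x \<noteq> \<infinity>"
proof -
  have "AE x in Q 0. exit_ind (0, 0) x * wt x \<noteq> \<infinity>"
    using gam_origin zero_mem unfolding gam_def by (intro nn_integral_PInf_AE) auto
  then show ?thesis
  proof eventually_elim
    case (elim x)
    then show ?case using phi_pos by (auto simp: exit_ind_def exp_ereal_def)
  qed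
qed

lemma cycle_time_finiteE:
  assumes "x \<in> space \<D>" "cycle_time x \<noteq> \<infinity>"
  shows "cycle_time x = ereal (cycle x)" "0 < cycle x" "\<And>r. returned x r \<longleftrightarrow> cycle x \<le> r"
proof -
  have "\<bar>cycle_time x\<bar> \<noteq> \<infinity>" using assms(2) cycle_time_nonneg[of x] by auto
  then have e: "cycle_time x = ereal (cycle x)" by (simp add: cycle_def ereal_real)
  then have "returned x (cycle x)" using cycle_time_le_iff[OF path_space_cadlag[OF assms(1)], of "cycle x"] by simp
  from cycleE[OF assms(1) this] show "cycle_time x = ereal (cycle x)" "0 < cycle x" "\<And>r. returned x r \<longleftrightarrow> cycle x \<le> r"
    by auto
qed

lemma AE_cycle: "AE x in Q 0. exits 0 x \<longrightarrow> cycle_time x = ereal (cycle x) \<and> 0 < cycle x \<and> (\<forall>r. returned x r \<longleftrightarrow> cycle x \<le> r)"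
  using AE_cycle_finite AE_space by eventually_elim (use cycle_time_finiteE zero_mem in auto)

text \<open>For exponents \<open>l n\<close> increasing to \<open>\<phi>\<close> the difference
  quotients of \<open>exp (l * c)\<close> are nonnegative and tend to
  \<open>c * exp (\<phi> * c)\<close>. Fatou's lemma bounds the mean of the cycle law by the limit
  \<open>D\<close> of the difference quotients of \<open>I\<close>.\<close>

lemma mean_bound: "(\<integral>\<^sup>+x. exit_ind (0, 0) x * wt x * ennreal (cycle x) \<partial>Q 0) \<le> ennreal D"
proof -
  define I where "I l = (\<integral>\<^sup>+x. (if full_holding_time x < 1 then exp_ereal l (cycle_time x) else 0) \<partial>Q 0)" for l
  define l where "l n = \<phi> - \<phi> / real (Suc (Suc n))" for n
  have l: "0 < l n" "l n < \<phi>" for n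
    using phi_pos by (auto simp: l_def field_simps intro: add_pos_nonneg)
  have Il: "I l = (\<integral>\<^sup>+x. exit_ind (0, 0) x * exp_ereal l (cycle_time x) \<partial>Q 0)" for l
    unfolding I_def by (intro nn_integral_cong_AE) (use AE_exit_strict in eventually_elim, simp add: exit_ind_def)
  have I\<phi>: "I \<phi> = 1" unfolding I_def by (rule mgf)
  have I1: "I (l n) \<le> 1" for n
    unfolding I\<phi>[symmetric] Il using l(2)[of n]
    by (intro nn_integral_mono mult_left_mono exp_ereal_mono cycle_time_nonneg) auto
  define sl where "sl n x = exit_ind (0, 0) x * ennreal ((exp (\<phi> * cycle x) - exp (l n * cycle x)) / (\<phi> - l n))" for n x
  have [measurable]: "sl n \<in> borel_measurable \<D>" for n unfolding sl_def by measurable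
  have int_sl: "(\<integral>\<^sup>+x. sl n x \<partial>Q 0) = ennreal ((1 - enn2real (I (l n))) / (\<phi> - l n))" for n
  proof -
    have pd: "0 < \<phi> - l n" using l by simp
    \<comment> \<open>The difference of \<open>I \<phi>\<close> and \<open>I (l n)\<close> is
      presented as a sum, so that no extended values are subtracted.\<close>
    have "1 = (\<integral>\<^sup>+x. ennreal (\<phi> - l n) * sl n x + exit_ind (0, 0) x * exp_ereal (l n) (cycle_time x) \<partial>Q 0)"
      unfolding I\<phi>[symmetric] Il
    proof (intro nn_integral_cong_AE, use AE_cycle in eventually_elim)
      case (elim x)
      show ?case
      proof (cases "exits 0 x")
        case True
        then have c: "cycle_time x = ereal (cycle x)" "0 < cycle x" using elim by auto
        have le: "exp (l n * cycle x) \<le> exp (\<phi> * cycle x)" using l(2)[of n] c(2) by simp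
        have "ennreal (\<phi> - l n) * ennreal ((exp (\<phi> * cycle x) - exp (l n * cycle x)) / (\<phi> - l n)) + ennreal (exp (l n * cycle x)) =
          ennreal ((\<phi> - l n) * ((exp (\<phi> * cycle x) - exp (l n * cycle x)) / (\<phi> - l n)) + exp (l n * cycle x))"
          using le pd by (subst ennreal_mult[symmetric], simp, simp, subst ennreal_plus[symmetric]) auto
        also have "(\<phi> - l n) * ((exp (\<phi> * cycle x) - exp (l n * cycle x)) / (\<phi> - l n)) + exp (l n * cycle x) = exp (\<phi> * cycle x)"
          using pd by simp
        finally show ?thesis using True by (simp add: c(1) sl_def exit_ind_def)
      qed (simp add: exit_ind_def sl_def)
    qed
    also have "\<dots> = ennreal (\<phi> - l n) * (\<integral>\<^sup>+x. sl n x \<partial>Q 0) + I (l n)"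
      unfolding Il using zero_mem by (subst nn_integral_add) (auto simp: nn_integral_cmult)
    finally have e: "1 = ennreal (\<phi> - l n) * (\<integral>\<^sup>+x. sl n x \<partial>Q 0) + I (l n)" .
    define A where "A = (\<integral>\<^sup>+x. sl n x \<partial>Q 0)"
    have Afin: "A \<noteq> \<infinity>" using e pd unfolding A_def[symmetric] by (auto simp: ennreal_mult_top)
    then obtain a where a: "A = ennreal a" "0 \<le> a" by (cases A) auto
    define b where "b = enn2real (I (l n))"
    have b: "I (l n) = ennreal b" "0 \<le> b"
      using I1[of n] unfolding b_def by (auto intro!: ennreal_enn2real[symmetric] order_le_less_trans[of "I (l n)" 1])
    have "ennreal 1 = ennreal ((\<phi> - l n) * a + b)"
      using e pd a(2) b(2) unfolding A_def[symmetric] a(1) b(1) by (simp add: ennreal_mult ennreal_plus)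
    then have "1 = (\<phi> - l n) * a + b" using pd a(2) b(2) by (subst (asm) ennreal_inj) auto
    then have "a = (1 - b) / (\<phi> - l n)" using pd by (simp add: field_simps)
    then show ?thesis unfolding A_def[symmetric] b_def[symmetric] a(1) by simp
  qed
  have filt: "filterlim l (at_left \<phi>) sequentially"
    unfolding filterlim_at
  proof
    have "(\<lambda>n. \<phi> - \<phi> / real (Suc (Suc n))) \<longlonglongrightarrow> \<phi> - 0" by (intro tendsto_diff tendsto_const) real_asymp
    then show "l \<longlonglongrightarrow> \<phi>" by (simp add: l_def[abs_def])
  qed (use l in \<open>auto simp: less_le\<close>)
  have "((\<lambda>y. (enn2real (I y) - enn2real (I \<phi>)) / (y - \<phi>)) \<longlongrightarrow> D) (at_left \<phi>)"
    using deriv unfolding has_field_derivative_iff I_def[symmetric] .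
  from filterlim_compose[OF this filt]
  have "(\<lambda>n. (enn2real (I (l n)) - 1) / (l n - \<phi>)) \<longlonglongrightarrow> D" by (simp add: I\<phi>)
  moreover have "(enn2real (I (l n)) - 1) / (l n - \<phi>) = (1 - enn2real (I (l n))) / (\<phi> - l n)" for n
    by (metis minus_diff_eq minus_divide_divide)
  ultimately have lim: "(\<lambda>n. \<integral>\<^sup>+x. sl n x \<partial>Q 0) \<longlonglongrightarrow> ennreal D"
    unfolding int_sl by (intro tendsto_ennrealI) simp
  have slim: "(\<lambda>n. sl n x) \<longlonglongrightarrow> exit_ind (0, 0) x * (ennreal (exp (\<phi> * cycle x) * cycle x))" for x
  proof -
    have "((\<lambda>y. exp (y * cycle x)) has_real_derivative exp (\<phi> * cycle x) * cycle x) (at_left \<phi>)"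
      by (auto intro!: derivative_eq_intros)
    then have "((\<lambda>y. (exp (y * cycle x) - exp (\<phi> * cycle x)) / (y - \<phi>)) \<longlongrightarrow> exp (\<phi> * cycle x) * cycle x) (at_left \<phi>)"
      unfolding has_field_derivative_iff .
    from filterlim_compose[OF this filt]
    have "(\<lambda>n. (exp (l n * cycle x) - exp (\<phi> * cycle x)) / (l n - \<phi>)) \<longlonglongrightarrow> exp (\<phi> * cycle x) * cycle x" .
    moreover have "(exp (l n * cycle x) - exp (\<phi> * cycle x)) / (l n - \<phi>) = (exp (\<phi> * cycle x) - exp (l n * cycle x)) / (\<phi> - l n)" for n
      by (metis minus_diff_eq minus_divide_divide)
    ultimately have "(\<lambda>n. ennreal ((exp (\<phi> * cycle x) - exp (l n * cycle x)) / (\<phi> - l n))) \<longlonglongrightarrow> ennreal (exp (\<phi> * cycle x) * cycle x)"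
      by (intro tendsto_ennrealI) simp
    then show ?thesis unfolding sl_def exit_ind_def by (cases "exits (snd (0, 0)) x") auto
  qed
  have "(\<integral>\<^sup>+x. exit_ind (0, 0) x * wt x * ennreal (cycle x) \<partial>Q 0) = (\<integral>\<^sup>+x. liminf (\<lambda>n. sl n x) \<partial>Q 0)"
  proof (intro nn_integral_cong_AE, use AE_cycle in eventually_elim)
    case (elim x)
    have "liminf (\<lambda>n. sl n x) = exit_ind (0, 0) x * (ennreal (exp (\<phi> * cycle x) * cycle x))"
      by (rule lim_imp_Liminf[OF _ slim]) simp
    then show ?case using elim by (auto simp: exit_ind_def ennreal_mult)
  qed
  also have "\<dots> \<le> liminf (\<lambda>n. \<integral>\<^sup>+x. sl n x \<partial>Q 0)"
    using zero_mem by (intro nn_integral_liminf) simp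
  also have "\<dots> = ennreal D" by (rule lim_imp_Liminf[OF _ lim]) simp
  finally show ?thesis .
qed

definition \<nu> :: "real measure" where
  "\<nu> = distr (density (Q 0) (\<lambda>x. exit_ind (0, 0) x * wt x)) borel cycle"

lemma cycle_meas_Q0: "cycle \<in> density (Q 0) f \<rightarrow>\<^sub>M borel"
  using zero_mem by simp

lemma nn_integral_\<nu>:
  assumes [measurable]: "f \<in> borel_measurable borel"
  shows "(\<integral>\<^sup>+r. f r \<partial>\<nu>) = (\<integral>\<^sup>+x. exit_ind (0, 0) x * wt x * f (cycle x) \<partial>Q 0)"
  unfolding \<nu>_def using zero_mem
  by (subst nn_integral_distr[OF cycle_meas_Q0]) (auto simp: nn_integral_density)

lemma AE_\<nu>_pos: "AE r in \<nu>. 0 < r"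
  unfolding \<nu>_def
proof (subst AE_distr_iff[OF cycle_meas_Q0])
  have m: "(\<lambda>x. exit_ind (0, 0) x * wt x) \<in> borel_measurable (Q 0)" using zero_mem by simp
  show "AE x in density (Q 0) (\<lambda>x. exit_ind (0, 0) x * wt x). 0 < cycle x"
    unfolding AE_density[OF m]
    using AE_cycle by eventually_elim (auto simp: exit_ind_def split: if_splits)
qed simp

sublocale nu: renewal_law \<nu>
proof (intro renewal_law.intro renewal_law_axioms.intro prob_spaceI)
  have "emeasure \<nu> (space \<nu>) = (\<integral>\<^sup>+r. 1 \<partial>\<nu>)" by simp
  also have "\<dots> = gam (0, 0)" by (subst nn_integral_\<nu>) (auto simp: gam_def)
  finally show "emeasure \<nu> (space \<nu>) = 1" by (simp add: gam_origin)
  show sets: "sets \<nu> = sets borel" by (simp add: \<nu>_def)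
  show "AE r in \<nu>. 0 < r" by (rule AE_\<nu>_pos)
  have "(\<integral>\<^sup>+r. ennreal (norm r) \<partial>\<nu>) = (\<integral>\<^sup>+r. ennreal r \<partial>\<nu>)"
    by (intro nn_integral_cong_AE) (use AE_\<nu>_pos in eventually_elim, simp)
  also have "\<dots> < \<infinity>"
    using mean_bound by (subst nn_integral_\<nu>) (auto intro: order_le_less_trans)
  finally show "integrable \<nu> (\<lambda>r. r)"
    by (intro integrableI_bounded) (auto simp: \<nu>_def)
qed

text \<open>The mean of \<open>\<nu>\<close> is positive and at most \<open>D\<close>.\<close>

lemma D_pos: "0 < D"
proof -
  have "ennreal (nu.expectation (\<lambda>r. r)) = (\<integral>\<^sup>+r. ennreal r \<partial>\<nu>)"
    by (rule nn_integral_eq_integral[symmetric, OF nu.mean]) (use AE_\<nu>_pos in eventually_elim, simp)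
  also have "\<dots> \<le> ennreal D" using mean_bound by (subst nn_integral_\<nu>) auto
  finally show ?thesis using nu.mean_pos by (simp add: ennreal_le_iff2)
qed

end

section \<open>The renewal equation for survival from 0\<close>

lemma returned_after_zero_run:
  assumes "\<forall>r\<in>{0..v}. x r = 0" "0 \<le> v" "0 \<le> a"
  shows "returned x (v + a) \<longleftrightarrow> returned (path_shift v x) a"
proof
  assume "returned x (v + a)"
  then obtain r r' where r: "0 \<le> r" "r \<le> r'" "r' \<le> v + a" "x r \<noteq> 0" "x r' = 0"
    by (auto simp: returned_def)
  have "v < r" using assms(1) r by force
  then show "returned (path_shift v x) a"
    unfolding returned_def using r
    by (intro exI[of _ "r - v"] exI[of _ "r' - v"]) (auto simp: path_shift_apply)
next
  assume "returned (path_shift v x) a"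
  then obtain r r' where "0 \<le> r" "r \<le> r'" "r' \<le> a" "path_shift v x r \<noteq> 0" "path_shift v x r' = 0"
    by (auto simp: returned_def)
  then show "returned x (v + a)"
    unfolding returned_def using assms(2)
    by (intro exI[of _ "v + r"] exI[of _ "v + r'"]) (auto simp: path_shift_apply)
qed

lemma not_returned_zero_run:
  assumes "\<forall>r\<in>{0..v}. x r = 0" "a \<le> v"
  shows "\<not> returned x a"
  using assms unfolding returned_def by (metis atLeastAtMost_iff order_trans)

context yaglom
begin

text \<open>The value 0 at negative times makes \<open>Zf (t - cycle x)\<close> vanish when the
  return comes after \<open>t\<close>.\<close>

definition Zf :: "real \<Rightarrow> real" where
  "Zf t = (if t < 0 then 0 else exp (\<phi> * t) * enn2real (surv (0, 0) t))"

text \<open>The contribution of the paths that survive without a return; scaled by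
  \<open>exp (\<phi> * t)\<close> it is the inhomogeneous term of the renewal equation.\<close>

definition first :: "real \<Rightarrow> ennreal" where
  "first t = (\<integral>\<^sup>+x. (if returned x t then 0 else alive_ind (0, 0) t x) \<partial>Q 0)"

definition zf :: "real \<Rightarrow> real" where
  "zf t = (if t < 0 then 0 else exp (\<phi> * t) * enn2real (first t))"

lemma first_antimono: "s \<le> t \<Longrightarrow> first t \<le> first s"
  unfolding first_def
  by (intro nn_integral_mono) (auto simp: alive_ind_def dest: path_alive_mono returned_mono)

lemma first_le_1: "first t \<le> 1"
proof -
  have "first t \<le> (\<integral>\<^sup>+x. 1 \<partial>Q 0)" unfolding first_def by (intro nn_integral_mono) (auto simp: alive_ind_le_1)
  then show ?thesis unfolding Q_one[OF zero_mem] .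
qed

lemma first_real: "first t = ennreal (enn2real (first t))"
  using first_le_1[of t] by (metis ennreal_enn2real ennreal_one_less_top order_le_less_trans)

lemma Zf_ennreal: "0 \<le> t \<Longrightarrow> ennreal (Zf t) = ennreal (exp (\<phi> * t)) * surv (0, 0) t"
  by (subst surv_real[OF origin_mem]) (simp add: Zf_def ennreal_mult)

lemma zf_ennreal: "0 \<le> t \<Longrightarrow> ennreal (zf t) = ennreal (exp (\<phi> * t)) * first t"
  by (subst first_real) (simp add: zf_def ennreal_mult)

lemma Zf_meas: "Zf \<in> borel_measurable borel"
proof -
  have [measurable]: "surv (0, 0) \<in> borel_measurable borel" by (rule measurable_surv_time[OF origin_mem])
  show ?thesis unfolding Zf_def by measurable
qed

lemma zf_meas: "zf \<in> borel_measurable borel"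
proof -
  have "mono (\<lambda>t. - enn2real (first t))"
    using first_antimono
    by (intro monoI) (auto intro!: enn2real_mono order_le_less_trans[OF first_le_1])
  then have "(\<lambda>t. - enn2real (first t)) \<in> borel_measurable borel" by (rule borel_measurable_mono)
  then have [measurable]: "(\<lambda>t. enn2real (first t)) \<in> borel_measurable borel"
    by (rule borel_measurable_uminus[THEN measurable_cong[THEN iffD1, rotated]]) simp
  show ?thesis unfolding zf_def[abs_def] by measurable
qed

text \<open>At the return the factor \<open>exp (\<phi> * t)\<close> splits into
  \<open>exp (\<phi> * cycle x)\<close>, the density that defines \<open>\<nu>\<close>, and the
  scaling of the survival probability for the remaining time.\<close>

lemma Zf_eq:
  assumes t: "0 \<le> t"
  shows "ennreal (Zf t) = ennreal (zf t) + (\<integral>\<^sup>+r. ennreal (Zf (t - r)) \<partial>\<nu>)"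
proof -
  note [measurable] = Zf_meas
  have [measurable]: "surv (0, 0) \<in> borel_measurable borel" by (rule measurable_surv_time[OF origin_mem])
  have "ennreal (exp (\<phi> * t)) * (\<integral>\<^sup>+x. (if returned x t then exit_ind (0, 0) x * surv (0, 0) (t - cycle x) else 0) \<partial>Q 0) =
    (\<integral>\<^sup>+x. ennreal (exp (\<phi> * t)) * (if returned x t then exit_ind (0, 0) x * surv (0, 0) (t - cycle x) else 0) \<partial>Q 0)"
    using zero_mem by (intro nn_integral_cmult[symmetric]) simp
  also have "\<dots> = (\<integral>\<^sup>+x. exit_ind (0, 0) x * wt x * ennreal (Zf (t - cycle x)) \<partial>Q 0)"
  proof (intro nn_integral_cong_AE, use AE_cycle in eventually_elim)
    case (elim x)
    show ?case
    proof (cases "exits 0 x")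
      case True
      then have c: "cycle_time x = ereal (cycle x)" "0 < cycle x" "\<And>r. returned x r \<longleftrightarrow> cycle x \<le> r"
        using elim by auto
      show ?thesis
      proof (cases "cycle x \<le> t")
        case le: True
        have "ennreal (exp (\<phi> * cycle x)) * ennreal (Zf (t - cycle x)) =
           ennreal (exp (\<phi> * cycle x) * exp (\<phi> * (t - cycle x))) * surv (0, 0) (t - cycle x)"
          using le by (simp add: Zf_ennreal ennreal_mult mult.assoc)
        also have "exp (\<phi> * cycle x) * exp (\<phi> * (t - cycle x)) = exp (\<phi> * t)"
          by (simp add: exp_add[symmetric] algebra_simps)
        finally show ?thesis using True c le by (simp add: exit_ind_def)
      next
        case False
        then show ?thesis using c by (simp add: Zf_def)
      qed
    qed (simp add: exit_ind_def)
  qed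
  also have "\<dots> = (\<integral>\<^sup>+r. ennreal (Zf (t - r)) \<partial>\<nu>)" by (rule nn_integral_\<nu>[symmetric]) measurable
  finally have 1: "ennreal (exp (\<phi> * t)) * (\<integral>\<^sup>+x. (if returned x t then exit_ind (0, 0) x * surv (0, 0) (t - cycle x) else 0) \<partial>Q 0) =
     (\<integral>\<^sup>+r. ennreal (Zf (t - r)) \<partial>\<nu>)" .
  have "surv (0, 0) t = first t + (\<integral>\<^sup>+x. (if returned x t then exit_ind (0, 0) x * surv (0, 0) (t - cycle x) else 0) \<partial>Q 0)"
    using surv_renewal[OF origin_mem t] by (simp add: first_def)
  then show ?thesis using t 1 by (simp add: Zf_ennreal zf_ennreal distrib_left)
qed

text \<open>A path that is alive at a time \<open>t \<ge> 1\<close> and has not returned has left the origin in time;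
  its cycle time exceeds \<open>t\<close>.\<close>

lemma first_le_tail:
  assumes t: "1 \<le> t"
  shows "ennreal (zf t) \<le> ennreal (nu.tail t)"
proof -
  have "ennreal (zf t) = (\<integral>\<^sup>+x. ennreal (exp (\<phi> * t)) * (if returned x t then 0 else alive_ind (0, 0) t x) \<partial>Q 0)"
    using t zero_mem by (simp add: zf_ennreal first_def nn_integral_cmult)
  also have "\<dots> \<le> (\<integral>\<^sup>+x. exit_ind (0, 0) x * wt x * indicator {t<..} (cycle x) \<partial>Q 0)"
  proof (intro nn_integral_mono_AE, use AE_cycle in eventually_elim)
    case (elim x)
    show ?case
    proof (cases "\<not> returned x t \<and> path_alive 0 x t")
      case True
      then have ex: "exits 0 x" using alive_before_cycle[of 0 t x] t by auto
      then have c: "cycle_time x = ereal (cycle x)" "t < cycle x" using elim True by auto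
      have "exp (\<phi> * t) \<le> exp (\<phi> * cycle x)" using c phi_pos by simp
      then show ?thesis using True ex c by (simp add: exit_ind_def alive_ind_def ennreal_leI)
    qed (auto simp: alive_ind_def)
  qed
  also have "\<dots> = (\<integral>\<^sup>+r. indicator {t<..} r \<partial>\<nu>)" by (rule nn_integral_\<nu>[symmetric]) measurable
  also have "\<dots> = ennreal (nu.tail t)"
    by (simp add: nu.tail_def nu.emeasure_eq_measure)
  finally show ?thesis .
qed

lemma zf_nonneg: "0 \<le> zf t" by (simp add: zf_def)

lemma zf_le_tail: "1 \<le> t \<Longrightarrow> zf t \<le> nu.tail t"
  using first_le_tail[of t] nu.tail_nn[of t] zf_nonneg[of t] by (simp add: ennreal_le_iff)

lemma zf_le: "t \<le> 1 \<Longrightarrow> zf t \<le> exp \<phi>"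
proof (cases "t < 0")
  case False
  assume t: "t \<le> 1"
  have "enn2real (first t) \<le> 1" using first_le_1[of t] by (intro enn2real_leI) auto
  moreover have "exp (\<phi> * t) \<le> exp \<phi>" using t phi_pos False by (simp add: mult_left_le)
  ultimately have "exp (\<phi> * t) * enn2real (first t) \<le> exp \<phi> * 1" by (intro mult_mono) auto
  then show ?thesis using False by (simp add: zf_def)
qed (simp add: zf_def)

lemma tail_le_mean: "0 < t \<Longrightarrow> nu.tail t \<le> nu.expectation (\<lambda>r. r) / t"
proof -
  assume t: "0 < t"
  have "nu.expectation (\<lambda>r. t * indicator {t<..} r) \<le> nu.expectation (\<lambda>r. r)"
  proof (rule integral_mono_AE[OF _ nu.mean])
    show "integrable \<nu> (\<lambda>r. t * indicator {t<..} r)"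
      by (intro integrable_mult_right nu.integrable_const_bound[of _ 1]) auto
    show "AE r in \<nu>. t * indicator {t<..} r \<le> r"
      using nu.pos by eventually_elim (auto simp: indicator_def)
  qed
  then show ?thesis using t by (simp add: nu.tail_def field_simps)
qed

lemma zf_lim: "(zf \<longlongrightarrow> 0) at_top"
proof (rule tendsto_sandwich[of "\<lambda>_. 0" _ _ "\<lambda>t. nu.expectation (\<lambda>r. r) / t"])
  show "eventually (\<lambda>t. zf t \<le> nu.expectation (\<lambda>r. r) / t) at_top"
    using eventually_ge_at_top[of 1]
    by eventually_elim (rule order_trans[OF zf_le_tail tail_le_mean], auto)
  show "((\<lambda>t. nu.expectation (\<lambda>r. r) / t) \<longlongrightarrow> 0) at_top"
    by (rule tendsto_divide_0[OF tendsto_const filterlim_at_top_imp_at_infinity[OF filterlim_ident]])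
qed (auto simp: zf_nonneg)

definition Jz :: ennreal where "Jz = (\<integral>\<^sup>+t\<in>{0..}. ennreal (zf t) \<partial>lborel)"

text \<open>Up to time 1 the function is at most \<open>exp \<phi>\<close>; afterwards it is below
  the tail of \<open>\<nu>\<close>, whose integral is the finite mean.\<close>

lemma Jz_finite: "Jz < \<infinity>"
proof -
  note [measurable] = nu.tail_meas
  have "Jz \<le> (\<integral>\<^sup>+t. ennreal (exp \<phi>) * indicator {0..1} t + ennreal (nu.tail t) * indicator {0..} t \<partial>lborel)"
    unfolding Jz_def
  proof (intro nn_integral_mono)
    fix t :: real
    show "ennreal (zf t) * indicator {0..} t \<le> ennreal (exp \<phi>) * indicator {0..1} t + ennreal (nu.tail t) * indicator {0..} t"
    proof (cases "t \<le> 1")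
      case True
      then show ?thesis using zf_le[of t] by (auto simp: indicator_def intro!: add_increasing2 ennreal_leI)
    next
      case False
      then show ?thesis using zf_le_tail[of t] by (auto simp: indicator_def intro!: ennreal_leI)
    qed
  qed
  also have "\<dots> = ennreal (exp \<phi>) + ennreal (nu.expectation (\<lambda>r. r))"
    by (subst nn_integral_add) (auto simp: nn_integral_cmult_indicator nu.tail_integral)
  also have "\<dots> < \<infinity>" by simp
  finally show ?thesis .
qed

text \<open>Before time 1 a path that has stayed in 0 is alive and has not returned, and this has
  probability at least \<open>exp q00\<close>.\<close>

lemma Jz_pos: "0 < Jz"
proof -
  have low: "exp q00 \<le> zf t" if t: "0 \<le> t" "t < 1" for t
  proof -
    have "ennreal (exp (q00 * t)) = (\<integral>\<^sup>+x. (if \<forall>r\<in>{0..t}. x r = 0 then 1 else 0) \<partial>Q 0)"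
      using nn_integral_zero_on[OF t(1), of 1] by simp
    also have "\<dots> \<le> first t"
      unfolding first_def using hat_at_zero_run(1)[of t _ 0] not_returned_zero_run[of t _ t] t
      by (intro nn_integral_mono) (auto simp: alive_ind_def)
    finally have "ennreal (exp (q00 * t)) \<le> ennreal (enn2real (first t))" by (subst first_real[symmetric])
    then have "exp (q00 * t) \<le> enn2real (first t)" by (simp add: ennreal_le_iff)
    moreover have "exp q00 \<le> exp (q00 * t)" using t q00_neg by (simp add: mult_le_cancel_left1)
    ultimately have "exp q00 \<le> enn2real (first t)" by linarith
    moreover have "1 \<le> exp (\<phi> * t)" using t phi_pos by simp
    ultimately have "1 * exp q00 \<le> exp (\<phi> * t) * enn2real (first t)" by (intro mult_mono) auto
    then show ?thesis using t by (simp add: zf_def)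
  qed
  have "0 < ennreal (exp q00) * emeasure lborel {0..<1::real}" by simp
  also have "\<dots> = (\<integral>\<^sup>+t. ennreal (exp q00) * indicator {0..<1::real} t \<partial>lborel)"
    by (rule nn_integral_cmult_indicator[symmetric]) simp
  also have "\<dots> \<le> Jz" unfolding Jz_def
    by (intro nn_integral_mono) (auto simp: indicator_def intro!: ennreal_leI low)
  finally show ?thesis .
qed

lemma Zf_quasi: "0 \<le> t \<Longrightarrow> 0 \<le> s \<Longrightarrow> Zf (t + s) \<le> exp (\<phi> * s) * Zf t"
proof -
  assume ts: "0 \<le> t" "0 \<le> s"
  have "enn2real (surv (0, 0) (t + s)) \<le> enn2real (surv (0, 0) t)"
    using surv_le_1[OF origin_mem, of t] ts
    by (intro enn2real_mono surv_antimono) (auto intro: order_le_less_trans)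
  then have "exp (\<phi> * (t + s)) * enn2real (surv (0, 0) (t + s)) \<le> exp (\<phi> * (t + s)) * enn2real (surv (0, 0) t)"
    by (intro mult_left_mono) auto
  then show ?thesis using ts by (simp add: Zf_def distrib_left exp_add mult.assoc mult.left_commute)
qed

text \<open>Leaving by time \<open>1/2\<close> makes room for a delay: \<open>nu_early\<close>
  prolongs the stay in 0 by less than \<open>1/2\<close> without killing the path.\<close>

definition early :: "real \<Rightarrow> real \<Rightarrow> real" where
  "early a b = Q0.prob {x\<in>space \<D>. exits (1/2) x \<and> \<not> returned x a \<and> returned x b}"

text \<open>\<open>c\<close> is the infimum of the times by which an early exit has been followed by
  a return with positive probability. Such times exist, because leaving by time \<open>1/2\<close>
  has positive probability and is almost surely followed by a return.\<close>

lemma early_support: obtains c where "0 \<le> c" "\<And>e. 0 < e \<Longrightarrow> 0 < early (c - e) (c + e)"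
proof -
  define F where "F t = Q0.prob {x\<in>space \<D>. exits (1/2) x \<and> returned x t}" for t
  have m: "{x\<in>space \<D>. exits (1/2) x \<and> returned x t} \<in> Q0.events" for t using zero_mem by simp
  have Fmono: "F s \<le> F t" if "s \<le> t" for s t
    unfolding F_def using m that by (intro Q0.finite_measure_mono) (auto dest: returned_mono)
  have F0: "F 0 = 0" by (simp add: F_def not_returned_0)
  have ex: "\<exists>t. 0 < F t"
  proof (rule ccontr)
    assume "\<not> ?thesis"
    then have "F (real n) = 0" for n unfolding F_def by (metis measure_nonneg order_antisym not_less)
    then have "AE x in Q 0. \<not> (exits (1/2) x \<and> returned x (real n))" for n
      using m[of "real n"] by (subst AE_iff_measurable[OF m[of "real n"]])
        (auto simp: F_def Q0.emeasure_eq_measure zero_mem)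
    then have "AE x in Q 0. \<forall>n. \<not> (exits (1/2) x \<and> returned x (real n))"
      unfolding AE_all_countable by blast
    then have "AE x in Q 0. \<forall>r\<in>{0..1/2}. x r = 0"
      using AE_cycle
    proof eventually_elim
      case (elim x)
      show ?case
      proof (rule ccontr)
        assume "\<not> ?case"
        then have h: "exits (1/2) x" by (auto simp: exits_def)
        then have "exits 0 x" by (auto simp: exits_def)
        then have "returned x (real (nat \<lceil>cycle x\<rceil>))" using elim(2) by (auto simp: real_nat_ceiling_ge)
        then show False using elim(1) h by blast
      qed
    qed
    then have "Q0.prob {x\<in>space \<D>. \<forall>r\<in>{0..1/2}. x r = 0} = 1"
      using zero_mem by (subst Q0.prob_eq_1) (auto elim!: AE_mp intro!: AE_I2)
    then show False using prob_zero_on[of "1/2"] q00_neg by simp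
  qed
  define c where "c = Inf {t. 0 < F t}"
  have pos: "0 < t" if "0 < F t" for t
  proof (rule ccontr)
    assume "\<not> 0 < t"
    then have "F t \<le> F 0" by (intro Fmono) simp
    then show False using F0 that by simp
  qed
  have bdd: "bdd_below {t. 0 < F t}" using pos by (intro bdd_belowI[of _ 0]) (auto intro: less_imp_le)
  have ne: "{t. 0 < F t} \<noteq> {}" using ex by auto
  show thesis
  proof (rule that[of c])
    show "0 \<le> c" unfolding c_def using pos ne by (intro cInf_greatest) (auto intro: less_imp_le)
    fix e :: real assume e: "0 < e"
    obtain t where t: "0 < F t" "t < c + e" using cInf_lessD[OF ne, of "c + e"] e unfolding c_def by auto
    have Fe: "0 < F (c + e)" using Fmono[of t "c + e"] t by simp
    have "c - e \<notin> {t. 0 < F t}"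
    proof
      assume "c - e \<in> {t. 0 < F t}"
      then have "c \<le> c - e" unfolding c_def by (rule cInf_lower[OF _ bdd])
      then show False using e by simp
    qed
    then have Fz: "F (c - e) = 0" by (simp add: F_def zero_less_measure_iff)
    have "F (c + e) \<le> Q0.prob ({x\<in>space \<D>. exits (1/2) x \<and> returned x (c - e)} \<union>
       {x\<in>space \<D>. exits (1/2) x \<and> \<not> returned x (c - e) \<and> returned x (c + e)})"
      unfolding F_def using zero_mem by (intro Q0.finite_measure_mono) auto
    also have "\<dots> \<le> F (c - e) + early (c - e) (c + e)"
      unfolding F_def early_def using zero_mem by (intro measure_Un_le) auto
    finally show "0 < early (c - e) (c + e)" using Fe Fz by simp
  qed
qed

text \<open>A path that waits in 0 for a time \<open>v < 1/2\<close> and then behaves as in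
  \<open>early a b\<close> leaves 0 before age 1 and returns in \<open>(v + a, v + b]\<close>; its
  weight is at least 1. Varying \<open>v\<close> spreads the single point \<open>c\<close> over an
  interval.\<close>

lemma nu_early:
  assumes v: "0 \<le> v" "v < 1/2" and early: "0 < early a b" and ab: "a < b"
  shows "0 < nu.prob {v + a<..v + b}"
proof -
  let ?E = "\<lambda>x. exits (1/2) x \<and> \<not> returned x a \<and> returned x b"
  have b0: "0 < b"
  proof (rule ccontr)
    assume "\<not> 0 < b"
    then have "\<not> returned x b" for x using returned_mono[of x b 0] not_returned_0 by auto
    then show False using early by (simp add: early_def)
  qed
  define F :: "(real \<Rightarrow> nat) \<Rightarrow> ennreal" where "F x = (if \<forall>r\<in>{0..v}. x r = 0 then 1 else 0)" for x
  define G :: "(real \<Rightarrow> nat) \<Rightarrow> ennreal" where "G x = (if ?E x then 1 else 0)" for x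
  have [measurable]: "F \<in> borel_measurable \<D>" "G \<in> borel_measurable \<D>"
    unfolding F_def G_def using v by measurable
  have stop: "F (path_stop v x) = F x" for x by (simp add: F_def path_stop_def)
  have G0: "(\<integral>\<^sup>+z. G z \<partial>Q 0) = ennreal (early a b)"
    unfolding G_def early_def by (subst nn_integral_indicator_Q[OF zero_mem]) (auto simp: Q0.emeasure_eq_measure)
  have "0 < ennreal (exp (q00 * v)) * ennreal (early a b)" using early by (simp add: ennreal_zero_less_mult_iff)
  also have "\<dots> = (\<integral>\<^sup>+x. (if \<forall>r\<in>{0..v}. x r = 0 then ennreal (early a b) else 0) \<partial>Q 0)"
    by (subst nn_integral_zero_on[OF v(1)]) (simp add: mult.commute)
  also have "\<dots> = (\<integral>\<^sup>+x. F x * (\<integral>\<^sup>+z. G z \<partial>Q (x v)) \<partial>Q 0)"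
    using v by (intro nn_integral_cong) (auto simp: F_def G0)
  also have "\<dots> = (\<integral>\<^sup>+x. F x * G (path_shift v x) \<partial>Q 0)"
    using v by (intro markov_simple[symmetric] zero_mem stop) auto
  also have "\<dots> \<le> (\<integral>\<^sup>+x. exit_ind (0, 0) x * wt x * indicator {v + a<..v + b} (cycle x) \<partial>Q 0)"
  proof (intro nn_integral_mono_AE, use AE_cycle in eventually_elim)
    case (elim x)
    show ?case
    proof (cases "(\<forall>r\<in>{0..v}. x r = 0) \<and> ?E (path_shift v x)")
      case True
      then obtain r where r: "0 \<le> r" "r \<le> 1/2" "x (v + r) \<noteq> 0"
        by (auto simp: exits_def path_shift_apply)
      then have ex: "exits 0 x" using v unfolding exits_def by (intro bexI[of _ "v + r"]) auto
      then have c: "\<And>r. returned x r \<longleftrightarrow> cycle x \<le> r" using elim by auto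
      have "returned x (v + b)" using True v b0 returned_after_zero_run[of v x b] by simp
      moreover have "\<not> returned x (v + a)"
        using True v returned_after_zero_run[of v x a] not_returned_zero_run[of v x "v + a"]
        by (cases "0 \<le> a") auto
      ultimately have "cycle x \<in> {v + a<..v + b}" using c by auto
      moreover have "1 \<le> wt x" using phi_pos cycle_time_nonneg by (intro exp_ereal_ge_1) auto
      ultimately show ?thesis using ex True by (simp add: F_def G_def exit_ind_def)
    qed (auto simp: F_def G_def)
  qed
  also have "\<dots> = (\<integral>\<^sup>+r. indicator {v + a<..v + b} r \<partial>\<nu>)" by (rule nn_integral_\<nu>[symmetric]) measurable
  also have "\<dots> = ennreal (nu.prob {v + a<..v + b})" by (simp add: nu.emeasure_eq_measure)
  finally show ?thesis by simp
qed

lemma Zf_limit: obtains L B where "0 < L" "(Zf \<longlongrightarrow> L) at_top" "\<And>t. Zf t \<le> B"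
proof -
  obtain c where c: "0 \<le> c" "\<And>e. 0 < e \<Longrightarrow> 0 < early (c - e) (c + e)" using early_support by blast
  have Jr: "Jz = ennreal (enn2real Jz)" using Jz_finite by simp
  \<comment> \<open>Delays \<open>r - c\<close> between \<open>1/4\<close> and \<open>1/2\<close>
    are used, so that the left end of the support interval is positive even if
    \<open>c = 0\<close>.\<close>
  interpret R: renewal \<nu> Zf zf \<phi> "c + 1/4" "1/4" "enn2real Jz"
  proof
    show "(\<integral>\<^sup>+t\<in>{0..}. ennreal (zf t) \<partial>lborel) = ennreal (enn2real Jz)"
      using Jr by (simp add: Jz_def)
    fix r e :: real assume r: "c + 1/4 < r" "r < c + 1/4 + 1/4" "0 < e"
    have "0 < nu.prob {(r - c) + (c - e/2)<..(r - c) + (c + e/2)}"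
      using r by (intro nu_early c(2)) auto
    also have "\<dots> \<le> nu.prob {r - e<..<r + e}"
      using r by (intro nu.finite_measure_mono) auto
    finally show "0 < nu.prob {r - e<..<r + e}" .
  qed (use phi_pos c Zf_meas zf_meas zf_nonneg zf_lim Zf_eq Zf_quasi in \<open>auto simp: Zf_def\<close>)
  obtain B where B: "\<And>t. Zf t \<le> B" using R.Z_bounded by blast
  have "0 < enn2real Jz" using Jz_pos Jz_finite by (simp add: enn2real_positive_iff)
  then have "0 < enn2real Jz / nu.expectation (\<lambda>r. r)" using nu.mean_pos by simp
  then show thesis using R.renewal_limit B by (rule that)
qed

definition Lz :: real where "Lz = Lim at_top Zf"

lemma Zf_tendsto: "(Zf \<longlongrightarrow> Lz) at_top" and Lz_pos: "0 < Lz"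
proof -
  obtain L B where "0 < L" and L: "(Zf \<longlongrightarrow> L) at_top" by (rule Zf_limit)
  moreover have "Lz = L" unfolding Lz_def using L by (intro tendsto_Lim) auto
  ultimately show "(Zf \<longlongrightarrow> Lz) at_top" "0 < Lz" by auto
qed

section \<open>Scaled survival from a general state\<close>

definition scaled :: "hat_state \<Rightarrow> real \<Rightarrow> ennreal" where
  "scaled y t = ennreal (exp (\<phi> * t)) * surv y t"

text \<open>The integrand of \<open>scaled y t\<close> for \<open>t \<ge> 1\<close> after the
  decomposition at the first return: a path that has returned contributes its weight times
  \<open>Zf\<close> of the remaining time, and any other contributes only if its first stay in 0
  ended in time.\<close>

definition ht :: "hat_state \<Rightarrow> real \<Rightarrow> (real \<Rightarrow> nat) \<Rightarrow> ennreal" where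
  "ht y t x = (if returned x t then exit_ind y x * wt x * ennreal (Zf (t - cycle x))
     else ennreal (exp (\<phi> * t)) * exit_ind y x)"

lemma measurable_ht [measurable]: "ht y t \<in> borel_measurable \<D>"
proof -
  note [measurable] = Zf_meas
  show ?thesis unfolding ht_def by measurable
qed

text \<open>From time 1 on, surviving without a return is the same as \<open>exits\<close>, whatever
  the initial age.\<close>

lemma scaled_eq:
  assumes y: "y \<in> hat_states S" and t: "1 \<le> t"
  shows "scaled y t = (\<integral>\<^sup>+x. ht y t x \<partial>Q (fst y))"
proof -
  have i: "fst y \<in> S" using y by (rule hat_fst_mem)
  have u: "0 \<le> snd y" "snd y < 1" using hat_states_snd[OF y] by auto
  have [measurable]: "surv (0, 0) \<in> borel_measurable borel" by (rule measurable_surv_time[OF origin_mem])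
  have "surv y t = (\<integral>\<^sup>+x. (if returned x t then 0 else alive_ind y t x) +
     (if returned x t then exit_ind y x * surv (0, 0) (t - cycle x) else 0) \<partial>Q (fst y))"
    using t i by (subst surv_renewal[OF y]) (auto intro!: nn_integral_add[symmetric])
  then have "scaled y t = (\<integral>\<^sup>+x. ennreal (exp (\<phi> * t)) * ((if returned x t then 0 else alive_ind y t x) +
     (if returned x t then exit_ind y x * surv (0, 0) (t - cycle x) else 0)) \<partial>Q (fst y))"
    unfolding scaled_def using i by (simp add: nn_integral_cmult)
  also have "\<dots> = (\<integral>\<^sup>+x. ht y t x \<partial>Q (fst y))"
  proof (rule nn_integral_cong)
    fix x assume "x \<in> space (Q (fst y))"
    then have x: "x \<in> space \<D>" using i by simp
    show "ennreal (exp (\<phi> * t)) * ((if returned x t then 0 else alive_ind y t x) +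
     (if returned x t then exit_ind y x * surv (0, 0) (t - cycle x) else 0)) = ht y t x"
    proof (cases "returned x t")
      case True
      note c = cycleE[OF x True]
      have "ennreal (exp (\<phi> * cycle x)) * ennreal (Zf (t - cycle x)) =
           ennreal (exp (\<phi> * cycle x) * exp (\<phi> * (t - cycle x))) * surv (0, 0) (t - cycle x)"
        using c(2) by (simp add: Zf_ennreal ennreal_mult mult.assoc)
      also have "exp (\<phi> * cycle x) * exp (\<phi> * (t - cycle x)) = exp (\<phi> * t)"
        by (simp add: exp_add[symmetric] algebra_simps)
      finally show ?thesis using True by (simp add: ht_def c(1) exit_ind_def)
    next
      case False
      then show ?thesis using alive_before_cycle[OF u, of t x] t u
        by (simp add: ht_def exit_ind_def alive_ind_def)
    qed
  qed
  finally show ?thesis .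
qed

lemma wt_gt:
  assumes "x \<in> space \<D>" "\<not> returned x t"
  shows "ennreal (exp (\<phi> * t)) \<le> wt x"
proof (rule exp_ereal_mono_time[OF phi_pos])
  have "\<not> cycle_time x \<le> ereal t" using cycle_time_le_iff[OF path_space_cadlag[OF assms(1)]] assms(2) by simp
  then show "ereal t \<le> cycle_time x" by simp
qed

text \<open>Before the return \<open>exp (\<phi> * t)\<close> is at most the weight, because the
  cycle time exceeds \<open>t\<close>; afterwards \<open>Zf\<close> is bounded. The majorant is
  uniform in \<open>t\<close>, as dominated convergence requires.\<close>

lemma ht_bound: obtains C where "0 \<le> C" "\<And>y t x. x \<in> space \<D> \<Longrightarrow> ht y t x \<le> ennreal C * (exit_ind y x * wt x)"
proof -
  obtain L B where "0 < L" "(Zf \<longlongrightarrow> L) at_top" and B: "\<And>t. Zf t \<le> B"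
    by (rule Zf_limit) (rule that, assumption+)
  show thesis
  proof (rule that[of "max 1 B"])
    fix y t x assume x: "x \<in> space \<D>"
    show "ht y t x \<le> ennreal (max 1 B) * (exit_ind y x * wt x)"
    proof (cases "returned x t")
      case True
      have "ennreal (Zf (t - cycle x)) \<le> ennreal (max 1 B)" using B by (intro ennreal_leI) (simp add: le_max_iff_disj)
      from mult_right_mono[OF this, of "exit_ind y x * wt x"]
      show ?thesis using True by (simp add: ht_def mult.commute[of _ "ennreal (Zf (t - cycle x))"])
    next
      case False
      have "1 * (exit_ind y x * ennreal (exp (\<phi> * t))) \<le> ennreal (max 1 B) * (exit_ind y x * wt x)"
        by (intro mult_mono wt_gt x False) auto
      then show ?thesis using False by (simp add: ht_def mult.commute)
    qed
  qed simp
qed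

lemma ht_lim:
  assumes x: "x \<in> space \<D>" and T: "filterlim T at_top sequentially"
  shows "(\<lambda>n. ht y (T n) x) \<longlonglongrightarrow> exit_ind y x * wt x * ennreal Lz"
proof (cases "exits (snd y) x")
  case False
  then show ?thesis by (simp add: ht_def exit_ind_def cong: if_cong)
next
  case ex: True
  show ?thesis
  proof (cases "cycle_time x = \<infinity>")
    \<comment> \<open>Without a return the weight is infinite, and the terms
      \<open>exp (\<phi> * T n)\<close> do tend to infinity.\<close>
    case True
    then have "\<not> returned x t" for t using cycle_time_le_iff[OF path_space_cadlag[OF x], of t] by simp
    then have "ht y (T n) x = ennreal (exp (\<phi> * T n))" for n using ex by (simp add: ht_def exit_ind_def)
    moreover have "filterlim (\<lambda>n. exp (\<phi> * T n)) at_top sequentially"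
      by (intro filterlim_compose[OF exp_at_top] filterlim_tendsto_pos_mult_at_top[OF tendsto_const phi_pos T])
    ultimately show ?thesis
      using True ex phi_pos Lz_pos by (simp add: exp_ereal_def exit_ind_def ennreal_tendsto_top_eq_at_top ennreal_top_mult)
  next
    case False
    note c = cycle_time_finiteE[OF x False]
    have "(\<lambda>n. Zf (T n - cycle x)) \<longlonglongrightarrow> Lz"
      using filterlim_compose[OF Zf_tendsto filterlim_tendsto_add_at_top[OF tendsto_const[of "- cycle x"] T]]
      by simp
    then have "(\<lambda>n. wt x * ennreal (Zf (T n - cycle x))) \<longlonglongrightarrow> wt x * ennreal Lz"
      by (intro ennreal_tendsto_cmult tendsto_ennrealI) (simp add: c(1))
    moreover have "eventually (\<lambda>n. cycle x \<le> T n) sequentially" using T by (simp add: filterlim_at_top)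
    then have "eventually (\<lambda>n. wt x * ennreal (Zf (T n - cycle x)) = ht y (T n) x) sequentially"
      by eventually_elim (use ex c(3) in \<open>simp add: ht_def exit_ind_def\<close>)
    ultimately have "(\<lambda>n. ht y (T n) x) \<longlonglongrightarrow> wt x * ennreal Lz" by (rule Lim_transform_eventually)
    then show ?thesis using ex by (simp add: exit_ind_def)
  qed
qed

lemma ev_ge_1: "filterlim T at_top sequentially \<Longrightarrow> eventually (\<lambda>n. (1::real) \<le> T n) sequentially"
  by (simp add: filterlim_at_top)

lemma gam_Lz: "y \<in> hat_states S \<Longrightarrow> (\<integral>\<^sup>+x. exit_ind y x * wt x * ennreal Lz \<partial>Q (fst y)) = gam y * ennreal Lz"
  unfolding gam_def using hat_fst_mem by (intro nn_integral_multc) simp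

text \<open>Fatou's lemma yields this half of the limit even where \<open>gam y\<close> could still
  be infinite, and the proof of finiteness rests on it.\<close>

lemma scaled_liminf:
  assumes y: "y \<in> hat_states S" and T: "filterlim T at_top sequentially"
  shows "gam y * ennreal Lz \<le> liminf (\<lambda>n. scaled y (T n))"
proof -
  have i: "fst y \<in> S" using y by (rule hat_fst_mem)
  have "gam y * ennreal Lz = (\<integral>\<^sup>+x. liminf (\<lambda>n. ht y (T n) x) \<partial>Q (fst y))"
    unfolding gam_Lz[OF y, symmetric]
    by (intro nn_integral_cong lim_imp_Liminf[symmetric] ht_lim T) (auto simp: i)
  also have "\<dots> \<le> liminf (\<lambda>n. \<integral>\<^sup>+x. ht y (T n) x \<partial>Q (fst y))"
    using i by (intro nn_integral_liminf) simp
  also have "\<dots> = liminf (\<lambda>n. scaled y (T n))"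
    by (rule Liminf_eq) (use ev_ge_1[OF T] in eventually_elim, simp add: scaled_eq[OF y])
  finally show ?thesis .
qed

lemma scaled_bound: obtains C where "0 \<le> C" "\<And>y t. y \<in> hat_states S \<Longrightarrow> 1 \<le> t \<Longrightarrow> scaled y t \<le> ennreal C * gam y"
proof -
  obtain C where C: "0 \<le> C" "\<And>y t x. x \<in> space \<D> \<Longrightarrow> ht y t x \<le> ennreal C * (exit_ind y x * wt x)"
    by (rule ht_bound) blast
  show thesis
  proof (rule that[OF C(1)])
    fix y t assume y: "y \<in> hat_states S" and t: "1 \<le> (t::real)"
    have i: "fst y \<in> S" using y by (rule hat_fst_mem)
    have "scaled y t \<le> (\<integral>\<^sup>+x. ennreal C * (exit_ind y x * wt x) \<partial>Q (fst y))"
      unfolding scaled_eq[OF y t] using i by (intro nn_integral_mono C(2)) simp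
    then show "scaled y t \<le> ennreal C * gam y"
      unfolding gam_def using i by (simp add: nn_integral_cmult)
  qed
qed

text \<open>Dominated convergence by \<open>ht_bound\<close>; the integral of the majorant is a
  multiple of \<open>gam y\<close>.\<close>

lemma scaled_lim_seq:
  assumes y: "y \<in> hat_states S" and fin: "gam y < \<infinity>" and T: "filterlim T at_top sequentially"
  shows "(\<lambda>n. scaled y (T n)) \<longlonglongrightarrow> gam y * ennreal Lz"
proof -
  have i: "fst y \<in> S" using y by (rule hat_fst_mem)
  obtain C where C: "0 \<le> C" "\<And>y t x. x \<in> space \<D> \<Longrightarrow> ht y t x \<le> ennreal C * (exit_ind y x * wt x)"
    by (rule ht_bound) blast
  have "(\<lambda>n. \<integral>\<^sup>+x. ht y (T n) x \<partial>Q (fst y)) \<longlonglongrightarrow> (\<integral>\<^sup>+x. exit_ind y x * wt x * ennreal Lz \<partial>Q (fst y))"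
  proof (rule nn_integral_dominated_convergence[where w="\<lambda>x. ennreal C * (exit_ind y x * wt x)"])
    show "AE x in Q (fst y). (\<lambda>n. ht y (T n) x) \<longlonglongrightarrow> exit_ind y x * wt x * ennreal Lz"
      by (intro AE_I2 ht_lim T) (simp add: i)
    show "AE x in Q (fst y). ht y (T n) x \<le> ennreal C * (exit_ind y x * wt x)" for n
      by (intro AE_I2 C(2)) (simp add: i)
    show "(\<integral>\<^sup>+x. ennreal C * (exit_ind y x * wt x) \<partial>Q (fst y)) < \<infinity>"
      using fin i unfolding gam_def by (simp add: nn_integral_cmult ennreal_mult_less_top)
  qed (use i in simp_all)
  then have "(\<lambda>n. \<integral>\<^sup>+x. ht y (T n) x \<partial>Q (fst y)) \<longlonglongrightarrow> gam y * ennreal Lz" by (simp add: gam_Lz[OF y])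
  moreover have "eventually (\<lambda>n. (\<integral>\<^sup>+x. ht y (T n) x \<partial>Q (fst y)) = scaled y (T n)) sequentially"
    using ev_ge_1[OF T] by eventually_elim (simp add: scaled_eq[OF y])
  ultimately show ?thesis by (rule Lim_transform_eventually)
qed

lemma measurable_gam [measurable]: "gam \<in> borel_measurable \<H>"
proof -
  have "(\<lambda>(y, x). (if full_holding_time x \<le> ereal (1 - snd y) then 1 else 0) * wt x :: ennreal) \<in> borel_measurable (\<H> \<Otimes>\<^sub>M \<D>)"
    by measurable
  from measurable_integral_Q[OF this]
  show ?thesis
  proof (rule measurable_cong[THEN iffD1, rotated])
    fix y assume "y \<in> space \<H>"
    then have i: "fst y \<in> S" by (simp add: hat_fst_mem)
    show "(\<integral>\<^sup>+x. (if full_holding_time x \<le> ereal (1 - snd y) then 1 else 0) * wt x \<partial>Q (fst y)) = gam y"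
      unfolding gam_def using i
      by (intro nn_integral_cong) (simp add: exit_ind_def exits_iff path_space_cadlag)
  qed
qed

lemma measurable_scaled [measurable]: "(\<lambda>y. scaled y t) \<in> borel_measurable \<H>"
  unfolding scaled_def by measurable

lemma scaled_markov:
  assumes y: "y \<in> hat_states S" and s: "0 \<le> s" and t: "0 \<le> t"
  shows "scaled y (s + t) = ennreal (exp (\<phi> * s)) * (\<integral>\<^sup>+x. alive_ind y s x * scaled (hat_at y s x) t \<partial>Q (fst y))"
proof -
  have i: "fst y \<in> S" using y by (rule hat_fst_mem)
  have [measurable]: "(\<lambda>x. surv (hat_at y s x) t) \<in> borel_measurable \<D>"
    by (rule measurable_compose[OF measurable_hat_at'[OF y s] measurable_surv])
  have "(\<integral>\<^sup>+x. alive_ind y s x * scaled (hat_at y s x) t \<partial>Q (fst y)) =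
     (\<integral>\<^sup>+x. ennreal (exp (\<phi> * t)) * (alive_ind y s x * surv (hat_at y s x) t) \<partial>Q (fst y))"
    unfolding scaled_def by (intro nn_integral_cong) (simp add: ac_simps)
  also have "\<dots> = ennreal (exp (\<phi> * t)) * surv y (s + t)"
    unfolding surv_markov[OF y s t] using i by (intro nn_integral_cmult) simp
  finally show ?thesis
    unfolding scaled_def by (simp add: distrib_left exp_add ennreal_mult mult.assoc)
qed

lemma unscaled_markov:
  assumes y: "y \<in> hat_states S" and s: "0 \<le> s" and t: "0 \<le> t"
  shows "(\<integral>\<^sup>+x. alive_ind y s x * scaled (hat_at y s x) t \<partial>Q (fst y)) = ennreal (exp (- \<phi> * s)) * scaled y (s + t)"
  unfolding scaled_markov[OF assms]
  by (simp add: mult.assoc[symmetric] ennreal_mult[symmetric] exp_add[symmetric])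

section \<open>Finiteness and harmonicity of the weight function\<close>

definition hsum :: "hat_state \<Rightarrow> real \<Rightarrow> ennreal" where
  "hsum y s = (\<integral>\<^sup>+x. alive_ind y s x * gam (hat_at y s x) \<partial>Q (fst y))"

lemma measurable_hat_comp:
  assumes "y \<in> hat_states S" "0 \<le> s" "f \<in> borel_measurable \<H>"
  shows "(\<lambda>x. f (hat_at y s x)) \<in> borel_measurable \<D>"
  by (rule measurable_compose[OF measurable_hat_at'[OF assms(1,2)] assms(3)])

text \<open>The Markov property writes \<open>scaled y (s + n)\<close> as a mean of
  \<open>scaled\<close> over the states at time \<open>s\<close>. Fatou's lemma bounds the limit of
  this mean from below by \<open>gam\<close> at these states, finite or not, while
  \<open>scaled y (s + n)\<close> itself converges because \<open>gam y\<close> is finite.\<close>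

lemma superharmonic:
  assumes y: "y \<in> hat_states S" and fin: "gam y < \<infinity>" and s: "0 \<le> s"
  shows "ennreal (exp (\<phi> * s)) * hsum y s \<le> gam y"
proof -
  have i: "fst y \<in> S" using y by (rule hat_fst_mem)
  note [measurable] = measurable_hat_comp[OF y s measurable_gam] measurable_hat_comp[OF y s measurable_scaled]
  have T: "filterlim real at_top sequentially" by (rule filterlim_real_sequentially)
  have h: "hat_at y s x \<in> hat_states S" if "x \<in> space (Q (fst y))" for x
    using that i y s path_space_mem by (intro hat_at_in_hat_states) auto
  have E0: "ennreal (exp (\<phi> * s)) \<noteq> 0" "ennreal (exp (\<phi> * s)) \<noteq> top" by auto
  have "hsum y s * ennreal Lz = (\<integral>\<^sup>+x. alive_ind y s x * (gam (hat_at y s x) * ennreal Lz) \<partial>Q (fst y))"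
    unfolding hsum_def using i by (subst nn_integral_multc[symmetric]) (auto simp: mult.assoc)
  also have "\<dots> \<le> (\<integral>\<^sup>+x. liminf (\<lambda>n. alive_ind y s x * scaled (hat_at y s x) (real n)) \<partial>Q (fst y))"
  proof (rule nn_integral_mono)
    fix x assume "x \<in> space (Q (fst y))"
    from scaled_liminf[OF h[OF this] T]
    show "alive_ind y s x * (gam (hat_at y s x) * ennreal Lz) \<le> liminf (\<lambda>n. alive_ind y s x * scaled (hat_at y s x) (real n))"
      by (simp add: alive_ind_def)
  qed
  also have "\<dots> \<le> liminf (\<lambda>n. \<integral>\<^sup>+x. alive_ind y s x * scaled (hat_at y s x) (real n) \<partial>Q (fst y))"
    using i by (intro nn_integral_liminf) simp
  also have "\<dots> = ennreal (exp (- \<phi> * s)) * (gam y * ennreal Lz)"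
  proof (rule lim_imp_Liminf)
    have "filterlim (\<lambda>n. s + real n) at_top sequentially"
      by (rule filterlim_tendsto_add_at_top[OF tendsto_const T])
    then have "(\<lambda>n. ennreal (exp (- \<phi> * s)) * scaled y (s + real n)) \<longlonglongrightarrow> ennreal (exp (- \<phi> * s)) * (gam y * ennreal Lz)"
      by (intro ennreal_tendsto_cmult scaled_lim_seq[OF y fin]) simp
    then show "(\<lambda>n. \<integral>\<^sup>+x. alive_ind y s x * scaled (hat_at y s x) (real n) \<partial>Q (fst y)) \<longlonglongrightarrow>
        ennreal (exp (- \<phi> * s)) * (gam y * ennreal Lz)"
      by (simp add: unscaled_markov[OF y s])
  qed simp
  finally have "ennreal Lz * hsum y s \<le> ennreal Lz * (ennreal (exp (- \<phi> * s)) * gam y)" by (simp add: ac_simps)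
  then have "hsum y s \<le> ennreal (exp (- \<phi> * s)) * gam y"
    using Lz_pos by (subst (asm) ennreal_mult_le_mult_iff) auto
  then have "ennreal (exp (\<phi> * s)) * hsum y s \<le> ennreal (exp (\<phi> * s)) * (ennreal (exp (- \<phi> * s)) * gam y)"
    by (rule mult_left_mono) simp
  also have "\<dots> = gam y" by (simp add: mult.assoc[symmetric] ennreal_mult[symmetric] exp_add[symmetric])
  finally show ?thesis .
qed

text \<open>A path from \<open>0\<close> to \<open>i \<noteq> 0\<close> is followed from a rational time shortly before its last
  exit from \<open>0\<close>: from then on it is alive.\<close>

lemma alive_reach:
  assumes x: "x \<in> space \<D>" "x 0 = 0" and t: "0 \<le> t" "x t = i" and i: "i \<noteq> 0"
  obtains q :: rat where "0 \<le> real_of_rat q" "real_of_rat q \<le> t" "x (real_of_rat q) = 0"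
    "path_alive 0 (path_shift (real_of_rat q) x) (t - real_of_rat q)"
proof -
  note xc = path_space_cadlag[OF x(1)]
  define A where "A = {r\<in>{0..t}. x r = 0}"
  have ne: "A \<noteq> {}" using x(2) t(1) by (auto simp: A_def)
  have bdd: "bdd_above A" by (rule bdd_aboveI[of _ t]) (auto simp: A_def)
  \<comment> \<open>The supremum of the times spent in 0 is not attained, since a zero at
    \<open>m\<close> would persist to the right; \<open>m\<close> is the last exit time.\<close>
  define m where "m = Sup A"
  have m0: "0 \<le> m" unfolding m_def using x(2) t(1) by (intro cSup_upper2[OF _ _ bdd, of 0]) (auto simp: A_def)
  have mt: "m \<le> t" unfolding m_def using ne by (intro cSup_least) (auto simp: A_def)
  have up: "r \<le> m" if "r \<in> A" for r unfolding m_def by (rule cSup_upper[OF that bdd])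
  have xm: "x m \<noteq> 0"
  proof
    assume z: "x m = 0"
    then have "m \<noteq> t" using t(2) i by auto
    obtain e where e: "e > 0" "\<And>r. m \<le> r \<Longrightarrow> r < m + e \<Longrightarrow> x r = x m"
      using cadlag_right_const[OF xc m0] by blast
    define r where "r = m + min (e / 2) (t - m)"
    have r: "m < r" "r < m + e" "r \<le> t" using e(1) mt \<open>m \<noteq> t\<close> by (auto simp: r_def min_def)
    have "x r = 0" using e(2)[of r] r z by simp
    then have "r \<in> A" using r m0 by (simp add: A_def)
    from up[OF this] show False using r by simp
  qed
  have mpos: "0 < m" using m0 xm x(2) by (cases "m = 0") auto
  obtain e l where e: "e > 0" "e \<le> m" "\<And>r. m - e \<le> r \<Longrightarrow> r < m \<Longrightarrow> x r = l"
    using cadlag_left_const[OF xc mpos] by blast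
  have "m - e < m" using e(1) by simp
  then obtain a where a: "a \<in> A" "m - e < a" unfolding m_def using less_cSupE[OF _ ne] by blast
  have "a < m" using up[OF a(1)] a(1) xm by (cases "a = m") (auto simp: A_def)
  then have l: "l = 0" using e(3)[of a] a by (simp add: A_def)
  have nz: "x r \<noteq> 0" if "m \<le> r" "r \<le> t" for r
  proof
    assume "x r = 0"
    then have "r \<in> A" using that m0 by (simp add: A_def)
    then have "r = m" using up that by force
    then show False using \<open>x r = 0\<close> xm by simp
  qed
  \<comment> \<open>\<open>q > m - e\<close> puts the path in 0 from \<open>q\<close> until
    \<open>m\<close>, and \<open>q > m - 1/2\<close> keeps the age, restarted from 0 at
    \<open>q\<close>, below 1 until the exit.\<close>
  obtain q :: rat where q: "max (m - e) (m - 1 / 2) < real_of_rat q" "real_of_rat q < m"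
    using of_rat_dense[of "max (m - e) (m - 1 / 2)" m] e(1) by auto
  let ?z = "path_shift (real_of_rat q) x"
  have "m - e < real_of_rat q" using q(1) by simp
  then have q0: "0 \<le> real_of_rat q" using e(2) by linarith
  have xq: "x r = 0" if "real_of_rat q \<le> r" "r < m" for r using e(3)[of r] q that l by auto
  have nr: "\<not> returned ?z (t - real_of_rat q)"
  proof
    assume "returned ?z (t - real_of_rat q)"
    then obtain r r' where r: "0 \<le> r" "r \<le> r'" "r' \<le> t - real_of_rat q" "?z r \<noteq> 0" "?z r' = 0"
      by (auto simp: returned_def)
    then have "m \<le> real_of_rat q + r" using xq[of "real_of_rat q + r"]
      by (cases "real_of_rat q + r < m") (auto simp: path_shift_apply not_less)
    then show False using nz[of "real_of_rat q + r'"] r by (auto simp: path_shift_apply)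
  qed
  have "exits 0 ?z"
    unfolding exits_def using q xm by (intro bexI[of _ "m - real_of_rat q"]) (auto simp: path_shift_apply)
  then have "path_alive 0 ?z (t - real_of_rat q)"
    using alive_before_cycle[OF _ _ _ nr, of 0] q mt by simp
  then show thesis using q0 q mt xq by (intro that[of q]) auto
qed

text \<open>If the killed process from 0 never charged \<open>i\<close>, the Markov property at each
  rational \<open>q\<close> would make the event of \<open>alive_reach\<close> null. The countable
  union over \<open>q\<close> would then be null as well, although \<open>i\<close> is reached from
  0 with positive probability.\<close>

lemma alive_reach_prob:
  assumes i: "i \<in> S" "i \<noteq> 0"
  obtains s where "0 \<le> s" "0 < (\<integral>\<^sup>+x. alive_ind (0, 0) s x * (if x s = i then 1 else 0) \<partial>Q 0)"
proof (rule ccontr)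
  assume n: "\<not> thesis"
  note ex = that
  define G where "G s = (\<lambda>x. alive_ind (0, 0) s x * (if x s = i then 1 else 0 :: ennreal))" for s
  have [measurable]: "G s \<in> borel_measurable \<D>" for s unfolding G_def by measurable
  have G0: "(\<integral>\<^sup>+x. G s x \<partial>Q 0) = 0" if "0 \<le> s" for s
  proof (rule ccontr)
    assume "(\<integral>\<^sup>+x. G s x \<partial>Q 0) \<noteq> 0"
    then have "0 < (\<integral>\<^sup>+x. G s x \<partial>Q 0)" by (simp add: zero_less_iff_neq_zero)
    then show False using n ex[OF \<open>0 \<le> s\<close>] unfolding G_def by simp
  qed
  obtain t where t: "0 \<le> t" "0 < measure (Q 0) {x\<in>space \<D>. x t = i}"
    using Q_irreducible[OF i(1)] by blast
  have "AE x in Q 0. real_of_rat q \<in> {0..t} \<longrightarrow> (if x (real_of_rat q) = 0 then 1 else 0) * G (t - real_of_rat q) (path_shift (real_of_rat q) x) = 0" for q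
  proof (cases "real_of_rat q \<in> {0..t}")
    case True
    let ?r = "real_of_rat q"
    let ?F = "\<lambda>x. if x ?r = 0 then 1 else 0 :: ennreal"
    have Fm: "?F \<in> borel_measurable \<D>" by measurable
    have r: "0 \<le> ?r" using True by simp
    have stop: "?F (path_stop ?r x) = ?F x" for x by (simp add: path_stop_def)
    have Gm: "G (t - ?r) \<in> borel_measurable \<D>" by measurable
    have "(\<integral>\<^sup>+x. ?F x * G (t - ?r) (path_shift ?r x) \<partial>Q 0) = (\<integral>\<^sup>+x. ?F x * (\<integral>\<^sup>+z. G (t - ?r) z \<partial>Q (x ?r)) \<partial>Q 0)"
      by (rule markov_simple[of 0 ?r ?F "G (t - ?r)", OF zero_mem r Fm Gm stop])
    also have "\<dots> = (\<integral>\<^sup>+x. 0 \<partial>Q 0)"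
      using True by (intro nn_integral_cong) (auto simp: G0)
    finally have z: "(\<integral>\<^sup>+x. ?F x * G (t - ?r) (path_shift ?r x) \<partial>Q 0) = 0" by simp
    have "(\<lambda>x. G (t - ?r) (path_shift ?r x)) \<in> borel_measurable \<D>"
      by (rule measurable_compose[OF measurable_path_shift[OF r] Gm])
    then have "(\<lambda>x. ?F x * G (t - ?r) (path_shift ?r x)) \<in> borel_measurable (Q 0)"
      using Fm zero_mem by simp
    from nn_integral_0_iff_AE[OF this] z have "AE x in Q 0. ?F x * G (t - ?r) (path_shift ?r x) = 0" by simp
    then show ?thesis by eventually_elim simp
  next
    case False
    then show ?thesis by (intro AE_I2 impI) blast
  qed
  then have "AE x in Q 0. \<forall>q. real_of_rat q \<in> {0..t} \<longrightarrow> (if x (real_of_rat q) = 0 then 1 else 0) * G (t - real_of_rat q) (path_shift (real_of_rat q) x) = 0"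
    unfolding AE_all_countable by blast
  then have "AE x in Q 0. \<not> (x t = i)"
    using Q_start[OF zero_mem] AE_space
  proof eventually_elim
    case (elim x)
    have xD: "x \<in> space \<D>" using elim(3) zero_mem by simp
    show ?case
    proof
      assume xt: "x t = i"
      obtain q :: rat where q: "0 \<le> real_of_rat q" "real_of_rat q \<le> t" "x (real_of_rat q) = 0"
        "path_alive 0 (path_shift (real_of_rat q) x) (t - real_of_rat q)"
        by (rule alive_reach[OF xD elim(2) t(1) xt i(2)])
      have "G (t - real_of_rat q) (path_shift (real_of_rat q) x) = 1"
        using q xt by (simp add: G_def alive_ind_def path_shift_apply)
      then show False using elim(1)[rule_format, of q] q by simp
    qed
  qed
  then have "measure (Q 0) {x\<in>space \<D>. x t = i} = 0"
    using zero_mem by (subst Q0.prob_eq_0) auto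
  then show False using t by simp
qed

text \<open>In 0 a larger age only removes paths. For \<open>i \<noteq> 0\<close>,
  \<open>gam (i, 0)\<close> times the positive probability of being alive in \<open>i\<close> at
  time \<open>s\<close> is at most \<open>hsum (0, 0) s\<close>, which superharmonicity bounds by
  \<open>gam (0, 0) = 1\<close>.\<close>

lemma gam_finite:
  assumes y: "y \<in> hat_states S"
  shows "gam y < \<infinity>"
proof (cases "fst y = 0")
  case True
  have "gam y \<le> gam (0, 0)"
    unfolding gam_def True fst_conv using hat_states_snd[OF y]
    by (intro nn_integral_mono mult_right_mono) (auto simp: exit_ind_def exits_def)
  then show ?thesis by (simp add: gam_origin order_le_less_trans)
next
  case False
  define i where "i = fst y"
  have i: "i \<in> S" "i \<noteq> 0" and yi: "y = (i, 0)"
    using y False hat_fst_mem[OF y] by (auto simp: i_def hat_states_iff prod_eq_iff)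
  obtain s where s: "0 \<le> s" "0 < (\<integral>\<^sup>+x. alive_ind (0, 0) s x * (if x s = i then 1 else 0) \<partial>Q 0)"
    by (rule alive_reach_prob[OF i])
  have "gam (i, 0) * (\<integral>\<^sup>+x. alive_ind (0, 0) s x * (if x s = i then 1 else 0) \<partial>Q 0) =
     (\<integral>\<^sup>+x. gam (i, 0) * (alive_ind (0, 0) s x * (if x s = i then 1 else 0)) \<partial>Q 0)"
    using zero_mem by (intro nn_integral_cmult[symmetric]) simp
  also have "\<dots> \<le> hsum (0, 0) s"
    unfolding hsum_def fst_conv
  proof (intro nn_integral_mono)
    fix x
    have "hat_at (0, 0) s x = (i, 0)" if "path_alive 0 x s" "x s = i"
      using that i by (intro prod_eqI) (auto simp: hat_at_def snd_hat_X)
    then show "gam (i, 0) * (alive_ind (0, 0) s x * (if x s = i then 1 else 0)) \<le> alive_ind (0, 0) s x * gam (hat_at (0, 0) s x)"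
      by (simp add: alive_ind_def)
  qed
  also have "\<dots> \<le> ennreal (exp (\<phi> * s)) * hsum (0, 0) s"
    using mult_right_mono[of 1 "ennreal (exp (\<phi> * s))" "hsum (0, 0) s"] phi_pos s(1) by simp
  also have "\<dots> \<le> gam (0, 0)" by (intro superharmonic origin_mem s(1)) (simp add: gam_origin)
  finally have "gam (i, 0) * (\<integral>\<^sup>+x. alive_ind (0, 0) s x * (if x s = i then 1 else 0) \<partial>Q 0) \<le> 1"
    by (simp add: gam_origin)
  then have "gam (i, 0) \<noteq> \<infinity>" using s(2) by (auto simp: ennreal_top_mult top_unique split: if_splits)
  then show ?thesis unfolding yi by (simp add: less_top)
qed

lemma scaled_lim: "y \<in> hat_states S \<Longrightarrow> filterlim T at_top sequentially \<Longrightarrow> (\<lambda>n. scaled y (T n)) \<longlonglongrightarrow> gam y * ennreal Lz"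
  by (intro scaled_lim_seq gam_finite)

text \<open>Dominated convergence with a multiple of \<open>gam (hat_at y s x)\<close> as majorant,
  integrable by superharmonicity. The constant weight gives harmonicity; a test functional of the
  path up to \<open>s\<close> gives the limit of the conditioned laws.\<close>

lemma weighted_lim:
  fixes F :: "(real \<Rightarrow> nat) \<Rightarrow> ennreal"
  assumes y: "y \<in> hat_states S" and s: "0 \<le> s" and T: "filterlim T at_top sequentially"
    and F [measurable]: "F \<in> borel_measurable \<D>" and F_le: "\<And>x. F x \<le> ennreal b"
  shows "(\<lambda>n. \<integral>\<^sup>+x. F x * alive_ind y s x * scaled (hat_at y s x) (T n) \<partial>Q (fst y)) \<longlonglongrightarrow>
    (\<integral>\<^sup>+x. F x * alive_ind y s x * gam (hat_at y s x) \<partial>Q (fst y)) * ennreal Lz"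
proof -
  have i: "fst y \<in> S" using y by (rule hat_fst_mem)
  note [measurable] = measurable_hat_comp[OF y s measurable_gam] measurable_hat_comp[OF y s measurable_scaled]
  have h: "hat_at y s x \<in> hat_states S" if "x \<in> space (Q (fst y))" for x
    using that i y s path_space_mem by (intro hat_at_in_hat_states) auto
  obtain C where C: "0 \<le> C" "\<And>y t. y \<in> hat_states S \<Longrightarrow> 1 \<le> t \<Longrightarrow> scaled y t \<le> ennreal C * gam y"
    by (rule scaled_bound) blast
  have hs: "hsum y s < \<infinity>"
  proof -
    have "hsum y s \<le> ennreal (exp (\<phi> * s)) * hsum y s"
      using mult_right_mono[of 1 "ennreal (exp (\<phi> * s))" "hsum y s"] phi_pos s by simp
    also have "\<dots> \<le> gam y" by (intro superharmonic y s gam_finite)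
    finally show ?thesis using gam_finite[OF y] by (rule order_le_less_trans)
  qed
  \<comment> \<open>The majorant is available for arguments of at least 1, so the sequence is
    started at \<open>n0\<close>; \<open>LIMSEQ_offset\<close> undoes this.\<close>
  obtain n0 where n0: "\<And>n. n0 \<le> n \<Longrightarrow> 1 \<le> T n"
    using ev_ge_1[OF T] by (auto simp: eventually_sequentially)
  have T0: "filterlim (\<lambda>n. T (n + n0)) at_top sequentially"
    by (rule filterlim_compose[OF T filterlim_add_const_nat_at_top])
  have "(\<lambda>n. \<integral>\<^sup>+x. F x * alive_ind y s x * scaled (hat_at y s x) (T (n + n0)) \<partial>Q (fst y)) \<longlonglongrightarrow>
    (\<integral>\<^sup>+x. F x * alive_ind y s x * (gam (hat_at y s x) * ennreal Lz) \<partial>Q (fst y))"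
  proof (rule nn_integral_dominated_convergence[where w="\<lambda>x. ennreal b * ennreal C * (alive_ind y s x * gam (hat_at y s x))"])
    show "AE x in Q (fst y). (\<lambda>n. F x * alive_ind y s x * scaled (hat_at y s x) (T (n + n0))) \<longlonglongrightarrow>
        F x * alive_ind y s x * (gam (hat_at y s x) * ennreal Lz)"
    proof (rule AE_I2)
      fix x assume "x \<in> space (Q (fst y))"
      have "F x * alive_ind y s x \<le> ennreal b * 1" by (intro mult_mono F_le alive_ind_le_1) auto
      then have "F x * alive_ind y s x < top" by (rule order_le_less_trans) simp
      then show "(\<lambda>n. F x * alive_ind y s x * scaled (hat_at y s x) (T (n + n0))) \<longlonglongrightarrow>
        F x * alive_ind y s x * (gam (hat_at y s x) * ennreal Lz)"
        by (intro ennreal_tendsto_cmult scaled_lim[OF h[OF \<open>x \<in> space (Q (fst y))\<close>] T0])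
    qed
    show "AE x in Q (fst y). F x * alive_ind y s x * scaled (hat_at y s x) (T (n + n0)) \<le>
        ennreal b * ennreal C * (alive_ind y s x * gam (hat_at y s x))" for n
    proof (rule AE_I2)
      fix x assume x: "x \<in> space (Q (fst y))"
      have "F x * alive_ind y s x * scaled (hat_at y s x) (T (n + n0)) \<le> ennreal b * alive_ind y s x * (ennreal C * gam (hat_at y s x))"
        using n0[of "n + n0"] by (intro mult_mono F_le C(2) h[OF x]) auto
      then show "F x * alive_ind y s x * scaled (hat_at y s x) (T (n + n0)) \<le>
        ennreal b * ennreal C * (alive_ind y s x * gam (hat_at y s x))" by (simp add: ac_simps)
    qed
    have "(\<integral>\<^sup>+x. ennreal b * ennreal C * (alive_ind y s x * gam (hat_at y s x)) \<partial>Q (fst y)) = ennreal b * ennreal C * hsum y s"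
      unfolding hsum_def using i by (intro nn_integral_cmult) simp
    also have "\<dots> < \<infinity>" using hs by (simp add: ennreal_mult_less_top)
    finally show "(\<integral>\<^sup>+x. ennreal b * ennreal C * (alive_ind y s x * gam (hat_at y s x)) \<partial>Q (fst y)) < \<infinity>" .
  qed (use i in simp_all)
  also have "(\<integral>\<^sup>+x. F x * alive_ind y s x * (gam (hat_at y s x) * ennreal Lz) \<partial>Q (fst y)) =
     (\<integral>\<^sup>+x. F x * alive_ind y s x * gam (hat_at y s x) \<partial>Q (fst y)) * ennreal Lz"
    using i by (subst nn_integral_multc[symmetric]) (auto simp: mult.assoc)
  finally show ?thesis by (rule LIMSEQ_offset)
qed

text \<open>The limit of \<open>scaled y (s + n)\<close> is computed twice, directly and through the
  states at time \<open>s\<close>.\<close>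

lemma harmonic:
  assumes y: "y \<in> hat_states S" and s: "0 \<le> s"
  shows "ennreal (exp (\<phi> * s)) * hsum y s = gam y"
proof -
  have T: "filterlim real at_top sequentially" by (rule filterlim_real_sequentially)
  have Ts: "filterlim (\<lambda>n. s + real n) at_top sequentially"
    by (rule filterlim_tendsto_add_at_top[OF tendsto_const T])
  have "(\<lambda>n. \<integral>\<^sup>+x. 1 * alive_ind y s x * scaled (hat_at y s x) (real n) \<partial>Q (fst y)) \<longlonglongrightarrow>
    (\<integral>\<^sup>+x. 1 * alive_ind y s x * gam (hat_at y s x) \<partial>Q (fst y)) * ennreal Lz"
    by (rule weighted_lim[OF y s T, where b=1]) auto
  then have "(\<lambda>n. ennreal (exp (\<phi> * s)) * (\<integral>\<^sup>+x. alive_ind y s x * scaled (hat_at y s x) (real n) \<partial>Q (fst y))) \<longlonglongrightarrow>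
    ennreal (exp (\<phi> * s)) * (hsum y s * ennreal Lz)"
    unfolding hsum_def by (intro ennreal_tendsto_cmult) simp_all
  then have "(\<lambda>n. scaled y (s + real n)) \<longlonglongrightarrow> ennreal (exp (\<phi> * s)) * (hsum y s * ennreal Lz)"
    by (simp add: scaled_markov[OF y s])
  from LIMSEQ_unique[OF this scaled_lim[OF y Ts]]
  have e: "ennreal Lz * (ennreal (exp (\<phi> * s)) * hsum y s) = ennreal Lz * gam y" by (simp add: ac_simps)
  have nz: "ennreal Lz \<noteq> 0" "ennreal Lz \<noteq> top" using Lz_pos by auto
  show ?thesis
    by (rule antisym; rule ennreal_mult_le_mult_iff[OF nz, THEN iffD1]; rule eq_refl)
       (rule e, rule e[symmetric])
qed

end

section \<open>The weight function at the states \<open>(0, u)\<close>\<close>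

lemma exp_integral:
  fixes a v :: real
  assumes "0 \<le> v"
  shows "integral {0..v} (\<lambda>s. exp (a * s)) = (if a = 0 then v else (exp (a * v) - 1) / a)"
proof (cases "a = 0")
  case True
  then show ?thesis using assms by simp
next
  case False
  have "((\<lambda>s. exp (a * s)) has_integral (exp (a * v) / a - exp (a * 0) / a)) {0..v}"
    using assms False
    by (intro fundamental_theorem_of_calculus)
       (auto intro!: derivative_eq_intros simp flip: has_real_derivative_iff_has_vector_derivative)
  then show ?thesis using False by (simp add: integral_unique diff_divide_distrib)
qed

text \<open>If \<open>a \<noteq> 0\<close>, writing 1 as \<open>v + (1 - v)\<close> and as
  \<open>(1 - v) + v\<close> gives two linear equations for \<open>G v\<close> and
  \<open>G (1 - v)\<close>. If \<open>a = 0\<close> these coincide, and monotonicity helps as for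
  Cauchy's equation: \<open>G\<close> fixes the positive fractions up to 1, hence every
  \<open>v\<close>.\<close>

lemma cocycle_solution:
  fixes G :: "real \<Rightarrow> real"
  assumes coc: "\<And>s r. 0 < s \<Longrightarrow> 0 < r \<Longrightarrow> s + r \<le> 1 \<Longrightarrow> G (s + r) = G s + exp (a * s) * G r"
    and mono: "\<And>s t. 0 < s \<Longrightarrow> s \<le> t \<Longrightarrow> t \<le> 1 \<Longrightarrow> G s \<le> G t"
    and one: "G 1 = 1" and nn: "\<And>s. 0 \<le> G s" and v: "0 < v" "v \<le> 1"
  shows "G v = integral {0..v} (\<lambda>s. exp (a * s)) / integral {0..1} (\<lambda>s. exp (a * s))"
proof (cases "v = 1")
  case True
  then show ?thesis using one by (simp add: exp_integral)
next
  case False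
  then have v1: "v < 1" using v by simp
  show ?thesis
  proof (cases "a = 0")
    case False
    have 1: "1 = G v + exp (a * v) * G (1 - v)" using coc[of v "1 - v"] v1 v one by simp
    have 2: "1 = G (1 - v) + exp (a * (1 - v)) * G v" using coc[of "1 - v" v] v1 v one by simp
    have e: "exp (a * v) * exp (a * (1 - v)) = exp a" by (simp add: exp_add[symmetric] algebra_simps)
    have "exp (a * v) = exp (a * v) * G (1 - v) + exp (a * v) * (exp (a * (1 - v)) * G v)"
      using arg_cong[OF 2, of "\<lambda>x. exp (a * v) * x"] by (simp add: distrib_left)
    then have "exp (a * v) = (1 - G v) + exp a * G v"
      using 1 e by (simp add: mult.assoc[symmetric])
    then have "G v * (exp a - 1) = exp (a * v) - 1" by (simp add: algebra_simps)
    moreover have J: "integral {0..v} (\<lambda>s. exp (a * s)) = (exp (a * v) - 1) / a"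
      "integral {0..1} (\<lambda>s. exp (a * s)) = (exp a - 1) / a"
      using exp_integral[of v a] exp_integral[of 1 a] False v by auto
    moreover have "exp a - 1 \<noteq> 0" using False by simp
    ultimately have "G v = (exp (a * v) - 1) / (exp a - 1)" by (simp add: nonzero_eq_divide_eq)
    then show ?thesis unfolding J using False by simp
  next
    case True
    have add: "G (s + r) = G s + G r" if "0 < s" "0 < r" "s + r \<le> 1" for s r
      using coc[OF that] True by simp
    have mult: "G (real (Suc k) * x) = real (Suc k) * G x" if "0 < x" "real (Suc k) * x \<le> 1" for k x
      using that(2)
    proof (induction k)
      case (Suc k)
      have "real (Suc k) * x \<le> real (Suc (Suc k)) * x" using that(1) by (intro mult_right_mono) auto
      then have le: "real (Suc k) * x \<le> 1" using Suc.prems by simp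
      have eq: "real (Suc (Suc k)) * x = real (Suc k) * x + x" by (simp add: algebra_simps)
      have "G (real (Suc (Suc k)) * x) = G (real (Suc k) * x) + G x"
        using add[of "real (Suc k) * x" x] Suc.prems that(1) unfolding eq by simp
      then show ?case using Suc.IH[OF le] by (simp add: algebra_simps)
    qed simp
    have frac: "G (real k / real (Suc n)) = real k / real (Suc n)" if "0 < k" "k \<le> Suc n" for k n
    proof -
      have "1 = real (Suc n) * G (1 / real (Suc n))"
        using mult[of "1 / real (Suc n)" n] one by simp
      then have g: "G (1 / real (Suc n)) = 1 / real (Suc n)" by (simp add: field_simps)
      obtain j where j: "k = Suc j" using \<open>0 < k\<close> by (cases k) auto
      have "real k * (1 / real (Suc n)) \<le> 1" using that(2) by simp
      then show ?thesis using mult[of "1 / real (Suc n)" j] g j by simp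
    qed
    have close: "\<bar>G v - v\<bar> \<le> 1 / real (Suc n)" for n
    proof -
      \<comment> \<open>\<open>k / (n + 1)\<close> and \<open>(k + 1) / (n + 1)\<close> enclose
        \<open>v\<close>, and \<open>G\<close> fixes them; for \<open>k = 0\<close> the lower bound
        is nonnegativity of \<open>G\<close>.\<close>
      define k where "k = nat \<lfloor>v * real (Suc n)\<rfloor>"
      have k: "real k = of_int \<lfloor>v * real (Suc n)\<rfloor>" unfolding k_def using v by simp
      have k1: "real k \<le> v * real (Suc n)" unfolding k by linarith
      have k2: "v * real (Suc n) < real k + 1" unfolding k by linarith
      have "v * real (Suc n) < 1 * real (Suc n)" using v1 by (intro mult_strict_right_mono) auto
      with k1 have "real k < 1 * real (Suc n)" by (rule order_le_less_trans)
      then have kn: "k < Suc n" by simp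
      have lo: "real k / real (Suc n) \<le> G v"
      proof (cases "k = 0")
        case False
        have "G (real k / real (Suc n)) \<le> G v"
          using False k1 v by (intro mono) (simp_all add: field_simps)
        then show ?thesis using frac[of k n] False kn by simp
      qed (simp add: nn)
      have "G v \<le> G (real (Suc k) / real (Suc n))"
        using k2 v kn by (intro mono) (simp_all add: field_simps)
      then have hi: "G v \<le> real (Suc k) / real (Suc n)" using frac[of "Suc k" n] kn by simp
      have "real k / real (Suc n) \<le> v" "v \<le> real (Suc k) / real (Suc n)"
        using k1 k2 by (simp_all add: field_simps)
      moreover have "real (Suc k) / real (Suc n) = real k / real (Suc n) + 1 / real (Suc n)" by (simp add: add_divide_distrib)
      ultimately show ?thesis using lo hi by linarith
    qed
    have "\<bar>G v - v\<bar> \<le> 0"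
    proof (rule LIMSEQ_le_const[of "\<lambda>n. 1 / real (Suc n)"])
      show "(\<lambda>n. 1 / real (Suc n)) \<longlonglongrightarrow> 0" by real_asymp
    qed (use close in auto)
    then show ?thesis using True v by (simp add: exp_integral)
  qed
qed

text \<open>Waiting in 0 creates no return, so it delays the first return by exactly the waiting
  time, also when this return never comes.\<close>

lemma cycle_time_shift:
  assumes xc: "cadlag_on {0..} x" and z: "\<forall>r\<in>{0..s}. x r = 0" and s: "0 \<le> s"
  shows "cycle_time x = ereal s + cycle_time (path_shift s x)"
proof -
  let ?z = "path_shift s x"
  have zc: "cadlag_on {0..} ?z" by (rule cadlag_path_shift[OF xc s])
  note iff = cycle_time_le_iff[OF xc] cycle_time_le_iff[OF zc]
  have ret: "returned x (s + a) \<longleftrightarrow> returned ?z a" if "0 \<le> a" for a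
    by (rule returned_after_zero_run[OF z s that])
  show ?thesis
  proof (cases "cycle_time x")
    case (real b)
    then have rb: "returned x b" using iff(1)[of b] by simp
    then have "s < b" using not_returned_zero_run[OF z, of b] by (cases "b \<le> s") auto
    then have "returned ?z (b - s)" using ret[of "b - s"] rb by simp
    then have le: "cycle_time ?z \<le> ereal (b - s)" using iff(2) by simp
    then obtain c where c: "cycle_time ?z = ereal c" "0 \<le> c"
      using cycle_time_nonneg[of ?z] by (cases "cycle_time ?z") auto
    then have "returned ?z c" using iff(2)[of c] by simp
    then have "returned x (s + c)" using ret c by simp
    then have "b \<le> s + c" using iff(1)[of "s + c"] real by simp
    then show ?thesis using le c real by simp
  next
    case PInf
    have "cycle_time ?z = \<infinity>"
    proof (rule ccontr)
      assume "cycle_time ?z \<noteq> \<infinity>"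
      then obtain c where c: "cycle_time ?z = ereal c" "0 \<le> c"
        using cycle_time_nonneg[of ?z] by (cases "cycle_time ?z") auto
      then have "returned ?z c" using iff(2)[of c] by simp
      then have "returned x (s + c)" using ret c by simp
      then show False using iff(1)[of "s + c"] PInf by simp
    qed
    then show ?thesis using PInf by simp
  qed (use cycle_time_nonneg[of x] in auto)
qed

lemma exits_antimono: "u \<le> v \<Longrightarrow> exits v x \<Longrightarrow> exits u x"
  unfolding exits_def by (meson atLeastAtMost_iff diff_left_mono order_trans)

context yaglom
begin

lemma wt_shift:
  assumes "cadlag_on {0..} x" "\<forall>r\<in>{0..s}. x r = 0" "0 \<le> s"
  shows "wt x = ennreal (exp (\<phi> * s)) * wt (path_shift s x)"
  unfolding cycle_time_shift[OF assms] using phi_pos cycle_time_nonneg[of "path_shift s x"]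
  by (cases "cycle_time (path_shift s x)")
     (auto simp: exp_ereal_def distrib_left exp_add ennreal_mult ennreal_mult_top)

text \<open>With a remaining time \<open>s + r\<close>, a path leaves 0 within \<open>s\<close>, or
  stays for \<open>s\<close> and then leaves within \<open>r\<close>. The second possibility carries
  \<open>exp (q00 * s)\<close> for the stay and \<open>exp (\<phi> * s)\<close> for the delay of the
  return.\<close>

lemma gam_cocycle:
  assumes s: "0 < s" and r: "0 < r" and sr: "s + r \<le> 1"
  shows "gam (0, 1 - (s + r)) = gam (0, 1 - s) + ennreal (exp ((\<phi> + q00) * s)) * gam (0, 1 - r)"
proof -
  define F :: "(real \<Rightarrow> nat) \<Rightarrow> ennreal" where "F x = (if \<forall>q\<in>{0..s}. x q = 0 then 1 else 0)" for x
  define G :: "(real \<Rightarrow> nat) \<Rightarrow> ennreal" where "G x = exit_ind (0, 1 - r) x * wt x" for x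
  have [measurable]: "F \<in> borel_measurable \<D>" "G \<in> borel_measurable \<D>"
    unfolding F_def G_def using s by measurable
  have s0: "0 \<le> s" using s by simp
  note [measurable] = measurable_path_shift[OF s0]
  have stop: "F (path_stop s x) = F x" for x by (simp add: F_def path_stop_def)
  have "gam (0, 1 - (s + r)) = (\<integral>\<^sup>+x. exit_ind (0, 1 - s) x * wt x + ennreal (exp (\<phi> * s)) * (F x * G (path_shift s x)) \<partial>Q 0)"
    unfolding gam_def fst_conv
  proof (rule nn_integral_cong)
    fix x assume "x \<in> space (Q 0)"
    then have xc: "cadlag_on {0..} x" using zero_mem path_space_cadlag by simp
    show "exit_ind (0, 1 - (s + r)) x * wt x = exit_ind (0, 1 - s) x * wt x + ennreal (exp (\<phi> * s)) * (F x * G (path_shift s x))"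
    proof (cases "\<forall>q\<in>{0..s}. x q = 0")
      case True
      have "exits (1 - (s + r)) x \<longleftrightarrow> exits (1 - r) (path_shift s x)"
      proof
        assume "exits (1 - (s + r)) x"
        then obtain q where q: "0 \<le> q" "q \<le> s + r" "x q \<noteq> 0" by (auto simp: exits_def)
        then have "s < q" using True by force
        then show "exits (1 - r) (path_shift s x)"
          unfolding exits_def using q by (intro bexI[of _ "q - s"]) (auto simp: path_shift_apply)
      next
        assume "exits (1 - r) (path_shift s x)"
        then obtain q where "0 \<le> q" "q \<le> r" "x (s + q) \<noteq> 0" by (auto simp: exits_def path_shift_apply)
        then show "exits (1 - (s + r)) x" unfolding exits_def using s by (intro bexI[of _ "s + q"]) auto
      qed
      moreover have "\<not> exits (1 - s) x" using True by (simp add: exits_def)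
      ultimately show ?thesis using True wt_shift[OF xc True s0] by (simp add: F_def G_def exit_ind_def)
    next
      case False
      then have "exits (1 - s) x" by (simp add: exits_def)
      moreover from this have "exits (1 - (s + r)) x" using r by (force simp: exits_def)
      moreover have "F x = 0" unfolding F_def using False by (rule if_not_P)
      ultimately show ?thesis by (simp add: exit_ind_def)
    qed
  qed
  also have "\<dots> = gam (0, 1 - s) + ennreal (exp (\<phi> * s)) * (\<integral>\<^sup>+x. F x * G (path_shift s x) \<partial>Q 0)"
    unfolding gam_def fst_conv using zero_mem by (subst nn_integral_add) (auto simp: nn_integral_cmult)
  also have "(\<integral>\<^sup>+x. F x * G (path_shift s x) \<partial>Q 0) = (\<integral>\<^sup>+x. F x * (\<integral>\<^sup>+z. G z \<partial>Q (x s)) \<partial>Q 0)"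
    by (intro markov_simple zero_mem stop s0) auto
  also have "\<dots> = (\<integral>\<^sup>+x. (if \<forall>q\<in>{0..s}. x q = 0 then gam (0, 1 - r) else 0) \<partial>Q 0)"
    using s by (intro nn_integral_cong) (auto simp: F_def G_def gam_def)
  also have "\<dots> = gam (0, 1 - r) * ennreal (exp (q00 * s))" by (rule nn_integral_zero_on[OF s0])
  also have "ennreal (exp (\<phi> * s)) * (gam (0, 1 - r) * ennreal (exp (q00 * s))) = ennreal (exp ((\<phi> + q00) * s)) * gam (0, 1 - r)"
  proof -
    have e: "exp ((\<phi> + q00) * s) = exp (\<phi> * s) * exp (q00 * s)" by (simp add: distrib_right exp_add)
    show ?thesis unfolding e by (simp add: ennreal_mult ac_simps)
  qed
  finally show ?thesis .
qed

lemma gam_le_1: "u < 1 \<Longrightarrow> 0 \<le> u \<Longrightarrow> gam (0, u) \<le> 1"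
  unfolding gam_origin[symmetric] unfolding gam_def fst_conv
  by (intro nn_integral_mono mult_right_mono) (auto simp: exit_ind_def exits_def)

text \<open>This solves the cocycle equation for \<open>G v = gam (0, 1 - v)\<close>, normalised at
  the full remaining time 1. Its exponent \<open>\<phi> + q00\<close> is
  \<open>\<phi> - q\<^sub>0\<close>, as the diagonal entry is minus the exit rate.\<close>

lemma gam_origin_formula:
  assumes u: "0 \<le> u" "u < 1"
  shows "gam (0, u) = ennreal (integral {0..1 - u} (\<lambda>s. exp ((\<phi> + q00) * s)) / integral {0..1} (\<lambda>s. exp ((\<phi> + q00) * s)))"
proof -
  define G where "G v = enn2real (gam (0, 1 - v))" for v
  have Gnn: "0 \<le> G v" for v by (simp add: G_def)
  have G: "gam (0, 1 - v) = ennreal (G v)" if "0 < v" "v \<le> 1" for v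
    unfolding G_def using gam_le_1[of "1 - v"] that
    by (intro ennreal_enn2real[symmetric]) (auto intro: order_le_less_trans)
  have "G (1 - u) = integral {0..1 - u} (\<lambda>s. exp ((\<phi> + q00) * s)) / integral {0..1} (\<lambda>s. exp ((\<phi> + q00) * s))"
  proof (rule cocycle_solution)
    fix s r :: real assume sr: "0 < s" "0 < r" "s + r \<le> 1"
    have "ennreal (G (s + r)) = ennreal (G s) + ennreal (exp ((\<phi> + q00) * s)) * ennreal (G r)"
      using gam_cocycle[OF sr] sr G[of s] G[of r] G[of "s + r"] by simp
    also have "\<dots> = ennreal (G s + exp ((\<phi> + q00) * s) * G r)"
      using Gnn by (simp add: ennreal_mult)
    finally show "G (s + r) = G s + exp ((\<phi> + q00) * s) * G r"
      using Gnn by (subst (asm) ennreal_inj) auto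
  next
    fix s t :: real assume st: "0 < s" "s \<le> t" "t \<le> 1"
    have "gam (0, 1 - s) \<le> gam (0, 1 - t)"
      unfolding gam_def fst_conv using exits_antimono[of "1 - t" "1 - s"] st
      by (intro nn_integral_mono mult_right_mono) (auto simp: exit_ind_def)
    then have "ennreal (G s) \<le> ennreal (G t)" using G[of s] G[of t] st by simp
    then show "G s \<le> G t" using Gnn by (subst (asm) ennreal_le_iff) auto
  next
    show "G 1 = 1" by (simp add: G_def gam_origin)
  qed (use u Gnn in auto)
  then show ?thesis using G[of "1 - u"] u by simp
qed

text \<open>All weights are at least 1. In 0 the probability of leaving in time is positive; outside
  0 almost every path satisfies \<open>exits\<close>.\<close>

lemma gam_pos:
  assumes y: "y \<in> hat_states S"
  shows "0 < gam y"
proof (cases "fst y = 0")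
  case True
  define u where "u = snd y"
  have u: "0 \<le> u" "u < 1" and yu: "y = (0, u)"
    using y True hat_states_snd[OF y] by (auto simp: u_def prod_eq_iff)
  have "0 < ennreal (1 - exp (q00 * (1 - u)))" using u q00_neg by (simp add: mult_neg_pos)
  also have "\<dots> = emeasure (Q 0) (space (Q 0) - {x\<in>space \<D>. \<forall>r\<in>{0..1 - u}. x r = 0})"
  proof -
    have "{x\<in>space \<D>. \<forall>r\<in>{0..1 - u}. x r = 0} \<in> Q0.events" using zero_mem u by simp
    from Q0.prob_compl[OF this] show ?thesis unfolding Q0.emeasure_eq_measure using prob_zero_on[of "1 - u"] u by simp
  qed
  also have "\<dots> = (\<integral>\<^sup>+x. indicator (space (Q 0) - {x\<in>space \<D>. \<forall>r\<in>{0..1 - u}. x r = 0}) x \<partial>Q 0)"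
    using zero_mem u by (intro nn_integral_indicator[symmetric]) simp
  also have "\<dots> \<le> (\<integral>\<^sup>+x. exit_ind y x * wt x \<partial>Q 0)"
    using zero_mem phi_pos exp_ereal_ge_1[of \<phi>, OF _ cycle_time_nonneg]
    by (intro nn_integral_mono) (auto simp: yu exit_ind_def exits_def indicator_def)
  also have "\<dots> = gam y" by (simp add: gam_def yu)
  finally show ?thesis .
next
  case False
  have "0 < (\<integral>\<^sup>+x. 1 \<partial>Q (fst y))" unfolding Q_one[OF hat_fst_mem[OF y]] by simp
  also have "\<dots> \<le> gam y"
    unfolding gam_def
  proof (intro nn_integral_mono_AE, use AE_start_hat[OF y] in eventually_elim)
    case (elim x)
    have "exits (snd y) x" unfolding exits_def using elim False hat_states_snd[OF y] by (intro bexI[of _ 0]) auto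
    then show ?case using phi_pos exp_ereal_ge_1[of \<phi>, OF _ cycle_time_nonneg] by (simp add: exit_ind_def)
  qed
  finally show ?thesis .
qed

section \<open>The Doob transform\<close>

text \<open>A multiplicative functional along the flow with mean 1, hence a density that turns the
  chain into a new Markov process on \<open>[0, t]\<close>.\<close>

definition tilt :: "hat_state \<Rightarrow> real \<Rightarrow> (real \<Rightarrow> nat) \<Rightarrow> ennreal" where
  "tilt y t x = ennreal (exp (\<phi> * t)) * alive_ind y t x * (gam (hat_at y t x) / gam y)"

lemma measurable_tilt [measurable (raw)]:
  assumes [measurable]: "f \<in> M \<rightarrow>\<^sub>M \<H>" "g \<in> M \<rightarrow>\<^sub>M \<D>" and t: "0 \<le> t"
  shows "(\<lambda>\<omega>. tilt (f \<omega>) t (g \<omega>)) \<in> borel_measurable M"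
proof -
  have 1: "(\<lambda>\<omega>. gam (f \<omega>)) \<in> borel_measurable M"
    by (rule measurable_compose[OF assms(1) measurable_gam])
  have 2: "(\<lambda>\<omega>. gam (hat_at (f \<omega>) t (g \<omega>))) \<in> borel_measurable M"
    by (rule measurable_compose[OF measurable_hat_at[OF assms(1,2) t] measurable_gam])
  show ?thesis unfolding tilt_def using 1 2 by measurable
qed

lemma measurable_tilt' [measurable]: "y \<in> hat_states S \<Longrightarrow> 0 \<le> t \<Longrightarrow> tilt y t \<in> borel_measurable \<D>"
  using measurable_tilt[of "\<lambda>_. y" \<D> "\<lambda>x. x" t] by simp

lemma tilt_stop: "0 \<le> t \<Longrightarrow> t \<le> s \<Longrightarrow> tilt y t (path_stop s x) = tilt y t x"
  by (simp add: tilt_def alive_ind_stop hat_at_stop)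

lemma tilt_dead: "\<not> path_alive (snd y) x t \<Longrightarrow> tilt y t x = 0"
  by (simp add: tilt_def alive_ind_def)

lemma hat_at_mem: "y \<in> hat_states S \<Longrightarrow> 0 \<le> s \<Longrightarrow> x \<in> space \<D> \<Longrightarrow> hat_at y s x \<in> hat_states S"
  by (intro hat_at_in_hat_states path_space_mem)

lemma tilt_integral:
  assumes y: "y \<in> hat_states S" and t: "0 \<le> t"
  shows "(\<integral>\<^sup>+x. tilt y t x \<partial>Q (fst y)) = 1"
proof -
  have i: "fst y \<in> S" using y by (rule hat_fst_mem)
  note [measurable] = measurable_hat_comp[OF y t measurable_gam]
  have "(\<integral>\<^sup>+x. tilt y t x \<partial>Q (fst y)) = (\<integral>\<^sup>+x. ennreal (exp (\<phi> * t)) * inverse (gam y) * (alive_ind y t x * gam (hat_at y t x)) \<partial>Q (fst y))"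
    unfolding tilt_def divide_ennreal_def by (intro nn_integral_cong) (simp add: ac_simps)
  also have "\<dots> = ennreal (exp (\<phi> * t)) * inverse (gam y) * hsum y t"
    unfolding hsum_def using i by (intro nn_integral_cmult) simp
  also have "\<dots> = (ennreal (exp (\<phi> * t)) * hsum y t) / gam y"
    unfolding divide_ennreal_def by (simp add: ac_simps)
  also have "\<dots> = 1" unfolding harmonic[OF y t] using gam_pos[OF y] gam_finite[OF y] by simp
  finally show ?thesis .
qed

text \<open>At the intermediate state the factors \<open>gam ?h\<close> and
  \<open>inverse (gam ?h)\<close> cancel, because \<open>gam\<close> is positive and finite
  there.\<close>

lemma tilt_flow:
  assumes y: "y \<in> hat_states S" and s: "0 \<le> s" and t: "0 \<le> t" and x: "x \<in> space \<D>"
  shows "tilt y (s + t) x = tilt y s x * tilt (hat_at y s x) t (path_shift s x)"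
proof (cases "path_alive (snd y) x s")
  case True
  let ?h = "hat_at y s x" and ?z = "path_shift s x"
  have h: "?h \<in> hat_states S" by (rule hat_at_mem[OF y s x])
  have one: "gam ?h * inverse (gam ?h) = 1"
    using gam_pos[OF h] gam_finite[OF h] by (simp add: divide_ennreal_def[symmetric])
  have e: "ennreal (exp (\<phi> * (s + t))) = ennreal (exp (\<phi> * s)) * ennreal (exp (\<phi> * t))"
    by (simp add: distrib_left exp_add ennreal_mult)
  have "tilt y (s + t) x = ennreal (exp (\<phi> * s)) * ennreal (exp (\<phi> * t)) * alive_ind ?h t ?z * (gam (hat_at ?h t ?z) * inverse (gam y))"
    using True s t by (simp add: tilt_def alive_ind_flow hat_at_flow e divide_ennreal_def) (simp add: alive_ind_def)
  also have "\<dots> = ennreal (exp (\<phi> * s)) * ennreal (exp (\<phi> * t)) * alive_ind ?h t ?z * (gam (hat_at ?h t ?z) * inverse (gam y)) * (gam ?h * inverse (gam ?h))"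
    by (simp add: one)
  also have "\<dots> = tilt y s x * tilt ?h t ?z"
    using True by (simp add: tilt_def divide_ennreal_def alive_ind_def[of y] ac_simps)
  finally show ?thesis .
next
  case False
  then have "\<not> path_alive (snd y) x (s + t)" using t path_alive_mono[of "snd y" x "s + t" s] by auto
  then show ?thesis using False by (simp add: tilt_dead)
qed

text \<open>By \<open>tilt_flow\<close> the density at \<open>s + t\<close> is a factor of the past
  times the tilt of the future from the state at \<open>s\<close>, so the tilted law inherits the
  Markov property.\<close>

lemma tilt_markov:
  fixes \<Psi> :: "(real \<Rightarrow> nat) \<Rightarrow> (real \<Rightarrow> nat) \<Rightarrow> ennreal"
  assumes y: "y \<in> hat_states S" and s: "0 \<le> s" and t: "0 \<le> t"
    and \<Psi> [measurable]: "(\<lambda>w. \<Psi> (fst w) (snd w)) \<in> borel_measurable (\<D> \<Otimes>\<^sub>M \<D>)"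
  shows "(\<integral>\<^sup>+x. tilt y (s + t) x * \<Psi> (path_stop s x) (path_shift s x) \<partial>Q (fst y)) =
    (\<integral>\<^sup>+x. tilt y s x * (\<integral>\<^sup>+z. tilt (hat_at y s x) t z * \<Psi> (path_stop s x) z \<partial>Q (fst (hat_at y s x))) \<partial>Q (fst y))"
proof -
  have i: "fst y \<in> S" using y by (rule hat_fst_mem)
  note [measurable] = measurable_hat_at'[OF y s] measurable_tilt'[OF y s]
  define \<Theta> where "\<Theta> x z = tilt y s x * (tilt (hat_at y s x) t z * \<Psi> x z)" for x z
  have [measurable]: "(\<lambda>w. tilt (hat_at y s (fst w)) t (snd w)) \<in> borel_measurable (\<D> \<Otimes>\<^sub>M \<D>)"
    by (intro measurable_tilt t) measurable
  have \<Theta>: "(\<lambda>w. \<Theta> (fst w) (snd w)) \<in> borel_measurable (\<D> \<Otimes>\<^sub>M \<D>)"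
    unfolding \<Theta>_def by measurable
  have "(\<integral>\<^sup>+x. tilt y (s + t) x * \<Psi> (path_stop s x) (path_shift s x) \<partial>Q (fst y)) =
     (\<integral>\<^sup>+x. \<Theta> (path_stop s x) (path_shift s x) \<partial>Q (fst y))"
    using s i by (intro nn_integral_cong) (simp add: \<Theta>_def tilt_stop hat_at_stop tilt_flow[OF y s t] mult.assoc)
  also have "\<dots> = (\<integral>\<^sup>+x. \<integral>\<^sup>+z. \<Theta> (path_stop s x) z \<partial>Q (x s) \<partial>Q (fst y))"
    using \<Theta> by (intro markov_integral i s) (simp add: split_beta')
  also have "\<dots> = (\<integral>\<^sup>+x. tilt y s x * (\<integral>\<^sup>+z. tilt (hat_at y s x) t z * \<Psi> (path_stop s x) z \<partial>Q (fst (hat_at y s x))) \<partial>Q (fst y))"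
  proof (rule nn_integral_cong)
    fix x assume "x \<in> space (Q (fst y))"
    then have x: "x \<in> space \<D>" "x s \<in> S" using i path_space_mem by auto
    show "(\<integral>\<^sup>+z. \<Theta> (path_stop s x) z \<partial>Q (x s)) = tilt y s x * (\<integral>\<^sup>+z. tilt (hat_at y s x) t z * \<Psi> (path_stop s x) z \<partial>Q (fst (hat_at y s x)))"
    proof (cases "path_alive (snd y) x s")
      case False
      then show ?thesis using s by (simp add: \<Theta>_def tilt_stop tilt_dead)
    next
      case True
      have h: "hat_at y s x \<in> hat_states S" by (rule hat_at_mem[OF y s x(1)])
      have sx: "path_stop s x \<in> space \<D>" using measurable_space[OF measurable_path_stop[OF s] x(1)] .
      have 1: "(\<lambda>z. \<Psi> (path_stop s x) z) \<in> borel_measurable \<D>"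
        using measurable_compose[OF measurable_Pair1'[OF sx] \<Psi>] by simp
      have "(\<lambda>z. tilt (hat_at y s x) t z * \<Psi> (path_stop s x) z) \<in> borel_measurable (Q (x s))"
        using 1 measurable_tilt'[OF h t] x(2) by simp
      from nn_integral_cmult[OF this, of "tilt y s x"]
      show ?thesis using s True by (simp add: \<Theta>_def tilt_stop hat_at_stop fst_hat_at)
    qed
  qed
  finally show ?thesis .
qed

text \<open>The martingale property of \<open>tilt\<close>: a functional of the path up to
  \<open>s\<close> has the same mean under the density of any later time. The tilted laws of
  different horizons are thus consistent.\<close>

lemma tilt_markov_start:
  assumes y: "y \<in> hat_states S" and s: "0 \<le> s" and t: "0 \<le> t"
    and F [measurable]: "F \<in> borel_measurable \<D>" and stop: "\<And>x. F (path_stop s x) = F x"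
  shows "(\<integral>\<^sup>+x. tilt y (s + t) x * F x \<partial>Q (fst y)) = (\<integral>\<^sup>+x. tilt y s x * F x \<partial>Q (fst y))"
proof -
  have i: "fst y \<in> S" using y by (rule hat_fst_mem)
  have "(\<integral>\<^sup>+x. tilt y (s + t) x * F (path_stop s x) \<partial>Q (fst y)) =
    (\<integral>\<^sup>+x. tilt y s x * (\<integral>\<^sup>+z. tilt (hat_at y s x) t z * F (path_stop s x) \<partial>Q (fst (hat_at y s x))) \<partial>Q (fst y))"
    by (rule tilt_markov[OF y s t, where \<Psi>="\<lambda>x z. F x"]) measurable
  also have "\<dots> = (\<integral>\<^sup>+x. tilt y s x * F x \<partial>Q (fst y))"
  proof (rule nn_integral_cong)
    fix x assume "x \<in> space (Q (fst y))"
    then have h: "hat_at y s x \<in> hat_states S" using i y s by (intro hat_at_mem) auto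
    have "(\<integral>\<^sup>+z. tilt (hat_at y s x) t z * F x \<partial>Q (fst (hat_at y s x))) = 1 * F x"
      unfolding tilt_integral[OF h t, symmetric]
      by (rule nn_integral_multc) (use h t hat_fst_mem[OF h] in simp)
    then show "tilt y s x * (\<integral>\<^sup>+z. tilt (hat_at y s x) t z * F (path_stop s x) \<partial>Q (fst (hat_at y s x))) = tilt y s x * F x"
      by (simp add: stop)
  qed
  finally show ?thesis by (simp add: stop)
qed

section \<open>Transition kernels of the Doob transform\<close>

definition K :: "real \<Rightarrow> hat_state \<Rightarrow> hat_state measure" where
  "K t y = distr (density (Q (fst y)) (tilt y t)) \<H> (hat_at y t)"

lemma measurable_density_Q: "i \<in> S \<Longrightarrow> f \<in> density (Q i) g \<rightarrow>\<^sub>M N \<longleftrightarrow> f \<in> \<D> \<rightarrow>\<^sub>M N"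
  using measurable_cong_sets[of "density (Q i) g" \<D> N N] by simp

lemma nn_integral_K:
  assumes y: "y \<in> hat_states S" and t: "0 \<le> t" and f [measurable]: "f \<in> borel_measurable \<H>"
  shows "(\<integral>\<^sup>+z. f z \<partial>K t y) = (\<integral>\<^sup>+x. tilt y t x * f (hat_at y t x) \<partial>Q (fst y))"
proof -
  have i: "fst y \<in> S" using y by (rule hat_fst_mem)
  have m: "hat_at y t \<in> density (Q (fst y)) (tilt y t) \<rightarrow>\<^sub>M \<H>"
    unfolding measurable_density_Q[OF i] by (rule measurable_hat_at'[OF y t])
  show ?thesis
    unfolding K_def using i y t measurable_hat_comp[OF y t f]
    by (subst nn_integral_distr[OF m]) (auto simp: nn_integral_density)
qed

lemma sets_K [simp]: "sets (K t y) = sets \<H>"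
  by (simp add: K_def)

lemma emeasure_K:
  assumes "y \<in> hat_states S" "0 \<le> t" "B \<in> sets \<H>"
  shows "emeasure (K t y) B = (\<integral>\<^sup>+x. tilt y t x * indicator B (hat_at y t x) \<partial>Q (fst y))"
  using nn_integral_K[OF assms(1,2), of "indicator B"] assms(3) by simp

lemma prob_space_K: "y \<in> hat_states S \<Longrightarrow> 0 \<le> t \<Longrightarrow> prob_space (K t y)"
  using nn_integral_K[of y t "\<lambda>_. 1"] tilt_integral[of y t] by (intro prob_spaceI) simp

lemma measurable_K [measurable]:
  assumes t: "0 \<le> t"
  shows "K t \<in> \<H> \<rightarrow>\<^sub>M prob_algebra \<H>"
proof (rule measurable_prob_algebraI)
  fix y assume "y \<in> space \<H>"
  then show "prob_space (K t y)" using t by (intro prob_space_K) auto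
next
  show "K t \<in> \<H> \<rightarrow>\<^sub>M subprob_algebra \<H>"
  proof (rule measurable_subprob_algebra)
    fix y assume "y \<in> space \<H>"
    then show "subprob_space (K t y)" using t by (intro prob_space_imp_subprob_space prob_space_K) auto
  next
    fix B assume B: "B \<in> sets \<H>"
    have m: "(\<lambda>w. hat_at (fst w) t (snd w)) \<in> \<H> \<Otimes>\<^sub>M \<D> \<rightarrow>\<^sub>M \<H>" using t by measurable
    have "(\<lambda>w. tilt (fst w) t (snd w) * indicator B (hat_at (fst w) t (snd w))) \<in> borel_measurable (\<H> \<Otimes>\<^sub>M \<D>)"
      using measurable_compose[OF m borel_measurable_indicator[OF B]] t by measurable
    then have "(\<lambda>(y, x). tilt y t x * indicator B (hat_at y t x)) \<in> borel_measurable (\<H> \<Otimes>\<^sub>M \<D>)"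
      by (simp add: split_beta')
    from measurable_integral_Q[OF this]
    show "(\<lambda>y. emeasure (K t y) B) \<in> borel_measurable \<H>"
      by (rule measurable_cong[THEN iffD1, rotated]) (simp add: emeasure_K t B)
  qed simp
qed

lemma hat_at_0:
  assumes "y \<in> hat_states S" "x 0 = fst y"
  shows "hat_at y 0 x = y" "path_alive (snd y) x 0"
proof -
  have h: "hat_X (snd y) x 0 = y"
    using assms by (auto simp: hat_X_0 hat_states_iff prod_eq_iff)
  then show "path_alive (snd y) x 0" using hat_states_snd[OF assms(1)] by (simp add: path_alive_def)
  then show "hat_at y 0 x = y" using h by (simp add: hat_at_def)
qed

lemma tilt_0: "y \<in> hat_states S \<Longrightarrow> x 0 = fst y \<Longrightarrow> tilt y 0 x = 1"
  using hat_at_0[of y x] gam_pos[of y] gam_finite[of y] by (simp add: tilt_def alive_ind_def)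

lemma K_0: "y \<in> hat_states S \<Longrightarrow> K 0 y = return \<H> y"
proof (rule measure_eqI)
  fix B assume y: "y \<in> hat_states S" and "B \<in> sets (K 0 y)"
  then have B: "B \<in> sets \<H>" by simp
  have "emeasure (K 0 y) B = (\<integral>\<^sup>+x. indicator B y \<partial>Q (fst y))"
    unfolding emeasure_K[OF y order_refl B]
    by (intro nn_integral_cong_AE, use AE_start_hat[OF y] in eventually_elim) (simp add: hat_at_0[OF y] tilt_0[OF y])
  also have "\<dots> = indicator B y" by (rule Q_one[OF hat_fst_mem[OF y]])
  finally show "emeasure (K 0 y) B = emeasure (return \<H> y) B" using B by simp
qed simp

text \<open>An instance of \<open>tilt_markov\<close> with the indicator of \<open>B\<close> at the
  final state, read off the past through the state at \<open>s\<close> and off the future.\<close>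

lemma K_add:
  assumes y: "y \<in> hat_states S" and s: "0 \<le> s" and t: "0 \<le> t"
  shows "K (s + t) y = K s y \<bind> K t"
proof -
  interpret Ks: prob_space "K s y" by (rule prob_space_K[OF y s])
  have Kt: "K t \<in> K s y \<rightarrow>\<^sub>M subprob_algebra \<H>"
    using measurable_prob_algebraD[OF measurable_K[OF t]] by (simp cong: measurable_cong_sets)
  have i: "fst y \<in> S" using y by (rule hat_fst_mem)
  show ?thesis
  proof (rule measure_eqI)
    have ss: "sets (K s y \<bind> K t) = sets \<H>"
      by (rule sets_bind) (auto simp: Ks.not_empty)
    then show "sets (K (s + t) y) = sets (K s y \<bind> K t)" by simp
    fix B assume "B \<in> sets (K (s + t) y)"
    then have B: "B \<in> sets \<H>" by simp
    have m: "(\<lambda>w. hat_at (hat_at y s (fst w)) t (snd w)) \<in> \<D> \<Otimes>\<^sub>M \<D> \<rightarrow>\<^sub>M \<H>"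
      using measurable_hat_at'[OF y s] t by measurable
    have "emeasure (K (s + t) y) B = (\<integral>\<^sup>+x. tilt y (s + t) x * indicator B (hat_at y (s + t) x) \<partial>Q (fst y))"
      using y s t B by (intro emeasure_K) auto
    also have "\<dots> = (\<integral>\<^sup>+x. tilt y (s + t) x * indicator B (hat_at (hat_at y s (path_stop s x)) t (path_shift s x)) \<partial>Q (fst y))"
    proof (rule nn_integral_cong)
      fix x
      show "tilt y (s + t) x * indicator B (hat_at y (s + t) x) =
        tilt y (s + t) x * indicator B (hat_at (hat_at y s (path_stop s x)) t (path_shift s x))"
      proof (cases "path_alive (snd y) x (s + t)")
        case True
        then have "path_alive (snd y) x s" using t by (auto intro: path_alive_mono)
        then show ?thesis using s t by (simp add: hat_at_stop hat_at_flow)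
      qed (simp add: tilt_dead)
    qed
    also have "\<dots> = (\<integral>\<^sup>+x. tilt y s x * (\<integral>\<^sup>+z. tilt (hat_at y s x) t z * indicator B (hat_at (hat_at y s (path_stop s x)) t z) \<partial>Q (fst (hat_at y s x))) \<partial>Q (fst y))"
      by (rule tilt_markov[OF y s t, where \<Psi>="\<lambda>x z. indicator B (hat_at (hat_at y s x) t z)"])
         (rule measurable_compose[OF m borel_measurable_indicator[OF B]])
    also have "\<dots> = (\<integral>\<^sup>+x. tilt y s x * emeasure (K t (hat_at y s x)) B \<partial>Q (fst y))"
      using s t B i y by (intro nn_integral_cong) (simp add: hat_at_stop emeasure_K hat_at_mem)
    also have "\<dots> = (\<integral>\<^sup>+h. emeasure (K t h) B \<partial>K s y)"
      using measurable_compose[OF measurable_prob_algebraD[OF measurable_K[OF t]] measurable_emeasure_subprob_algebra[OF B]]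
      by (intro nn_integral_K[symmetric] y s)
    also have "\<dots> = emeasure (K s y \<bind> K t) B"
      by (rule emeasure_bind[symmetric, OF Ks.not_empty Kt B])
    finally show "emeasure (K (s + t) y) B = emeasure (K s y \<bind> K t) B" .
  qed
qed

end

section \<open>The law of the limit process\<close>

lemma cadlag_on_initial:
  assumes f: "cadlag_on {0..} f" and g: "\<And>t. t \<in> {0..s} \<Longrightarrow> g t = f t"
  shows "cadlag_on {0..s} g"
  unfolding cadlag_on_def
proof (intro conjI ballI)
  fix t :: real assume t: "t \<in> {0..s}"
  have "(f \<longlongrightarrow> f t) (at t within {0..} \<inter> {t<..})" using f t by (auto simp: cadlag_on_def)
  then have "(f \<longlongrightarrow> f t) (at t within {0..s} \<inter> {t<..})" by (rule tendsto_within_subset) auto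
  then have "(g \<longlongrightarrow> f t) (at t within {0..s} \<inter> {t<..})"
    by (rule Lim_transform_within[where d=1]) (auto simp: g)
  then show "(g \<longlongrightarrow> g t) (at t within {0..s} \<inter> {t<..})" using g t by simp
  obtain l where "(f \<longlongrightarrow> l) (at t within {0..} \<inter> {..<t})" using f t by (auto simp: cadlag_on_def)
  then have "(f \<longlongrightarrow> l) (at t within {0..s} \<inter> {..<t})" by (rule tendsto_within_subset) auto
  then have "(g \<longlongrightarrow> l) (at t within {0..s} \<inter> {..<t})"
    by (rule Lim_transform_within[where d=1]) (auto simp: g)
  then show "\<exists>l. (g \<longlongrightarrow> l) (at t within {0..s} \<inter> {..<t})" by blast
qed

lemma cadlag_on_const: "cadlag_on I (\<lambda>_. c)"
  by (auto simp: cadlag_on_def)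

lemma measurable_skorokhod_coord:
  assumes "t \<in> I"
  shows "(\<lambda>f. f t) \<in> skorokhod_space S I \<rightarrow>\<^sub>M hat_space S"
  unfolding skorokhod_space_def by (intro measurable_restrict_space1 measurable_component_singleton assms)

lemma measurable_into_skorokhod:
  assumes "\<And>t. t \<in> I \<Longrightarrow> (\<lambda>\<omega>. f \<omega> t) \<in> M \<rightarrow>\<^sub>M hat_space S"
    and "\<And>\<omega>. \<omega> \<in> space M \<Longrightarrow> f \<omega> \<in> extensional I" "\<And>\<omega>. \<omega> \<in> space M \<Longrightarrow> cadlag_on I (f \<omega>)"
  shows "f \<in> M \<rightarrow>\<^sub>M skorokhod_space S I"
  unfolding skorokhod_space_def
proof (rule measurable_restrict_space2)
  show "f \<in> space M \<rightarrow> {f. cadlag_on I f}" using assms(3) by auto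
  show "f \<in> M \<rightarrow>\<^sub>M (\<Pi>\<^sub>M t\<in>I. hat_space S)"
  proof (rule measurable_PiM_single')
    show "f \<in> space M \<rightarrow> (\<Pi>\<^sub>E i\<in>I. space (hat_space S))"
      using measurable_space[OF assms(1)] assms(2) by (auto simp: PiE_def)
  qed (rule assms(1))
qed

text \<open>The constant path \<open>(0, 0)\<close> stands in for killed paths, so that every path
  is mapped into the Skorokhod space. Under \<open>tilt y s\<close> the killed paths have density
  0.\<close>

definition hat_path :: "hat_state \<Rightarrow> real \<Rightarrow> (real \<Rightarrow> nat) \<Rightarrow> real \<Rightarrow> hat_state" where
  "hat_path y s x = (\<lambda>t\<in>{0..s}. if path_alive (snd y) x s then hat_X (snd y) x t else (0, 0))"

lemma measurable_hat_path [measurable (raw)]: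
  assumes f: "f \<in> M \<rightarrow>\<^sub>M hat_space S" and g [measurable]: "g \<in> M \<rightarrow>\<^sub>M path_space S"
  shows "(\<lambda>\<omega>. hat_path (f \<omega>) s (g \<omega>)) \<in> M \<rightarrow>\<^sub>M skorokhod_space S {0..s}"
proof (rule measurable_into_skorokhod)
  fix t assume t: "t \<in> {0..s}"
  have sf: "(\<lambda>\<omega>. snd (f \<omega>)) \<in> borel_measurable M"
    by (rule measurable_compose[OF f]) measurable
  have hX: "(\<lambda>\<omega>. hat_X (snd (f \<omega>)) (g \<omega>) t) \<in> borel_measurable M"
    using t by (intro measurable_hat_X_borel[OF sf g]) simp
  have al: "{\<omega>\<in>space M. path_alive (snd (f \<omega>)) (g \<omega>) s} \<in> sets M"
    using pred_path_alive[OF sf g, of s] by (simp add: pred_def)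
  have "(\<lambda>\<omega>. if path_alive (snd (f \<omega>)) (g \<omega>) s then hat_X (snd (f \<omega>)) (g \<omega>) t else (0, 0)) \<in> borel_measurable M"
    by (rule measurable_If[OF hX _ al]) simp
  moreover have "(\<lambda>\<omega>. if path_alive (snd (f \<omega>)) (g \<omega>) s then hat_X (snd (f \<omega>)) (g \<omega>) t else (0, 0)) \<in> space M \<rightarrow> hat_states S"
  proof
    fix \<omega> assume w: "\<omega> \<in> space M"
    have "f \<omega> \<in> hat_states S" "g \<omega> \<in> space (path_space S)"
      using measurable_space[OF f w] measurable_space[OF g w] by auto
    then show "(if path_alive (snd (f \<omega>)) (g \<omega>) s then hat_X (snd (f \<omega>)) (g \<omega>) t else (0, 0)) \<in> hat_states S"
      using t hat_states_snd[of "f \<omega>" S] path_alive_mono[of "snd (f \<omega>)" "g \<omega>" s t]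
      by (auto intro!: hat_X_in_hat_states simp: path_space_mem) (simp add: hat_states_iff)
  qed
  ultimately have "(\<lambda>\<omega>. if path_alive (snd (f \<omega>)) (g \<omega>) s then hat_X (snd (f \<omega>)) (g \<omega>) t else (0, 0)) \<in> M \<rightarrow>\<^sub>M hat_space S"
    unfolding hat_space_def by (intro measurable_restrict_space2)
  then show "(\<lambda>\<omega>. hat_path (f \<omega>) s (g \<omega>) t) \<in> M \<rightarrow>\<^sub>M hat_space S"
    using t by (simp add: hat_path_def)
next
  fix \<omega> assume w: "\<omega> \<in> space M"
  show "hat_path (f \<omega>) s (g \<omega>) \<in> extensional {0..s}" by (simp add: hat_path_def)
  have gc: "cadlag_on {0..} (g \<omega>)" using measurable_space[OF g w] by (rule path_space_cadlag)
  show "cadlag_on {0..s} (hat_path (f \<omega>) s (g \<omega>))"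
  proof (cases "path_alive (snd (f \<omega>)) (g \<omega>) s")
    case True
    then show ?thesis by (intro cadlag_on_initial[OF cadlag_hat_X[OF gc]]) (simp add: hat_path_def)
  next
    case False
    then show ?thesis by (intro cadlag_on_initial[OF cadlag_on_const[of _ "(0, 0)"]]) (simp add: hat_path_def)
  qed
qed

lemma hat_path_apply:
  "path_alive (snd y) x s \<Longrightarrow> 0 \<le> t \<Longrightarrow> t \<le> s \<Longrightarrow> hat_path y s x t = hat_at y t x"
  using path_alive_mono[of "snd y" x s t] by (simp add: hat_path_def hat_at_def)

lemma hat_path_cong:
  assumes "\<And>r. 0 \<le> r \<Longrightarrow> r \<le> s \<Longrightarrow> x r = x' r"
  shows "hat_path y s x = hat_path y s x'"
  unfolding hat_path_def
proof (rule restrict_ext)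
  fix t assume t: "t \<in> {0..s}"
  have "hat_X (snd y) x t = hat_X (snd y) x' t" using assms t by (intro hat_X_cong) auto
  moreover have "path_alive (snd y) x s = path_alive (snd y) x' s" by (rule path_alive_cong[OF assms])
  ultimately show "(if path_alive (snd y) x s then hat_X (snd y) x t else (0, 0)) =
    (if path_alive (snd y) x' s then hat_X (snd y) x' t else (0, 0))" by simp
qed

lemma hat_path_restrict:
  "path_alive (snd y) x t \<Longrightarrow> 0 \<le> s \<Longrightarrow> s \<le> t \<Longrightarrow> restrict (hat_path y t x) {0..s} = hat_path y s x"
  using path_alive_mono[of "snd y" x t s] by (intro ext) (auto simp: hat_path_def restrict_def)

text \<open>Segment \<open>k\<close> governs \<open>[k, k + 1)\<close>, so the value at an integer
  time comes from the segment that begins there. Any sequence of cadlag segments gives a cadlag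
  path, whether or not the end points match.\<close>

definition concat_path :: "(nat \<Rightarrow> real \<Rightarrow> hat_state) \<Rightarrow> real \<Rightarrow> hat_state" where
  "concat_path \<omega> = (\<lambda>t\<in>{0..}. \<omega> (nat \<lfloor>t\<rfloor>) (t - real (nat \<lfloor>t\<rfloor>)))"

lemma concat_path_apply:
  assumes "real k \<le> t" "t < real k + 1"
  shows "concat_path \<omega> t = \<omega> k (t - real k)"
proof -
  have "nat \<lfloor>t\<rfloor> = k" using assms by linarith
  then show ?thesis using assms by (simp add: concat_path_def)
qed

lemma tendsto_shift_within:
  fixes g :: "real \<Rightarrow> 'b::topological_space"
  assumes g: "(g \<longlongrightarrow> l) (at (t - k) within A)" and d: "0 < d"
    and f: "\<And>r. r \<in> B \<Longrightarrow> r \<noteq> t \<Longrightarrow> \<bar>r - t\<bar> < d \<Longrightarrow> r - k \<in> A \<and> f r = g (r - k)"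
  shows "(f \<longlongrightarrow> l) (at t within B)"
proof (rule topological_tendstoI)
  fix U assume "open U" "l \<in> U"
  with g have "\<forall>\<^sub>F r in at (t - k) within A. g r \<in> U" by (rule topological_tendstoD)
  then obtain e where e: "e > 0" "\<And>r. r \<in> A \<Longrightarrow> r \<noteq> t - k \<Longrightarrow> dist r (t - k) < e \<Longrightarrow> g r \<in> U"
    unfolding eventually_at by blast
  show "\<forall>\<^sub>F r in at t within B. f r \<in> U"
    unfolding eventually_at
  proof (intro exI[of _ "min d e"] conjI ballI impI)
    fix r assume "r \<in> B" and r: "r \<noteq> t \<and> dist r t < min d e"
    then have "r - k \<in> A" "f r = g (r - k)" using f[of r] by (auto simp: dist_real_def)
    then show "f r \<in> U" using e(2)[of "r - k"] r by (auto simp: dist_real_def)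
  qed (use d e in auto)
qed

lemma cadlag_concat_path:
  assumes \<omega>: "\<And>k. cadlag_on {0..1} (\<omega> k)"
  shows "cadlag_on {0..} (concat_path \<omega>)"
  unfolding cadlag_on_def
proof (intro conjI ballI)
  fix t :: real assume "t \<in> {0..}"
  then have t: "0 \<le> t" by simp
  define k where "k = nat \<lfloor>t\<rfloor>"
  have k: "real k \<le> t" "t < real k + 1" unfolding k_def using t by linarith+
  have ft: "concat_path \<omega> t = \<omega> k (t - real k)" by (rule concat_path_apply[OF k])
  have "(\<omega> k \<longlongrightarrow> \<omega> k (t - real k)) (at (t - real k) within {0..1} \<inter> {t - real k<..})"
    using \<omega>[of k] k unfolding cadlag_on_def by auto
  then show "(concat_path \<omega> \<longlongrightarrow> concat_path \<omega> t) (at t within {0..} \<inter> {t<..})"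
    unfolding ft
  proof (rule tendsto_shift_within)
    show "0 < real k + 1 - t" using k by simp
    fix r assume "r \<in> {0..} \<inter> {t<..}" "r \<noteq> t" "\<bar>r - t\<bar> < real k + 1 - t"
    then show "r - real k \<in> {0..1} \<inter> {t - real k<..} \<and> concat_path \<omega> r = \<omega> k (r - real k)"
      using k by (auto intro!: concat_path_apply)
  qed
  show "\<exists>l. (concat_path \<omega> \<longlongrightarrow> l) (at t within {0..} \<inter> {..<t})"
  proof (cases "t = 0")
    case True
    then have "{0..} \<inter> {..<t} = ({} :: real set)" by auto
    then show ?thesis by simp
  next
    case False
    \<comment> \<open>The left limit at a positive integer \<open>k\<close> belongs to the preceding
      segment, hence \<open>j = k - 1\<close> in that case.\<close>
    obtain j where j: "real j < t" "t \<le> real j + 1"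
    proof (cases "t = real k")
      case True
      then have "k \<noteq> 0" using False by auto
      then show ?thesis using True by (intro that[of "k - 1"]) auto
    next
      case False
      then show ?thesis using k by (intro that[of k]) auto
    qed
    have "t - real j \<in> {0..1}" using j by simp
    then obtain l where l: "(\<omega> j \<longlongrightarrow> l) (at (t - real j) within {0..1} \<inter> {..<t - real j})"
      using \<omega>[of j] unfolding cadlag_on_def by blast
    have "(concat_path \<omega> \<longlongrightarrow> l) (at t within {0..} \<inter> {..<t})"
    proof (rule tendsto_shift_within[OF l])
      show "0 < t - real j" using j by simp
      fix r assume "r \<in> {0..} \<inter> {..<t}" "r \<noteq> t" "\<bar>r - t\<bar> < t - real j"
      then show "r - real j \<in> {0..1} \<inter> {..<t - real j} \<and> concat_path \<omega> r = \<omega> j (r - real j)"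
        using j by (auto intro!: concat_path_apply)
    qed
    then show ?thesis by blast
  qed
qed

lemma measurable_segment_point:
  assumes "k \<in> I" "t \<in> J"
  shows "(\<lambda>\<omega>. \<omega> k t) \<in> PiM I (\<lambda>_. skorokhod_space S J) \<rightarrow>\<^sub>M hat_space S"
  using measurable_compose[OF measurable_component_singleton[OF assms(1), of "\<lambda>_. skorokhod_space S J"]
      measurable_skorokhod_coord[OF assms(2), of S]] .

lemma measurable_concat_path:
  "concat_path \<in> (\<Pi>\<^sub>M k\<in>UNIV. skorokhod_space S {0..1}) \<rightarrow>\<^sub>M skorokhod_space S {0..}"
proof (rule measurable_into_skorokhod)
  fix t :: real assume t: "t \<in> {0..}"
  have "t - real (nat \<lfloor>t\<rfloor>) \<in> {0..1}" using t by (auto simp: of_nat_nat) linarith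
  then have "(\<lambda>\<omega>. \<omega> (nat \<lfloor>t\<rfloor>) (t - real (nat \<lfloor>t\<rfloor>))) \<in> (\<Pi>\<^sub>M k\<in>UNIV. skorokhod_space S {0..1}) \<rightarrow>\<^sub>M hat_space S"
    by (intro measurable_segment_point) auto
  then show "(\<lambda>\<omega>. concat_path \<omega> t) \<in> (\<Pi>\<^sub>M k\<in>UNIV. skorokhod_space S {0..1}) \<rightarrow>\<^sub>M hat_space S"
    using t by (simp add: concat_path_def)
next
  fix \<omega> :: "nat \<Rightarrow> real \<Rightarrow> hat_state"
  assume "\<omega> \<in> space (\<Pi>\<^sub>M k\<in>UNIV. skorokhod_space S {0..1})"
  then have "\<omega> k \<in> space (skorokhod_space S {0..1})" for k by (auto simp: space_PiM)
  then show "cadlag_on {0..} (concat_path \<omega>)"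
    by (intro cadlag_concat_path) (auto simp: skorokhod_space_def space_restrict_space)
qed (simp add: concat_path_def)

context yaglom
begin

abbreviation "\<E> \<equiv> skorokhod_space S {0..1}"

section \<open>Construction of the limit law from unit segments\<close>

definition unit_kernel :: "hat_state \<Rightarrow> (real \<Rightarrow> hat_state) measure" where
  "unit_kernel y = distr (density (Q (fst y)) (tilt y 1)) \<E> (hat_path y 1)"

lemma measurable_hat_path' [measurable]:
  "y \<in> hat_states S \<Longrightarrow> hat_path y s \<in> \<D> \<rightarrow>\<^sub>M skorokhod_space S {0..s}"
  using measurable_hat_path[of "\<lambda>_. y" \<D> S "\<lambda>x. x" s] by simp

lemma nn_integral_tilted_path:
  assumes y: "y \<in> hat_states S" and s: "0 \<le> s" and f: "f \<in> borel_measurable (skorokhod_space S {0..s})"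
  shows "(\<integral>\<^sup>+w. f w \<partial>distr (density (Q (fst y)) (tilt y s)) (skorokhod_space S {0..s}) (hat_path y s)) =
    (\<integral>\<^sup>+x. tilt y s x * f (hat_path y s x) \<partial>Q (fst y))"
proof -
  have i: "fst y \<in> S" using y by (rule hat_fst_mem)
  have m: "hat_path y s \<in> density (Q (fst y)) (tilt y s) \<rightarrow>\<^sub>M skorokhod_space S {0..s}"
    unfolding measurable_density_Q[OF i] by (rule measurable_hat_path'[OF y])
  show ?thesis
    using i y s f measurable_compose[OF measurable_hat_path'[OF y] f]
    by (subst nn_integral_distr[OF m]) (auto simp: nn_integral_density)
qed

lemma nn_integral_unit_kernel:
  assumes y: "y \<in> hat_states S" and f: "f \<in> borel_measurable \<E>"
  shows "(\<integral>\<^sup>+w. f w \<partial>unit_kernel y) = (\<integral>\<^sup>+x. tilt y 1 x * f (hat_path y 1 x) \<partial>Q (fst y))"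
  unfolding unit_kernel_def using nn_integral_tilted_path[OF y _ f] by simp

lemma sets_unit_kernel [simp]: "sets (unit_kernel y) = sets \<E>"
  by (simp add: unit_kernel_def)

lemma prob_space_unit_kernel: "y \<in> hat_states S \<Longrightarrow> prob_space (unit_kernel y)"
  using nn_integral_unit_kernel[of y "\<lambda>_. 1"] tilt_integral[of y 1] by (intro prob_spaceI) simp

lemma measurable_unit_kernel: "unit_kernel \<in> \<H> \<rightarrow>\<^sub>M subprob_algebra \<E>"
proof (rule measurable_subprob_algebra)
  fix y assume "y \<in> space \<H>"
  then show "subprob_space (unit_kernel y)" by (intro prob_space_imp_subprob_space prob_space_unit_kernel) auto
next
  fix B assume B: "B \<in> sets \<E>"
  have m: "(\<lambda>w. hat_path (fst w) 1 (snd w)) \<in> \<H> \<Otimes>\<^sub>M \<D> \<rightarrow>\<^sub>M \<E>" by measurable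
  have "(\<lambda>w. tilt (fst w) 1 (snd w) * indicator B (hat_path (fst w) 1 (snd w))) \<in> borel_measurable (\<H> \<Otimes>\<^sub>M \<D>)"
    using measurable_compose[OF m borel_measurable_indicator[OF B]] by measurable
  then have "(\<lambda>(y, x). tilt y 1 x * indicator B (hat_path y 1 x)) \<in> borel_measurable (\<H> \<Otimes>\<^sub>M \<D>)"
    by (simp add: split_beta')
  from measurable_integral_Q[OF this]
  show "(\<lambda>y. emeasure (unit_kernel y) B) \<in> borel_measurable \<H>"
  proof (rule measurable_cong[THEN iffD1, rotated])
    fix y assume "y \<in> space \<H>"
    then show "(\<integral>\<^sup>+x. tilt y 1 x * indicator B (hat_path y 1 x) \<partial>Q (fst y)) = emeasure (unit_kernel y) B"
      using nn_integral_unit_kernel[of y "indicator B"] B by simp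
  qed
qed simp

definition last_point :: "hat_state \<Rightarrow> nat \<Rightarrow> (nat \<Rightarrow> real \<Rightarrow> hat_state) \<Rightarrow> hat_state" where
  "last_point y n \<omega> = (if n = 0 then y else \<omega> (n - 1) 1)"

lemma measurable_last_point:
  assumes "y \<in> hat_states S"
  shows "last_point y n \<in> PiM {0..<n} (\<lambda>_. \<E>) \<rightarrow>\<^sub>M \<H>"
proof (cases "n = 0")
  case True
  then show ?thesis using assms by (simp add: last_point_def[abs_def])
next
  case False
  then have "(\<lambda>\<omega>. \<omega> (n - 1) 1) \<in> PiM {0..<n} (\<lambda>_. \<E>) \<rightarrow>\<^sub>M \<H>"
    by (intro measurable_segment_point) auto
  then show ?thesis using False by (simp add: last_point_def[abs_def])
qed

text \<open>The unit segments of one path, each computed from the state at its beginning. For an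
  alive path they are the pieces of its hat process, as \<open>segs_apply\<close> shows.\<close>

definition segs :: "hat_state \<Rightarrow> nat \<Rightarrow> (real \<Rightarrow> nat) \<Rightarrow> nat \<Rightarrow> real \<Rightarrow> hat_state" where
  "segs y n x = (\<lambda>k\<in>{0..<n}. hat_path (hat_at y (real k) x) 1 (path_shift (real k) x))"

lemma measurable_segs:
  assumes y: "y \<in> hat_states S"
  shows "segs y n \<in> \<D> \<rightarrow>\<^sub>M PiM {0..<n} (\<lambda>_. \<E>)"
  unfolding segs_def[abs_def]
proof (rule measurable_restrict)
  fix k
  show "(\<lambda>x. hat_path (hat_at y (real k) x) 1 (path_shift (real k) x)) \<in> \<D> \<rightarrow>\<^sub>M \<E>"
    by (intro measurable_hat_path measurable_hat_at'[OF y] measurable_path_shift) auto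
qed

lemma segs_stop: "segs y n (path_stop (real n) x) = segs y n x"
  unfolding segs_def
proof (rule restrict_ext)
  fix k assume k: "k \<in> {0..<n}"
  then have kn: "real k + 1 \<le> real n" by (simp add: Suc_leI of_nat_le_iff[symmetric, of "Suc k"] del: of_nat_le_iff)
  have "hat_path h 1 (path_shift (real k) (path_stop (real n) x)) = hat_path h 1 (path_shift (real k) x)" for h
    using kn by (intro hat_path_cong) (simp add: path_shift_def path_stop_def)
  then show "hat_path (hat_at y (real k) (path_stop (real n) x)) 1 (path_shift (real k) (path_stop (real n) x)) =
    hat_path (hat_at y (real k) x) 1 (path_shift (real k) x)"
    using kn by (simp add: hat_at_stop)
qed

lemma segs_apply:
  assumes "path_alive (snd y) x (real n)" "k < n" "0 \<le> r" "r \<le> 1"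
  shows "segs y n x k r = hat_at y (real k + r) x"
proof -
  have kn: "real k + 1 \<le> real n" using assms(2) by linarith
  have al: "path_alive (snd y) x (real k + 1)" by (rule path_alive_mono[OF assms(1) kn])
  then have "path_alive (snd (hat_at y (real k) x)) (path_shift (real k) x) 1" and ak: "path_alive (snd y) x (real k)"
    using path_alive_flow[of "real k" 1 "snd y" x] by (auto simp: hat_at_alive)
  then show ?thesis using assms ak by (simp add: segs_def hat_path_apply hat_at_flow)
qed

lemma last_point_segs:
  assumes "y \<in> hat_states S" "x 0 = fst y" "path_alive (snd y) x (real n)"
  shows "last_point y n (segs y n x) = hat_at y (real n) x"
proof (cases n)
  case 0
  then show ?thesis using hat_at_0[of y x] assms by (simp add: last_point_def)
next
  case (Suc k)
  then show ?thesis using segs_apply[OF assms(3), of k 1] by (simp add: last_point_def add.commute)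
qed

definition step_kernel :: "hat_state \<Rightarrow> nat \<Rightarrow> (nat \<Rightarrow> real \<Rightarrow> hat_state) \<Rightarrow> (real \<Rightarrow> hat_state) measure" where
  "step_kernel y n \<omega> = unit_kernel (last_point y n \<omega>)"

lemma Ionescu_Tulcea_step_kernel:
  assumes y: "y \<in> hat_states S"
  shows "Ionescu_Tulcea (step_kernel y) (\<lambda>_. \<E>)"
proof (rule Ionescu_Tulcea.intro)
  fix n
  show "step_kernel y n \<in> PiM {0..<n} (\<lambda>_. \<E>) \<rightarrow>\<^sub>M subprob_algebra \<E>"
    unfolding step_kernel_def[abs_def]
    by (rule measurable_compose[OF measurable_last_point[OF y] measurable_unit_kernel])
next
  fix n :: nat and \<omega> :: "nat \<Rightarrow> real \<Rightarrow> hat_state" assume "\<omega> \<in> space (PiM {0..<n} (\<lambda>_. \<E>))"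
  then show "prob_space (step_kernel y n \<omega>)"
    unfolding step_kernel_def
    using measurable_space[OF measurable_last_point[OF y]] by (intro prob_space_unit_kernel) auto
qed

text \<open>The first \<open>n\<close> segments of the Ionescu-Tulcea construction are distributed
  as those of a path under the tilted law. The induction step appends a segment drawn from the state
  at time \<open>n\<close>, which is \<open>tilt_markov\<close> with a further time of 1.\<close>

lemma nn_integral_segments:
  assumes y: "y \<in> hat_states S" and F: "F \<in> borel_measurable (PiM {0..<n} (\<lambda>_. \<E>))"
  shows "(\<integral>\<^sup>+\<omega>. F \<omega> \<partial>Ionescu_Tulcea.C (step_kernel y) (\<lambda>_. \<E>) 0 n (\<lambda>_. undefined)) =
    (\<integral>\<^sup>+x. tilt y (real n) x * F (segs y n x) \<partial>Q (fst y))"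
  using F
proof (induction n arbitrary: F)
  interpret IT: Ionescu_Tulcea "step_kernel y" "\<lambda>_. \<E>" by (rule Ionescu_Tulcea_step_kernel[OF y])
  have i: "fst y \<in> S" using y by (rule hat_fst_mem)
  {
    case 0
    have "segs y 0 x = (\<lambda>_. undefined)" for x by (simp add: segs_def restrict_def)
    then have "(\<integral>\<^sup>+x. tilt y (real 0) x * F (segs y 0 x) \<partial>Q (fst y)) = (\<integral>\<^sup>+x. tilt y 0 x \<partial>Q (fst y)) * F (\<lambda>_. undefined)"
      using i y by (simp add: nn_integral_multc)
    then show ?case
      using 0 tilt_integral[OF y order_refl] by (simp add: nn_integral_return space_PiM)
  next
    case (Suc n)
    have C: "IT.C 0 n (\<lambda>_. undefined) \<in> space (prob_algebra (PiM {0..<n} (\<lambda>_. \<E>)))"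
      using IT.sets_C[of "\<lambda>_. undefined" 0 n] IT.prob_space_C[of "\<lambda>_. undefined" 0 n]
      by (simp add: space_prob_algebra space_PiM)
    have sC: "sets (IT.C 0 n (\<lambda>_. undefined)) = sets (PiM {0..<n} (\<lambda>_. \<E>))"
      using C by (simp add: space_prob_algebra)
    have spC: "space (IT.C 0 n (\<lambda>_. undefined)) = space (PiM {0..<n} (\<lambda>_. \<E>))"
      by (rule sets_eq_imp_space_eq[OF sC])
    have eP: "IT.eP n \<in> IT.C 0 n (\<lambda>_. undefined) \<rightarrow>\<^sub>M subprob_algebra (PiM {0..<Suc n} (\<lambda>_. \<E>))"
      using IT.measurable_eP[of n] sC by (simp cong: measurable_cong_sets)
    define G where "G \<omega> = (\<integral>\<^sup>+f. F (fun_upd \<omega> n f) \<partial>step_kernel y n \<omega>)" for \<omega>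
    have upd: "(\<lambda>w. fun_upd (fst w) n (snd w)) \<in> PiM {0..<n} (\<lambda>_. \<E>) \<Otimes>\<^sub>M \<E> \<rightarrow>\<^sub>M PiM {0..<Suc n} (\<lambda>_. \<E>)"
      by (rule measurable_fun_upd[where J="{0..<n}"]) auto
    have G: "G \<in> borel_measurable (PiM {0..<n} (\<lambda>_. \<E>))"
    proof -
      have "(\<lambda>(\<omega>, f). F (fun_upd \<omega> n f)) \<in> borel_measurable (PiM {0..<n} (\<lambda>_. \<E>) \<Otimes>\<^sub>M \<E>)"
        unfolding split_beta' by (rule measurable_compose[OF upd Suc.prems])
      then show ?thesis unfolding G_def by (rule nn_integral_measurable_subprob_algebra2[OF _ IT.P])
    qed
    have "(\<integral>\<^sup>+\<omega>. F \<omega> \<partial>IT.C 0 (Suc n) (\<lambda>_. undefined)) = (\<integral>\<^sup>+\<omega>. \<integral>\<^sup>+\<omega>'. F \<omega>' \<partial>IT.eP n \<omega> \<partial>IT.C 0 n (\<lambda>_. undefined))"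
      using nn_integral_bind[OF Suc.prems eP] by simp
    also have "\<dots> = (\<integral>\<^sup>+\<omega>. G \<omega> \<partial>IT.C 0 n (\<lambda>_. undefined))"
      unfolding G_def using Suc.prems by (intro nn_integral_cong IT.nn_integral_eP) (simp_all add: spC)
    also have "\<dots> = (\<integral>\<^sup>+x. tilt y (real n) x * G (segs y n x) \<partial>Q (fst y))"
      by (rule Suc.IH[OF G])
    \<comment> \<open>Inserting \<open>path_stop\<close> leaves the integrand unchanged but displays
      it as a function of past and future, as \<open>tilt_markov\<close> expects.\<close>
    also have "\<dots> = (\<integral>\<^sup>+x. tilt y (real n) x * (\<integral>\<^sup>+z. tilt (hat_at y (real n) x) 1 z *
        F (fun_upd (segs y n (path_stop (real n) x)) n (hat_path (hat_at y (real n) (path_stop (real n) x)) 1 z))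
          \<partial>Q (fst (hat_at y (real n) x))) \<partial>Q (fst y))"
    proof (intro nn_integral_cong_AE, use AE_start_hat[OF y] in eventually_elim)
      case (elim x)
      show ?case
      proof (cases "path_alive (snd y) x (real n)")
        case True
        have h: "hat_at y (real n) x \<in> hat_states S" using elim y by (intro hat_at_mem) auto
        have sg: "segs y n x \<in> space (PiM {0..<n} (\<lambda>_. \<E>))"
          using measurable_space[OF measurable_segs[OF y]] elim by simp
        have Fm: "(\<lambda>f. F (fun_upd (segs y n x) n f)) \<in> borel_measurable \<E>"
          using measurable_compose[OF measurable_compose[OF measurable_Pair1'[OF sg] upd] Suc.prems] by (simp add: fun_upd_def)
        have "G (segs y n x) = (\<integral>\<^sup>+f. F (fun_upd (segs y n x) n f) \<partial>unit_kernel (hat_at y (real n) x))"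
          using last_point_segs[of y x n] y elim True by (simp add: G_def step_kernel_def)
        then show ?thesis
          using nn_integral_unit_kernel[OF h Fm] by (simp add: segs_stop hat_at_stop)
      qed (simp add: tilt_dead)
    qed
    also have "\<dots> = (\<integral>\<^sup>+x. tilt y (real n + 1) x *
        F (fun_upd (segs y n (path_stop (real n) x)) n (hat_path (hat_at y (real n) (path_stop (real n) x)) 1 (path_shift (real n) x))) \<partial>Q (fst y))"
    proof (rule tilt_markov[symmetric, OF y of_nat_0_le_iff zero_le_one, where \<Psi>="\<lambda>x z. F (fun_upd (segs y n x) n (hat_path (hat_at y (real n) x) 1 z))"])
      have m1: "(\<lambda>w. segs y n (fst w)) \<in> \<D> \<Otimes>\<^sub>M \<D> \<rightarrow>\<^sub>M PiM {0..<n} (\<lambda>_. \<E>)"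
        by (rule measurable_compose[OF measurable_fst measurable_segs[OF y]])
      have m2: "(\<lambda>w. hat_path (hat_at y (real n) (fst w)) 1 (snd w)) \<in> \<D> \<Otimes>\<^sub>M \<D> \<rightarrow>\<^sub>M \<E>"
        by (intro measurable_hat_path measurable_snd measurable_compose[OF measurable_fst measurable_hat_at'[OF y]]) auto
      show "(\<lambda>w. F (fun_upd (segs y n (fst w)) n (hat_path (hat_at y (real n) (fst w)) 1 (snd w)))) \<in> borel_measurable (\<D> \<Otimes>\<^sub>M \<D>)"
        using measurable_compose[OF measurable_compose[OF measurable_Pair[OF m1 m2] upd] Suc.prems] by (simp add: fun_upd_def)
    qed
    also have "\<dots> = (\<integral>\<^sup>+x. tilt y (real (Suc n)) x * F (segs y (Suc n) x) \<partial>Q (fst y))"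
    proof (rule nn_integral_cong)
      fix x
      have "fun_upd (segs y n x) n (hat_path (hat_at y (real n) x) 1 (path_shift (real n) x)) = segs y (Suc n) x"
        by (intro ext) (auto simp: segs_def restrict_def less_Suc_eq)
      then show "tilt y (real n + 1) x *
        F (fun_upd (segs y n (path_stop (real n) x)) n (hat_path (hat_at y (real n) (path_stop (real n) x)) 1 (path_shift (real n) x))) =
        tilt y (real (Suc n)) x * F (segs y (Suc n) x)"
        by (simp add: segs_stop hat_at_stop add.commute)
    qed
    finally show ?case .
  }
qed

text \<open>Each tilt is a density for one finite horizon. The law on
  \<open>[0, \<infinity>)\<close> is therefore taken as the projective limit of the laws of finitely
  many unit segments, concatenated to one path.\<close>

definition N :: "hat_state \<Rightarrow> (real \<Rightarrow> hat_state) measure" where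
  "N y = distr (projective_family.lim UNIV (Ionescu_Tulcea.CI (step_kernel y) (\<lambda>_. \<E>)) (\<lambda>_. \<E>))
     (skorokhod_space S {0..}) concat_path"

lemma sets_N [simp]: "sets (N y) = sets (skorokhod_space S {0..})"
  by (simp add: N_def)

lemma measurable_skorokhod_restrict:
  assumes "0 \<le> s" "I = {0..} \<or> (\<exists>t\<ge>s. I = {0..t})"
  shows "(\<lambda>f. restrict f {0..s}) \<in> skorokhod_space S I \<rightarrow>\<^sub>M skorokhod_space S {0..s}"
proof (rule measurable_into_skorokhod)
  fix t assume t: "t \<in> {0..s}"
  then have "t \<in> I" using assms by auto
  then show "(\<lambda>f. restrict f {0..s} t) \<in> skorokhod_space S I \<rightarrow>\<^sub>M \<H>"
    using measurable_skorokhod_coord[of t I S] t by simp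
next
  fix f assume "f \<in> space (skorokhod_space S I)"
  then have f: "cadlag_on I f" by (simp add: skorokhod_space_def space_restrict_space)
  show "cadlag_on {0..s} (restrict f {0..s})"
    unfolding cadlag_on_def
  proof (intro conjI ballI)
    fix t assume t: "t \<in> {0..s}"
    have tI: "t \<in> I" "{0..s} \<subseteq> I" using assms t by auto
    have "(f \<longlongrightarrow> f t) (at t within I \<inter> {t<..})" using f tI by (auto simp: cadlag_on_def)
    then have "(f \<longlongrightarrow> f t) (at t within {0..s} \<inter> {t<..})" by (rule tendsto_within_subset) (use tI in auto)
    then have "(restrict f {0..s} \<longlongrightarrow> f t) (at t within {0..s} \<inter> {t<..})"
      by (rule Lim_transform_within[where d=1]) auto
    then show "(restrict f {0..s} \<longlongrightarrow> restrict f {0..s} t) (at t within {0..s} \<inter> {t<..})" using t by simp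
    obtain l where "(f \<longlongrightarrow> l) (at t within I \<inter> {..<t})" using f tI by (auto simp: cadlag_on_def)
    then have "(f \<longlongrightarrow> l) (at t within {0..s} \<inter> {..<t})" by (rule tendsto_within_subset) (use tI in auto)
    then have "(restrict f {0..s} \<longlongrightarrow> l) (at t within {0..s} \<inter> {..<t})"
      by (rule Lim_transform_within[where d=1]) auto
    then show "\<exists>l. (restrict f {0..s} \<longlongrightarrow> l) (at t within {0..s} \<inter> {..<t})" by blast
  qed
qed simp

lemma hat_path_stop: "hat_path y s (path_stop s x) = hat_path y s x"
  by (rule hat_path_cong) (simp add: path_stop_def)

text \<open>The path on \<open>[0, s]\<close> depends on finitely many segments, whose law has the
  density of the integer horizon \<open>n\<close>; \<open>tilt_markov_start\<close> lowers this
  horizon to \<open>s\<close>.\<close>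

lemma N_law:
  assumes y: "y \<in> hat_states S" and s: "0 \<le> s" and G: "G \<in> borel_measurable (skorokhod_space S {0..s})"
  shows "(\<integral>\<^sup>+f. G (restrict f {0..s}) \<partial>N y) = (\<integral>\<^sup>+x. tilt y s x * G (hat_path y s x) \<partial>Q (fst y))"
proof -
  interpret IT: Ionescu_Tulcea "step_kernel y" "\<lambda>_. \<E>" by (rule Ionescu_Tulcea_step_kernel[OF y])
  have i: "fst y \<in> S" using y by (rule hat_fst_mem)
  \<comment> \<open>One more than the integer part, because for an integer \<open>s\<close> the
    value at \<open>s\<close> already belongs to the next segment.\<close>
  define n where "n = nat \<lfloor>s\<rfloor> + 1"
  have sn: "s \<le> real n" unfolding n_def using s by linarith
  define glue where "glue \<omega> = (\<lambda>t\<in>{0..s}. \<omega> (nat \<lfloor>t\<rfloor>) (t - real (nat \<lfloor>t\<rfloor>)))" for \<omega> :: "nat \<Rightarrow> real \<Rightarrow> hat_state"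
  have idx: "nat \<lfloor>t\<rfloor> < n" "t - real (nat \<lfloor>t\<rfloor>) \<in> {0..1}" if "t \<in> {0..s}" for t
    unfolding n_def using that s by (auto simp: nat_less_iff floor_mono le_nat_floor less_Suc_eq_le nat_mono) linarith+
  have glue: "glue \<omega> = restrict (concat_path \<omega>) {0..s}" for \<omega>
    unfolding glue_def by (intro ext) (auto simp: concat_path_def restrict_def)
  have glue_restrict: "glue (restrict \<omega> {0..<n}) = glue \<omega>" for \<omega>
    unfolding glue_def by (rule restrict_ext) (use idx in auto)
  have PFs: "sets IT.PF.lim = sets (PiM UNIV (\<lambda>_. \<E>))" by (rule IT.PF.sets_lim)
  have cm: "concat_path \<in> IT.PF.lim \<rightarrow>\<^sub>M skorokhod_space S {0..}"
    using measurable_concat_path[of S] by (simp cong: measurable_cong_sets add: PFs)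
  have gm: "glue \<in> PiM {0..<n} (\<lambda>_. \<E>) \<rightarrow>\<^sub>M skorokhod_space S {0..s}"
  proof (rule measurable_into_skorokhod)
    fix t assume t: "t \<in> {0..s}"
    show "(\<lambda>\<omega>. glue \<omega> t) \<in> PiM {0..<n} (\<lambda>_. \<E>) \<rightarrow>\<^sub>M \<H>"
      unfolding glue_def using t idx[OF t] by (simp add: measurable_segment_point)
  next
    fix \<omega> assume w: "\<omega> \<in> space (PiM {0..<n} (\<lambda>_. \<E>))"
    \<comment> \<open>A finite family of segments is continued by constant ones, so that
      \<open>cadlag_concat_path\<close> applies to a full sequence.\<close>
    define \<omega>' where "\<omega>' k = (if k < n then \<omega> k else (\<lambda>t\<in>{0..1}. (0, 0)))" for k
    have "cadlag_on {0..1} (\<omega>' k)" for k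
    proof (cases "k < n")
      case True
      then have "\<omega> k \<in> space \<E>" using w by (auto simp: space_PiM)
      then show ?thesis using True by (simp add: \<omega>'_def skorokhod_space_def space_restrict_space)
    next
      case False
      then show ?thesis unfolding \<omega>'_def by (auto intro!: cadlag_on_initial[OF cadlag_on_const[of _ "(0, 0)"]])
    qed
    then have "cadlag_on {0..} (concat_path \<omega>')" by (rule cadlag_concat_path)
    moreover have "glue \<omega> = glue \<omega>'" unfolding glue_def by (rule restrict_ext) (use idx in \<open>auto simp: \<omega>'_def\<close>)
    ultimately show "cadlag_on {0..s} (glue \<omega>)" unfolding glue by (intro cadlag_on_initial) auto
  qed (simp add: glue_def)
  have Ggm: "(\<lambda>\<omega>. G (glue \<omega>)) \<in> borel_measurable (PiM {0..<n} (\<lambda>_. \<E>))" by (rule measurable_compose[OF gm G])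
  have Rm: "(\<lambda>f. restrict f {0..s}) \<in> skorokhod_space S {0..} \<rightarrow>\<^sub>M skorokhod_space S {0..s}"
    by (rule measurable_skorokhod_restrict[OF s]) simp
  have "(\<integral>\<^sup>+f. G (restrict f {0..s}) \<partial>N y) = (\<integral>\<^sup>+\<omega>. G (restrict (concat_path \<omega>) {0..s}) \<partial>IT.PF.lim)"
    unfolding N_def using measurable_compose[OF Rm G] by (intro nn_integral_distr cm) simp
  also have "\<dots> = (\<integral>\<^sup>+\<omega>. G (glue (restrict \<omega> {0..<n})) \<partial>IT.PF.lim)"
    by (simp only: glue_restrict glue[symmetric])
  also have "\<dots> = (\<integral>\<^sup>+\<omega>. G (glue \<omega>) \<partial>distr IT.PF.lim (PiM {0..<n} (\<lambda>_. \<E>)) (\<lambda>\<omega>. restrict \<omega> {0..<n}))"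
  proof (rule nn_integral_distr[symmetric])
    have "(\<lambda>\<omega>. restrict \<omega> {0..<n}) \<in> PiM UNIV (\<lambda>_. \<E>) \<rightarrow>\<^sub>M PiM {0..<n} (\<lambda>_. \<E>)"
      by (rule measurable_restrict_subset) simp
    then show "(\<lambda>\<omega>. restrict \<omega> {0..<n}) \<in> IT.PF.lim \<rightarrow>\<^sub>M PiM {0..<n} (\<lambda>_. \<E>)"
      by (simp cong: measurable_cong_sets add: PFs)
  qed (use Ggm in simp)
  also have "distr IT.PF.lim (PiM {0..<n} (\<lambda>_. \<E>)) (\<lambda>\<omega>. restrict \<omega> {0..<n}) = IT.C 0 n (\<lambda>_. undefined)"
  proof -
    have "IT.up_to {0..<n} = n"
    proof (rule antisym)
      show "IT.up_to {0..<n} \<le> n" by (simp add: IT.up_to_iff)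
      show "n \<le> IT.up_to {0..<n}" using IT.up_to[of "{0..<n}"] by auto
    qed
    then have "IT.CI {0..<n} = distr (IT.C 0 n (\<lambda>_. undefined)) (PiM {0..<n} (\<lambda>_. \<E>)) (\<lambda>f. restrict f {0..<n})"
      by (simp add: IT.CI_def)
    also have "\<dots> = IT.C 0 n (\<lambda>_. undefined)"
      using IT.distr_C[of n n "\<lambda>_. undefined" 0] by (simp add: space_PiM)
    finally show ?thesis by (simp add: IT.distr_lim)
  qed
  also have "(\<integral>\<^sup>+\<omega>. G (glue \<omega>) \<partial>IT.C 0 n (\<lambda>_. undefined)) = (\<integral>\<^sup>+x. tilt y (real n) x * G (glue (segs y n x)) \<partial>Q (fst y))"
    by (rule nn_integral_segments[OF y Ggm])
  also have "\<dots> = (\<integral>\<^sup>+x. tilt y (s + (real n - s)) x * G (hat_path y s x) \<partial>Q (fst y))"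
  proof (rule nn_integral_cong)
    fix x
    show "tilt y (real n) x * G (glue (segs y n x)) = tilt y (s + (real n - s)) x * G (hat_path y s x)"
    proof (cases "path_alive (snd y) x (real n)")
      case True
      have "glue (segs y n x) = hat_path y s x"
      proof (rule extensionalityI[of _ "{0..s}"])
        fix t assume t: "t \<in> {0..s}"
        have "glue (segs y n x) t = segs y n x (nat \<lfloor>t\<rfloor>) (t - real (nat \<lfloor>t\<rfloor>))" using t by (simp add: glue_def)
        also have "\<dots> = hat_at y (real (nat \<lfloor>t\<rfloor>) + (t - real (nat \<lfloor>t\<rfloor>))) x"
          by (rule segs_apply[OF True]) (use idx[OF t] in \<open>simp_all only: atLeastAtMost_iff\<close>)
        also have "\<dots> = hat_at y t x" by (rule arg_cong[where f="\<lambda>r. hat_at y r x"]) simp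
        also have "\<dots> = hat_path y s x t"
          using hat_path_apply[of y x s t] path_alive_mono[OF True sn] t by simp
        finally show "glue (segs y n x) t = hat_path y s x t" .
      qed (auto simp: glue_def hat_path_def)
      then show ?thesis by simp
    qed (simp add: tilt_dead)
  qed
  also have "\<dots> = (\<integral>\<^sup>+x. tilt y s x * G (hat_path y s x) \<partial>Q (fst y))"
    using sn measurable_compose[OF measurable_hat_path'[OF y] G]
    by (intro tilt_markov_start[OF y s]) (auto simp: hat_path_stop)
  finally show ?thesis .
qed

section \<open>Initial state and Markov property of the limit law\<close>

lemma measurable_N_iff: "f \<in> N y \<rightarrow>\<^sub>M M \<longleftrightarrow> f \<in> skorokhod_space S {0..} \<rightarrow>\<^sub>M M"
  using measurable_cong_sets[of "N y" "skorokhod_space S {0..}" M M] by simp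

lemma measurable_N_coord: "0 \<le> t \<Longrightarrow> (\<lambda>f. f t) \<in> N y \<rightarrow>\<^sub>M \<H>"
  unfolding measurable_N_iff by (rule measurable_skorokhod_coord) simp

lemma measurable_N_restrict: "0 \<le> s \<Longrightarrow> (\<lambda>f. restrict f {0..s}) \<in> N y \<rightarrow>\<^sub>M skorokhod_space S {0..s}"
  unfolding measurable_N_iff by (rule measurable_skorokhod_restrict) auto

lemma prob_space_N: "y \<in> hat_states S \<Longrightarrow> prob_space (N y)"
  using N_law[of y 0 "\<lambda>_. 1"] tilt_integral[of y 0] by (intro prob_spaceI) simp

lemma AE_N_start:
  assumes y: "y \<in> hat_states S"
  shows "AE f in N y. f 0 = y"
proof -
  have yH: "{y} \<in> sets \<H>"
    unfolding hat_space_def sets_restrict_space using y by (intro image_eqI[of _ _ "{y}"]) auto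
  define G :: "(real \<Rightarrow> hat_state) \<Rightarrow> ennreal" where "G g = indicator (space \<H> - {y}) (g 0)" for g
  have G: "G \<in> borel_measurable (skorokhod_space S {0..0})"
    unfolding G_def
    by (rule measurable_compose[OF measurable_skorokhod_coord borel_measurable_indicator[OF sets.compl_sets[OF yH]]]) simp
  have "(\<integral>\<^sup>+f. G (restrict f {0..0}) \<partial>N y) = (\<integral>\<^sup>+x. tilt y 0 x * G (hat_path y 0 x) \<partial>Q (fst y))"
    by (rule N_law[OF y order_refl G])
  also have "\<dots> = (\<integral>\<^sup>+x. 0 \<partial>Q (fst y))"
  proof (intro nn_integral_cong_AE, use AE_start_hat[OF y] in eventually_elim)
    case (elim x)
    then show ?case using hat_at_0[OF y, of x] hat_path_apply[of y x 0 0] by (simp add: G_def)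
  qed
  finally have "(\<integral>\<^sup>+f. G (restrict f {0..0}) \<partial>N y) = 0" by simp
  then have "AE f in N y. G (restrict f {0..0}) = 0"
    unfolding nn_integral_0_iff_AE[OF measurable_compose[OF measurable_N_restrict[OF order_refl] G]] .
  then show ?thesis
  proof (rule AE_mp, intro AE_I2 impI)
    fix f assume "f \<in> space (N y)" and G0: "G (restrict f {0..0}) = 0"
    then have "f 0 \<in> space \<H>" using measurable_space[OF measurable_N_coord[of 0 y]] by simp
    then show "f 0 = y" using G0 by (simp add: G_def indicator_def split: if_splits)
  qed
qed

text \<open>Preimages under restriction to \<open>[0, s]\<close> form a \<sigma>-algebra, and it
  contains the generators of the past.\<close>

lemma past_N_cases:
  assumes s: "0 \<le> s" and A: "A \<in> sets (past (N y) \<H> (\<lambda>t f. f t) s)"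
  obtains A' where "A' \<in> sets (skorokhod_space S {0..s})" "A = (\<lambda>f. restrict f {0..s}) -` A' \<inter> space (N y)"
proof -
  let ?V = "vimage_algebra (space (N y)) (\<lambda>f. restrict f {0..s}) (skorokhod_space S {0..s})"
  have fs: "(\<lambda>f. restrict f {0..s}) \<in> space (N y) \<rightarrow> space (skorokhod_space S {0..s})"
    using measurable_space[OF measurable_N_restrict[OF s]] by auto
  have gen: "{(\<lambda>f. f r) -` B \<inter> space (N y) |r B. r \<in> {0..s} \<and> B \<in> sets \<H>} \<subseteq> sets ?V"
  proof (rule subsetI)
    fix Z assume "Z \<in> {(\<lambda>f. f r) -` B \<inter> space (N y) |r B. r \<in> {0..s} \<and> B \<in> sets \<H>}"
    then obtain r B where r: "r \<in> {0..s}" "B \<in> sets \<H>" and Z: "Z = (\<lambda>f. f r) -` B \<inter> space (N y)" by blast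
    have "Z = (\<lambda>f. restrict f {0..s}) -` ((\<lambda>g. g r) -` B \<inter> space (skorokhod_space S {0..s})) \<inter> space (N y)"
      using r fs Z by auto
    moreover have "(\<lambda>g. g r) -` B \<inter> space (skorokhod_space S {0..s}) \<in> sets (skorokhod_space S {0..s})"
      by (rule measurable_sets[OF measurable_skorokhod_coord[OF r(1)] r(2)])
    ultimately show "Z \<in> sets ?V" unfolding sets_vimage_algebra2[OF fs] by blast
  qed
  have "A \<in> sigma_sets (space (N y)) {(\<lambda>f. f r) -` B \<inter> space (N y) |r B. r \<in> {0..s} \<and> B \<in> sets \<H>}"
    using A unfolding past_def by (subst (asm) sets_measure_of) auto
  also have "\<dots> \<subseteq> sets ?V"
    using sets.sigma_sets_subset[OF gen] by simp
  finally show thesis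
    unfolding sets_vimage_algebra2[OF fs] using that by blast
qed

text \<open>The two sides are means of functionals of the path on \<open>[0, s + t]\<close> and on
  \<open>[0, s]\<close>. \<open>N_law\<close> transfers both to the tilted path law, where
  \<open>tilt_markov\<close> conditions at time \<open>s\<close>.\<close>

lemma markov_process_N:
  assumes y: "y \<in> hat_states S"
  shows "markov_process \<H> K (N y) (\<lambda>t f. f t)"
  unfolding markov_process_def
proof (intro conjI allI ballI impI)
  show "prob_space (N y)" by (rule prob_space_N[OF y])
  show "(\<lambda>f. f t) \<in> N y \<rightarrow>\<^sub>M \<H>" if "0 \<le> t" for t using that by (rule measurable_N_coord)
next
  fix s t :: real and A B assume s: "0 \<le> s" and t: "0 \<le> t"
    and "A \<in> sets (past (N y) \<H> (\<lambda>t f. f t) s)" and B: "B \<in> sets \<H>"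
  obtain A' where A': "A' \<in> sets (skorokhod_space S {0..s})"
    and A: "A = (\<lambda>f. restrict f {0..s}) -` A' \<inter> space (N y)"
    by (rule past_N_cases[OF s \<open>A \<in> sets (past (N y) \<H> (\<lambda>t f. f t) s)\<close>])
  have st: "0 \<le> s + t" using s t by simp
  have i: "fst y \<in> S" using y by (rule hat_fst_mem)
  define G :: "(real \<Rightarrow> hat_state) \<Rightarrow> ennreal" where "G g = indicator A' (restrict g {0..s}) * indicator B (g (s + t))" for g
  have G: "G \<in> borel_measurable (skorokhod_space S {0..s + t})"
  proof -
    have 1: "(\<lambda>g. restrict g {0..s}) \<in> skorokhod_space S {0..s + t} \<rightarrow>\<^sub>M skorokhod_space S {0..s}"
      using t by (intro measurable_skorokhod_restrict[OF s] disjI2 exI[of _ "s + t"]) simp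
    have 2: "(\<lambda>g. g (s + t)) \<in> skorokhod_space S {0..s + t} \<rightarrow>\<^sub>M \<H>"
      using s t by (intro measurable_skorokhod_coord) auto
    show ?thesis unfolding G_def
      by (intro borel_measurable_times_ennreal measurable_compose[OF 1 borel_measurable_indicator[OF A']]
          measurable_compose[OF 2 borel_measurable_indicator[OF B]])
  qed
  define \<Psi> :: "(real \<Rightarrow> nat) \<Rightarrow> (real \<Rightarrow> nat) \<Rightarrow> ennreal"
    where "\<Psi> x z = indicator A' (hat_path y s x) * indicator B (hat_at (hat_at y s x) t z)" for x z
  have \<Psi>: "(\<lambda>w. \<Psi> (fst w) (snd w)) \<in> borel_measurable (\<D> \<Otimes>\<^sub>M \<D>)"
  proof -
    have 1: "(\<lambda>w. hat_path y s (fst w)) \<in> \<D> \<Otimes>\<^sub>M \<D> \<rightarrow>\<^sub>M skorokhod_space S {0..s}"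
      by (rule measurable_compose[OF measurable_fst measurable_hat_path'[OF y]])
    have 2: "(\<lambda>w. hat_at (hat_at y s (fst w)) t (snd w)) \<in> \<D> \<Otimes>\<^sub>M \<D> \<rightarrow>\<^sub>M \<H>"
      using measurable_hat_at'[OF y s] t by measurable
    show ?thesis unfolding \<Psi>_def
      by (intro borel_measurable_times_ennreal measurable_compose[OF 1 borel_measurable_indicator[OF A']]
          measurable_compose[OF 2 borel_measurable_indicator[OF B]])
  qed
  define R :: "(real \<Rightarrow> hat_state) \<Rightarrow> ennreal" where "R g = indicator A' g * emeasure (K t (g s)) B" for g
  have R: "R \<in> borel_measurable (skorokhod_space S {0..s})"
  proof -
    have 1: "(\<lambda>g. g s) \<in> skorokhod_space S {0..s} \<rightarrow>\<^sub>M \<H>"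
      using s by (intro measurable_skorokhod_coord) auto
    have 2: "(\<lambda>z. emeasure (K t z) B) \<in> borel_measurable \<H>"
      by (rule measurable_compose[OF measurable_prob_algebraD[OF measurable_K[OF t]] measurable_emeasure_subprob_algebra[OF B]])
    show ?thesis unfolding R_def
      by (intro borel_measurable_times_ennreal borel_measurable_indicator[OF A'] measurable_compose[OF 1 2])
  qed
  have AB: "A \<inter> {f \<in> space (N y). f (s + t) \<in> B} \<in> sets (N y)"
  proof (rule sets.Int)
    show "A \<in> sets (N y)" unfolding A by (rule measurable_sets[OF measurable_N_restrict[OF s] A'])
    have "{f \<in> space (N y). f (s + t) \<in> B} = (\<lambda>f. f (s + t)) -` B \<inter> space (N y)" by auto
    then show "{f \<in> space (N y). f (s + t) \<in> B} \<in> sets (N y)"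
      using measurable_sets[OF measurable_N_coord[OF st] B, of y] by simp
  qed
  have "emeasure (N y) (A \<inter> {f \<in> space (N y). f (s + t) \<in> B}) = (\<integral>\<^sup>+f. G (restrict f {0..s + t}) \<partial>N y)"
    unfolding nn_integral_indicator[OF AB, symmetric]
  proof (rule nn_integral_cong)
    fix f assume f: "f \<in> space (N y)"
    have "restrict (restrict f {0..s + t}) {0..s} = restrict f {0..s}"
      using t by (intro ext) (auto simp: restrict_def)
    then show "indicator (A \<inter> {f \<in> space (N y). f (s + t) \<in> B}) f = G (restrict f {0..s + t})"
      using f st by (simp add: G_def A indicator_def)
  qed
  also have "\<dots> = (\<integral>\<^sup>+x. tilt y (s + t) x * G (hat_path y (s + t) x) \<partial>Q (fst y))"
    by (rule N_law[OF y st G])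
  also have "\<dots> = (\<integral>\<^sup>+x. tilt y (s + t) x * \<Psi> (path_stop s x) (path_shift s x) \<partial>Q (fst y))"
  proof (rule nn_integral_cong)
    fix x
    show "tilt y (s + t) x * G (hat_path y (s + t) x) = tilt y (s + t) x * \<Psi> (path_stop s x) (path_shift s x)"
    proof (cases "path_alive (snd y) x (s + t)")
      case True
      then have al: "path_alive (snd y) x s" using t by (auto intro: path_alive_mono)
      have "restrict (hat_path y (s + t) x) {0..s} = hat_path y s x"
        using s t by (intro hat_path_restrict[OF True]) auto
      moreover have "hat_path y (s + t) x (s + t) = hat_at y (s + t) x"
        using st by (intro hat_path_apply[OF True]) auto
      moreover have "hat_at y (s + t) x = hat_at (hat_at y s x) t (path_shift s x)"
        using hat_at_flow[OF s t] al by simp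
      ultimately show ?thesis
        using s by (simp add: G_def \<Psi>_def hat_path_stop hat_at_stop)
    qed (simp add: tilt_dead)
  qed
  also have "\<dots> = (\<integral>\<^sup>+x. tilt y s x * (\<integral>\<^sup>+z. tilt (hat_at y s x) t z * \<Psi> (path_stop s x) z \<partial>Q (fst (hat_at y s x))) \<partial>Q (fst y))"
    by (rule tilt_markov[OF y s t \<Psi>])
  also have "\<dots> = (\<integral>\<^sup>+x. tilt y s x * R (hat_path y s x) \<partial>Q (fst y))"
  proof (rule nn_integral_cong)
    fix x assume "x \<in> space (Q (fst y))"
    then have x: "x \<in> space \<D>" using i by simp
    show "tilt y s x * (\<integral>\<^sup>+z. tilt (hat_at y s x) t z * \<Psi> (path_stop s x) z \<partial>Q (fst (hat_at y s x))) = tilt y s x * R (hat_path y s x)"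
    proof (cases "path_alive (snd y) x s")
      case True
      have h: "hat_at y s x \<in> hat_states S" by (rule hat_at_mem[OF y s x])
      have hi: "fst (hat_at y s x) \<in> S" by (rule hat_fst_mem[OF h])
      have m: "(\<lambda>z. tilt (hat_at y s x) t z * indicator B (hat_at (hat_at y s x) t z)) \<in> borel_measurable (Q (fst (hat_at y s x)))"
        unfolding measurable_Q_iff[OF hi]
        by (intro borel_measurable_times_ennreal measurable_tilt'[OF h t] measurable_compose[OF measurable_hat_at'[OF h t] borel_measurable_indicator[OF B]])
      have "(\<integral>\<^sup>+z. tilt (hat_at y s x) t z * \<Psi> (path_stop s x) z \<partial>Q (fst (hat_at y s x))) =
        (\<integral>\<^sup>+z. indicator A' (hat_path y s x) * (tilt (hat_at y s x) t z * indicator B (hat_at (hat_at y s x) t z)) \<partial>Q (fst (hat_at y s x)))"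
        using s by (intro nn_integral_cong) (simp add: \<Psi>_def hat_path_stop hat_at_stop ac_simps)
      also have "\<dots> = indicator A' (hat_path y s x) * emeasure (K t (hat_at y s x)) B"
        unfolding emeasure_K[OF h t B] by (rule nn_integral_cmult[OF m])
      also have "\<dots> = R (hat_path y s x)"
        using hat_path_apply[OF True, of s] s by (simp add: R_def)
      finally show ?thesis by simp
    qed (simp add: tilt_dead)
  qed
  also have "\<dots> = (\<integral>\<^sup>+f. R (restrict f {0..s}) \<partial>N y)"
    by (rule N_law[OF y s R, symmetric])
  also have "\<dots> = (\<integral>\<^sup>+f\<in>A. emeasure (K t (f s)) B \<partial>N y)"
    using s by (intro nn_integral_cong) (simp add: R_def A indicator_def)
  finally show "emeasure (N y) (A \<inter> {f \<in> space (N y). f (s + t) \<in> B}) = (\<integral>\<^sup>+f\<in>A. emeasure (K t (f s)) B \<partial>N y)" .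
qed

lemma restricted_law_N:
  assumes y: "y \<in> hat_states S" and s: "0 \<le> s"
  shows "restricted_law S (N y) s = distr (density (Q (fst y)) (tilt y s)) (skorokhod_space S {0..s}) (hat_path y s)"
    (is "_ = ?R")
proof (rule measure_eqI)
  fix A assume "A \<in> sets (restricted_law S (N y) s)"
  then have A: "A \<in> sets (skorokhod_space S {0..s})" by (simp add: restricted_law_def)
  have "emeasure (restricted_law S (N y) s) A = (\<integral>\<^sup>+f. indicator A f \<partial>restricted_law S (N y) s)"
    using A by (simp add: restricted_law_def)
  also have "\<dots> = (\<integral>\<^sup>+f. indicator A (restrict f {0..s}) \<partial>N y)"
    unfolding restricted_law_def using A by (intro nn_integral_distr measurable_N_restrict[OF s]) simp
  also have "\<dots> = (\<integral>\<^sup>+f. indicator A f \<partial>?R)"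
    using N_law[OF y s, of "indicator A"] nn_integral_tilted_path[OF y s, of "indicator A"] A by simp
  also have "\<dots> = emeasure ?R A" using A by simp
  finally show "emeasure (restricted_law S (N y) s) A = emeasure ?R A" .
qed (simp add: restricted_law_def)

end

section \<open>Convergence of the conditioned laws\<close>

lemma tendsto_divide_ennreal_pos:
  assumes f: "(f \<longlongrightarrow> ennreal a) F" and g: "(g \<longlongrightarrow> ennreal c) F" and ac: "0 \<le> a" "0 < c"
  shows "((\<lambda>x. f x / g x) \<longlongrightarrow> ennreal (a / c)) F"
proof -
  have f': "((\<lambda>x. enn2real (f x)) \<longlongrightarrow> a) F" and g': "((\<lambda>x. enn2real (g x)) \<longlongrightarrow> c) F"
    using ac by (auto intro!: tendsto_enn2real f g)
  have "((\<lambda>x. ennreal (enn2real (f x) / enn2real (g x))) \<longlongrightarrow> ennreal (a / c)) F"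
    using ac by (intro tendsto_ennrealI tendsto_divide f' g') auto
  then show ?thesis
  proof (rule Lim_transform_eventually)
    have "\<forall>\<^sub>F x in F. f x < top" "\<forall>\<^sub>F x in F. g x < top" "\<forall>\<^sub>F x in F. 0 < enn2real (g x)"
      using order_tendstoD(2)[OF f, of top] order_tendstoD(2)[OF g, of top] order_tendstoD(1)[OF g' ac(2)] by auto
    then show "\<forall>\<^sub>F x in F. ennreal (enn2real (f x) / enn2real (g x)) = f x / g x"
    proof eventually_elim
      case (elim x)
      then show ?case by (simp add: divide_ennreal[symmetric])
    qed
  qed
qed

text \<open>Adding its bound makes a bounded measurable test function nonnegative, so convergence of
  nonnegative integrals suffices. The topology enters through its carrier set alone.\<close>

lemma weakly_convergesI:
  fixes M :: "'p measure"
  assumes top: "topspace \<T> = space M" and \<mu>: "\<And>T. sets (\<mu> T) = sets M" and \<nu>: "sets \<nu> = sets M"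
    and p\<mu>: "\<forall>\<^sub>F T in at_top. prob_space (\<mu> T)" and p\<nu>: "prob_space \<nu>"
    and lim: "\<And>G b. G \<in> borel_measurable M \<Longrightarrow> (\<And>x. G x \<le> ennreal b) \<Longrightarrow>
      ((\<lambda>T. \<integral>\<^sup>+x. G x \<partial>\<mu> T) \<longlongrightarrow> (\<integral>\<^sup>+x. G x \<partial>\<nu>)) at_top"
  shows "weakly_converges \<T> \<mu> \<nu>"
  unfolding weakly_converges_def
proof (intro allI impI)
  fix F assume "continuous_map \<T> euclideanreal F \<and> bounded (F ` topspace \<T>)"
  then obtain b where b: "\<And>x. x \<in> space M \<Longrightarrow> \<bar>F x\<bar> \<le> b"
    unfolding bounded_iff top by auto
  show "((\<lambda>T. \<integral>x. F x \<partial>\<mu> T) \<longlongrightarrow> (\<integral>x. F x \<partial>\<nu>)) at_top"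
  proof (cases "F \<in> borel_measurable M")
    \<comment> \<open>A test function that is not measurable is not integrable, and both integrals
      take the default value 0.\<close>
    case False
    have "\<not> integrable L F" if "sets L = sets M" for L
      using False measurable_cong_sets[OF that refl] borel_measurable_integrable by blast
    then show ?thesis by (simp add: not_integrable_integral_eq \<mu> \<nu>)
  next
    case True
    \<comment> \<open>On the space \<open>p\<close> equals \<open>F + b\<close>; the truncation
      makes its bounds hold outside the space as well.\<close>
    define p where "p x = max 0 (min (2 * b) (F x + b))" for x
    have p: "p \<in> borel_measurable M" "\<And>x. 0 \<le> p x" "\<And>x. ennreal (p x) \<le> ennreal (max 0 (2 * b))"
      using True unfolding p_def by (auto intro!: ennreal_leI)
    have F: "(\<integral>x. F x \<partial>L) = enn2real (\<integral>\<^sup>+x. ennreal (p x) \<partial>L) - b" if L: "sets L = sets M" "prob_space L" for L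
    proof -
      interpret prob_space L by (rule L(2))
      have sp: "space L = space M" by (rule sets_eq_imp_space_eq[OF L(1)])
      have pm: "p \<in> borel_measurable L" using p(1) measurable_cong_sets[OF L(1) refl] by blast
      have pi: "integrable L p"
      proof (rule integrable_const_bound[OF _ pm])
        show "AE x in L. norm (p x) \<le> max 0 (2 * b)" by (auto simp: p_def)
      qed
      have "(\<integral>x. F x \<partial>L) = (\<integral>x. p x - b \<partial>L)"
      proof (rule Bochner_Integration.integral_cong[OF refl])
        fix x assume "x \<in> space L"
        then show "F x = p x - b" using b[of x] by (auto simp: p_def sp)
      qed
      also have "\<dots> = (\<integral>x. p x \<partial>L) - b" using pi prob_space by simp
      also have "(\<integral>x. p x \<partial>L) = enn2real (\<integral>\<^sup>+x. ennreal (p x) \<partial>L)"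
        by (rule integral_eq_nn_integral[OF pm]) (simp add: p(2))
      finally show ?thesis .
    qed
    have fin: "(\<integral>\<^sup>+x. ennreal (p x) \<partial>\<nu>) < top"
    proof -
      interpret prob_space \<nu> by (rule p\<nu>)
      have "(\<integral>\<^sup>+x. ennreal (p x) \<partial>\<nu>) \<le> (\<integral>\<^sup>+x. ennreal (max 0 (2 * b)) \<partial>\<nu>)" by (intro nn_integral_mono p(3))
      also have "\<dots> < top" by (simp add: emeasure_space_1 del: max_0_1)
      finally show ?thesis .
    qed
    have "((\<lambda>T. \<integral>\<^sup>+x. ennreal (p x) \<partial>\<mu> T) \<longlongrightarrow> (\<integral>\<^sup>+x. ennreal (p x) \<partial>\<nu>)) at_top"
      using p by (intro lim[of _ "max 0 (2 * b)"]) auto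
    then have "((\<lambda>T. enn2real (\<integral>\<^sup>+x. ennreal (p x) \<partial>\<mu> T)) \<longlongrightarrow> enn2real (\<integral>\<^sup>+x. ennreal (p x) \<partial>\<nu>)) at_top"
      using fin by (intro tendsto_enn2real) auto
    then have "((\<lambda>T. enn2real (\<integral>\<^sup>+x. ennreal (p x) \<partial>\<mu> T) - b) \<longlongrightarrow> (\<integral>x. F x \<partial>\<nu>)) at_top"
      unfolding F[OF \<nu> p\<nu>] by (intro tendsto_diff tendsto_const)
    then show ?thesis
      by (rule Lim_transform_eventually) (use p\<mu> in eventually_elim, simp add: F[OF \<mu>])
  qed
qed

context yaglom
begin

lemma scaled_pos_eventually:
  assumes "y \<in> hat_states S"
  shows "\<forall>\<^sub>F T in at_top. 0 < surv y T"
proof -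
  have "(scaled y \<longlongrightarrow> gam y * ennreal Lz) at_top"
    by (rule tendsto_at_topI_sequentially) (rule scaled_lim[OF assms])
  moreover have "0 < gam y * ennreal Lz" using gam_pos[OF assms] Lz_pos by (simp add: ennreal_zero_less_mult_iff)
  ultimately have "\<forall>\<^sub>F T in at_top. 0 < scaled y T" by (rule order_tendstoD(1))
  then show ?thesis by eventually_elim (simp add: scaled_def ennreal_zero_less_mult_iff)
qed

text \<open>Numerator and denominator are multiplied by \<open>exp (\<phi> * T)\<close>. By the
  Markov property at \<open>s\<close> the numerator becomes \<open>exp (\<phi> * s)\<close> times a
  mean of \<open>scaled\<close> at the states at time \<open>s\<close> and the remaining time
  \<open>T - s\<close>, with limit given by \<open>weighted_lim\<close>; the denominator becomes
  \<open>scaled y T\<close>. The constant \<open>Lz\<close> cancels.\<close>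

lemma conditioned_limit:
  fixes F :: "(real \<Rightarrow> nat) \<Rightarrow> ennreal"
  assumes y: "y \<in> hat_states S" and s: "0 \<le> s"
    and F [measurable]: "F \<in> borel_measurable \<D>" and stop: "\<And>x. F (path_stop s x) = F x" and Fb: "\<And>x. F x \<le> ennreal b"
  shows "((\<lambda>T. (\<integral>\<^sup>+x. F x * alive_ind y T x \<partial>Q (fst y)) / surv y T) \<longlongrightarrow> (\<integral>\<^sup>+x. tilt y s x * F x \<partial>Q (fst y))) at_top"
proof (rule tendsto_at_topI_sequentially)
  fix T :: "nat \<Rightarrow> real" assume T: "filterlim T at_top sequentially"
  have i: "fst y \<in> S" using y by (rule hat_fst_mem)
  note [measurable] = measurable_hat_comp[OF y s measurable_gam] measurable_hat_comp[OF y s measurable_scaled]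
    measurable_hat_comp[OF y s measurable_surv] measurable_tilt'[OF y s]
  define I where "I = (\<integral>\<^sup>+x. tilt y s x * F x \<partial>Q (fst y))"
  define W where "W = (\<integral>\<^sup>+x. F x * alive_ind y s x * gam (hat_at y s x) \<partial>Q (fst y))"
  have "I \<le> (\<integral>\<^sup>+x. tilt y s x * ennreal b \<partial>Q (fst y))"
    unfolding I_def by (intro nn_integral_mono mult_left_mono Fb) simp
  also have "\<dots> = ennreal b" using i tilt_integral[OF y s] by (simp add: nn_integral_multc)
  finally have "I < top" by (rule order_le_less_trans) simp
  then obtain r where r: "I = ennreal r" "0 \<le> r" by (cases I) auto
  obtain g where g: "gam y = ennreal g" "0 < g"
    using gam_finite[OF y] gam_pos[OF y] by (cases "gam y") auto
  have W: "ennreal (exp (\<phi> * s)) * W = gam y * I"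
  proof -
    have "gam y * I = (\<integral>\<^sup>+x. gam y * (tilt y s x * F x) \<partial>Q (fst y))"
      unfolding I_def using i by (simp add: nn_integral_cmult)
    also have "\<dots> = (\<integral>\<^sup>+x. ennreal (exp (\<phi> * s)) * (F x * alive_ind y s x * gam (hat_at y s x)) \<partial>Q (fst y))"
    proof (rule nn_integral_cong)
      fix x
      have one: "gam y * inverse (gam y) = 1" using gam_pos[OF y] gam_finite[OF y] by (simp add: divide_ennreal_def[symmetric])
      have "gam y * (tilt y s x * F x) = (gam y * inverse (gam y)) * (ennreal (exp (\<phi> * s)) * (F x * alive_ind y s x * gam (hat_at y s x)))"
        by (simp only: tilt_def divide_ennreal_def ac_simps)
      then show "gam y * (tilt y s x * F x) = ennreal (exp (\<phi> * s)) * (F x * alive_ind y s x * gam (hat_at y s x))"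
        by (simp add: one)
    qed
    also have "\<dots> = ennreal (exp (\<phi> * s)) * W"
      unfolding W_def using i by (intro nn_integral_cmult) simp
    finally show ?thesis by simp
  qed
  have T': "filterlim (\<lambda>n. T n - s) at_top sequentially"
    using filterlim_tendsto_add_at_top[OF tendsto_const[of "- s"] T] by simp
  have num: "(\<lambda>n. ennreal (exp (\<phi> * s)) * (\<integral>\<^sup>+x. F x * alive_ind y s x * scaled (hat_at y s x) (T n - s) \<partial>Q (fst y)))
      \<longlonglongrightarrow> ennreal (g * r * Lz)"
  proof -
    have "(\<lambda>n. ennreal (exp (\<phi> * s)) * (\<integral>\<^sup>+x. F x * alive_ind y s x * scaled (hat_at y s x) (T n - s) \<partial>Q (fst y)))
      \<longlonglongrightarrow> ennreal (exp (\<phi> * s)) * (W * ennreal Lz)"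
      unfolding W_def by (intro ennreal_tendsto_cmult weighted_lim[OF y s T' F Fb]) simp
    also have "ennreal (exp (\<phi> * s)) * (W * ennreal Lz) = ennreal (g * r * Lz)"
      unfolding mult.assoc[symmetric] W g(1) r(1) using g r Lz_pos by (simp add: ennreal_mult)
    finally show ?thesis .
  qed
  have "(\<lambda>n. scaled y (T n)) \<longlonglongrightarrow> ennreal (g * Lz)"
    using scaled_lim[OF y T] g Lz_pos by (simp add: ennreal_mult)
  from tendsto_divide_ennreal_pos[OF num this]
  have "(\<lambda>n. ennreal (exp (\<phi> * s)) * (\<integral>\<^sup>+x. F x * alive_ind y s x * scaled (hat_at y s x) (T n - s) \<partial>Q (fst y)) / scaled y (T n))
      \<longlonglongrightarrow> I"
    using g r Lz_pos by (simp add: field_simps)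
  then show "(\<lambda>n. (\<integral>\<^sup>+x. F x * alive_ind y (T n) x \<partial>Q (fst y)) / surv y (T n)) \<longlonglongrightarrow> (\<integral>\<^sup>+x. tilt y s x * F x \<partial>Q (fst y))"
    unfolding I_def[symmetric]
  proof (rule Lim_transform_eventually)
    have "\<forall>\<^sub>F n in sequentially. s \<le> T n" using T by (auto simp: filterlim_at_top)
    then show "\<forall>\<^sub>F n in sequentially. ennreal (exp (\<phi> * s)) * (\<integral>\<^sup>+x. F x * alive_ind y s x * scaled (hat_at y s x) (T n - s) \<partial>Q (fst y)) / scaled y (T n) =
      (\<integral>\<^sup>+x. F x * alive_ind y (T n) x \<partial>Q (fst y)) / surv y (T n)"
    proof eventually_elim
      case (elim n)
      have "ennreal (exp (\<phi> * s)) * (\<integral>\<^sup>+x. F x * alive_ind y s x * scaled (hat_at y s x) (T n - s) \<partial>Q (fst y)) =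
        (\<integral>\<^sup>+x. ennreal (exp (\<phi> * s)) * (F x * alive_ind y s x * scaled (hat_at y s x) (T n - s)) \<partial>Q (fst y))"
        using i by (intro nn_integral_cmult[symmetric]) simp
      also have "\<dots> = (\<integral>\<^sup>+x. ennreal (exp (\<phi> * T n)) * (F x * alive_ind y s x * surv (hat_at y s x) (T n - s)) \<partial>Q (fst y))"
      proof (rule nn_integral_cong)
        fix x
        have e: "ennreal (exp (\<phi> * T n)) = ennreal (exp (\<phi> * s)) * ennreal (exp (\<phi> * (T n - s)))"
          by (simp add: ennreal_mult[symmetric] exp_add[symmetric] distrib_left[symmetric])
        show "ennreal (exp (\<phi> * s)) * (F x * alive_ind y s x * scaled (hat_at y s x) (T n - s)) =
          ennreal (exp (\<phi> * T n)) * (F x * alive_ind y s x * surv (hat_at y s x) (T n - s))"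
          unfolding e scaled_def by (simp only: ac_simps)
      qed
      also have "\<dots> = ennreal (exp (\<phi> * T n)) * (\<integral>\<^sup>+x. F x * alive_ind y s x * surv (hat_at y s x) (T n - s) \<partial>Q (fst y))"
        using i by (intro nn_integral_cmult) simp
      also have "\<dots> = (\<integral>\<^sup>+x. F x * alive_ind y (T n) x \<partial>Q (fst y)) * ennreal (exp (\<phi> * T n))"
        using surv_markov_weight[OF y s, of "T n - s" F] elim stop F by (simp add: mult.commute)
      finally show ?case
        unfolding scaled_def mult.commute[of "ennreal (exp (\<phi> * T n))" "surv y (T n)"]
        by (simp add: divide_mult_eq)
    qed
  qed
qed

end

section \<open>Translation to the given chain\<close>

lemma cycle_time_cong:
  assumes "\<And>t. 0 \<le> t \<Longrightarrow> x t = x' t"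
  shows "cycle_time x = cycle_time x'"
proof -
  have "(x t = 0 \<and> (\<exists>r\<in>{0..t}. x r \<noteq> 0)) = (x' t = 0 \<and> (\<exists>r\<in>{0..t}. x' r \<noteq> 0))" for t
    using assms by (cases "0 \<le> t") auto
  then show ?thesis by (simp add: cycle_time_def)
qed

lemma full_holding_time_cong: "(\<And>t. 0 \<le> t \<Longrightarrow> x t = x' t) \<Longrightarrow> full_holding_time x = full_holding_time x'"
  unfolding full_holding_time_def by (intro arg_cong[where f=Inf] Collect_cong ex_cong1 conj_cong refl) auto

context ctmc
begin

lemma path_of_apply: "0 \<le> t \<Longrightarrow> path_of \<omega> t = X t \<omega>"
  by (simp add: path_of_def)

lemma nn_integral_law:
  assumes "i \<in> S" "f \<in> borel_measurable (path_space S)"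
  shows "(\<integral>\<^sup>+x. f x \<partial>law i) = (\<integral>\<^sup>+\<omega>. f (path_of \<omega>) \<partial>P i)"
  unfolding law_def using assms by (intro nn_integral_distr) auto

lemma cycle_mgf_law:
  "cycle_mgf P X l = (\<integral>\<^sup>+x. (if full_holding_time x < 1 then exp_ereal l (cycle_time x) else 0) \<partial>law 0)"
proof -
  have c: "cycle_time (path_of \<omega>) = cycle_time (\<lambda>t. X t \<omega>)" "full_holding_time (path_of \<omega>) = full_holding_time (\<lambda>t. X t \<omega>)" for \<omega>
    by (auto intro!: cycle_time_cong full_holding_time_cong simp: path_of_apply)
  have "(\<integral>\<^sup>+x. (if full_holding_time x < 1 then exp_ereal l (cycle_time x) else 0) \<partial>law 0) =
    (\<integral>\<^sup>+\<omega>. (if full_holding_time (path_of \<omega>) < 1 then exp_ereal l (cycle_time (path_of \<omega>)) else 0) \<partial>P 0)"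
    by (rule nn_integral_law[OF zero_mem]) measurable
  also have "\<dots> = cycle_mgf P X l"
    unfolding cycle_mgf_def c by (intro nn_integral_cong) (simp add: indicator_def)
  finally show ?thesis by simp
qed

lemma survival_iff:
  assumes y: "fst y \<in> S" and T: "0 \<le> T" and \<omega>: "\<omega> \<in> space (P (fst y))"
  shows "\<omega> \<in> survival P X T y \<longleftrightarrow> path_alive (snd y) (path_of \<omega>) T"
proof -
  have "cadlag_on {0..} (\<lambda>r. X r \<omega>)" using nonexplosive y \<omega> by (auto simp: nonexplosive_ctmc_def)
  then have "ereal T < killing_time (snd y) (\<lambda>r. X r \<omega>) \<longleftrightarrow> path_alive (snd y) (\<lambda>r. X r \<omega>) T"
    using T by (rule less_killing_time_iff)
  also have "\<dots> \<longleftrightarrow> path_alive (snd y) (path_of \<omega>) T"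
    by (rule path_alive_cong) (simp add: path_of_apply)
  finally show ?thesis using \<omega> by (simp add: survival_def split_beta)
qed

lemma hat_X_path_of: "0 \<le> t \<Longrightarrow> hat_X u (\<lambda>r. X r \<omega>) t = hat_X u (path_of \<omega>) t"
  by (rule hat_X_cong) (auto simp: path_of_apply)

lemma survival_sets:
  assumes "fst y \<in> S" "0 \<le> T"
  shows "survival P X T y \<in> sets (P (fst y))"
proof -
  have "survival P X T y = {\<omega> \<in> space (P (fst y)). path_alive (snd y) (path_of \<omega>) T}"
    using survival_iff[OF assms] by (auto simp: survival_def split_beta)
  also have "\<dots> \<in> sets (P (fst y))" using assms by measurable
  finally show ?thesis .
qed

lemma nn_integral_survival:
  assumes y: "fst y \<in> S" and T: "0 \<le> T" and f [measurable]: "f \<in> borel_measurable (path_space S)"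
  shows "(\<integral>\<^sup>+\<omega>. f (path_of \<omega>) * indicator (survival P X T y) \<omega> \<partial>P (fst y)) = (\<integral>\<^sup>+x. f x * alive_ind y T x \<partial>law (fst y))"
proof -
  have "(\<integral>\<^sup>+x. f x * alive_ind y T x \<partial>law (fst y)) = (\<integral>\<^sup>+\<omega>. f (path_of \<omega>) * alive_ind y T (path_of \<omega>) \<partial>P (fst y))"
    by (rule nn_integral_law[OF y]) measurable
  also have "\<dots> = (\<integral>\<^sup>+\<omega>. f (path_of \<omega>) * indicator (survival P X T y) \<omega> \<partial>P (fst y))"
    using survival_iff[OF y T] by (intro nn_integral_cong) (simp add: alive_ind_def indicator_def)
  finally show ?thesis by simp
qed

end

locale conditioned_chain = ctmc S q P X + yaglom S "ctmc.law S P X" "q 0 0" \<phi> D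
  for S :: "nat set" and q P and X :: "real \<Rightarrow> 'w \<Rightarrow> nat" and \<phi> D
begin

lemma kappa_pos: "0 < kappa q \<phi> D"
  using phi_pos D_pos by (simp add: kappa_def)

text \<open>In 0 this is the closed form of \<open>gam\<close>. Outside 0 the first return is the
  hitting time of 0 and almost every path satisfies \<open>exits\<close>.\<close>

lemma p_fun_eq:
  assumes y: "y \<in> hat_states S"
  shows "p_fun q P X \<phi> D y = ennreal (kappa q \<phi> D) * gam y"
proof (cases "fst y = 0")
  case True
  define u where "u = snd y"
  have u: "0 \<le> u" "u < 1" and yu: "y = (0, u)"
    using y True hat_states_snd[OF y] by (auto simp: u_def prod_eq_iff)
  have nn: "0 \<le> integral {0..1 - u} (\<lambda>s. exp ((\<phi> + q 0 0) * s)) / integral {0..1} (\<lambda>s. exp ((\<phi> + q 0 0) * s))"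
    by (intro divide_nonneg_nonneg Henstock_Kurzweil_Integration.integral_nonneg integrable_continuous_interval continuous_intros) auto
  show ?thesis
    unfolding yu gam_origin_formula[OF u] ennreal_mult[OF less_imp_le[OF kappa_pos] nn, symmetric]
    by (simp add: p_fun_def exit_rate_def mult.commute)
next
  case False
  have i: "fst y \<in> S" using y by (rule hat_fst_mem)
  have s: "snd y = 0" using y False by (auto simp: hat_states_iff)
  have "gam y = (\<integral>\<^sup>+\<omega>. exit_ind y (path_of \<omega>) * exp_ereal \<phi> (cycle_time (path_of \<omega>)) \<partial>P (fst y))"
    unfolding gam_def by (rule nn_integral_law[OF i]) measurable
  also have "\<dots> = (\<integral>\<^sup>+\<omega>. exp_ereal \<phi> (hitting_time_0 (\<lambda>t. X t \<omega>)) \<partial>P (fst y))"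
  proof (rule nn_integral_cong_AE)
    have "AE \<omega> in P (fst y). X 0 \<omega> = fst y" using nonexplosive i by (auto simp: nonexplosive_ctmc_def)
    then show "AE \<omega> in P (fst y). exit_ind y (path_of \<omega>) * exp_ereal \<phi> (cycle_time (path_of \<omega>)) = exp_ereal \<phi> (hitting_time_0 (\<lambda>t. X t \<omega>))"
    proof eventually_elim
      case (elim \<omega>)
      have "exits (snd y) (path_of \<omega>)"
        unfolding exits_def using elim False s by (intro bexI[of _ 0]) (auto simp: path_of_apply)
      moreover have "hitting_time_0 (\<lambda>t. X t \<omega>) = cycle_time (path_of \<omega>)"
        using elim False by (subst hitting_time_eq_cycle_time) (auto intro!: cycle_time_cong simp: path_of_apply)
      ultimately show ?case by (simp add: exit_ind_def)
    qed
  qed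
  finally show ?thesis using False by (simp add: p_fun_def split_beta)
qed

lemma p_fun_ratio:
  assumes "y \<in> hat_states S" "z \<in> hat_states S"
  shows "p_fun q P X \<phi> D z / p_fun q P X \<phi> D y = gam z / gam y"
proof -
  have k: "ennreal (kappa q \<phi> D) \<noteq> 0" "ennreal (kappa q \<phi> D) \<noteq> \<infinity>" using kappa_pos by auto
  show ?thesis
    unfolding p_fun_eq[OF assms(1)] p_fun_eq[OF assms(2)] mult.commute[of "ennreal (kappa q \<phi> D)"]
    by (rule divide_mult_eq[OF k])
qed

text \<open>Read along a surviving path, the density of \<open>P_infinity\<close> is
  \<open>exp (\<phi> * t)\<close> times a ratio of values of \<open>gam\<close>; together with the
  survival indicator it is \<open>tilt\<close>.\<close>

lemma P_infinity_eq:
  assumes y: "y \<in> hat_states S" and t: "0 \<le> t"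
  shows "P_infinity S q P X \<phi> D t y = K t y"
proof (rule measure_eqI)
  let ?A = "survival P X t y" and ?h = "\<lambda>\<omega>. hat_X (snd y) (\<lambda>r. X r \<omega>) t"
  have i: "fst y \<in> S" using y by (rule hat_fst_mem)
  have A: "?A \<in> sets (P (fst y))" by (rule survival_sets[OF i t])
  have hP: "hat_P S P X t y = distr (restrict_space (P (fst y)) ?A) \<H> ?h"
    by (simp add: hat_P_def split_beta)
  have sP: "sets (hat_P S P X t y) = sets \<H>" by (simp add: hP)
  define w where "w z = ennreal (exp (\<phi> * t)) * (gam z / gam y)" for z
  have wm: "w \<in> borel_measurable \<H>"
    unfolding w_def using measurable_gam by measurable
  have P: "P_infinity S q P X \<phi> D t y = density (hat_P S P X t y) w"
  proof -
    have eq: "ennreal (exp (\<phi> * t)) * (p_fun q P X \<phi> D z / p_fun q P X \<phi> D y) = w z" if "z \<in> space \<H>" for z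
      using that p_fun_ratio[OF y, of z] by (simp add: w_def)
    have sp: "space (hat_P S P X t y) = space \<H>" by (rule sets_eq_imp_space_eq[OF sP])
    have wm': "w \<in> borel_measurable (hat_P S P X t y)" using wm measurable_cong_sets[OF sP refl] by blast
    then have "(\<lambda>z. ennreal (exp (\<phi> * t)) * (p_fun q P X \<phi> D z / p_fun q P X \<phi> D y)) \<in> borel_measurable (hat_P S P X t y)"
      using eq sp by (subst measurable_cong[where g=w]) auto
    then show ?thesis
      unfolding P_infinity_def using wm' eq sp by (intro density_cong) (auto intro!: AE_I2)
  qed
  show sets: "sets (P_infinity S q P X \<phi> D t y) = sets (K t y)" by (simp add: P sP)
  fix B assume "B \<in> sets (P_infinity S q P X \<phi> D t y)"
  then have B: "B \<in> sets \<H>" by (simp add: sets)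
  have wB: "(\<lambda>z. w z * indicator B z) \<in> borel_measurable \<H>"
    by (intro borel_measurable_times_ennreal wm borel_measurable_indicator B)
  have h: "?h \<omega> = hat_at y t (path_of \<omega>)" if "\<omega> \<in> ?A" "\<omega> \<in> space (P (fst y))" for \<omega>
    using that survival_iff[OF i t] t by (simp add: hat_at_def hat_X_path_of)
  have m: "?h \<in> restrict_space (P (fst y)) ?A \<rightarrow>\<^sub>M \<H>"
  proof (subst measurable_cong[where g="\<lambda>\<omega>. hat_at y t (path_of \<omega>)"])
    show "\<And>\<omega>. \<omega> \<in> space (restrict_space (P (fst y)) ?A) \<Longrightarrow> ?h \<omega> = hat_at y t (path_of \<omega>)"
      using h by (auto simp: space_restrict_space)
    show "(\<lambda>\<omega>. hat_at y t (path_of \<omega>)) \<in> restrict_space (P (fst y)) ?A \<rightarrow>\<^sub>M \<H>"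
      by (rule measurable_restrict_space1[OF measurable_compose[OF measurable_path_of[OF i] measurable_hat_at'[OF y t]]])
  qed
  have "emeasure (P_infinity S q P X \<phi> D t y) B = (\<integral>\<^sup>+z. w z * indicator B z \<partial>hat_P S P X t y)"
    unfolding P using B wm sP by (intro emeasure_density) (auto cong: measurable_cong_sets)
  also have "\<dots> = (\<integral>\<^sup>+\<omega>. w (?h \<omega>) * indicator B (?h \<omega>) \<partial>restrict_space (P (fst y)) ?A)"
    unfolding hP using wB by (intro nn_integral_distr m) simp
  also have "\<dots> = (\<integral>\<^sup>+\<omega>. w (?h \<omega>) * indicator B (?h \<omega>) * indicator ?A \<omega> \<partial>P (fst y))"
    using A by (intro nn_integral_restrict_space) auto
  also have "\<dots> = (\<integral>\<^sup>+\<omega>. (w (hat_at y t (path_of \<omega>)) * indicator B (hat_at y t (path_of \<omega>))) * indicator ?A \<omega> \<partial>P (fst y))"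
    using h by (intro nn_integral_cong) (auto simp: indicator_def)
  also have "\<dots> = (\<integral>\<^sup>+x. (w (hat_at y t x) * indicator B (hat_at y t x)) * alive_ind y t x \<partial>law (fst y))"
    by (rule nn_integral_survival[OF i t measurable_compose[OF measurable_hat_at'[OF y t] wB]])
  also have "\<dots> = (\<integral>\<^sup>+x. tilt y t x * indicator B (hat_at y t x) \<partial>law (fst y))"
    by (intro nn_integral_cong) (simp add: tilt_def w_def ac_simps)
  also have "\<dots> = emeasure (K t y) B" by (rule emeasure_K[OF y t B, symmetric])
  finally show "emeasure (P_infinity S q P X \<phi> D t y) B = emeasure (K t y) B" .
qed

lemma transition_semigroup_P_infinity: "transition_semigroup \<H> (P_infinity S q P X \<phi> D)"
  unfolding transition_semigroup_def
proof (intro conjI allI impI ballI)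
  fix s :: real assume s: "0 \<le> s"
  show "P_infinity S q P X \<phi> D s \<in> \<H> \<rightarrow>\<^sub>M prob_algebra \<H>"
    using measurable_K[OF s] by (subst measurable_cong[where g="K s"]) (auto simp: P_infinity_eq s)
next
  fix y assume y: "y \<in> space \<H>"
  then show "P_infinity S q P X \<phi> D 0 y = return \<H> y" by (simp add: P_infinity_eq K_0)
next
  fix s t :: real and y assume st: "0 \<le> s" "0 \<le> t" and "y \<in> space \<H>"
  then have y: "y \<in> hat_states S" by simp
  have "space (K s y) = space \<H>" by (rule sets_eq_imp_space_eq) simp
  then have "K s y \<bind> K t = K s y \<bind> P_infinity S q P X \<phi> D t"
    using st by (intro bind_cong refl) (simp add: P_infinity_eq)
  then show "P_infinity S q P X \<phi> D (s + t) y = P_infinity S q P X \<phi> D s y \<bind> P_infinity S q P X \<phi> D t"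
    using y st by (simp add: P_infinity_eq K_add)
qed

lemma markov_process_P_infinity:
  assumes y: "y \<in> hat_states S"
  shows "markov_process \<H> (P_infinity S q P X \<phi> D) (N y) (\<lambda>t f. f t)"
proof -
  have "(\<integral>\<^sup>+f\<in>A. emeasure (P_infinity S q P X \<phi> D t (f s)) B \<partial>N y) = (\<integral>\<^sup>+f\<in>A. emeasure (K t (f s)) B \<partial>N y)"
    if "0 \<le> s" "0 \<le> t" for s t A B
    using that measurable_space[OF measurable_N_coord[of s y]]
    by (intro nn_integral_cong) (simp add: P_infinity_eq)
  then show ?thesis
    using markov_process_N[OF y] unfolding markov_process_def by simp
qed

text \<open>For \<open>T \<ge> s\<close> survival beyond \<open>T\<close> implies survival up to
  \<open>s\<close>, so on the conditioning event the conditioned path is \<open>hat_path y s\<close>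
  of the chain.\<close>

lemma nn_integral_conditioned_law:
  assumes y: "y \<in> hat_states S" and s: "0 \<le> s" "s \<le> T" and G: "G \<in> borel_measurable (skorokhod_space S {0..s})"
  shows "(\<integral>\<^sup>+f. G f \<partial>conditioned_law S P X y s T) = (\<integral>\<^sup>+x. G (hat_path y s x) * alive_ind y T x \<partial>law (fst y)) / surv y T"
proof -
  let ?A = "survival P X T y" and ?h = "\<lambda>\<omega>. \<lambda>t\<in>{0..s}. hat_X (snd y) (\<lambda>r. X r \<omega>) t"
  let ?U = "uniform_measure (P (fst y)) ?A"
  have T: "0 \<le> T" using s by simp
  have i: "fst y \<in> S" using y by (rule hat_fst_mem)
  have A: "?A \<in> sets (P (fst y))" by (rule survival_sets[OF i T])
  have law: "conditioned_law S P X y s T = distr (restrict_space ?U ?A) (skorokhod_space S {0..s}) ?h"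
    by (simp add: conditioned_law_def split_beta Let_def)
  have h: "?h \<omega> = hat_path y s (path_of \<omega>)" if "\<omega> \<in> ?A" "\<omega> \<in> space (P (fst y))" for \<omega>
    using that survival_iff[OF i T] s path_alive_mono[of "snd y" "path_of \<omega>" T s]
    by (intro ext) (auto simp: hat_path_def hat_X_path_of restrict_def)
  have pm: "(\<lambda>\<omega>. hat_path y s (path_of \<omega>)) \<in> P (fst y) \<rightarrow>\<^sub>M skorokhod_space S {0..s}"
    by (rule measurable_compose[OF measurable_path_of[OF i] measurable_hat_path'[OF y]])
  have m: "?h \<in> restrict_space ?U ?A \<rightarrow>\<^sub>M skorokhod_space S {0..s}"
  proof (subst measurable_cong[where g="\<lambda>\<omega>. hat_path y s (path_of \<omega>)"])
    show "\<And>\<omega>. \<omega> \<in> space (restrict_space ?U ?A) \<Longrightarrow> ?h \<omega> = hat_path y s (path_of \<omega>)"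
      using h by (auto simp: space_restrict_space)
    show "(\<lambda>\<omega>. hat_path y s (path_of \<omega>)) \<in> restrict_space ?U ?A \<rightarrow>\<^sub>M skorokhod_space S {0..s}"
      using pm by (intro measurable_restrict_space1) simp
  qed
  have "(\<integral>\<^sup>+f. G f \<partial>conditioned_law S P X y s T) = (\<integral>\<^sup>+\<omega>. G (?h \<omega>) \<partial>restrict_space ?U ?A)"
    unfolding law using G by (intro nn_integral_distr m) simp
  also have "\<dots> = (\<integral>\<^sup>+\<omega>. G (?h \<omega>) * indicator ?A \<omega> \<partial>?U)"
    using A by (intro nn_integral_restrict_space) auto
  also have "\<dots> = (\<integral>\<^sup>+\<omega>. G (hat_path y s (path_of \<omega>)) * indicator ?A \<omega> \<partial>?U)"
    using h by (intro nn_integral_cong) (auto simp: indicator_def)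
  also have "\<dots> = (\<integral>\<^sup>+\<omega>. G (hat_path y s (path_of \<omega>)) * indicator ?A \<omega> * indicator ?A \<omega> \<partial>P (fst y)) / emeasure (P (fst y)) ?A"
    by (intro nn_integral_uniform_measure borel_measurable_times_ennreal measurable_compose[OF pm G] borel_measurable_indicator A)
  also have "(\<integral>\<^sup>+\<omega>. G (hat_path y s (path_of \<omega>)) * indicator ?A \<omega> * indicator ?A \<omega> \<partial>P (fst y)) =
    (\<integral>\<^sup>+\<omega>. G (hat_path y s (path_of \<omega>)) * indicator ?A \<omega> \<partial>P (fst y))"
    by (intro nn_integral_cong) (simp add: indicator_def)
  also have "\<dots> = (\<integral>\<^sup>+x. G (hat_path y s x) * alive_ind y T x \<partial>law (fst y))"
    by (rule nn_integral_survival[OF i T measurable_compose[OF measurable_hat_path'[OF y] G]])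
  also have "emeasure (P (fst y)) ?A = surv y T"
    using nn_integral_survival[OF i T, of "\<lambda>_. 1"] A by (simp add: surv_def)
  finally show ?thesis .
qed

text \<open>All bounded measurable functionals of the path on \<open>[0, s]\<close> converge, by
  \<open>conditioned_limit\<close> applied to their composition with \<open>hat_path y s\<close>;
  the limit is identified by \<open>restricted_law_N\<close>.\<close>

lemma conditioned_law_converges:
  assumes y: "y \<in> hat_states S" and s: "0 \<le> s"
  shows "weakly_converges (skorokhod_topology S s) (\<lambda>T. conditioned_law S P X y s T) (restricted_law S (N y) s)"
proof (rule weakly_convergesI[where M="skorokhod_space S {0..s}"])
  show "topspace (skorokhod_topology S s) = space (skorokhod_space S {0..s})"
    unfolding skorokhod_topology_def by (rule Metric_space.topspace_mtopology[OF Metric_space_skorokhod])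
  show "sets (conditioned_law S P X y s T) = sets (skorokhod_space S {0..s})" for T
    by (simp add: conditioned_law_def split_beta Let_def)
  show sr: "sets (restricted_law S (N y) s) = sets (skorokhod_space S {0..s})"
    by (simp add: restricted_law_def)
  show "prob_space (restricted_law S (N y) s)"
    unfolding restricted_law_def by (intro prob_space.prob_space_distr prob_space_N y measurable_N_restrict s)
  show "\<forall>\<^sub>F T in at_top. prob_space (conditioned_law S P X y s T)"
    using scaled_pos_eventually[OF y] eventually_ge_at_top[of s]
  proof eventually_elim
    case (elim T)
    have "surv y T < top" using surv_le_1[OF y, of T] by (rule order_le_less_trans) simp
    then show ?case
      using nn_integral_conditioned_law[OF y s elim(2), of "\<lambda>_. 1"] elim(1)
      by (intro prob_spaceI) (simp add: surv_def[symmetric])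
  qed
  fix G :: "(real \<Rightarrow> hat_state) \<Rightarrow> ennreal" and b assume G: "G \<in> borel_measurable (skorokhod_space S {0..s})" "\<And>f. G f \<le> ennreal b"
  have "((\<lambda>T. (\<integral>\<^sup>+x. G (hat_path y s x) * alive_ind y T x \<partial>law (fst y)) / surv y T) \<longlongrightarrow> (\<integral>\<^sup>+x. tilt y s x * G (hat_path y s x) \<partial>law (fst y))) at_top"
    by (rule conditioned_limit[OF y s measurable_compose[OF measurable_hat_path'[OF y] G(1)] _ G(2)]) (simp add: hat_path_stop)
  also have "(\<integral>\<^sup>+x. tilt y s x * G (hat_path y s x) \<partial>law (fst y)) = (\<integral>\<^sup>+f. G f \<partial>restricted_law S (N y) s)"
    unfolding restricted_law_N[OF y s] by (rule nn_integral_tilted_path[OF y s G(1), symmetric])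
  finally show "((\<lambda>T. \<integral>\<^sup>+f. G f \<partial>conditioned_law S P X y s T) \<longlongrightarrow> (\<integral>\<^sup>+f. G f \<partial>restricted_law S (N y) s)) at_top"
  proof (rule Lim_transform_eventually)
    show "\<forall>\<^sub>F T in at_top. (\<integral>\<^sup>+x. G (hat_path y s x) * alive_ind y T x \<partial>law (fst y)) / surv y T = (\<integral>\<^sup>+f. G f \<partial>conditioned_law S P X y s T)"
      using eventually_ge_at_top[of s] by eventually_elim (rule nn_integral_conditioned_law[OF y s _ G(1), symmetric])
  qed
qed

end

theorem corollary1p4:
  fixes S :: "nat set" and q :: "nat \<Rightarrow> nat \<Rightarrow> real"
    and P :: "nat \<Rightarrow> 'w measure" and X :: "real \<Rightarrow> 'w \<Rightarrow> nat"
    and \<phi> D :: real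
  assumes "S = UNIV \<or> (\<exists>K. S = {0..K})"
    and "nonexplosive_ctmc S q P X"
    and "irreducible_chain S P X"
    and "recurrent_chain S P X"
    and "cycle_mgf P X \<phi> = 1"
    and "((\<lambda>l. enn2real (cycle_mgf P X l)) has_real_derivative D) (at_left \<phi>)"
  shows "transition_semigroup (hat_space S) (P_infinity S q P X \<phi> D) \<and>
    (\<forall>x\<in>hat_states S. \<exists>N.
       sets N = sets (skorokhod_space S {0..}) \<and>
       markov_process (hat_space S) (P_infinity S q P X \<phi> D) N (\<lambda>t f. f t) \<and>
       (AE f in N. f 0 = x) \<and>
       (\<forall>s>0. weakly_converges (skorokhod_topology S s)
                (\<lambda>T. conditioned_law S P X x s T) (restricted_law S N s)))"
proof -
  have z: "0 \<in> S" using assms(1) by auto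
  interpret c: ctmc S q P X by (rule ctmc.intro[OF z assms(2)])
  interpret conditioned_chain S q P X \<phi> D
  proof unfold_locales
    fix i assume i: "i \<in> S"
    show "c.law i \<in> space (prob_algebra (path_space S))" by (rule c.law_prob[OF i])
    show "AE x in c.law i. x 0 = i" by (rule c.law_start[OF i])
    show "\<exists>t\<ge>0. 0 < measure (c.law 0) {x \<in> space (path_space S). x t = i}"
    proof -
      obtain t where t: "0 \<le> t" "0 < measure (P 0) {\<omega> \<in> space (P 0). X t \<omega> = i}"
        using assms(3) z i unfolding irreducible_chain_def by blast
      then show ?thesis using c.measure_law_coord[OF z t(1), of i] by (intro exI[of _ t]) simp
    qed
  next
    fix i and s :: real and A E assume "i \<in> S" "0 \<le> s" "A \<in> sets (path_space S)" "E \<in> sets (path_space S)"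
    then show "emeasure (c.law i) {x \<in> space (path_space S). path_stop s x \<in> A \<and> path_shift s x \<in> E} =
      (\<integral>\<^sup>+x. indicator A (path_stop s x) * emeasure (c.law (x s)) E \<partial>c.law i)"
      by (rule c.law_markov)
  next
    show "((\<lambda>t. measure (c.law 0) {x \<in> space (path_space S). x t = 0}) has_real_derivative q 0 0) (at_right 0)"
      by (rule c.law_rate)
    show "(\<integral>\<^sup>+x. (if full_holding_time x < 1 then exp_ereal \<phi> (cycle_time x) else 0) \<partial>c.law 0) = 1"
      using assms(5) by (simp only: c.cycle_mgf_law)
    show "((\<lambda>l. enn2real (\<integral>\<^sup>+x. (if full_holding_time x < 1 then exp_ereal l (cycle_time x) else 0) \<partial>c.law 0))
      has_real_derivative D) (at_left \<phi>)"
      using assms(6) by (simp only: c.cycle_mgf_law)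
  qed (rule z)
  show ?thesis
  proof (intro conjI ballI)
    show "transition_semigroup (hat_space S) (P_infinity S q P X \<phi> D)" by (rule transition_semigroup_P_infinity)
    fix y assume y: "y \<in> hat_states S"
    show "\<exists>N. sets N = sets (skorokhod_space S {0..}) \<and>
       markov_process (hat_space S) (P_infinity S q P X \<phi> D) N (\<lambda>t f. f t) \<and>
       (AE f in N. f 0 = y) \<and>
       (\<forall>s>0. weakly_converges (skorokhod_topology S s)
                (\<lambda>T. conditioned_law S P X y s T) (restricted_law S N s))"
      using markov_process_P_infinity[OF y] AE_N_start[OF y] conditioned_law_converges[OF y]
      by (intro exI[of _ "N y"]) auto
  qed
qed

end
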